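(* For every $n\ge1$ and every unitary parameter $\alpha\in(\Lambda^\times)^n$ (i.e. $\alpha_r^\dagger\alpha_r=1$ for $1\le r\le n$), the forms $$(\Phi,\Psi)_{C,\mu}=\tau_C\bigl(\operatorname{tr}(\Phi^\dagger\Psi)\bigr)=\int_{H_0}\operatorname{tr}\bigl(\Phi(kC)^\dagger\Psi(kC)\bigr)\,d\mu_0(k)$$ on the Hom-spaces $\underline{\langle V,W\rangle}^{(2)}_{C,\mu}=\operatorname{Hom}_{\mathcal S_C^{\mathrm{cyl}}(\alpha)}(V,W)$, $C\in\mathcal C_{H_0}$, have the following properties. (i) They are positive-definite Hermitian forms. In particular, no quotient by a null radical is required, and $\|\mathrm{id}_{v_{\alpha,C}}\|_{C,\mu}^2=1$. (ii) The assignment $(V,W)\mapsto\underline{\langle V,W\rangle}^{(2)}_{C,\mu}$ is a bifunctor $$\bigl(\mathcal S_C^{\mathrm{cyl}}(\alpha)\bigr)^{\mathrm{op}}\times\mathcal S_C^{\mathrm{cyl}}(\alpha)\longrightarrow\operatorname{PreHilb}^X_\Lambda .$$ The dagger is antiunitary, and composition is adjointable. More precisely, whenever the compositions are defined, $$(A\Phi,\Psi)_{C,\mu}=(\Phi,A^\dagger\Psi)_{C,\mu},\qquad(\Phi B,\Psi)_{C,\mu}=(\Phi,\Psi B^\dagger)_{C,\mu}.$$ (iii) If $D\subseteq C$ in $\mathcal C_{H_0}$, the refinement functor $\pi_{D,C}^*:\mathcal S_C^{\mathrm{cyl}}(\alpha)\to\mathcal S_D^{\mathrm{cyl}}(\alpha)$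 is an isometric dagger functor. Consequently $\mathcal S_F^{\mathrm{cyl},u\text{-}\mathrm{sm}}(\alpha)$ carries a well-defined Hom-valued formal 2-inner product. (iv) The restriction of the right-translation 2-representation $\rho_\alpha$ to $H_0$ preserves $\mathcal S_F^{\mathrm{cyl},u\text{-}\mathrm{sm}}(\alpha)$ and its inner product up to the coherent right $H_0$-equivariant structure of $v_{\alpha,C}$. If $\varphi_h:R_h^Cv_{\alpha,C}\xrightarrow{\sim}v_{\alpha,C}$ denotes that structure map, set $$U_h(\Phi)=\varphi_h^{\oplus s}\,R_h^C(\Phi)\,(\varphi_h^{\oplus r})^{-1}\qquad(\Phi:v_{\alpha,C}^{\oplus r}\to v_{\alpha,C}^{\oplus s}).$$ In the integral picture this is $(U_h\Phi)(kC)=\Phi(khC)$, $h\in H_0$, and $(U_h\Phi,U_h\Psi)_{C,\mu}=(\Phi,\Psi)_{C,\mu}$. Thus the $H_0$-restriction of the spherical part of $\rho_\alpha$ is a unitary 2-representation in the Hom-enriched sense (with respect to the Hom-valued inner product $\underline{\langle\cdot,\cdot\rangle}^{(2)}$).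
   Context: **Field.** $k=\mathbb F_q$, $E=k((u))$, $F=E((t))$, $\mathcal O_1=E[[t]]$, $\mathcal O_2=k[[u]]+tE[[t]]$; $v_t,v_u$ normalized valuations of $F,E$; bar is reduction mod $t$ of a $t$-adic unit (or of an element of $\mathcal O_1$). $\partial_t\{a,b\}=(-1)^{v_t(a)v_t(b)}\overline{a^{v_t(b)}b^{-v_t(a)}}\in E^\times$, $\nu_F\{a,b\}=v_u(\partial_t\{a,b\})$. $\Lambda=\mathbb C((X))$ with involution $(\sum a_mX^m)^\dagger=\sum\overline{a_m}X^m$. $\mathbb R((X))$ is ordered: a nonzero series is positive if its lowest nonzero coefficient is positive. **Multiplier.** $G=\mathrm{GL}_n(F)$, $H=G_L\times G_R$, $B\subset G$ upper triangular, $B_H=B_L\times B_R$, $x_r(b)=(b_L)_{rr}$, $y_r(b)=(b_R)_{rr}$, $\sigma_\alpha(b,b')=\prod_r\alpha_r^{-\nu_F\{x_r(b),y_r(b')\}}$, $L_\alpha(b)=\Lambda e_b$, $m_{b,b'}(e_b\otimes e_{b'})=\sigma_\alpha(b,b')e_{bb'}$. **Levels and principal series.** $K_0=\mathrm{GL}_n(\mathcal O_2)$, $H_0=K_{0,L}\times K_{0,R}$, $J_{i,j}=u^it^j\mathcal O_2$, $K_{i,j}=I_n+M_n(J_{i,j})$, $C^{\mathrm{dbl}}_{i,j}=K_{i,j,L}\times K_{i,j,R}$ ($i,j\ge1$). $\mathcal C_H$: finite intersections of $H$-conjugates of the $C^{\mathrm{dbl}}_{i,j}$; $\mathcal C_{H_0}$: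 finite intersections of the $C^{\mathrm{dbl}}_{i,j}$ (all normal in $H_0$; cofinal in $\mathcal C_H$). $S_C=H/C$. $\mathcal I_C(\alpha)$: families of $\Lambda$-spaces $(V_s)_{s\in S_C}$ with isomorphisms $\theta_b(s):L_\alpha(b)\otimes V_s\to V_{bs}$ ($b\in B_H$) satisfying $\theta_{bb'}(s)(m_{b,b'}\otimes\mathrm{id})=\theta_b(b's)(\mathrm{id}\otimes\theta_{b'}(s))$, $\theta_1(s)(e_1\otimes v)=v$. For $D\subseteq C$, $\pi_{D,C}^*$ is pullback along $gD\mapsto gC$. $\mathcal I_F^{u\text{-}\mathrm{sm}}(\alpha)$: objects $(C,V)$, $C\in\mathcal C_H$, $V\in\mathcal I_C(\alpha)$; Hom $=\varinjlim_{D\subseteq C\cap C'}\operatorname{Hom}_{\mathcal I_D(\alpha)}(\pi^*_{D,C}V,\pi^*_{D,C'}V')$. $R_h^C:\mathcal I_C(\alpha)\to\mathcal I_{hCh^{-1}}(\alpha)$ is pullback along $g(hCh^{-1})\mapsto ghC$; $\rho_\alpha$ is the strict action $h\mapsto R_h$, $R_h(C,V)=(hCh^{-1},R_h^CV)$, of $H$ on $\mathcal I_F^{u\text{-}\mathrm{sm}}(\alpha)$. **Spherical object.** For $C\in\mathcal C_{H_0}$: $X_C=H_0/C$, $Q_0=B_H\cap H_0$, $O_C=B_HH_0/C$. The inclusion of action groupoids $Q_0\ltimes X_C\to B_H\ltimes O_C$ is an equivalence and $\sigma_\alpha=1$ on $Q_0\times Q_0$. $v_{\alpha,C}\in\mathcal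 I_C(\alpha)$ is obtained by transporting the constant line $\underline\Lambda_{X_C}$ with $\theta_q(x):e_q\otimes\lambda\mapsto\lambda$ across this equivalence ("integral picture") and extending by zero to $S_C$. Its right $H_0$-equivariant structure $\varphi_h:R_h^Cv_{\alpha,C}\to v_{\alpha,C}$ ($h\in H_0$), with $\varphi_{h_1h_2}=\varphi_{h_1}R_{h_1}^C(\varphi_{h_2})$, is the one given by the identity maps on fibers of the constant line in the integral picture. For $D\subseteq C$, $\pi^*_{D,C}v_{\alpha,C}\simeq v_{\alpha,D}$ canonically. In the integral picture $\operatorname{Hom}_{\mathcal I_C(\alpha)}(v_{\alpha,C}^{\oplus r},v_{\alpha,C}^{\oplus s})\cong M_{s\times r}(\operatorname{Fun}(X_C,\Lambda)^{Q_0})$. **Measure.** Additive Haar measure on $E$ has $\operatorname{vol}(k[[u]])=1$; the Fesenko–Morrow integral on $F$ is the $\mathbb C(X)$-linear functional on the span of lifts $f^{a,\gamma}$ ($f^{a,\gamma}(x)=f(\overline{(x-a)t^{-\gamma}})$ on $a+t^\gamma\mathcal O_1$, $0$ elsewhere; $f$ Haar integrable on $E$) with $\int_F f^{a,\gamma}=X^\gamma\int_Ef$; on $M_n(F)=F^{n^2}$ one uses repeated integrals of functions for which these exist and agree in every order. With $|a|_F=q^{-v_u(\overline{at^{-v_t(a)}})}X^{v_t(a)}$, Morrow's bi-invariant integral on $G$ is $\mathcal I_n(\phi)=\int_{M_n(F)}f_\phi(x)\,dx$, where $f_\phi$ extends $\phi\,|\det|_F^{-n}$ to $M_n(F)$.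 Put $c_{n,q}=\prod_{r=1}^n(1-q^{-r})^{-1}$, $\mu_n=c_{n,q}\mathcal I_n$, $m_n=n(n-1)/2$, $\mu_0=\mu_n\boxtimes\mu_n$ (product functional on finite sums of products of functions on the two factors), extended $\Lambda$-linearly. Then $\mu_0(H_0)=1$, $\mu_0$ is bi-invariant under $H_0$, and for $E'=C^{\mathrm{dbl}}_{i,j}$ and $g\in H_0$, $\mu_0(Q_0E'g)=c_{n,q}^2(1-q^{-1})^{2n}q^{-2m_ni}X^{2m_nj}$. **Cylindrical functions.** For $E'\in\mathcal C_{H_0}$ put $P_{E'}=Q_0E'$ (a subgroup of $H_0$). $\mathcal A_C^{\mathrm{cyl}}\subseteq\operatorname{Fun}(X_C,\Lambda)^{Q_0}$ is the $\Lambda$-span of $\mathbf 1_{X_C}$ and of all $\mathbf 1_{P_{E'}g/C}$ with $E'\in\mathcal C_{H_0}$, $C\subseteq E'$, $g\in H_0$; it is a $\dagger$-algebra under pointwise operations. $\tau_C(f)=\int_{H_0}f(kC)\,d\mu_0(k)$. **Spherical dagger category.** $\mathcal S_C^{\mathrm{cyl}}(\alpha)\subseteq\mathcal I_C(\alpha)$ has objects $v_{\alpha,C}^{\oplus r}$, $r\ge0$, and $\operatorname{Hom}(v_{\alpha,C}^{\oplus r},v_{\alpha,C}^{\oplus s})=M_{s\times r}(\mathcal A_C^{\mathrm{cyl}})$, with pointwise matrix multiplication as composition and $\Phi^\dagger(kC)=\Phi(kC)^\dagger$ the conjugate transpose. $\mathcal S_F^{\mathrm{cyl},u\text{-}\mathrm{sm}}(\alpha)=\varinjlim_{C\in\mathcal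 C_{H_0}}\mathcal S_C^{\mathrm{cyl}}(\alpha)$ is the filtered pseudocolimit along the refinement functors; its Hom-valued inner product is the one induced on its Hom-spaces (filtered colimits of the fixed-level Hom-spaces) by the forms $(\cdot,\cdot)_{C,\mu}$. **Conventions.** A formal pre-Hilbert $\Lambda$-space is a $\Lambda$-vector space with a positive-definite Hermitian form (Hermitian with respect to $\dagger$) with diagonal values in $\mathbb R((X))_{\ge0}$; no completion is understood. $\operatorname{PreHilb}^X_\Lambda$ is the category of these with adjointable linear maps. On morphisms $a:V'\to V$, $b:W\to W'$ the bifunctor is $\Phi\mapsto b\Phi a$. Antiunitarity of the dagger means $(\Phi^\dagger,\Psi^\dagger)=(\Psi,\Phi)$, the left side computed in $\underline{\langle W,V\rangle}^{(2)}_{C,\mu}$ and the right side in $\underline{\langle V,W\rangle}^{(2)}_{C,\mu}$. $\|\Phi\|^2_{C,\mu}=(\Phi,\Phi)_{C,\mu}$. *)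

theory Defs
  imports
    "HOL-Analysis.Analysis"
    "HOL-Algebra.Coset"
    "HOL-Algebra.Module"
    "HOL-Computational_Algebra.Polynomial_FPS"
    "HOL-Computational_Algebra.Formal_Laurent_Series"
    "Jordan_Normal_Form.Determinant"
begin

hide_const (open) Finite_Cartesian_Product.mat Determinants.det Finite_Cartesian_Product.vec

section \<open>The two-dimensional local field and the coefficient field\<close>

text \<open>For a finite field \<open>k\<close> (a type of class \<open>field\<close>, \<open>finite\<close>), \<open>E = k((u))\<close> is \<open>'k fls\<close> and
  \<open>F = E((t))\<close> is \<open>'k fls fls\<close>; both normalized valuations are \<open>fls_subdegree\<close> on nonzero elements.
  The coefficient field \<open>\<Lambda> = \<complex>((X))\<close> is \<open>complex fls\<close>.\<close>

type_synonym 'k F = "'k fls fls"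
type_synonym 'k HH = "'k fls fls mat \<times> 'k fls fls mat"
type_synonym lam = "complex fls"

definition tt :: "'k::field F" where "tt = fls_X"
definition uu :: "'k::field F" where "uu = fls_const fls_X"

definition O1 :: "'k::field F set" where
  "O1 = {x. \<forall>i<0. fls_nth x i = 0}"

definition red :: "'k::field F \<Rightarrow> 'k fls" where
  "red x = fls_nth x 0"

definition O2 :: "'k::field F set" where
  "O2 = {x \<in> O1. \<forall>j<0. fls_nth (red x) j = 0}"

definition tame :: "'k::field F \<Rightarrow> 'k F \<Rightarrow> 'k fls" where
  "tame a b = (- 1) powi (fls_subdegree a * fls_subdegree b)
     * red (a powi fls_subdegree b * b powi (- fls_subdegree a))"

definition nuF :: "'k::field F \<Rightarrow> 'k F \<Rightarrow> int" where
  "nuF a b = fls_subdegree (tame a b)"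

definition lam_dag :: "lam \<Rightarrow> lam" where
  "lam_dag a = Abs_fls (\<lambda>i. cnj (fls_nth a i))"

definition lam_nonneg :: "lam \<Rightarrow> bool" where
  "lam_nonneg a \<longleftrightarrow> (\<forall>i. fls_nth a i \<in> \<real>) \<and> (a = 0 \<or> Re (fls_nth a (fls_subdegree a)) > 0)"

definition lam_ring :: "lam ring" where
  "lam_ring = \<lparr>carrier = UNIV, mult = (*), one = 1, zero = 0, add = (+)\<rparr>"

text \<open>The subfield \<open>\<complex>(X)\<close> of \<open>\<complex>((X))\<close>.\<close>

definition CX :: "lam set" where
  "CX = {fps_to_fls (fps_of_poly p) / fps_to_fls (fps_of_poly q) | p q. q \<noteq> 0}"


section \<open>Groups, levels and the multiplier\<close>

definition GLF :: "nat \<Rightarrow> 'k::field F mat monoid" where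
  "GLF n = \<lparr>carrier = {A \<in> carrier_mat n n. invertible_mat A}, mult = (*), one = 1\<^sub>m n\<rparr>"

definition Hgrp :: "nat \<Rightarrow> 'k::field HH monoid" where
  "Hgrp n = GLF n \<times>\<times> GLF n"

definition Bor :: "nat \<Rightarrow> 'k::field F mat set" where
  "Bor n = {A \<in> carrier (GLF n). upper_triangular A}"

definition BH :: "nat \<Rightarrow> 'k::field HH set" where
  "BH n = Bor n \<times> Bor n"

definition K0 :: "nat \<Rightarrow> 'k::field F mat set" where
  "K0 n = {A \<in> carrier (GLF n). elements_mat A \<subseteq> O2 \<and> elements_mat (inv\<^bsub>GLF n\<^esub> A) \<subseteq> O2}"

definition H0 :: "nat \<Rightarrow> 'k::field HH set" where
  "H0 n = K0 n \<times> K0 n"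

definition Q0 :: "nat \<Rightarrow> 'k::field HH set" where
  "Q0 n = BH n \<inter> H0 n"

definition Jid :: "nat \<Rightarrow> nat \<Rightarrow> 'k::field F set" where
  "Jid i j = (\<lambda>x. uu ^ i * tt ^ j * x) ` O2"

definition Kij :: "nat \<Rightarrow> nat \<Rightarrow> nat \<Rightarrow> 'k::field F mat set" where
  "Kij n i j = {1\<^sub>m n + M | M. M \<in> carrier_mat n n \<and> elements_mat M \<subseteq> Jid i j}"

definition Cdbl :: "nat \<Rightarrow> nat \<Rightarrow> nat \<Rightarrow> 'k::field HH set" where
  "Cdbl n i j = Kij n i j \<times> Kij n i j"

definition cj :: "nat \<Rightarrow> 'k::field HH \<Rightarrow> 'k HH set \<Rightarrow> 'k HH set" where
  "cj n h C = (h <#\<^bsub>Hgrp n\<^esub> C) #>\<^bsub>Hgrp n\<^esub> (inv\<^bsub>Hgrp n\<^esub> h)"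

text \<open>Finite intersections are over nonempty families.\<close>

definition CH :: "nat \<Rightarrow> 'k::field HH set set" where
  "CH n = {\<Inter>\<C> | \<C>. finite \<C> \<and> \<C> \<noteq> {} \<and>
     \<C> \<subseteq> {cj n h (Cdbl n i j) | h i j. h \<in> carrier (Hgrp n) \<and> 1 \<le> i \<and> 1 \<le> j}}"

definition CH0 :: "nat \<Rightarrow> 'k::field HH set set" where
  "CH0 n = {\<Inter>\<C> | \<C>. finite \<C> \<and> \<C> \<noteq> {} \<and>
     \<C> \<subseteq> {Cdbl n i j | i j. 1 \<le> i \<and> 1 \<le> j}}"

definition SS :: "nat \<Rightarrow> 'k::field HH set \<Rightarrow> 'k HH set set" where
  "SS n C = (\<lambda>g. g <#\<^bsub>Hgrp n\<^esub> C) ` carrier (Hgrp n)"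

definition XX :: "nat \<Rightarrow> 'k::field HH set \<Rightarrow> 'k HH set set" where
  "XX n C = (\<lambda>k. k <#\<^bsub>Hgrp n\<^esub> C) ` H0 n"

text \<open>Matrix indices and the components of \<open>\<alpha>\<close> are numbered from 0.\<close>

definition sigma :: "nat \<Rightarrow> (nat \<Rightarrow> lam) \<Rightarrow> 'k::field HH \<Rightarrow> 'k HH \<Rightarrow> lam" where
  "sigma n \<alpha> b b' = (\<Prod>r<n. \<alpha> r powi (- nuF (fst b $$ (r, r)) (snd b' $$ (r, r))))"


section \<open>Twisted equivariant families\<close>

definition mk_module :: "'v set \<Rightarrow> 'v \<Rightarrow> ('v \<Rightarrow> 'v \<Rightarrow> 'v) \<Rightarrow> (lam \<Rightarrow> 'v \<Rightarrow> 'v) \<Rightarrow> (lam, 'v) module" where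
  "mk_module V z a sc =
     \<lparr>carrier = V, mult = undefined, one = undefined, zero = z, add = a, smult = sc\<rparr>"

definition lin_map :: "(lam, 'v) module \<Rightarrow> (lam, 'w) module \<Rightarrow> ('v \<Rightarrow> 'w) \<Rightarrow> bool" where
  "lin_map M N f \<longleftrightarrow> f \<in> carrier M \<rightarrow> carrier N
     \<and> (\<forall>x\<in>carrier M. \<forall>y\<in>carrier M. f (x \<oplus>\<^bsub>M\<^esub> y) = f x \<oplus>\<^bsub>N\<^esub> f y)
     \<and> (\<forall>c. \<forall>x\<in>carrier M. f (c \<odot>\<^bsub>M\<^esub> x) = c \<odot>\<^bsub>N\<^esub> f x)"

text \<open>An object of \<open>\<I>\<^sub>C(\<alpha>)\<close>. Since \<open>L\<^sub>\<alpha>(b)\<close> has basis \<open>e\<^sub>b\<close>, the isomorphism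
  \<open>\<theta>\<^sub>b(s) : L\<^sub>\<alpha>(b) \<otimes> V\<^sub>s \<rightarrow> V\<^bsub>bs\<^esub>\<close> is recorded as the linear bijection
  \<open>act V b s : v \<mapsto> \<theta>\<^sub>b(s)(e\<^sub>b \<otimes> v)\<close>; evaluating the cocycle axiom on \<open>e\<^sub>b \<otimes> e\<^bsub>b'\<^esub> \<otimes> v\<close> gives the
  factor \<open>sigma\<close>. Families, actions and morphisms are extensional, so that HOL equality is
  equality of objects and morphisms.\<close>

record ('g, 'v) tfam =
  fib :: "'g set \<Rightarrow> (lam, 'v) module"
  act :: "'g \<Rightarrow> 'g set \<Rightarrow> 'v \<Rightarrow> 'v"

definition fam_obj :: "nat \<Rightarrow> (nat \<Rightarrow> lam) \<Rightarrow> 'k::field HH set \<Rightarrow> ('k HH, 'v) tfam \<Rightarrow> bool" where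
  "fam_obj n \<alpha> C V \<longleftrightarrow>
     fib V \<in> extensional (SS n C) \<and> act V \<in> extensional (BH n)
     \<and> (\<forall>b\<in>BH n. act V b \<in> extensional (SS n C)
          \<and> (\<forall>s\<in>SS n C. act V b s \<in> extensional (carrier (fib V s))))
     \<and> (\<forall>s\<in>SS n C. module lam_ring (fib V s))
     \<and> (\<forall>b\<in>BH n. \<forall>s\<in>SS n C.
          lin_map (fib V s) (fib V (b <#\<^bsub>Hgrp n\<^esub> s)) (act V b s)
          \<and> bij_betw (act V b s) (carrier (fib V s)) (carrier (fib V (b <#\<^bsub>Hgrp n\<^esub> s))))
     \<and> (\<forall>b\<in>BH n. \<forall>b'\<in>BH n. \<forall>s\<in>SS n C. \<forall>v\<in>carrier (fib V s).
          sigma n \<alpha> b b' \<odot>\<^bsub>fib V ((b \<otimes>\<^bsub>Hgrp n\<^esub> b') <#\<^bsub>Hgrp n\<^esub> s)\<^esub> act V (b \<otimes>\<^bsub>Hgrp n\<^esub> b') s v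
            = act V b (b' <#\<^bsub>Hgrp n\<^esub> s) (act V b' s v))
     \<and> (\<forall>s\<in>SS n C. \<forall>v\<in>carrier (fib V s). act V \<one>\<^bsub>Hgrp n\<^esub> s v = v)"

definition I_hom :: "nat \<Rightarrow> 'k::field HH set \<Rightarrow> ('k HH, 'v) tfam \<Rightarrow> ('k HH, 'v) tfam
    \<Rightarrow> ('k HH set \<Rightarrow> 'v \<Rightarrow> 'v) set" where
  "I_hom n C V W = {f \<in> extensional (SS n C).
     (\<forall>s\<in>SS n C. f s \<in> extensional (carrier (fib V s)) \<and> lin_map (fib V s) (fib W s) (f s))
     \<and> (\<forall>b\<in>BH n. \<forall>s\<in>SS n C. \<forall>v\<in>carrier (fib V s).
          f (b <#\<^bsub>Hgrp n\<^esub> s) (act V b s v) = act W b s (f s v))}"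

definition I_id :: "nat \<Rightarrow> 'k::field HH set \<Rightarrow> ('k HH, 'v) tfam \<Rightarrow> 'k HH set \<Rightarrow> 'v \<Rightarrow> 'v" where
  "I_id n C V = (\<lambda>s\<in>SS n C. \<lambda>v\<in>carrier (fib V s). v)"

text \<open>\<open>I_comp n C V g f\<close> is \<open>g \<circ> f\<close>, where \<open>V\<close> is the source of \<open>f\<close>.\<close>

definition I_comp :: "nat \<Rightarrow> 'k::field HH set \<Rightarrow> ('k HH, 'v) tfam
    \<Rightarrow> ('k HH set \<Rightarrow> 'v \<Rightarrow> 'v) \<Rightarrow> ('k HH set \<Rightarrow> 'v \<Rightarrow> 'v) \<Rightarrow> 'k HH set \<Rightarrow> 'v \<Rightarrow> 'v" where
  "I_comp n C V g f = (\<lambda>s\<in>SS n C. \<lambda>v\<in>carrier (fib V s). g s (f s v))"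

definition I_inv :: "nat \<Rightarrow> 'k::field HH set \<Rightarrow> ('k HH, 'v) tfam \<Rightarrow> ('k HH, 'v) tfam
    \<Rightarrow> ('k HH set \<Rightarrow> 'v \<Rightarrow> 'v) \<Rightarrow> 'k HH set \<Rightarrow> 'v \<Rightarrow> 'v" where
  "I_inv n C V W f = (\<lambda>s\<in>SS n C. \<lambda>w\<in>carrier (fib W s). inv_into (carrier (fib V s)) (f s) w)"

definition pow_fam :: "nat \<Rightarrow> 'k::field HH set \<Rightarrow> nat \<Rightarrow> ('k HH, 'v) tfam \<Rightarrow> ('k HH, nat \<Rightarrow> 'v) tfam" where
  "pow_fam n C r V = \<lparr>
     fib = (\<lambda>s\<in>SS n C. mk_module ({..<r} \<rightarrow>\<^sub>E carrier (fib V s)) (\<lambda>i\<in>{..<r}. \<zero>\<^bsub>fib V s\<^esub>)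
              (\<lambda>v w. \<lambda>i\<in>{..<r}. v i \<oplus>\<^bsub>fib V s\<^esub> w i) (\<lambda>c v. \<lambda>i\<in>{..<r}. c \<odot>\<^bsub>fib V s\<^esub> v i)),
     act = (\<lambda>b\<in>BH n. \<lambda>s\<in>SS n C. \<lambda>v\<in>{..<r} \<rightarrow>\<^sub>E carrier (fib V s). \<lambda>i\<in>{..<r}. act V b s (v i))\<rparr>"

definition pow_mor :: "nat \<Rightarrow> 'k::field HH set \<Rightarrow> nat \<Rightarrow> ('k HH, 'v) tfam
    \<Rightarrow> ('k HH set \<Rightarrow> 'v \<Rightarrow> 'v) \<Rightarrow> 'k HH set \<Rightarrow> (nat \<Rightarrow> 'v) \<Rightarrow> (nat \<Rightarrow> 'v)" where
  "pow_mor n C r V f =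
     (\<lambda>s\<in>SS n C. \<lambda>v\<in>{..<r} \<rightarrow>\<^sub>E carrier (fib V s). \<lambda>i\<in>{..<r}. f s (v i))"

text \<open>Pullback along a \<open>B\<^sub>H\<close>-equivariant map \<open>p : H/D \<rightarrow> H/C\<close>. The refinement map \<open>gD \<mapsto> gC\<close> is
  \<open>s \<mapsto> sC\<close> and the translation map \<open>g(hCh\<inverse>) \<mapsto> ghC\<close> is \<open>s \<mapsto> sh\<close>.\<close>

definition pull_fam :: "nat \<Rightarrow> 'k::field HH set \<Rightarrow> ('k HH set \<Rightarrow> 'k HH set)
    \<Rightarrow> ('k HH, 'v) tfam \<Rightarrow> ('k HH, 'v) tfam" where
  "pull_fam n D p V = \<lparr>fib = (\<lambda>s\<in>SS n D. fib V (p s)), act = (\<lambda>b\<in>BH n. \<lambda>s\<in>SS n D. act V b (p s))\<rparr>"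

definition pull_mor :: "nat \<Rightarrow> 'k::field HH set \<Rightarrow> ('k HH set \<Rightarrow> 'k HH set)
    \<Rightarrow> ('k HH set \<Rightarrow> 'v \<Rightarrow> 'v) \<Rightarrow> 'k HH set \<Rightarrow> 'v \<Rightarrow> 'v" where
  "pull_mor n D p f = (\<lambda>s\<in>SS n D. f (p s))"

definition ref_fam :: "nat \<Rightarrow> 'k::field HH set \<Rightarrow> 'k HH set \<Rightarrow> ('k HH, 'v) tfam \<Rightarrow> ('k HH, 'v) tfam" where
  "ref_fam n D C = pull_fam n D (\<lambda>s. s <#>\<^bsub>Hgrp n\<^esub> C)"

definition ref_mor :: "nat \<Rightarrow> 'k::field HH set \<Rightarrow> 'k HH set
    \<Rightarrow> ('k HH set \<Rightarrow> 'v \<Rightarrow> 'v) \<Rightarrow> 'k HH set \<Rightarrow> 'v \<Rightarrow> 'v" where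
  "ref_mor n D C = pull_mor n D (\<lambda>s. s <#>\<^bsub>Hgrp n\<^esub> C)"

definition R_fam :: "nat \<Rightarrow> 'k::field HH \<Rightarrow> 'k HH set \<Rightarrow> ('k HH, 'v) tfam \<Rightarrow> ('k HH, 'v) tfam" where
  "R_fam n h C = pull_fam n (cj n h C) (\<lambda>s. s #>\<^bsub>Hgrp n\<^esub> h)"

definition R_mor :: "nat \<Rightarrow> 'k::field HH \<Rightarrow> 'k HH set
    \<Rightarrow> ('k HH set \<Rightarrow> 'v \<Rightarrow> 'v) \<Rightarrow> 'k HH set \<Rightarrow> 'v \<Rightarrow> 'v" where
  "R_mor n h C = pull_mor n (cj n h C) (\<lambda>s. s #>\<^bsub>Hgrp n\<^esub> h)"


section \<open>The spherical object\<close>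

text \<open>The transport of the constant line from \<open>Q\<^sub>0 \<ltimes> X\<^sub>C\<close> to \<open>B\<^sub>H \<ltimes> O\<^sub>C\<close>. An element \<open>v\<close> of the fiber at
  \<open>s\<close> is given by the scalars \<open>w b\<close>, for all \<open>b\<close> with \<open>b\<inverse>s \<in> X\<^sub>C\<close>, such that
  \<open>v = \<theta>\<^sub>b(e\<^sub>b \<otimes> w b)\<close> with \<open>w b\<close> in the constant line at \<open>b\<inverse>s\<close>; since \<open>\<theta>\<^sub>q\<close> is the identity on the
  constant line, the cocycle axiom forces \<open>w (bq) = \<sigma>(b,q) w b\<close> for \<open>q \<in> Q\<^sub>0\<close>.
  The fiber vanishes off \<open>O\<^sub>C\<close>, where no such \<open>b\<close> exists, so extension by zero is built in.
  For \<open>x \<in> X\<^sub>C\<close> the identification with the constant line is \<open>w \<mapsto> w \<one>\<close>, and the basis vector of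
  the constant line is the indicator function of \<open>Q\<^sub>0\<close>.\<close>

definition sph_fib :: "nat \<Rightarrow> (nat \<Rightarrow> lam) \<Rightarrow> 'k::field HH set \<Rightarrow> 'k HH set \<Rightarrow> (lam, 'k HH \<Rightarrow> lam) module" where
  "sph_fib n \<alpha> C s = mk_module
     {w. (\<forall>b. w b \<noteq> 0 \<longrightarrow> b \<in> BH n \<and> (inv\<^bsub>Hgrp n\<^esub> b) <#\<^bsub>Hgrp n\<^esub> s \<in> XX n C)
       \<and> (\<forall>b\<in>BH n. \<forall>q\<in>Q0 n. w (b \<otimes>\<^bsub>Hgrp n\<^esub> q) = sigma n \<alpha> b q * w b)}
     (\<lambda>b. 0) (\<lambda>v w b. v b + w b) (\<lambda>c w b. c * w b)"

definition sph :: "nat \<Rightarrow> (nat \<Rightarrow> lam) \<Rightarrow> 'k::field HH set \<Rightarrow> ('k HH, 'k HH \<Rightarrow> lam) tfam" where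
  "sph n \<alpha> C = \<lparr>
     fib = (\<lambda>s\<in>SS n C. sph_fib n \<alpha> C s),
     act = (\<lambda>b\<in>BH n. \<lambda>s\<in>SS n C. \<lambda>w\<in>carrier (sph_fib n \<alpha> C s). \<lambda>c.
              if c \<in> BH n
              then sigma n \<alpha> b (inv\<^bsub>Hgrp n\<^esub> b \<otimes>\<^bsub>Hgrp n\<^esub> c) * w (inv\<^bsub>Hgrp n\<^esub> b \<otimes>\<^bsub>Hgrp n\<^esub> c)
              else 0)\<rparr>"

definition line_unit :: "nat \<Rightarrow> 'k::field HH \<Rightarrow> lam" where
  "line_unit n b = (if b \<in> Q0 n then 1 else 0)"

definition sph_pow :: "nat \<Rightarrow> (nat \<Rightarrow> lam) \<Rightarrow> 'k::field HH set \<Rightarrow> nat \<Rightarrow> ('k HH, nat \<Rightarrow> 'k HH \<Rightarrow> lam) tfam" where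
  "sph_pow n \<alpha> C r = pow_fam n C r (sph n \<alpha> C)"

text \<open>The integral picture of a morphism \<open>f : v\<^bsup>\<oplus>r\<^esup> \<rightarrow> v\<^bsup>\<oplus>s\<^esup>\<close>: its \<open>s \<times> r\<close> matrices over the points
  of \<open>X\<^sub>C\<close>.\<close>

definition pow_unit :: "nat \<Rightarrow> nat \<Rightarrow> nat \<Rightarrow> nat \<Rightarrow> 'k::field HH \<Rightarrow> lam" where
  "pow_unit n r j = (\<lambda>i\<in>{..<r}. if i = j then line_unit n else (\<lambda>b. 0))"

definition picture :: "nat \<Rightarrow> 'k::field HH set \<Rightarrow> nat \<Rightarrow> nat
    \<Rightarrow> ('k HH set \<Rightarrow> (nat \<Rightarrow> 'k HH \<Rightarrow> lam) \<Rightarrow> (nat \<Rightarrow> 'k HH \<Rightarrow> lam)) \<Rightarrow> 'k HH set \<Rightarrow> lam mat" where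
  "picture n C r s f = (\<lambda>x\<in>XX n C. mat s r (\<lambda>(i, j). f x (pow_unit n r j) i \<one>\<^bsub>Hgrp n\<^esub>))"

text \<open>The structure map \<open>\<phi>\<^sub>h : R\<^sub>h v \<rightarrow> v\<close>. With the model of the fibers above, the fiber of \<open>R\<^sub>h v\<close> at
  \<open>s\<close>, which is the fiber of \<open>v\<close> at \<open>sh\<close>, and the fiber of \<open>v\<close> at \<open>s\<close> are the same space of
  functions for \<open>h \<in> H\<^sub>0\<close>, because \<open>b\<inverse>sh \<in> X\<^sub>C\<close> if and only if \<open>b\<inverse>s \<in> X\<^sub>C\<close>. On \<open>X\<^sub>C\<close> the identity is the
  identity of the constant line. Likewise the canonical identification of \<open>\<pi>\<^sup>* v\<^sub>C\<close> with \<open>v\<^sub>D\<close> is an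
  equality.\<close>

definition phi :: "nat \<Rightarrow> (nat \<Rightarrow> lam) \<Rightarrow> 'k::field HH set \<Rightarrow> 'k HH
    \<Rightarrow> 'k HH set \<Rightarrow> ('k HH \<Rightarrow> lam) \<Rightarrow> ('k HH \<Rightarrow> lam)" where
  "phi n \<alpha> C h = (\<lambda>s\<in>SS n C. \<lambda>w\<in>carrier (fib (R_fam n h C (sph n \<alpha> C)) s). w)"

definition phi_pow :: "nat \<Rightarrow> (nat \<Rightarrow> lam) \<Rightarrow> 'k::field HH set \<Rightarrow> 'k HH \<Rightarrow> nat
    \<Rightarrow> 'k HH set \<Rightarrow> (nat \<Rightarrow> 'k HH \<Rightarrow> lam) \<Rightarrow> (nat \<Rightarrow> 'k HH \<Rightarrow> lam)" where
  "phi_pow n \<alpha> C h r = pow_mor n C r (R_fam n h C (sph n \<alpha> C)) (phi n \<alpha> C h)"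

definition phi_pow_inv :: "nat \<Rightarrow> (nat \<Rightarrow> lam) \<Rightarrow> 'k::field HH set \<Rightarrow> 'k HH \<Rightarrow> nat
    \<Rightarrow> 'k HH set \<Rightarrow> (nat \<Rightarrow> 'k HH \<Rightarrow> lam) \<Rightarrow> (nat \<Rightarrow> 'k HH \<Rightarrow> lam)" where
  "phi_pow_inv n \<alpha> C h r =
     I_inv n C (R_fam n h C (sph_pow n \<alpha> C r)) (sph_pow n \<alpha> C r) (phi_pow n \<alpha> C h r)"

definition U_op :: "nat \<Rightarrow> (nat \<Rightarrow> lam) \<Rightarrow> 'k::field HH set \<Rightarrow> 'k HH \<Rightarrow> nat \<Rightarrow> nat
    \<Rightarrow> ('k HH set \<Rightarrow> (nat \<Rightarrow> 'k HH \<Rightarrow> lam) \<Rightarrow> (nat \<Rightarrow> 'k HH \<Rightarrow> lam))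
    \<Rightarrow> ('k HH set \<Rightarrow> (nat \<Rightarrow> 'k HH \<Rightarrow> lam) \<Rightarrow> (nat \<Rightarrow> 'k HH \<Rightarrow> lam))" where
  "U_op n \<alpha> C h r s f = I_comp n C (sph_pow n \<alpha> C r) (phi_pow n \<alpha> C h s)
     (I_comp n C (sph_pow n \<alpha> C r) (R_mor n h C f) (phi_pow_inv n \<alpha> C h r))"


section \<open>The measure\<close>

text \<open>\<open>borel\<close> refers to the metric topology on \<open>'k fls\<close>, which is the \<open>u\<close>-adic one.\<close>

definition haar_E :: "'k::field fls measure" where
  "haar_E = (THE M. sets M = sets borel
     \<and> (\<forall>a. \<forall>A\<in>sets M. emeasure M ((\<lambda>x. a + x) ` A) = emeasure M A)
     \<and> emeasure M {x. \<forall>i<0. fls_nth x i = 0} = 1)"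

definition lift :: "('k::field fls \<Rightarrow> complex) \<Rightarrow> 'k F \<Rightarrow> int \<Rightarrow> 'k F \<Rightarrow> lam" where
  "lift f a \<gamma> x = (let y = (x - a) * tt powi (- \<gamma>) in if y \<in> O1 then fls_const (f (red y)) else 0)"

definition has_int_F :: "('k::field F \<Rightarrow> lam) \<Rightarrow> lam \<Rightarrow> bool" where
  "has_int_F \<phi> v \<longleftrightarrow> (\<exists>L :: (lam \<times> ('k fls \<Rightarrow> complex) \<times> 'k F \<times> int) list.
     (\<forall>(c, f, a, \<gamma>)\<in>set L. c \<in> CX \<and> integrable haar_E f)
     \<and> \<phi> = (\<lambda>x. \<Sum>(c, f, a, \<gamma>)\<leftarrow>L. c * lift f a \<gamma> x)
     \<and> v = (\<Sum>(c, f, a, \<gamma>)\<leftarrow>L. c * fls_X powi \<gamma> * fls_const (integral\<^sup>L haar_E f)))"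

text \<open>Repeated integration over the coordinates in a list, the head being the innermost variable.\<close>

fun has_repeated_int :: "(nat \<times> nat) list \<Rightarrow> ((nat \<times> nat \<Rightarrow> 'k::field F) \<Rightarrow> lam) \<Rightarrow> lam \<Rightarrow> bool" where
  "has_repeated_int [] g v \<longleftrightarrow> (\<forall>y. g y = v)"
| "has_repeated_int (p # ps) g v \<longleftrightarrow>
     (\<exists>g'. (\<forall>y. has_int_F (\<lambda>x. g (y(p := x))) (g' y)) \<and> has_repeated_int ps g' v)"

definition has_int_M :: "nat \<Rightarrow> ('k::field F mat \<Rightarrow> lam) \<Rightarrow> lam \<Rightarrow> bool" where
  "has_int_M n f v \<longleftrightarrow> (\<forall>ps. distinct ps \<and> set ps = {..<n} \<times> {..<n}
     \<longrightarrow> has_repeated_int ps (\<lambda>y. f (mat n n y)) v)"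

definition abs_F :: "'k::{field,finite} F \<Rightarrow> lam" where
  "abs_F a = (if a = 0 then 0 else
     fls_const (of_nat CARD('k) powi (- fls_subdegree (red (a * tt powi (- fls_subdegree a)))))
       * fls_X powi fls_subdegree a)"

definition has_int_G :: "nat \<Rightarrow> ('k::{field,finite} F mat \<Rightarrow> lam) \<Rightarrow> lam \<Rightarrow> bool" where
  "has_int_G n \<phi> v \<longleftrightarrow> (\<exists>f. (\<forall>g\<in>carrier (GLF n). f g = \<phi> g * abs_F (Determinant.det g) powi (- int n))
     \<and> has_int_M n f v)"

definition c_const :: "nat \<Rightarrow> nat \<Rightarrow> complex" where
  "c_const n q = (\<Prod>r=1..n. inverse (1 - of_nat q powi (- int r)))"

definition has_mu_n :: "nat \<Rightarrow> ('k::{field,finite} F mat \<Rightarrow> lam) \<Rightarrow> lam \<Rightarrow> bool" where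
  "has_mu_n n \<phi> v \<longleftrightarrow> (\<exists>w. has_int_G n \<phi> w \<and> v = fls_const (c_const n CARD('k)) * w)"

definition has_mu_0 :: "nat \<Rightarrow> ('k::{field,finite} HH \<Rightarrow> lam) \<Rightarrow> lam \<Rightarrow> bool" where
  "has_mu_0 n \<Psi> v \<longleftrightarrow> (\<exists>L :: (lam \<times> ('k F mat \<Rightarrow> lam) \<times> ('k F mat \<Rightarrow> lam) \<times> lam \<times> lam) list.
     (\<forall>(c, \<phi>, \<psi>, a, b)\<in>set L. has_mu_n n \<phi> a \<and> has_mu_n n \<psi> b)
     \<and> (\<forall>(g, h)\<in>carrier (Hgrp n). \<Psi> (g, h) = (\<Sum>(c, \<phi>, \<psi>, a, b)\<leftarrow>L. c * \<phi> g * \<psi> h))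
     \<and> v = (\<Sum>(c, \<phi>, \<psi>, a, b)\<leftarrow>L. c * a * b))"

text \<open>\<open>has_tau n C f v\<close>: the function \<open>k \<mapsto> f(kC)\<close> on \<open>H\<^sub>0\<close> is \<open>\<mu>\<^sub>0\<close>-integrable with integral \<open>v\<close>.\<close>

definition has_tau :: "nat \<Rightarrow> 'k::{field,finite} HH set \<Rightarrow> ('k HH set \<Rightarrow> lam) \<Rightarrow> lam \<Rightarrow> bool" where
  "has_tau n C f v \<longleftrightarrow> has_mu_0 n (\<lambda>k. if k \<in> H0 n then f (k <#\<^bsub>Hgrp n\<^esub> C) else 0) v"

definition tau :: "nat \<Rightarrow> 'k::{field,finite} HH set \<Rightarrow> ('k HH set \<Rightarrow> lam) \<Rightarrow> lam" where
  "tau n C f = (THE v. has_tau n C f v)"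


section \<open>The cylindrical spherical category\<close>

text \<open>Functions on \<open>X\<^sub>C\<close> are extensional.\<close>

inductive_set A_cyl :: "nat \<Rightarrow> 'k::field HH set \<Rightarrow> ('k HH set \<Rightarrow> lam) set"
  for n :: nat and C :: "'k HH set" where
  one: "(\<lambda>x\<in>XX n C. 1) \<in> A_cyl n C"
| ind: "\<lbrakk>E \<in> CH0 n; C \<subseteq> E; g \<in> H0 n\<rbrakk> \<Longrightarrow>
     (\<lambda>x\<in>XX n C. if x \<in> (\<lambda>k. k <#\<^bsub>Hgrp n\<^esub> C) ` ((Q0 n <#>\<^bsub>Hgrp n\<^esub> E) #>\<^bsub>Hgrp n\<^esub> g) then 1 else 0)
       \<in> A_cyl n C"
| add: "\<lbrakk>f \<in> A_cyl n C; g \<in> A_cyl n C\<rbrakk> \<Longrightarrow> (\<lambda>x\<in>XX n C. f x + g x) \<in> A_cyl n C"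
| scale: "f \<in> A_cyl n C \<Longrightarrow> (\<lambda>x\<in>XX n C. c * f x) \<in> A_cyl n C"

definition S_hom :: "nat \<Rightarrow> (nat \<Rightarrow> lam) \<Rightarrow> 'k::field HH set \<Rightarrow> nat \<Rightarrow> nat
    \<Rightarrow> ('k HH set \<Rightarrow> (nat \<Rightarrow> 'k HH \<Rightarrow> lam) \<Rightarrow> (nat \<Rightarrow> 'k HH \<Rightarrow> lam)) set" where
  "S_hom n \<alpha> C r s = {f \<in> I_hom n C (sph_pow n \<alpha> C r) (sph_pow n \<alpha> C s).
     \<forall>i<s. \<forall>j<r. (\<lambda>x\<in>XX n C. picture n C r s f x $$ (i, j)) \<in> A_cyl n C}"

definition mat_adj :: "lam mat \<Rightarrow> lam mat" where
  "mat_adj A = map_mat lam_dag (transpose_mat A)"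

definition mat_tr :: "lam mat \<Rightarrow> lam" where
  "mat_tr A = (\<Sum>i<dim_row A. A $$ (i, i))"

definition S_dag :: "nat \<Rightarrow> (nat \<Rightarrow> lam) \<Rightarrow> 'k::field HH set \<Rightarrow> nat \<Rightarrow> nat
    \<Rightarrow> ('k HH set \<Rightarrow> (nat \<Rightarrow> 'k HH \<Rightarrow> lam) \<Rightarrow> (nat \<Rightarrow> 'k HH \<Rightarrow> lam))
    \<Rightarrow> ('k HH set \<Rightarrow> (nat \<Rightarrow> 'k HH \<Rightarrow> lam) \<Rightarrow> (nat \<Rightarrow> 'k HH \<Rightarrow> lam))" where
  "S_dag n \<alpha> C r s f = (THE g. g \<in> I_hom n C (sph_pow n \<alpha> C s) (sph_pow n \<alpha> C r)
     \<and> (\<forall>x\<in>XX n C. picture n C s r g x = mat_adj (picture n C r s f x)))"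

text \<open>Data of a \<open>\<Lambda>\<close>-linear dagger category; \<open>cmp \<S> X Y Z g f\<close> is \<open>g \<circ> f\<close> for \<open>f : X \<rightarrow> Y\<close>, \<open>g : Y \<rightarrow> Z\<close>,
  and \<open>dgr \<S> X Y f : Y \<rightarrow> X\<close> for \<open>f : X \<rightarrow> Y\<close>.\<close>

record ('o, 'm) dagcat =
  obs :: "'o set"
  hm :: "'o \<Rightarrow> 'o \<Rightarrow> (lam, 'm) module"
  cmp :: "'o \<Rightarrow> 'o \<Rightarrow> 'o \<Rightarrow> 'm \<Rightarrow> 'm \<Rightarrow> 'm"
  idn :: "'o \<Rightarrow> 'm"
  dgr :: "'o \<Rightarrow> 'o \<Rightarrow> 'm \<Rightarrow> 'm"

text \<open>The object \<open>v\<^bsup>\<oplus>r\<^esup>\<close> of \<open>\<S>\<^sub>C\<close> is named by \<open>r\<close>.\<close>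

definition S_cat :: "nat \<Rightarrow> (nat \<Rightarrow> lam) \<Rightarrow> 'k::field HH set
    \<Rightarrow> (nat, 'k HH set \<Rightarrow> (nat \<Rightarrow> 'k HH \<Rightarrow> lam) \<Rightarrow> (nat \<Rightarrow> 'k HH \<Rightarrow> lam)) dagcat" where
  "S_cat n \<alpha> C = \<lparr>
     obs = UNIV,
     hm = (\<lambda>r s. let V = sph_pow n \<alpha> C r; W = sph_pow n \<alpha> C s in mk_module (S_hom n \<alpha> C r s)
        (\<lambda>x\<in>SS n C. \<lambda>v\<in>carrier (fib V x). \<zero>\<^bsub>fib W x\<^esub>)
        (\<lambda>f g. \<lambda>x\<in>SS n C. \<lambda>v\<in>carrier (fib V x). f x v \<oplus>\<^bsub>fib W x\<^esub> g x v)
        (\<lambda>c f. \<lambda>x\<in>SS n C. \<lambda>v\<in>carrier (fib V x). c \<odot>\<^bsub>fib W x\<^esub> f x v)),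
     cmp = (\<lambda>r s m g f. I_comp n C (sph_pow n \<alpha> C r) g f),
     idn = (\<lambda>r. I_id n C (sph_pow n \<alpha> C r)),
     dgr = S_dag n \<alpha> C\<rparr>"

text \<open>The form \<open>(\<Phi>,\<Psi>)\<^bsub>C,\<mu>\<^esub>\<close> on morphisms \<open>v\<^bsup>\<oplus>r\<^esup> \<rightarrow> v\<^bsup>\<oplus>s\<^esup>\<close>.\<close>

definition tr_fun :: "nat \<Rightarrow> 'k::field HH set \<Rightarrow> nat \<Rightarrow> nat
    \<Rightarrow> ('k HH set \<Rightarrow> (nat \<Rightarrow> 'k HH \<Rightarrow> lam) \<Rightarrow> (nat \<Rightarrow> 'k HH \<Rightarrow> lam))
    \<Rightarrow> ('k HH set \<Rightarrow> (nat \<Rightarrow> 'k HH \<Rightarrow> lam) \<Rightarrow> (nat \<Rightarrow> 'k HH \<Rightarrow> lam)) \<Rightarrow> 'k HH set \<Rightarrow> lam" where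
  "tr_fun n C r s \<Phi> \<Psi> = (\<lambda>x\<in>XX n C. mat_tr (mat_adj (picture n C r s \<Phi> x) * picture n C r s \<Psi> x))"

definition S_form :: "nat \<Rightarrow> 'k::{field,finite} HH set \<Rightarrow> nat \<Rightarrow> nat
    \<Rightarrow> ('k HH set \<Rightarrow> (nat \<Rightarrow> 'k HH \<Rightarrow> lam) \<Rightarrow> (nat \<Rightarrow> 'k HH \<Rightarrow> lam))
    \<Rightarrow> ('k HH set \<Rightarrow> (nat \<Rightarrow> 'k HH \<Rightarrow> lam) \<Rightarrow> (nat \<Rightarrow> 'k HH \<Rightarrow> lam)) \<Rightarrow> lam" where
  "S_form n C r s \<Phi> \<Psi> = tau n C (tr_fun n C r s \<Phi> \<Psi>)"


section \<open>Dagger categories with Hom-valued inner products\<close>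

definition dagger_category :: "('o, 'm) dagcat \<Rightarrow> bool" where
  "dagger_category \<S> \<longleftrightarrow>
     (\<forall>X\<in>obs \<S>. \<forall>Y\<in>obs \<S>. module lam_ring (hm \<S> X Y))
     \<and> (\<forall>X\<in>obs \<S>. idn \<S> X \<in> carrier (hm \<S> X X))
     \<and> (\<forall>X\<in>obs \<S>. \<forall>Y\<in>obs \<S>. \<forall>f\<in>carrier (hm \<S> X Y).
          cmp \<S> X Y Y (idn \<S> Y) f = f \<and> cmp \<S> X X Y f (idn \<S> X) = f)
     \<and> (\<forall>X\<in>obs \<S>. \<forall>Y\<in>obs \<S>. \<forall>Z\<in>obs \<S>.
          (\<forall>g\<in>carrier (hm \<S> Y Z). lin_map (hm \<S> X Y) (hm \<S> X Z) (cmp \<S> X Y Z g))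
          \<and> (\<forall>f\<in>carrier (hm \<S> X Y). lin_map (hm \<S> Y Z) (hm \<S> X Z) (\<lambda>g. cmp \<S> X Y Z g f)))
     \<and> (\<forall>W\<in>obs \<S>. \<forall>X\<in>obs \<S>. \<forall>Y\<in>obs \<S>. \<forall>Z\<in>obs \<S>.
          \<forall>f\<in>carrier (hm \<S> W X). \<forall>g\<in>carrier (hm \<S> X Y). \<forall>h\<in>carrier (hm \<S> Y Z).
          cmp \<S> W X Z (cmp \<S> X Y Z h g) f = cmp \<S> W Y Z h (cmp \<S> W X Y g f))
     \<and> (\<forall>X\<in>obs \<S>. \<forall>Y\<in>obs \<S>. \<forall>f\<in>carrier (hm \<S> X Y).
          dgr \<S> X Y f \<in> carrier (hm \<S> Y X) \<and> dgr \<S> Y X (dgr \<S> X Y f) = f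
          \<and> (\<forall>g\<in>carrier (hm \<S> X Y).
               dgr \<S> X Y (f \<oplus>\<^bsub>hm \<S> X Y\<^esub> g) = dgr \<S> X Y f \<oplus>\<^bsub>hm \<S> Y X\<^esub> dgr \<S> X Y g)
          \<and> (\<forall>c. dgr \<S> X Y (c \<odot>\<^bsub>hm \<S> X Y\<^esub> f) = lam_dag c \<odot>\<^bsub>hm \<S> Y X\<^esub> dgr \<S> X Y f))
     \<and> (\<forall>X\<in>obs \<S>. dgr \<S> X X (idn \<S> X) = idn \<S> X)
     \<and> (\<forall>X\<in>obs \<S>. \<forall>Y\<in>obs \<S>. \<forall>Z\<in>obs \<S>. \<forall>f\<in>carrier (hm \<S> X Y). \<forall>g\<in>carrier (hm \<S> Y Z).
          dgr \<S> X Z (cmp \<S> X Y Z g f) = cmp \<S> Z Y X (dgr \<S> X Y f) (dgr \<S> Y Z g))"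

definition pos_def_hermitian :: "(lam, 'm) module \<Rightarrow> ('m \<Rightarrow> 'm \<Rightarrow> lam) \<Rightarrow> bool" where
  "pos_def_hermitian M p \<longleftrightarrow>
     (\<forall>x\<in>carrier M. \<forall>y\<in>carrier M. \<forall>z\<in>carrier M. p x (y \<oplus>\<^bsub>M\<^esub> z) = p x y + p x z)
     \<and> (\<forall>c. \<forall>x\<in>carrier M. \<forall>y\<in>carrier M. p x (c \<odot>\<^bsub>M\<^esub> y) = c * p x y)
     \<and> (\<forall>x\<in>carrier M. \<forall>y\<in>carrier M. p x y = lam_dag (p y x))
     \<and> (\<forall>x\<in>carrier M. lam_nonneg (p x x) \<and> (p x x = 0 \<longrightarrow> x = \<zero>\<^bsub>M\<^esub>))"

definition pre_hilbert :: "(lam, 'm) module \<Rightarrow> ('m \<Rightarrow> 'm \<Rightarrow> lam) \<Rightarrow> bool" where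
  "pre_hilbert M p \<longleftrightarrow> module lam_ring M \<and> pos_def_hermitian M p"

definition pre_hilbert_mor :: "(lam, 'm) module \<Rightarrow> ('m \<Rightarrow> 'm \<Rightarrow> lam)
    \<Rightarrow> (lam, 'm) module \<Rightarrow> ('m \<Rightarrow> 'm \<Rightarrow> lam) \<Rightarrow> ('m \<Rightarrow> 'm) \<Rightarrow> bool" where
  "pre_hilbert_mor M p N p' T \<longleftrightarrow> lin_map M N T \<and>
     (\<exists>T'. lin_map N M T' \<and> (\<forall>x\<in>carrier M. \<forall>y\<in>carrier N. p' (T x) y = p x (T' y)))"

definition hom_action :: "('o, 'm) dagcat \<Rightarrow> 'o \<Rightarrow> 'o \<Rightarrow> 'o \<Rightarrow> 'o \<Rightarrow> 'm \<Rightarrow> 'm \<Rightarrow> 'm \<Rightarrow> 'm" where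
  "hom_action \<S> V' V W W' a b \<Phi> = cmp \<S> V' W W' b (cmp \<S> V' V W \<Phi> a)"

text \<open>The Hom-spaces with the forms \<open>p V W\<close> form a bifunctor from \<open>\<S>\<^sup>o\<^sup>p \<times> \<S>\<close> to \<open>PreHilb\<close>.\<close>

definition hom_bifunctor :: "('o, 'm) dagcat \<Rightarrow> ('o \<Rightarrow> 'o \<Rightarrow> 'm \<Rightarrow> 'm \<Rightarrow> lam) \<Rightarrow> bool" where
  "hom_bifunctor \<S> p \<longleftrightarrow>
     (\<forall>V\<in>obs \<S>. \<forall>W\<in>obs \<S>. pre_hilbert (hm \<S> V W) (p V W))
     \<and> (\<forall>V\<in>obs \<S>. \<forall>V'\<in>obs \<S>. \<forall>W\<in>obs \<S>. \<forall>W'\<in>obs \<S>.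
          \<forall>a\<in>carrier (hm \<S> V' V). \<forall>b\<in>carrier (hm \<S> W W').
          pre_hilbert_mor (hm \<S> V W) (p V W) (hm \<S> V' W') (p V' W') (hom_action \<S> V' V W W' a b))
     \<and> (\<forall>V\<in>obs \<S>. \<forall>W\<in>obs \<S>. \<forall>\<Phi>\<in>carrier (hm \<S> V W).
          hom_action \<S> V V W W (idn \<S> V) (idn \<S> W) \<Phi> = \<Phi>)
     \<and> (\<forall>V\<in>obs \<S>. \<forall>V'\<in>obs \<S>. \<forall>V''\<in>obs \<S>. \<forall>W\<in>obs \<S>. \<forall>W'\<in>obs \<S>. \<forall>W''\<in>obs \<S>.
          \<forall>a\<in>carrier (hm \<S> V' V). \<forall>a'\<in>carrier (hm \<S> V'' V').
          \<forall>b\<in>carrier (hm \<S> W W'). \<forall>b'\<in>carrier (hm \<S> W' W''). \<forall>\<Phi>\<in>carrier (hm \<S> V W).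
          hom_action \<S> V'' V W W'' (cmp \<S> V'' V' V a a') (cmp \<S> W W' W'' b' b) \<Phi>
            = hom_action \<S> V'' V' W' W'' a' b' (hom_action \<S> V' V W W' a b \<Phi>))"

definition dagger_antiunitary :: "('o, 'm) dagcat \<Rightarrow> ('o \<Rightarrow> 'o \<Rightarrow> 'm \<Rightarrow> 'm \<Rightarrow> lam) \<Rightarrow> bool" where
  "dagger_antiunitary \<S> p \<longleftrightarrow> (\<forall>V\<in>obs \<S>. \<forall>W\<in>obs \<S>.
     \<forall>\<Phi>\<in>carrier (hm \<S> V W). \<forall>\<Psi>\<in>carrier (hm \<S> V W).
       p W V (dgr \<S> V W \<Phi>) (dgr \<S> V W \<Psi>) = p V W \<Psi> \<Phi>)"

definition composition_adjointable :: "('o, 'm) dagcat \<Rightarrow> ('o \<Rightarrow> 'o \<Rightarrow> 'm \<Rightarrow> 'm \<Rightarrow> lam) \<Rightarrow> bool" where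
  "composition_adjointable \<S> p \<longleftrightarrow>
     (\<forall>V\<in>obs \<S>. \<forall>W\<in>obs \<S>. \<forall>W'\<in>obs \<S>. \<forall>A\<in>carrier (hm \<S> W W').
        \<forall>\<Phi>\<in>carrier (hm \<S> V W). \<forall>\<Psi>\<in>carrier (hm \<S> V W').
        p V W' (cmp \<S> V W W' A \<Phi>) \<Psi> = p V W \<Phi> (cmp \<S> V W' W (dgr \<S> W W' A) \<Psi>))
     \<and> (\<forall>V\<in>obs \<S>. \<forall>V'\<in>obs \<S>. \<forall>W\<in>obs \<S>. \<forall>B\<in>carrier (hm \<S> V' V).
        \<forall>\<Phi>\<in>carrier (hm \<S> V W). \<forall>\<Psi>\<in>carrier (hm \<S> V' W).
        p V' W (cmp \<S> V' V W \<Phi> B) \<Psi> = p V W \<Phi> (cmp \<S> V V' W \<Psi> (dgr \<S> V' V B)))"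

text \<open>A Hom-valued formal 2-inner product on a dagger category.\<close>

definition two_inner_product :: "('o, 'm) dagcat \<Rightarrow> ('o \<Rightarrow> 'o \<Rightarrow> 'm \<Rightarrow> 'm \<Rightarrow> lam) \<Rightarrow> bool" where
  "two_inner_product \<S> p \<longleftrightarrow> dagger_category \<S> \<and> hom_bifunctor \<S> p
     \<and> dagger_antiunitary \<S> p \<and> composition_adjointable \<S> p"

definition isometric_dagger_functor :: "('o, 'm) dagcat \<Rightarrow> ('o \<Rightarrow> 'o \<Rightarrow> 'm \<Rightarrow> 'm \<Rightarrow> lam)
    \<Rightarrow> ('o', 'm') dagcat \<Rightarrow> ('o' \<Rightarrow> 'o' \<Rightarrow> 'm' \<Rightarrow> 'm' \<Rightarrow> lam)
    \<Rightarrow> ('o \<Rightarrow> 'o') \<Rightarrow> ('o \<Rightarrow> 'o \<Rightarrow> 'm \<Rightarrow> 'm') \<Rightarrow> bool" where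
  "isometric_dagger_functor \<S> p \<T> p' Fo Fm \<longleftrightarrow>
     (\<forall>X\<in>obs \<S>. Fo X \<in> obs \<T>)
     \<and> (\<forall>X\<in>obs \<S>. \<forall>Y\<in>obs \<S>. lin_map (hm \<S> X Y) (hm \<T> (Fo X) (Fo Y)) (Fm X Y))
     \<and> (\<forall>X\<in>obs \<S>. Fm X X (idn \<S> X) = idn \<T> (Fo X))
     \<and> (\<forall>X\<in>obs \<S>. \<forall>Y\<in>obs \<S>. \<forall>Z\<in>obs \<S>. \<forall>f\<in>carrier (hm \<S> X Y). \<forall>g\<in>carrier (hm \<S> Y Z).
          Fm X Z (cmp \<S> X Y Z g f) = cmp \<T> (Fo X) (Fo Y) (Fo Z) (Fm Y Z g) (Fm X Y f))
     \<and> (\<forall>X\<in>obs \<S>. \<forall>Y\<in>obs \<S>. \<forall>f\<in>carrier (hm \<S> X Y).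
          Fm Y X (dgr \<S> X Y f) = dgr \<T> (Fo X) (Fo Y) (Fm X Y f))
     \<and> (\<forall>X\<in>obs \<S>. \<forall>Y\<in>obs \<S>. \<forall>f\<in>carrier (hm \<S> X Y). \<forall>g\<in>carrier (hm \<S> X Y).
          p' (Fo X) (Fo Y) (Fm X Y f) (Fm X Y g) = p X Y f g)"


section \<open>Filtered colimits over the levels\<close>

text \<open>Representatives of the elements of \<open>colim Hom\<^sub>D\<close> over the levels \<open>D \<in> \<D>\<close> contained in \<open>K\<close>, and the
  identification of two representatives which agree at a common refinement.\<close>

definition colim_reps :: "'k::field HH set set \<Rightarrow> 'k HH set
    \<Rightarrow> ('k HH set \<Rightarrow> ('k HH set \<Rightarrow> 'v \<Rightarrow> 'v) set) \<Rightarrow> ('k HH set \<times> ('k HH set \<Rightarrow> 'v \<Rightarrow> 'v)) set" where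
  "colim_reps \<D> K Hm = {(D, f). D \<in> \<D> \<and> D \<subseteq> K \<and> f \<in> Hm D}"

definition colim_rel :: "nat \<Rightarrow> 'k::field HH set set \<Rightarrow> 'k HH set
    \<Rightarrow> ('k HH set \<Rightarrow> ('k HH set \<Rightarrow> 'v \<Rightarrow> 'v) set)
    \<Rightarrow> (('k HH set \<times> ('k HH set \<Rightarrow> 'v \<Rightarrow> 'v)) \<times> ('k HH set \<times> ('k HH set \<Rightarrow> 'v \<Rightarrow> 'v))) set" where
  "colim_rel n \<D> K Hm = {((D, f), (D', f')).
     (D, f) \<in> colim_reps \<D> K Hm \<and> (D', f') \<in> colim_reps \<D> K Hm
     \<and> (\<exists>E\<in>\<D>. E \<subseteq> D \<inter> D' \<and> ref_mor n E D f = ref_mor n E D' f')}"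

text \<open>The category \<open>\<I>\<^sub>F\<close> of \<open>u\<close>-smooth principal series: objects \<open>(C,V)\<close>.\<close>

definition IF_homs :: "nat \<Rightarrow> 'k::field HH set \<times> ('k HH, 'v) tfam \<Rightarrow> 'k HH set \<times> ('k HH, 'v) tfam
    \<Rightarrow> 'k HH set \<Rightarrow> ('k HH set \<Rightarrow> 'v \<Rightarrow> 'v) set" where
  "IF_homs n X Y D = I_hom n D (ref_fam n D (fst X) (snd X)) (ref_fam n D (fst Y) (snd Y))"

definition IF_obj :: "nat \<Rightarrow> (nat \<Rightarrow> lam) \<Rightarrow> ('k::field HH set \<times> ('k HH, 'v) tfam) set" where
  "IF_obj n \<alpha> = {(C, V). C \<in> CH n \<and> fam_obj n \<alpha> C V}"

definition IF_rel where
  "IF_rel n X Y = colim_rel n (CH n) (fst X \<inter> fst Y) (IF_homs n X Y)"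

definition IF_hom :: "nat \<Rightarrow> 'k::field HH set \<times> ('k HH, 'v) tfam \<Rightarrow> 'k HH set \<times> ('k HH, 'v) tfam
    \<Rightarrow> ('k HH set \<times> ('k HH set \<Rightarrow> 'v \<Rightarrow> 'v)) set set" where
  "IF_hom n X Y = colim_reps (CH n) (fst X \<inter> fst Y) (IF_homs n X Y) // IF_rel n X Y"

definition IF_comp :: "nat \<Rightarrow> 'k::field HH set \<times> ('k HH, 'v) tfam \<Rightarrow> 'k HH set \<times> ('k HH, 'v) tfam
    \<Rightarrow> ('k HH set \<times> ('k HH set \<Rightarrow> 'v \<Rightarrow> 'v)) set \<Rightarrow> ('k HH set \<times> ('k HH set \<Rightarrow> 'v \<Rightarrow> 'v)) set
    \<Rightarrow> ('k HH set \<times> ('k HH set \<Rightarrow> 'v \<Rightarrow> 'v)) set" where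
  "IF_comp n X Z Q P = (\<Union>(D, f)\<in>P. \<Union>(D', g)\<in>Q. IF_rel n X Z ``
     {(D \<inter> D', I_comp n (D \<inter> D') (ref_fam n (D \<inter> D') (fst X) (snd X))
        (ref_mor n (D \<inter> D') D' g) (ref_mor n (D \<inter> D') D f))})"

text \<open>The action \<open>\<rho>\<^sub>\<alpha>\<close> on objects and on morphisms.\<close>

definition rho_obj :: "nat \<Rightarrow> 'k::field HH \<Rightarrow> 'k HH set \<times> ('k HH, 'v) tfam
    \<Rightarrow> 'k HH set \<times> ('k HH, 'v) tfam" where
  "rho_obj n h X = (cj n h (fst X), R_fam n h (fst X) (snd X))"

definition rho_mor :: "nat \<Rightarrow> 'k::field HH
    \<Rightarrow> ('k HH set \<times> ('k HH set \<Rightarrow> 'v \<Rightarrow> 'v)) set \<Rightarrow> ('k HH set \<times> ('k HH set \<Rightarrow> 'v \<Rightarrow> 'v)) set" where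
  "rho_mor n h P = (\<lambda>(D, f). (cj n h D, R_mor n h D f)) ` P"

text \<open>The pseudocolimit \<open>\<S>\<^sub>F\<close>: the object \<open>v\<^bsub>\<alpha>,C\<^esub>\<^bsup>\<oplus>r\<^esup>\<close> is named by \<open>(C,r)\<close>.\<close>

definition SF_reps where
  "SF_reps n \<alpha> X Y = colim_reps (CH0 n) (fst X \<inter> fst Y) (\<lambda>D. S_hom n \<alpha> D (snd X) (snd Y))"

definition SF_rel where
  "SF_rel n \<alpha> X Y = colim_rel n (CH0 n) (fst X \<inter> fst Y) (\<lambda>D. S_hom n \<alpha> D (snd X) (snd Y))"

definition SF_cat :: "nat \<Rightarrow> (nat \<Rightarrow> lam) \<Rightarrow> ('k::field HH set \<times> nat,
    ('k HH set \<times> ('k HH set \<Rightarrow> (nat \<Rightarrow> 'k HH \<Rightarrow> lam) \<Rightarrow> (nat \<Rightarrow> 'k HH \<Rightarrow> lam))) set) dagcat" where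
  "SF_cat n \<alpha> = \<lparr>
     obs = CH0 n \<times> UNIV,
     hm = (\<lambda>X Y. mk_module (SF_reps n \<alpha> X Y // SF_rel n \<alpha> X Y)
        (SF_rel n \<alpha> X Y `` {(fst X \<inter> fst Y, \<zero>\<^bsub>hm (S_cat n \<alpha> (fst X \<inter> fst Y)) (snd X) (snd Y)\<^esub>)})
        (\<lambda>P Q. \<Union>(D, f)\<in>P. \<Union>(D', g)\<in>Q. SF_rel n \<alpha> X Y ``
           {(D \<inter> D', ref_mor n (D \<inter> D') D f
              \<oplus>\<^bsub>hm (S_cat n \<alpha> (D \<inter> D')) (snd X) (snd Y)\<^esub> ref_mor n (D \<inter> D') D' g)})
        (\<lambda>c P. \<Union>(D, f)\<in>P. SF_rel n \<alpha> X Y `` {(D, c \<odot>\<^bsub>hm (S_cat n \<alpha> D) (snd X) (snd Y)\<^esub> f)})),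
     cmp = (\<lambda>X Y Z Q P. \<Union>(D, f)\<in>P. \<Union>(D', g)\<in>Q. SF_rel n \<alpha> X Z ``
        {(D \<inter> D', cmp (S_cat n \<alpha> (D \<inter> D')) (snd X) (snd Y) (snd Z)
           (ref_mor n (D \<inter> D') D' g) (ref_mor n (D \<inter> D') D f))}),
     idn = (\<lambda>X. SF_rel n \<alpha> X X `` {(fst X, idn (S_cat n \<alpha> (fst X)) (snd X))}),
     dgr = (\<lambda>X Y P. \<Union>(D, f)\<in>P. SF_rel n \<alpha> Y X `` {(D, dgr (S_cat n \<alpha> D) (snd X) (snd Y) f)})\<rparr>"

text \<open>\<open>v\<close> is the value of the form at every common refinement of every pair of representatives.\<close>

definition SF_form_value :: "nat \<Rightarrow> 'k::{field,finite} HH set \<times> nat \<Rightarrow> 'k HH set \<times> nat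
    \<Rightarrow> ('k HH set \<times> ('k HH set \<Rightarrow> (nat \<Rightarrow> 'k HH \<Rightarrow> lam) \<Rightarrow> (nat \<Rightarrow> 'k HH \<Rightarrow> lam))) set
    \<Rightarrow> ('k HH set \<times> ('k HH set \<Rightarrow> (nat \<Rightarrow> 'k HH \<Rightarrow> lam) \<Rightarrow> (nat \<Rightarrow> 'k HH \<Rightarrow> lam))) set \<Rightarrow> lam \<Rightarrow> bool" where
  "SF_form_value n X Y P Q v \<longleftrightarrow> (\<forall>(D, f)\<in>P. \<forall>(D', g)\<in>Q. \<forall>E\<in>CH0 n. E \<subseteq> D \<inter> D' \<longrightarrow>
     v = S_form n E (snd X) (snd Y) (ref_mor n E D f) (ref_mor n E D' g))"

definition SF_form :: "nat \<Rightarrow> 'k::{field,finite} HH set \<times> nat \<Rightarrow> 'k HH set \<times> nat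
    \<Rightarrow> ('k HH set \<times> ('k HH set \<Rightarrow> (nat \<Rightarrow> 'k HH \<Rightarrow> lam) \<Rightarrow> (nat \<Rightarrow> 'k HH \<Rightarrow> lam))) set
    \<Rightarrow> ('k HH set \<times> ('k HH set \<Rightarrow> (nat \<Rightarrow> 'k HH \<Rightarrow> lam) \<Rightarrow> (nat \<Rightarrow> 'k HH \<Rightarrow> lam))) set \<Rightarrow> lam" where
  "SF_form n X Y P Q = (THE v. SF_form_value n X Y P Q v)"

text \<open>The inclusion of \<open>\<S>\<^sub>F\<close> into \<open>\<I>\<^sub>F\<close>.\<close>

definition SF_emb_obj :: "nat \<Rightarrow> (nat \<Rightarrow> lam) \<Rightarrow> 'k::field HH set \<times> nat
    \<Rightarrow> 'k HH set \<times> ('k HH, nat \<Rightarrow> 'k HH \<Rightarrow> lam) tfam" where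
  "SF_emb_obj n \<alpha> X = (fst X, sph_pow n \<alpha> (fst X) (snd X))"

definition SF_emb :: "nat \<Rightarrow> (nat \<Rightarrow> lam) \<Rightarrow> 'k::field HH set \<times> nat \<Rightarrow> 'k HH set \<times> nat
    \<Rightarrow> ('k HH set \<times> ('k HH set \<Rightarrow> (nat \<Rightarrow> 'k HH \<Rightarrow> lam) \<Rightarrow> (nat \<Rightarrow> 'k HH \<Rightarrow> lam))) set
    \<Rightarrow> ('k HH set \<times> ('k HH set \<Rightarrow> (nat \<Rightarrow> 'k HH \<Rightarrow> lam) \<Rightarrow> (nat \<Rightarrow> 'k HH \<Rightarrow> lam))) set" where
  "SF_emb n \<alpha> X Y P = IF_rel n (SF_emb_obj n \<alpha> X) (SF_emb_obj n \<alpha> Y) `` P"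

text \<open>The classes of \<open>\<phi>\<^sub>h\<^bsup>\<oplus>r\<^esup> : R\<^sub>h(C,v\<^bsup>\<oplus>r\<^esup>) \<rightarrow> (C,v\<^bsup>\<oplus>r\<^esup>)\<close> and of its inverse in \<open>\<I>\<^sub>F\<close>, and the operator
  induced by the \<open>U\<^sub>h\<close> on \<open>\<S>\<^sub>F\<close>.\<close>

definition phi_F where
  "phi_F n \<alpha> h X = IF_rel n (rho_obj n h (SF_emb_obj n \<alpha> X)) (SF_emb_obj n \<alpha> X)
     `` {(fst X, phi_pow n \<alpha> (fst X) h (snd X))}"

definition phi_F_inv where
  "phi_F_inv n \<alpha> h X = IF_rel n (SF_emb_obj n \<alpha> X) (rho_obj n h (SF_emb_obj n \<alpha> X))
     `` {(fst X, phi_pow_inv n \<alpha> (fst X) h (snd X))}"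

definition U_F :: "nat \<Rightarrow> (nat \<Rightarrow> lam) \<Rightarrow> 'k::field HH \<Rightarrow> 'k HH set \<times> nat \<Rightarrow> 'k HH set \<times> nat
    \<Rightarrow> ('k HH set \<times> ('k HH set \<Rightarrow> (nat \<Rightarrow> 'k HH \<Rightarrow> lam) \<Rightarrow> (nat \<Rightarrow> 'k HH \<Rightarrow> lam))) set
    \<Rightarrow> ('k HH set \<times> ('k HH set \<Rightarrow> (nat \<Rightarrow> 'k HH \<Rightarrow> lam) \<Rightarrow> (nat \<Rightarrow> 'k HH \<Rightarrow> lam))) set" where
  "U_F n \<alpha> h X Y P =
     (\<Union>(D, f)\<in>P. SF_rel n \<alpha> X Y `` {(D, U_op n \<alpha> D h (snd X) (snd Y) f)})"

end

theory Submission
  imports Defs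
begin

text \<open>The argument has an algebraic and an analytic half.

  The fibre of the spherical family at \<open>gC\<close> consists of functions on \<open>BH n\<close>, supported where \<open>b\<^sup>-\<^sup>1g \<in> H0 n\<close>,
  with prescribed behaviour under right translation by \<open>Q0 n\<close>. This space depends only on \<open>g\<close> (\<open>sph_fib_eq\<close>), and over
  \<open>g \<in> H0 n\<close> it is a line (\<open>Fb_line\<close>). An equivariant map between powers of the family is therefore determined by a
  matrix function on \<open>H0 n\<close>, left invariant under \<open>Q0 n\<close> and right invariant under \<open>C\<close>, and every such function
  occurs (\<open>I_hom_eq_opv\<close>, \<open>op_mem\<close>, \<open>md_bij\<close>). In these coordinates composition is the pointwise matrix product,
  the dagger is the pointwise adjoint, refinement changes nothing and the action of \<open>h\<close> is right translation of the argument.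
  So the category at level \<open>C\<close> is a category of matrices with entries in \<open>Cyl n \<E>\<close>, where \<open>\<E>\<close> consists of
  the levels containing \<open>C\<close>, and the filtered colimit is the same thing for the set of all levels in \<open>H0 n\<close>. The axioms are
  checked once for such categories (locale \<open>dag_model\<close>, \<open>dag_functor\<close>). In the larger category of smooth
  principal series a class is again described by its values at the elements \<open>g\<close> (\<open>IF_rel_icls\<close>), and the
  structure maps are identities, which leaves the right translation (\<open>SF_emb_equivariant\<close>).

  The analytic half says that integration over \<open>H0 n\<close> is a well defined, Hermitian, right invariant and positive
  functional on cylindrical functions. Well-definedness (\<open>has_mu_0_unique\<close>) holds because the part of a
  Fesenko--Morrow integral in degree \<open>\<gamma>\<close> can be read off along the points of a ball of level \<open>\<gamma>\<close> away from finitely many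
  centres, where an integrable function on \<open>k((u))\<close> that is constant has integral zero, and because the singular matrices
  can be ignored in the repeated integral. Volumes come from one formula for affine lattices (\<open>lattice_volume\<close>). The cosets
  of the groups \<open>Q0 E\<close> are nested or disjoint and equal in volume at each level. A coset minus finitely many smaller ones
  has positive volume unless it is empty (\<open>piece_volume_positive\<close>): the smaller ones with the same
  power of \<open>t\<close> are finitely many pieces of a finite partition, and those with a higher power are infinitesimal in \<open>\<real>((X))\<close>. Hence
  the integral of \<open>F\<^sup>\<dagger>F\<close> is a sum of squares with positive weights (\<open>tauH_positive\<close>).\<close>

abbreviation Hom where "Hom S X Y \<equiv> carrier (hm S X Y)"
abbreviation ddet where "ddet \<equiv> Determinant.det"
abbreviation MN where "MN n \<equiv> carrier_mat n n"
abbreviation sdeg where "sdeg \<equiv> fls_subdegree"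

section \<open>The rank two valuation\<close>

definition lc :: "'k::field F => 'k fls" where
 "lc a = fls_nth a (sdeg a)"

definition vu :: "'k::field F => int" where
 "vu a = sdeg (lc a)"

lemma lc_eq_0_iff [simp]: "lc a = 0 \<longleftrightarrow> a = 0"
 by (simp add: lc_def nth_fls_subdegree_zero_iff)

lemma lc_0 [simp]: "lc 0 = 0"
 by simp

lemma lc_1 [simp]: "lc 1 = 1"
 by (simp add: lc_def)

lemma lc_mult: "lc (a * b) = lc a * lc b"
proof (cases "a = 0 | b = 0")
 case False
 hence "sdeg (a * b) = sdeg a + sdeg b" by simp
 thus ?thesis unfolding lc_def by simp
qed (auto simp: lc_def)

lemma lc_inverse: "lc (inverse a) = inverse (lc a)"
proof (cases "a = 0")
 case False
 hence "lc (inverse a) * lc a = 1" by (simp flip: lc_mult)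
 thus ?thesis using False by (metis inverse_unique mult.commute)
qed simp

lemma lc_power: "lc (a ^ n) = lc a ^ n"
 by (induction n) (simp_all add: lc_mult)

lemma lc_powi: "lc (a powi k) = lc a powi k"
 by (cases k rule: int_cases2) (simp_all add: lc_power lc_inverse power_int_minus)

lemma vt_powi: "a ~= 0 ==> sdeg (a powi k) = k * sdeg (a :: 'a::field fls)"
 by (cases k rule: int_cases2) (simp_all add: fls_subdegree_pow power_int_minus)

lemma vt_mult: "a ~= 0 ==> b ~= 0 ==> sdeg (a * b) = sdeg a + sdeg (b :: 'a::field fls)"
 by simp

lemma vu_mult: "a ~= 0 ==> b ~= 0 ==> vu (a * b) = vu a + vu b"
 by (simp add: vu_def lc_mult)

lemma vu_inverse: "vu (inverse a) = - vu a"
 by (cases "a = 0") (simp_all add: vu_def lc_inverse)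

lemma vu_1 [simp]: "vu 1 = 0" and vu_0 [simp]: "vu 0 = 0"
 by (simp_all add: vu_def)

lemma vu_powi: "a ~= 0 ==> vu (a powi k) = k * vu a"
 by (simp add: vu_def lc_powi vt_powi)

lemma vt_divide: "a ~= 0 ==> b ~= 0 ==> sdeg (a / b) = sdeg a - sdeg (b :: 'a::field fls)"
 by (simp add: divide_inverse)

lemma vu_divide: "a ~= 0 ==> b ~= 0 ==> vu (a / b) = vu a - vu b"
 by (simp add: divide_inverse vu_mult vu_inverse)

text \<open>The sign of the tame symbol is a unit of \<open>k[[u]]\<close>, so \<open>nuF\<close> is the determinant of the two
 valuation vectors; in particular it is bimultiplicative.\<close>

lemma nuF_eq:
 assumes "a ~= 0" "b ~= 0"
 shows "nuF a b = sdeg b * vu a - sdeg a * vu b"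
proof -
 define c where "c = a powi sdeg b * b powi (- sdeg a)"
 have c0: "c ~= 0" using assms by (simp add: c_def)
 have "sdeg c = 0" unfolding c_def using assms by (simp add: vt_powi)
 hence red: "red c = lc c" by (simp add: red_def lc_def)
 have sg: "sdeg ((- 1 :: 'a fls) powi m) = 0" for m
  by (simp add: vt_powi)
 have "nuF a b = sdeg (lc c)"
  unfolding nuF_def tame_def c_def[symmetric] red
  using c0 by (subst vt_mult) (simp_all add: sg)
 also have "... = sdeg b * vu a - sdeg a * vu b"
  unfolding c_def lc_mult lc_powi vu_def using assms by (simp add: vt_powi)
 finally show ?thesis .
qed

lemma tt_powi_mult: "fls_nth (x * tt powi m) i = fls_nth x (i - m)"
 by (simp add: tt_def fls_X_intpow_times_conv_shift)

lemma uu_neq_0 [simp]: "uu ~= 0" and tt_neq_0 [simp]: "tt ~= 0"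
 by (auto simp: uu_def tt_def fls_const_nonzero)

lemma vt_uu [simp]: "sdeg uu = 0" and vt_tt [simp]: "sdeg tt = 1"
 and vu_uu [simp]: "vu uu = 1" and vu_tt [simp]: "vu tt = 0"
 by (simp_all add: uu_def tt_def vu_def lc_def)

section \<open>The valuation ring\<close>

lemma O2_iff_nth: "x : O2 \<longleftrightarrow> (\<forall>i<0. fls_nth x i = 0) & (\<forall>j<0. fls_nth (fls_nth x 0) j = 0)"
 by (auto simp: O2_def O1_def red_def)

lemma fls_nonneg_iff: "(\<forall>i<0. fls_nth x i = 0) \<longleftrightarrow> x = 0 | sdeg x >= 0"
 using fls_subdegree_ge0I[of x] by (auto simp: not_le)

lemma O2_iff: "x : O2 \<longleftrightarrow> x = 0 | sdeg x > 0 | sdeg x = 0 & vu x >= 0"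
proof -
 have "sdeg x > 0 ==> fls_nth x 0 = 0" by simp
 moreover have "sdeg x = 0 ==> fls_nth x 0 = lc x" by (simp add: lc_def)
 ultimately show ?thesis
  unfolding O2_iff_nth fls_nonneg_iff[of x] fls_nonneg_iff[of "fls_nth x 0"]
  by (auto simp: vu_def order_le_less)
qed

lemma O2_0 [simp]: "0 : O2" and O2_1 [simp]: "1 : O2"
 by (simp_all add: O2_iff)

lemma O2_add: "x : O2 ==> y : O2 ==> x + y : O2"
 by (simp add: O2_iff_nth)

lemma O2_uminus [simp]: "- x : O2 \<longleftrightarrow> x : O2"
 by (simp add: O2_iff_nth)

lemma O2_diff: "x : O2 ==> y : O2 ==> x - y : O2"
 by (simp add: O2_iff_nth)

lemma O2_mult:
 assumes "x : O2" "y : O2"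
 shows "x * y : O2"
proof (cases "x = 0 | y = 0")
 case False
 thus ?thesis using assms by (auto simp: O2_iff vu_mult)
qed auto

lemma O2_sum: "(!!i. i : I ==> f i : O2) ==> sum f I : O2"
 by (induction I rule: infinite_finite_induct) (auto intro: O2_add)

lemma O2_prod: "(!!i. i : I ==> f i : O2) ==> prod f I : O2"
 by (induction I rule: infinite_finite_induct) (auto intro: O2_mult)

lemma O2_total: "x / y : O2 | y / x : O2"
proof (cases "x = 0 | y = 0")
 case False
 thus ?thesis by (auto simp: O2_iff vt_divide vu_divide)
qed auto

definition m2 :: "'k::field F set" where
 "m2 = {x. x = 0 | sdeg x > 0 | sdeg x = 0 & vu x > 0}"

definition O2u :: "'k::field F set" where
 "O2u = {x. x ~= 0 & sdeg x = 0 & vu x = 0}"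

lemma O2_eq: "O2 = O2u Un m2" and O2u_m2: "O2u Int m2 = {}"
 by (auto simp: O2_iff O2u_def m2_def)

lemma O2u_iff: "x : O2u \<longleftrightarrow> x : O2 & inverse x : O2 & x ~= 0"
 by (auto simp: O2_iff O2u_def vu_inverse)

lemma O2u_mult: "x : O2u ==> y : O2u ==> x * y : O2u"
 by (auto simp: O2u_def vu_mult)

lemma O2u_1 [simp]: "1 : O2u"
 by (simp add: O2u_def)

lemma O2u_inverse [simp]: "inverse x : O2u \<longleftrightarrow> x : O2u"
 by (auto simp: O2u_def vu_inverse)

lemma O2u_prod: "(!!i. i : I ==> f i : O2u) ==> prod f I : O2u"
 by (induction I rule: infinite_finite_induct) (auto intro: O2u_mult)

lemma O2u_mult_iff: "x : O2 ==> y : O2 ==> x * y : O2u \<longleftrightarrow> x : O2u & y : O2u"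
 by (cases "x = 0 | y = 0") (auto simp: O2u_def O2_iff vu_mult)

definition res :: "'k::field F => 'k" where
 "res x = fls_nth (fls_nth x 0) 0"

lemma fls_nth_mult_0:
 assumes "\<forall>i<0. fls_nth x i = 0" "\<forall>i<0. fls_nth y i = 0"
 shows "fls_nth (x * y) 0 = fls_nth x 0 * fls_nth (y :: 'a::comm_ring_1 fls) 0"
proof -
 have s: "sdeg x >= 0" "sdeg y >= 0"
  using assms by (auto intro!: fls_subdegree_ge0I)
 show ?thesis by (subst fls_times_conv_fps_times[OF s]) simp
qed

lemma res_add: "res (x + y) = res x + res y" and res_diff: "res (x - y) = res x - res y"
 and res_0 [simp]: "res 0 = 0" and res_1 [simp]: "res 1 = 1"
 and res_uminus: "res (- x) = - res x"
 by (simp_all add: res_def)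

lemma res_mult: "x : O2 ==> y : O2 ==> res (x * y) = res x * res y"
 unfolding res_def by (subst fls_nth_mult_0, simp add: O2_iff_nth, simp add: O2_iff_nth)
  (subst fls_nth_mult_0, simp_all add: O2_iff_nth)

lemma res_sum: "res (sum f I) = (\<Sum>i\<in>I. res (f i))"
 by (induction I rule: infinite_finite_induct) (simp_all add: res_add)

lemma res_prod: "(!!i. i : I ==> f i : O2) ==> res (prod f I) = (\<Prod>i\<in>I. res (f i))"
 by (induction I rule: infinite_finite_induct) (simp_all add: res_mult O2_prod)

lemma m2_iff_res: "x : O2 ==> x : m2 \<longleftrightarrow> res x = 0"
proof -
 assume x: "x : O2"
 consider "x = 0" | "x ~= 0" "sdeg x > 0" | "x ~= 0" "sdeg x = 0" "vu x >= 0"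
  using x by (auto simp: O2_iff)
 thus ?thesis
 proof cases
  case 3
  hence "res x = fls_nth (lc x) 0" by (simp add: res_def lc_def)
  moreover have "fls_nth (lc x) 0 = 0 \<longleftrightarrow> vu x > 0"
   using 3 nth_fls_subdegree_nonzero[of "lc x"]
   by (cases "vu x = 0") (auto simp: vu_def simp del: nth_fls_subdegree_nonzero)
  ultimately show ?thesis using 3 by (auto simp: m2_def)
 qed (auto simp: res_def m2_def)
qed

lemma O2u_iff_res: "x : O2u \<longleftrightarrow> x : O2 & res x ~= 0"
 using O2_eq O2u_m2 m2_iff_res by blast

definition klift :: "'k::field => 'k F" where
 "klift c = fls_const (fls_const c)"

lemma klift_O2 [simp]: "klift c : O2" and res_klift [simp]: "res (klift c) = c"
 by (simp_all add: O2_iff_nth klift_def res_def)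

lemma m2_eq: "x : m2 \<longleftrightarrow> x / uu : O2"
 by (cases "x = 0") (auto simp: m2_def O2_iff vt_divide vu_divide)

section \<open>The ideals\<close>

definition pu :: "nat => nat => 'k::field F" where
 "pu i j = uu ^ i * tt ^ j"

lemma pu_neq_0 [simp]: "pu i j ~= 0"
 by (simp add: pu_def)

lemma vt_pu [simp]: "sdeg (pu i j) = int j"
 by (simp add: pu_def fls_subdegree_pow)

lemma vu_pu [simp]: "vu (pu i j :: 'a::field F) = int i"
 using vu_powi[of "uu :: 'a F" "int i"] vu_powi[of "tt :: 'a F" "int j"] by (simp add: pu_def vu_mult)

lemma Jid_iff: "x : Jid i j \<longleftrightarrow> x / pu i j : O2"
proof
 assume "x : Jid i j"
 then obtain y where "y : O2" "x = pu i j * y" by (auto simp: Jid_def pu_def)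
 thus "x / pu i j : O2" by simp
next
 assume "x / pu i j : O2"
 moreover have "x = pu i j * (x / pu i j)" by simp
 ultimately show "x : Jid i j" unfolding Jid_def pu_def by blast
qed

lemma Jid_iff_val: "x : Jid i j \<longleftrightarrow>
  x = 0 | sdeg x > int j | sdeg x = int j & vu x >= int i"
 unfolding Jid_iff by (cases "x = 0") (auto simp: O2_iff vt_divide vu_divide)

lemma Jid_0 [simp]: "0 : Jid i j"
 by (simp add: Jid_iff)

lemma Jid_add: "x : Jid i j ==> y : Jid i j ==> x + y : Jid i j"
 by (simp add: Jid_iff add_divide_distrib O2_add)

lemma Jid_uminus: "x : Jid i j ==> - x : Jid i j"
 by (simp add: Jid_iff)

lemma Jid_diff: "x : Jid i j ==> y : Jid i j ==> x - y : Jid i j"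
 by (simp add: Jid_iff diff_divide_distrib O2_diff)

lemma Jid_mult: "x : O2 ==> y : Jid i j ==> x * y : Jid i j"
 using O2_mult[of x "y / pu i j"] by (simp add: Jid_iff)

lemma Jid_mult_right: "y : O2 ==> x : Jid i j ==> x * y : Jid i j"
 using Jid_mult[of y x] by (simp add: mult.commute)

lemma Jid_sum: "(!!l. l : I ==> f l : Jid i j) ==> sum f I : Jid i j"
 by (induction I rule: infinite_finite_induct) (auto intro: Jid_add)

lemma Jid_m2: "1 <= i ==> 1 <= j ==> Jid i j <= m2"
 by (auto simp: Jid_iff_val m2_def)

lemma Jid_O2: "Jid i j <= O2"
 by (auto simp: Jid_iff_val O2_iff)

lemma Jid_mono: "j < j' | j = j' & i <= i' ==> Jid i' j' <= Jid i j"
 by (auto simp: Jid_iff_val)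

section \<open>The absolute value\<close>

lemma abs_F_eq: "a ~= 0 ==> abs_F a =
  fls_const (of_nat CARD('k) powi (- vu a)) * fls_X powi sdeg (a :: 'k::{field,finite} F)"
proof -
 assume "a ~= 0"
 have "red (a * tt powi (- sdeg a)) = lc a"
  unfolding red_def tt_powi_mult lc_def by simp
 thus ?thesis using \<open>a ~= 0\<close> by (simp add: abs_F_def vu_def)
qed

lemma abs_F_0 [simp]: "abs_F 0 = 0"
 by (simp add: abs_F_def)

lemma fls_X_powi_add: "fls_X powi (m + n) = fls_X powi m * (fls_X powi n :: 'a::field fls)"
 by (intro power_int_add) simp

lemma abs_F_mult: "abs_F (a * b) = abs_F a * abs_F (b :: 'k::{field,finite} F)"
proof (cases "a = 0 | b = 0")
 case False
 hence *: "a ~= 0" "b ~= 0" "a * b ~= 0" by auto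
 have "(of_nat CARD('k) :: complex) powi (- vu (a * b)) = of_nat CARD('k) powi (- vu a) * of_nat CARD('k) powi (- vu b)"
  using * by (simp add: vu_mult power_int_add power_int_diff divide_inverse power_int_minus)
 thus ?thesis
  unfolding abs_F_eq[OF *(1)] abs_F_eq[OF *(2)] abs_F_eq[OF *(3)] vt_mult[OF *(1,2)] fls_X_powi_add
  by (simp only: fls_const_mult_const[symmetric] mult_ac)
qed auto

lemma abs_F_O2u: "a : O2u ==> abs_F a = 1"
 using abs_F_eq[of a] by (simp add: O2u_def)

lemma abs_F_inverse: "abs_F (inverse a) = inverse (abs_F (a :: 'k::{field,finite} F))"
proof (cases "a = 0")
 case False
 hence "abs_F (inverse a) * abs_F a = 1" by (simp flip: abs_F_mult add: abs_F_O2u)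
 thus ?thesis by (metis inverse_unique mult.commute)
qed simp

lemma abs_F_prod: "abs_F (prod f I) = (\<Prod>i\<in>I. abs_F (f i :: 'k::{field,finite} F))"
 by (induction I rule: infinite_finite_induct) (simp_all add: abs_F_mult abs_F_O2u)

lemma abs_F_neq_0: "a ~= 0 ==> abs_F (a :: 'k::{field,finite} F) ~= 0"
 by (simp add: abs_F_eq)

section \<open>Haar measure on the residue field\<close>

definition bE :: "'k::field fls => int => 'k fls set" where
 "bE a i = {x. \<forall>l<i. fls_nth x l = fls_nth a l}"

lemma bE_refl [simp]: "a : bE a i"
 by (simp add: bE_def)

lemma bE_cong: "b : bE a i ==> bE b i = bE a i"
 by (auto simp: bE_def)

lemma bE_Int: "x : bE a i ==> x : bE b j ==> bE a i Int bE b j = bE x (max i j)"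
 by (auto simp: bE_def less_max_iff_disj)

lemma bE_image_add: "(%x. c + x) ` bE a i = bE (c + a) i"
proof (intro equalityI subsetI)
 fix x assume "x : bE (c + a) i"
 hence "x - c : bE a i" by (simp add: bE_def)
 hence "c + (x - c) : (%x. c + x) ` bE a i" by blast
 thus "x : (%x. c + x) ` bE a i" by simp
qed (auto simp: bE_def)

lemma bE_iff_subdegree: "x : bE a i \<longleftrightarrow> x = a | sdeg (x - a) >= i"
proof
 assume "x : bE a i"
 thus "x = a | sdeg (x - a) >= i"
  by (cases "x = a") (auto simp: bE_def intro!: fls_subdegree_geI)
next
 assume *: "x = a | sdeg (x - a) >= i"
 have "fls_nth x l = fls_nth a l" if "l < i" for l
 proof (cases "x = a")
  case False
  with * that have "fls_nth (x - a) l = 0" by (intro fls_eq0_below_subdegree) simp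
  thus ?thesis by simp
 qed simp
 thus "x : bE a i" by (simp add: bE_def)
qed

lemma open_bE: "open (bE a i)"
 unfolding open_fls_def
proof (intro ballI exI conjI subsetI)
 fix y z assume y: "y : bE a i"
 show "(0::real) < inverse (2 ^ nat \<bar>i\<bar>)" by simp
 assume "z : {z. dist z y < inverse (2 ^ nat \<bar>i\<bar>)}"
 hence d: "dist z y < inverse (2 ^ nat \<bar>i\<bar>)" by simp
 have "z : bE y i"
 proof (cases "z = y")
  case False
  have "sdeg (z - y) >= 0"
  proof (rule ccontr)
   assume "~ sdeg (z - y) >= 0"
   hence "dist z y = 2 ^ nat (- sdeg (z - y))"
    using False by (simp add: dist_fls_def)
   hence "1 <= dist z y" by simp
   moreover have "inverse (2 ^ nat \<bar>i\<bar>) <= (1::real)"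
    by (intro inverse_le_1_iff[THEN iffD2]) simp
   ultimately show False using d by linarith
  qed
  hence "inverse (2 ^ nat (sdeg (z - y))) < inverse ((2::real) ^ nat \<bar>i\<bar>)"
   using d False by (simp add: dist_fls_def)
  hence "(2::real) ^ nat \<bar>i\<bar> < 2 ^ nat (sdeg (z - y))"
   by (subst (asm) inverse_less_iff_less) auto
  hence "nat \<bar>i\<bar> < nat (sdeg (z - y))" by simp
  thus ?thesis by (auto simp: bE_iff_subdegree)
 qed simp
 thus "z : bE a i" using bE_cong[OF y] by simp
qed

lemma open_imp_bE:
 assumes "open U" "x : U"
 shows "EX i. bE x i <= U"
proof -
 obtain r where r: "r > 0" "{y. dist y x < r} <= U"
  using assms by (auto simp: open_fls_def)
 obtain m :: nat where m: "inverse (2 ^ m) < r"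
  using real_arch_pow_inv[of r "1/2"] r(1) by (auto simp: power_one_over inverse_eq_divide)
 have "bE x (int m) <= {y. dist y x < r}"
 proof
  fix y assume y: "y : bE x (int m)"
  show "y : {y. dist y x < r}"
  proof (cases "y = x")
   case False
   hence s: "sdeg (y - x) >= int m" using y by (simp add: bE_iff_subdegree)
   hence "dist y x = inverse (2 ^ nat (sdeg (y - x)))"
    using False by (simp add: dist_fls_def)
   also have "... <= inverse (2 ^ m)"
    using s by (intro le_imp_inverse_le power_increasing) auto
   finally show ?thesis using m by simp
  qed (simp add: r(1))
 qed
 thus ?thesis using r(2) by blast
qed

definition balls_E :: "'k::{field,finite} fls set set" where
 "balls_E = {bE a i | a i. True}"

lemma countable_balls_E: "countable (balls_E :: 'k::{field,finite} fls set set)"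
proof -
 let ?f = "%(xs :: 'k list, m :: int, i :: int).
  bE (fls_shift m (fps_to_fls (Abs_fps (%l. if l < length xs then xs ! l else 0)))) i"
 have "balls_E <= range ?f"
 proof
  fix B :: "'k fls set" assume "B : balls_E"
  then obtain a i where B: "B = bE a i" by (auto simp: balls_E_def)
  define s where "s = sdeg a"
  define xs where "xs = map (%l. fls_nth a (int l + s)) [0..<nat (i - s)]"
  have "fls_shift (- s) (fps_to_fls (Abs_fps (%l. if l < length xs then xs ! l else 0))) : bE a i"
  proof -
   have "fls_nth (fls_shift (- s) (fps_to_fls (Abs_fps (%l. if l < length xs then xs ! l else 0)))) l
     = fls_nth a l" if "l < i" for l
   proof (cases "l < s")
    case True
    thus ?thesis by (simp add: s_def)
   next
    case False
    hence "nat (l - s) < nat (i - s)" using that by linarith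
    thus ?thesis using False by (simp add: xs_def)
   qed
   thus ?thesis by (simp add: bE_def)
  qed
  from bE_cong[OF this] have "B = ?f (xs, - s, i)" by (simp add: B)
  thus "B : range ?f" by blast
 qed
 thus ?thesis by (rule countable_subset) simp
qed

lemma borel_E: "(borel :: 'k::{field,finite} fls measure) = Sigma_Algebra.sigma UNIV balls_E"
proof (rule borel_eq_countable_basis[OF countable_balls_E])
 show "topological_basis (balls_E :: 'k fls set set)"
 proof (rule topological_basisI)
  fix U x assume "open U" "(x :: 'k fls) : U"
  then obtain i where "bE x i <= U" using open_imp_bE by blast
  thus "EX B':balls_E. x : B' & B' <= U"
   by (intro bexI[of _ "bE x i"]) (auto simp: balls_E_def)
 qed (auto simp: balls_E_def open_bE)
qed

lemma bE_borel [measurable]: "bE a i : sets borel"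
 by (simp add: open_bE borel_open)

text \<open>Two balls are disjoint or nested, and the balls generate the Borel sets.\<close>

lemma measure_eq_balls:
 fixes M N :: "'k::{field,finite} fls measure"
 assumes M: "sets M = sets borel" and N: "sets N = sets borel"
  and eq: "!!a i. emeasure M (bE a i) = emeasure N (bE a i)"
  and fin: "!!a i. emeasure M (bE a i) ~= \<infinity>"
 shows "M = N"
proof (rule measure_eqI_generator_eq[of "insert {} balls_E" UNIV M N "%i. bE 0 (- int i)"])
 show "Int_stable (insert {} (balls_E :: 'k fls set set))"
 proof (rule Int_stableI)
  fix A B :: "'k fls set"
  assume AB: "A : insert {} balls_E" "B : insert {} balls_E"
  show "A Int B : insert {} balls_E"
  proof (cases "A Int B = {}")
   case False
   hence "A : balls_E" "B : balls_E" using AB by auto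
   then obtain a i b j where "A = bE a i" "B = bE b j"
    by (auto simp: balls_E_def)
   moreover obtain x where "x : A" "x : B" using False by auto
   ultimately
   have "A Int B = bE x (max i j)" using bE_Int by metis
   thus ?thesis by (auto simp: balls_E_def)
  qed simp
 qed
 have s: "sigma_sets UNIV (insert {} balls_E) = sets (borel :: 'k fls measure)"
  unfolding borel_E
  by (subst sets_measure_of) (auto intro!: sigma_sets_eqI intro: sigma_sets.Empty sigma_sets.Basic)
 show "sets M = sigma_sets UNIV (insert {} balls_E)" "sets N = sigma_sets UNIV (insert {} balls_E)"
  by (simp_all add: s M N)
 show "(\<Union>i. bE (0 :: 'k fls) (- int i)) = UNIV"
 proof (intro equalityI subsetI)
  fix x :: "'k fls"
  have "x : bE 0 (- int (nat (- sdeg x)))"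
   unfolding bE_iff_subdegree by simp
  thus "x : (\<Union>i. bE 0 (- int i))" by blast
 qed simp
qed (use eq fin in \<open>auto simp: balls_E_def\<close>)

text \<open>Base \<open>q\<close> digits, with the digits numbered so that the ball \<open>bE a i\<close> corresponds to
 an interval of length \<open>q\<^sup>-\<^sup>i\<close>.\<close>

lemma nat_digits_unique:
 fixes q :: nat
 assumes q: "q >= 2" and "!!k. x div q ^ k mod q = y div q ^ k mod q"
 shows "x = y"
 using assms(2)
proof (induction x arbitrary: y rule: less_induct)
 case (less x)
 have dig: "x div q div q ^ k mod q = y div q div q ^ k mod q" for k
  using less.prems[of "Suc k"] by (simp add: div_mult2_eq)
 have m: "x mod q = y mod q" using less.prems[of 0] by simp
 have "x div q = y div q"
 proof (cases "x = 0")
  case True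
  have "y div q ^ k mod q = 0" for k using less.prems[of k] True by simp
  hence "q ^ k dvd y" for k
  proof (induction k)
   case (Suc k)
   then obtain z where z: "y = q ^ k * z" by (auto simp: dvd_def)
   have "z mod q = 0" using Suc.prems[of k] q by (simp add: z)
   thus ?case by (simp add: z mult.commute[of q] mod_eq_0_iff_dvd)
  qed simp
  moreover have "y < q ^ y" using q by (intro power_gt_expt) simp
  ultimately have "y = 0" using nat_dvd_not_less by blast
  thus ?thesis using True by simp
 next
  case False
  thus ?thesis using less.IH[of "x div q" "y div q"] dig q by simp
 qed
 thus ?case using m by (metis div_mult_mod_eq)
qed

lemma nat_digits_exist:
 fixes q :: nat and d :: "nat => nat"
 assumes q: "q >= 2" and "!!k. d k < q" and "!!k. k >= K ==> d k = 0"
 shows "EX y. ALL k. y div q ^ k mod q = d k"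
 using assms(2,3)
proof (induction K arbitrary: d)
 case 0
 thus ?case by (intro exI[of _ 0]) simp
next
 case (Suc K)
 obtain y where y: "!!k. y div q ^ k mod q = d (Suc k)"
  using Suc.IH[of "%k. d (Suc k)"] Suc.prems by auto
 have "(d 0 + q * y) div q ^ k mod q = d k" for k
 proof (cases k)
  case 0
  thus ?thesis using Suc.prems(1)[of 0] by simp
 next
  case (Suc l)
  have "(d 0 + q * y) div q = y" using Suc.prems(1)[of 0] q by (simp add: div_add1_eq)
  thus ?thesis using y[of l] Suc by (simp add: div_mult2_eq)
 qed
 thus ?case by blast
qed

lemma CARD_ge_2: "CARD('k::{field,finite}) >= 2"
proof -
 have "card {0, 1 :: 'k} <= CARD('k)" by (intro card_mono) auto
 thus ?thesis by simp
qed

text \<open>The image of Lebesgue measure on the half line under expansion in base \<open>q\<close>: intervals of length \<open>q\<^sup>-\<^sup>i\<close> whose end points have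
 finitely many digits go to balls, and a translation permutes the balls of a given radius.\<close>

lemma haar_exists:
 "\<exists>M :: 'k::{field,finite} fls measure. sets M = sets borel
  & (ALL a i. emeasure M (bE a i) = ennreal (real CARD('k) powi (- i)))"
proof -
 define q where "q = CARD('k)"
 have q2: "q >= 2" using CARD_ge_2[where 'k = 'k] by (simp add: q_def)
 have q0: "real q > 0" using q2 by simp
 obtain h :: "nat => 'k" where h: "bij_betw h {0..<q} UNIV"
  using ex_bij_betw_nat_finite[of "UNIV :: 'k set"] by (auto simp: q_def)
 define e where "e = Transposition.transpose 0 (h 0) \<circ> h"
 have e: "bij_betw e {0..<q} UNIV"
  unfolding e_def using h by (rule bij_betw_trans) (rule bij_transpose)
 have e0: "e 0 = 0" by (simp add: e_def)
 define e' where "e' = the_inv_into {0..<q} e"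
 have e': "e' c < q" "e (e' c) = c" for c
  using the_inv_into_into[of e "{0..<q}" c "{0..<q}"] f_the_inv_into_f[of e "{0..<q}" c] e
  by (auto simp: e'_def bij_betw_def)
 have e'_eq: "x < q ==> e x = c \<longleftrightarrow> x = e' c" for x c
  using e e'[of c] by (auto simp: bij_betw_def inj_on_def)
 have e'0: "e' 0 = 0" using e'_eq[of 0 0] e0 q2 by simp
 define dg where "dg x l = nat \<lfloor>x * real q powi (l + 1)\<rfloor> mod q" for x :: real and l :: int
 define D where "D x = Abs_fls (%l. e (dg x l))" for x :: real
 have D_nth: "fls_nth (D x) l = e (dg x l)" if "x >= 0" for x l
 proof -
  obtain N :: nat where N: "x < real q ^ N" using real_arch_pow[of "real q" x] q2 by auto
  have "\<forall>l<(- int N). e (dg x l) = 0"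
  proof (intro allI impI)
   fix l assume l: "l < - int N"
   have "x * real q powi (l + 1) <= x * real q powi (- int N)"
    using l q2 that by (intro mult_left_mono power_int_increasing) auto
   also have "... < 1" using N q0 by (simp add: power_int_minus field_simps)
   finally have "\<lfloor>x * real q powi (l + 1)\<rfloor> <= 0" by linarith
   thus "e (dg x l) = 0" by (simp add: dg_def e0)
  qed
  thus ?thesis unfolding D_def by (rule nth_Abs_fls_lower_bound)
 qed
 have ball: "\<exists>m::nat. {x. x >= 0 & D x : bE a i} = {real m * real q powi (- i)..<(real m + 1) * real q powi (- i)}"
  for a :: "'k fls" and i
 proof -
  define d where "d k = e' (fls_nth a (i - 1 - int k))" for k :: nat
  have "d k = 0" if "k >= nat (i - sdeg a)" for k
  proof -
   have "i - 1 - int k < sdeg a" using that by linarith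
   thus ?thesis by (simp add: d_def e'0)
  qed
  then obtain m where m: "!!k. m div q ^ k mod q = d k"
   using nat_digits_exist[OF q2, of d] e'(1) unfolding d_def by metis
  have "D x : bE a i \<longleftrightarrow> \<lfloor>x * real q powi i\<rfloor> = int m" if x: "x >= 0" for x
  proof -
   define y where "y = nat \<lfloor>x * real q powi i\<rfloor>"
   have y: "\<lfloor>x * real q powi i\<rfloor> = int y" using x q0 by (simp add: y_def)
   have dg: "dg x (i - 1 - int k) = y div q ^ k mod q" for k
   proof -
    have "x * real q powi (i - 1 - int k + 1) = x * real q powi i / real_of_int (int (q ^ k))"
     using q0 by (simp add: power_int_diff)
    hence "\<lfloor>x * real q powi (i - 1 - int k + 1)\<rfloor> = int y div int (q ^ k)"
     by (simp only: floor_divide_real_eq_div y of_nat_0_le_iff)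
    thus ?thesis
     unfolding dg_def by (simp flip: zdiv_int of_nat_power)
   qed
   have "D x : bE a i \<longleftrightarrow> (\<forall>l<i. e (dg x l) = fls_nth a l)"
    by (simp add: bE_def D_nth[OF x])
   also have "... \<longleftrightarrow> (ALL k. e (dg x (i - 1 - int k)) = fls_nth a (i - 1 - int k))"
   proof
    assume *: "ALL k. e (dg x (i - 1 - int k)) = fls_nth a (i - 1 - int k)"
    show "\<forall>l<i. e (dg x l) = fls_nth a l"
    proof (intro allI impI)
     fix l assume "l < i"
     hence "i - 1 - int (nat (i - 1 - l)) = l" by simp
     thus "e (dg x l) = fls_nth a l" using *[rule_format, of "nat (i - 1 - l)"] by simp
    qed
   qed auto
   also have "... \<longleftrightarrow> (ALL k. y div q ^ k mod q = m div q ^ k mod q)"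
    using q2 by (simp add: dg m d_def e'_eq)
   also have "... \<longleftrightarrow> y = m" using nat_digits_unique[OF q2, of y m] by auto
   also have "... \<longleftrightarrow> \<lfloor>x * real q powi i\<rfloor> = int m" by (simp add: y)
   finally show ?thesis .
  qed
  hence "{x. x >= 0 & D x : bE a i} = {x. x >= 0 & \<lfloor>x * real q powi i\<rfloor> = int m}" by auto
  also have "... = {x. x >= 0 & real m <= x * real q powi i & x * real q powi i < real m + 1}"
   by (auto simp: floor_eq_iff)
  also have "... = {real m * real q powi (- i)..<(real m + 1) * real q powi (- i)}"
  proof -
   have p: "real q powi i > 0" using q0 by simp
   have "0 <= x" if "real m / real q powi i <= x" for x
    using that p by (meson divide_nonneg_pos of_nat_0_le_iff order_trans)
   thus ?thesis using p by (auto simp: power_int_minus field_simps)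
  qed
  finally show ?thesis by blast
 qed
 define L where "L = restrict_space lborel {0::real..}"
 have spL: "space L = {0..}" by (simp add: L_def)
 have pre: "\<exists>m::nat. D -` bE a i Int space L = {real m * real q powi (- i)..<(real m + 1) * real q powi (- i)}
  & D -` bE a i Int space L <= {0..}" for a i
  using ball[of a i] by (auto simp: spL vimage_def Int_def conj_commute)
 have D_meas: "D : measurable L borel"
  unfolding borel_E
 proof (rule measurable_measure_of)
  fix B :: "'k fls set" assume "B : balls_E"
  then obtain a i where B: "B = bE a i" by (auto simp: balls_E_def)
  obtain m :: nat where m: "D -` bE a i Int space L = {real m * real q powi (- i)..<(real m + 1) * real q powi (- i)}"
    "D -` bE a i Int space L <= {0..}"
   using pre by blast
  show "D -` B Int space L : sets L"
   unfolding B L_def using m unfolding L_def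
   by (subst sets_restrict_space_iff) auto
 qed auto
 have "emeasure (distr L borel D) (bE a i) = ennreal (real q powi (- i))" for a i
 proof -
  obtain m :: nat where m: "D -` bE a i Int space L = {real m * real q powi (- i)..<(real m + 1) * real q powi (- i)}"
    "D -` bE a i Int space L <= {0..}"
   using pre by blast
  have "emeasure (distr L borel D) (bE a i) = emeasure L (D -` bE a i Int space L)"
   by (rule emeasure_distr[OF D_meas]) simp
  also have "... = emeasure lborel (D -` bE a i Int space L)"
   unfolding L_def using m(2) unfolding L_def by (intro emeasure_restrict_space) auto
  also have "... = ennreal ((real m + 1) * real q powi (- i) - real m * real q powi (- i))"
   unfolding m(1) using q0 by (intro emeasure_lborel_Ico mult_right_mono) auto
  finally show ?thesis by (simp add: algebra_simps)
 qed
 thus ?thesis by (intro exI[of _ "distr L borel D"]) (simp add: q_def)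
qed

text \<open>A ball is the disjoint union of \<open>q\<close> translates of the next smaller ball.\<close>

lemma emeasure_bE_unique:
 fixes M :: "'k::{field,finite} fls measure"
 assumes M: "sets M = sets borel"
  and inv: "!!a A. A : sets M ==> emeasure M ((%x. a + x) ` A) = emeasure M A"
  and one: "emeasure M {x. \<forall>i<0. fls_nth x i = 0} = 1"
 shows "emeasure M (bE a i) = ennreal (real CARD('k) powi (- i))"
proof -
 define q where "q = CARD('k)"
 have q0: "real q > 0" using CARD_ge_2[where 'k = 'k] by (simp add: q_def)
 have tr: "emeasure M (bE a i) = emeasure M (bE 0 i)" for a i
  using inv[of "bE 0 i" a] by (simp add: bE_image_add M)
 have step: "emeasure M (bE 0 i) = ennreal (real q) * emeasure M (bE 0 (i + 1))" for i
 proof -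
  define s where "s c = fls_shift (- i) (fls_const c)" for c :: 'k
  have s: "fls_nth (s c) l = (if l = i then c else 0)" for c l by (simp add: s_def)
  have mem: "x : bE (s c) (i + 1) \<longleftrightarrow> x : bE 0 i & fls_nth x i = c" for x c
  proof -
   have "x : bE (s c) (i + 1) \<longleftrightarrow> (ALL l. l < i | l = i --> fls_nth x l = fls_nth (s c) l)"
    unfolding bE_def mem_Collect_eq zless_add1_eq ..
   also have "... \<longleftrightarrow> (\<forall>l<i. fls_nth x l = fls_nth (s c) l) & fls_nth x i = fls_nth (s c) i"
    by blast
   also have "... \<longleftrightarrow> x : bE 0 i & fls_nth x i = c"
    unfolding bE_def s by simp
   finally show ?thesis .
  qed
  have U: "bE 0 i = (\<Union>c. bE (s c) (i + 1))"
   unfolding set_eq_iff UN_iff mem by blast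
  have "emeasure M (bE 0 i) = emeasure M (\<Union>c. bE (s c) (i + 1))"
   by (simp only: U)
  also have "... = (\<Sum>c\<in>UNIV. emeasure M (bE (s c) (i + 1)))"
  proof (rule sum_emeasure[symmetric])
   show "disjoint_family (%c. bE (s c) (i + 1))"
    unfolding disjoint_family_on_def disjoint_iff mem by blast
   show "(%c. bE (s c) (i + 1)) ` UNIV <= sets M"
    by (intro image_subsetI) (simp add: M bE_borel)
  qed simp
  also have "... = (\<Sum>c\<in>(UNIV :: 'k set). emeasure M (bE 0 (i + 1)))"
   by (intro sum.cong refl tr)
  also have "... = of_nat q * emeasure M (bE 0 (i + 1))" by (simp add: q_def)
  finally show ?thesis by (simp add: ennreal_of_nat_eq_real_of_nat)
 qed
 have "bE 0 0 = {x :: 'k fls. \<forall>i<0. fls_nth x i = 0}" by (simp add: bE_def)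
 hence base: "emeasure M (bE 0 0) = 1" using one by simp
 have "emeasure M (bE 0 i) = ennreal (real q powi (- i))"
 proof (induction i rule: int_induct[where k = 0])
  case base
  show ?case using \<open>emeasure M (bE 0 0) = 1\<close> by simp
 next
  case (step1 i)
  have "ennreal (real q) * emeasure M (bE 0 (i + 1)) = ennreal (real q) * ennreal (real q powi (- (i + 1)))"
  proof -
   have "real q powi 1 * real q powi (- (i + 1)) = real q powi (1 + (- (i + 1)))"
    using q0 by (subst power_int_add) auto
   hence "real q * real q powi (- (i + 1)) = real q powi (- i)" by simp
   thus ?thesis using step1(2) step[of i] q0 by (simp flip: ennreal_mult)
  qed
  thus ?case using q0 by (subst (asm) ennreal_mult_cancel_left) auto
 next
  case (step2 i)
  have "emeasure M (bE 0 (i - 1)) = ennreal (real q) * ennreal (real q powi (- i))"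
   using step[of "i - 1"] step2(2) by simp
  also have "... = ennreal (real q powi (- (i - 1)))"
  proof -
   have "real q * real q powi (- i) = real q powi (1 + (- i))"
    using q0 by (subst power_int_add) auto
   hence "real q * real q powi (- i) = real q powi (- (i - 1))" by (simp add: algebra_simps)
   thus ?thesis using q0 by (simp flip: ennreal_mult)
  qed
  finally show ?case .
 qed
 thus ?thesis by (subst tr) (simp add: q_def)
qed

lemma haar_E_char:
 "sets (haar_E :: 'k::{field,finite} fls measure) = sets borel
 & (ALL a i. emeasure (haar_E :: 'k fls measure) (bE a i) = ennreal (real CARD('k) powi (- i)))"
proof -
 obtain M :: "'k fls measure" where M: "sets M = sets borel"
  "!!a i. emeasure M (bE a i) = ennreal (real CARD('k) powi (- i))"
  using haar_exists by blast
 have sp: "space M = UNIV" using sets_eq_imp_space_eq[OF M(1)] by simp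
 have inv: "emeasure M ((%x. a + x) ` A) = emeasure M A" if A: "A : sets M" for a A
 proof -
  have vim: "(%x. - a + x) -` B = (%x. a + x) ` B" for B
  proof (intro equalityI subsetI)
   fix x assume "x : (%x. - a + x) -` B"
   hence "a + (- a + x) : (%x. a + x) ` B" by blast
   thus "x : (%x. a + x) ` B" by simp
  qed auto
  have meas: "(%x. - a + x) : measurable M borel"
   unfolding borel_E
  proof (rule measurable_measure_of)
   fix B :: "'k fls set" assume "B : balls_E"
   thus "(%x. - a + x) -` B Int space M : sets M"
    unfolding vim by (auto simp: balls_E_def bE_image_add M(1) sp)
  qed auto
  have "distr M borel (%x. - a + x) = M"
  proof (rule measure_eq_balls)
   show "emeasure (distr M borel (%x. - a + x)) (bE b i) = emeasure M (bE b i)" for b i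
    by (subst emeasure_distr[OF meas]) (auto simp: vim bE_image_add M sp)
   thus "emeasure (distr M borel (%x. - a + x)) (bE b i) ~= \<infinity>" for b i
    by (simp add: M)
  qed (simp_all add: M)
  hence "emeasure M A = emeasure (distr M borel (%x. - a + x)) A" by simp
  also have "... = emeasure M ((%x. a + x) ` A)"
   using A by (subst emeasure_distr[OF meas]) (auto simp: vim M sp)
  finally show ?thesis by simp
 qed
 have one: "emeasure M {x. \<forall>i<0. fls_nth x i = 0} = 1"
  using M(2)[of 0 0] by (simp add: bE_def)
 have "haar_E = M"
  unfolding haar_E_def
 proof (rule the_equality)
  fix N :: "'k fls measure"
  assume N: "sets N = sets borel
  & (ALL a. ALL A:sets N. emeasure N ((%x. a + x) ` A) = emeasure N A)
  & emeasure N {x. \<forall>i<0. fls_nth x i = 0} = 1"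
  have "emeasure N (bE a i) = ennreal (real CARD('k) powi (- i))" for a i
   using N by (intro emeasure_bE_unique) auto
  thus "N = M" using N by (intro measure_eq_balls) (auto simp: M)
 qed (use M inv one in auto)
 thus ?thesis using M by simp
qed

lemma sets_haar_E [simp]: "sets (haar_E :: 'k::{field,finite} fls measure) = sets borel"
 and emeasure_haar_E: "emeasure (haar_E :: 'k fls measure) (bE a i) = ennreal (real CARD('k) powi (- i))"
 using haar_E_char by auto

lemma space_haar_E [simp]: "space (haar_E :: 'k::{field,finite} fls measure) = UNIV"
 using sets_eq_imp_space_eq[OF sets_haar_E] by simp

lemma measurable_translate_E: "(%x :: 'k::{field,finite} fls. x + e) : measurable borel borel"
proof -
 have "(%x. x + e) : measurable borel (Sigma_Algebra.sigma UNIV balls_E)"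
 proof (rule measurable_measure_of)
  fix B :: "'k fls set" assume "B : balls_E"
  then obtain a i where B: "B = bE a i" by (auto simp: balls_E_def)
  have "(%x. x + e) -` B = bE (a - e) i" by (auto simp: B bE_def eq_diff_eq)
  thus "(%x. x + e) -` B Int space borel : sets borel" by simp
 qed auto
 thus ?thesis by (simp add: borel_E)
qed

lemma distr_haar_E: "distr (haar_E :: 'k::{field,finite} fls measure) borel (%x. x + e) = haar_E"
proof (rule measure_eq_balls)
 have m: "(%x. x + e) : measurable (haar_E :: 'k fls measure) borel"
  using measurable_translate_E by (simp add: measurable_def)
 show em: "emeasure (distr haar_E borel (%x. x + e)) (bE a i) = emeasure haar_E (bE a i)" for a i
 proof -
  have "(%x. x + e) -` bE a i = bE (a - e) i" by (auto simp: bE_def eq_diff_eq)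
  thus ?thesis by (subst emeasure_distr[OF m]) (simp_all add: emeasure_haar_E)
 qed
 show "emeasure (distr haar_E borel (%x. x + e)) (bE a i) ~= \<infinity>" for a i
  unfolding em by (simp add: emeasure_haar_E)
qed simp_all

lemma integral_translate_E:
 fixes f :: "'k::{field,finite} fls => complex"
 assumes "integrable haar_E f"
 shows "integrable haar_E (%x. f (x + e))"
  and "integral\<^sup>L haar_E (%x. f (x + e)) = integral\<^sup>L haar_E f"
proof -
 have m: "(%x. x + e) : measurable (haar_E :: 'k fls measure) borel"
  using measurable_translate_E by (simp add: measurable_def)
 have fm: "f : borel_measurable borel"
  using borel_measurable_integrable[OF assms] by (simp add: measurable_def)
 show "integrable haar_E (%x. f (x + e))"
  using integrable_distr_eq[OF m fm] assms by (simp add: distr_haar_E)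
 show "integral\<^sup>L haar_E (%x. f (x + e)) = integral\<^sup>L haar_E f"
  using integral_distr[OF m fm] by (simp add: distr_haar_E)
qed

lemma haar_E_singleton: "emeasure (haar_E :: 'k::{field,finite} fls measure) {a} = 0"
proof -
 define q where "q = real CARD('k)"
 have q2: "q >= 2" using CARD_ge_2[where 'k = 'k] by (simp add: q_def)
 have "emeasure haar_E {a} <= ennreal e" if e: "e > 0" for e :: real
 proof -
  obtain m :: nat where m: "(1 / q) ^ m < e" using real_arch_pow_inv[OF e, of "1 / q"] q2 by (auto simp: divide_less_eq)
  have "emeasure haar_E {a} <= emeasure haar_E (bE a (int m))"
   by (intro emeasure_mono) auto
  also have "... = ennreal ((1 / q) ^ m)"
   by (simp add: emeasure_haar_E q_def power_int_minus power_one_over inverse_eq_divide)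
  also have "... <= ennreal e" using m by (intro ennreal_leI) simp
  finally show ?thesis .
 qed
 thus ?thesis
  by (metis ennreal_le_epsilon add_0 le_zero_eq)
qed

lemma haar_E_infinite: "emeasure (haar_E :: 'k::{field,finite} fls measure) UNIV = \<infinity>"
proof (rule ccontr)
 define q where "q = real CARD('k)"
 have q2: "q >= 2" using CARD_ge_2[where 'k = 'k] by (simp add: q_def)
 assume "~ ?thesis"
 then obtain r where r: "emeasure (haar_E :: 'k fls measure) UNIV = ennreal r" "r >= 0"
  by (metis ennreal_cases infinity_ennreal_def)
 obtain m :: nat where m: "r < q ^ m" using real_arch_pow[of q r] q2 by auto
 have "ennreal (q ^ m) = emeasure (haar_E :: 'k fls measure) (bE 0 (- int m))"
  by (simp add: emeasure_haar_E q_def)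
 also have "... <= emeasure (haar_E :: 'k fls measure) UNIV" by (intro emeasure_mono) auto
 finally have "q ^ m <= r" using r by simp
 thus False using m by simp
qed

lemma integral_bE:
 "integrable haar_E (%x. indicator (bE a i) x :: complex)"
 "integral\<^sup>L haar_E (%x. indicator (bE a i) x :: complex) = of_nat CARD('k) powi (- i)"
 for a :: "'k::{field,finite} fls"
proof -
 have m: "measure haar_E (bE a i) = real CARD('k) powi (- i)"
  by (simp add: measure_def emeasure_haar_E)
 have e: "(%x. indicator (bE a i) x :: complex) = (%x. complex_of_real (indicator (bE a i) x))"
  by (auto simp: indicator_def)
 show "integrable haar_E (%x. indicator (bE a i) x :: complex)"
  unfolding e by (intro integrable_of_real integrable_real_indicator) (auto simp: emeasure_haar_E)
 show "integral\<^sup>L haar_E (%x. indicator (bE a i) x :: complex) = of_nat CARD('k) powi (- i)"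
  unfolding e by (simp add: m of_real_power_int)
qed

text \<open>A function which is integrable and constant outside a finite set has integral zero, because
 points are null sets and the whole line has infinite measure.\<close>

lemma integral_almost_const_eq_0:
 fixes f :: "'k::{field,finite} fls => complex"
 assumes f: "integrable haar_E f" and S: "finite S" and c: "!!x. x ~: S ==> f x = c"
 shows "integral\<^sup>L haar_E f = 0"
proof -
 have "S : null_sets haar_E"
 proof -
  have "(\<Union>x\<in>S. {x}) : null_sets haar_E"
   using S by (intro null_sets_UN' countable_finite) (auto intro!: null_setsI haar_E_singleton)
  thus ?thesis by simp
 qed
 hence "AE x in haar_E. x ~: S" by (rule AE_not_in)
 hence ae: "AE x in haar_E. f x = c" by eventually_elim (rule c)
 have "integrable haar_E (%x :: 'k fls. c)"
  using integrable_cong_AE_imp[OF f _ ae] by simp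
 hence "c = 0"
  using haar_E_infinite[where 'k = 'k]
  by (auto simp: integrable_iff_bounded ennreal_mult_less_top)
 have "integral\<^sup>L haar_E f = integral\<^sup>L haar_E (%x :: 'k fls. c)"
  by (intro integral_cong_AE ae) (use f in auto)
 thus ?thesis using \<open>c = 0\<close> by simp
qed

section \<open>The Fesenko--Morrow integral\<close>

text \<open>The same integral with coefficients in \<open>\<Lambda>\<close> instead of \<open>\<complex>(X)\<close>: all uniqueness arguments work
 for it, and it is \<open>\<Lambda>\<close>-linear.\<close>

definition FMint :: "('k::field F => lam) => lam => bool" where
 "FMint \<phi> v \<longleftrightarrow> (\<exists>L :: (lam \<times> ('k fls => complex) \<times> 'k F \<times> int) list.
  (\<forall>(c, f, a, \<gamma>)\<in>set L. integrable haar_E f)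
  & \<phi> = (%x. \<Sum>(c, f, a, \<gamma>)\<leftarrow>L. c * lift f a \<gamma> x)
  & v = (\<Sum>(c, f, a, \<gamma>)\<leftarrow>L. c * fls_X powi \<gamma> * fls_const (integral\<^sup>L haar_E f)))"

lemma lift_eq: "lift f a \<gamma> x =
  (if \<forall>i<\<gamma>. fls_nth x i = fls_nth a i then fls_const (f (fls_nth x \<gamma> - fls_nth a \<gamma>)) else 0)"
proof -
 have "(x - a) * tt powi (- \<gamma>) : O1 \<longleftrightarrow> (\<forall>i<0. fls_nth x (i + \<gamma>) = fls_nth a (i + \<gamma>))"
  by (simp add: O1_def tt_powi_mult)
 also have "... \<longleftrightarrow> (\<forall>i<\<gamma>. fls_nth x i = fls_nth a i)"
 proof
  assume *: "\<forall>i<0. fls_nth x (i + \<gamma>) = fls_nth a (i + \<gamma>)"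
  show "\<forall>i<\<gamma>. fls_nth x i = fls_nth a i"
  proof (intro allI impI)
   fix i assume "i < \<gamma>"
   thus "fls_nth x i = fls_nth a i" using *[rule_format, of "i - \<gamma>"] by simp
  qed
 qed auto
 finally show ?thesis by (auto simp: lift_def Let_def red_def tt_powi_mult)
qed

lemma fls_nth_mult_X_powi: "fls_nth (x * fls_X powi m) i = fls_nth (x :: 'a::field fls) (i - m)"
 by (simp add: fls_X_intpow_times_conv_shift)

text \<open>Fix a level \<open>\<gamma>\<close> and a ball of that level. Along the points \<open>a + y t\<^sup>\<gamma>\<close> of this ball the lifts of
 lower level are constant, and a lift of higher level vanishes for all but one \<open>y\<close>. So if a
 combination of lifts vanishes, the sum of the functions of level \<open>\<gamma>\<close> in this ball is constant outside a
 finite set, and its integral is zero.\<close>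

lemma FM_level_ball:
 fixes f :: "'l => 'k::{field,finite} fls => complex"
 assumes I: "finite I" and f: "!!l. l : I ==> integrable haar_E (f l)"
  and zero: "!!x. (\<Sum>l\<in>I. c l * lift (f l) (a l) (\<gamma> l) x) = 0"
 shows "(\<Sum>l\<in>{l\<in>I. \<gamma> l = \<gamma>0 & (\<forall>i<\<gamma>0. fls_nth (a l) i = fls_nth a0 i)}.
      fls_nth (c l) m * integral\<^sup>L haar_E (f l)) = 0"
proof -
 define J where "J = {l\<in>I. \<gamma> l = \<gamma>0 & (\<forall>i<\<gamma>0. fls_nth (a l) i = fls_nth a0 i)}"
 define lv where "lv l x = (if \<forall>i<\<gamma> l. fls_nth x i = fls_nth (a l) i
   then f l (fls_nth x (\<gamma> l) - fls_nth (a l) (\<gamma> l)) else 0)" for l x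
 have lift_lv: "lift (f l) (a l) (\<gamma> l) x = fls_const (lv l x)" for l x
  by (auto simp: lift_eq lv_def)
 have zc: "(\<Sum>l\<in>I. fls_nth (c l) m * lv l x) = 0" for x
 proof -
  have "fls_nth (\<Sum>l\<in>I. c l * lift (f l) (a l) (\<gamma> l) x) m = 0" by (simp only: zero fls_zero_nth)
  thus ?thesis by (simp only: fls_nth_sum lift_lv fls_mult_const_nth)
 qed
 define X where "X y = a0 + fls_const y * tt powi \<gamma>0" for y :: "'k fls"
 have X: "fls_nth (X y) i = fls_nth a0 i + (if i = \<gamma>0 then y else 0)" for y i
  by (simp add: X_def tt_powi_mult)
 define e where "e l = fls_nth a0 \<gamma>0 - fls_nth (a l) \<gamma>0" for l
 have lvJ: "lv l (X y) = f l (y + e l)" if "l : J" for l y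
 proof -
  have *: "\<gamma> l = \<gamma>0" "\<forall>i<\<gamma>0. fls_nth (X y) i = fls_nth (a l) i" using that by (auto simp: J_def X)
  have "fls_nth (X y) \<gamma>0 - fls_nth (a l) \<gamma>0 = y + e l" by (simp add: X e_def)
  thus ?thesis unfolding lv_def *(1) using *(2) by auto
 qed
 define S where "S = (%l. fls_nth (a l) \<gamma>0 - fls_nth a0 \<gamma>0) ` I"
 define K where "K l = (if \<gamma> l < \<gamma>0 then lv l (X 0) else 0)" for l
 have lvI: "lv l (X y) = (if l : J then f l (y + e l) else 0) + K l" if l: "l : I" and y: "y ~: S" for l y
 proof -
  consider "\<gamma> l < \<gamma>0" | "\<gamma> l = \<gamma>0" | "\<gamma> l > \<gamma>0" by linarith
  thus ?thesis
  proof cases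
   case 1
   hence "\<forall>i\<le>\<gamma> l. fls_nth (X y) i = fls_nth (X 0) i" by (simp add: X)
   hence "lv l (X y) = lv l (X 0)" unfolding lv_def by auto
   thus ?thesis using 1 by (simp add: K_def J_def)
  next
   case 2
   thus ?thesis using l lvJ[of l y] by (cases "l : J") (auto simp: K_def J_def lv_def X)
  next
   case 3
   have "y ~= fls_nth (a l) \<gamma>0 - fls_nth a0 \<gamma>0" using y l by (auto simp: S_def)
   hence "fls_nth (X y) \<gamma>0 ~= fls_nth (a l) \<gamma>0" by (simp add: X eq_diff_eq add.commute)
   hence "lv l (X y) = 0" using 3 unfolding lv_def by auto
   thus ?thesis using 3 by (simp add: K_def J_def)
  qed
 qed
 define g where "g y = (\<Sum>l\<in>J. fls_nth (c l) m * f l (y + e l))" for y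
 have fin: "finite J" "J <= I" using I by (auto simp: J_def)
 have intf: "integrable haar_E (%y. fls_nth (c l) m * f l (y + e l))"
  "integral\<^sup>L haar_E (%y. fls_nth (c l) m * f l (y + e l)) = fls_nth (c l) m * integral\<^sup>L haar_E (f l)"
  if "l : J" for l
 proof -
  have fl: "integrable haar_E (f l)" using f fin that by blast
  show "integrable haar_E (%y. fls_nth (c l) m * f l (y + e l))"
   by (intro integrable_mult_right integral_translate_E fl)
  show "integral\<^sup>L haar_E (%y. fls_nth (c l) m * f l (y + e l)) = fls_nth (c l) m * integral\<^sup>L haar_E (f l)"
   using integral_translate_E[OF fl] by simp
 qed
 have const: "g y = - (\<Sum>l\<in>I. fls_nth (c l) m * K l)" if y: "y ~: S" for y
 proof -
  have "0 = (\<Sum>l\<in>I. fls_nth (c l) m * lv l (X y))" using zc by simp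
  also have "... = (\<Sum>l\<in>I. (if l : J then fls_nth (c l) m * f l (y + e l) else 0) + fls_nth (c l) m * K l)"
   by (intro sum.cong) (auto simp: lvI[OF _ y] distrib_left)
  also have "... = g y + (\<Sum>l\<in>I. fls_nth (c l) m * K l)"
  proof -
   have "(\<Sum>l\<in>I. if l : J then fls_nth (c l) m * f l (y + e l) else 0) = g y"
    unfolding g_def using I fin(2) by (subst sum.inter_restrict[symmetric]) (auto simp: Int_absorb1)
   thus ?thesis by (simp add: sum.distrib)
  qed
  finally show ?thesis by (simp add: eq_neg_iff_add_eq_0)
 qed
 have "integrable haar_E g" unfolding g_def by (intro Bochner_Integration.integrable_sum intf)
 moreover have "finite S" using I by (simp add: S_def)
 ultimately have "integral\<^sup>L haar_E g = 0" using const by (rule integral_almost_const_eq_0)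
 moreover have "integral\<^sup>L haar_E g = (\<Sum>l\<in>J. fls_nth (c l) m * integral\<^sup>L haar_E (f l))"
  unfolding g_def by (simp only: Bochner_Integration.integral_sum[OF intf(1)] intf(2) cong: sum.cong)
 ultimately show ?thesis by (simp add: J_def)
qed

lemma FM_level:
 fixes f :: "'l => 'k::{field,finite} fls => complex"
 assumes I: "finite I" and f: "!!l. l : I ==> integrable haar_E (f l)"
  and zero: "!!x. (\<Sum>l\<in>I. c l * lift (f l) (a l) (\<gamma> l) x) = 0"
 shows "(\<Sum>l\<in>{l\<in>I. \<gamma> l = \<gamma>0}. fls_nth (c l) m * integral\<^sup>L haar_E (f l)) = 0"
proof -
 define h where "h l = fls_nth (c l) m * integral\<^sup>L haar_E (f l)" for l
 define J where "J = {l\<in>I. \<gamma> l = \<gamma>0}"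
 define g where "g l = {x. \<forall>i<\<gamma>0. fls_nth x i = fls_nth (a l) i}" for l
 have J: "finite J" using I by (simp add: J_def)
 have "sum h J = (\<Sum>y\<in>g ` J. sum h {x\<in>J. g x = y})"
  using J by (intro sum.group[symmetric]) auto
 also have "... = 0"
 proof (rule sum.neutral, intro ballI)
  fix y assume "y : g ` J"
  then obtain l0 where l0: "y = g l0" by auto
  have "g l = y \<longleftrightarrow> (\<forall>i<\<gamma>0. fls_nth (a l) i = fls_nth (a l0) i)" for l
  proof
   assume "g l = y"
   hence "a l : g l0" using l0 by (auto simp: g_def)
   thus "\<forall>i<\<gamma>0. fls_nth (a l) i = fls_nth (a l0) i" by (simp add: g_def)
  qed (auto simp: g_def l0)
  hence "{x\<in>J. g x = y} = {l\<in>I. \<gamma> l = \<gamma>0 & (\<forall>i<\<gamma>0. fls_nth (a l) i = fls_nth (a l0) i)}"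
   by (auto simp: J_def)
  thus "sum h {x\<in>J. g x = y} = 0"
   unfolding h_def using FM_level_ball[OF I f zero, where ?a0.0 = "a l0" and ?\<gamma>0.0 = \<gamma>0 and m = m] by simp
 qed
 finally show ?thesis by (simp add: h_def J_def)
qed

lemma FM_zero:
 fixes f :: "'l => 'k::{field,finite} fls => complex"
 assumes I: "finite I" and f: "!!l. l : I ==> integrable haar_E (f l)"
  and zero: "!!x. (\<Sum>l\<in>I. c l * lift (f l) (a l) (\<gamma> l) x) = 0"
 shows "(\<Sum>l\<in>I. c l * fls_X powi \<gamma> l * fls_const (integral\<^sup>L haar_E (f l))) = 0"
proof (rule fls_zero_eqI)
 fix N
 have "fls_nth (\<Sum>l\<in>I. c l * fls_X powi \<gamma> l * fls_const (integral\<^sup>L haar_E (f l))) N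
   = (\<Sum>l\<in>I. fls_nth (c l) (N - \<gamma> l) * integral\<^sup>L haar_E (f l))"
  by (simp only: fls_nth_sum fls_mult_const_nth fls_nth_mult_X_powi)
 also have "... = (\<Sum>\<gamma>0\<in>\<gamma> ` I. \<Sum>l\<in>{l\<in>I. \<gamma> l = \<gamma>0}. fls_nth (c l) (N - \<gamma> l) * integral\<^sup>L haar_E (f l))"
  using I by (intro sum.group[symmetric]) auto
 also have "... = (\<Sum>\<gamma>0\<in>\<gamma> ` I. \<Sum>l\<in>{l\<in>I. \<gamma> l = \<gamma>0}. fls_nth (c l) (N - \<gamma>0) * integral\<^sup>L haar_E (f l))"
  by (intro sum.cong) auto
 also have "... = 0" by (intro sum.neutral ballI FM_level[OF I f zero])
 finally show "fls_nth (\<Sum>l\<in>I. c l * fls_X powi \<gamma> l * fls_const (integral\<^sup>L haar_E (f l))) N = 0" .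
qed

lemma sum_list_index: "(\<Sum>x\<leftarrow>L. F x) = (\<Sum>l<length L. F (L ! l))"
 by (simp add: sum_list_sum_nth atLeast0LessThan)

lemma FMint_zero:
 fixes \<phi> :: "'k::{field,finite} F => lam"
 assumes "FMint \<phi> v" "!!x. \<phi> x = 0"
 shows "v = 0"
proof -
 obtain L :: "(lam \<times> ('k fls => complex) \<times> 'k F \<times> int) list" where
  L: "\<forall>(c, f, a, \<gamma>)\<in>set L. integrable haar_E f"
   "\<phi> = (%x. \<Sum>(c, f, a, \<gamma>)\<leftarrow>L. c * lift f a \<gamma> x)"
   "v = (\<Sum>(c, f, a, \<gamma>)\<leftarrow>L. c * fls_X powi \<gamma> * fls_const (integral\<^sup>L haar_E f))"
  using assms(1) unfolding FMint_def by blast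
 define c where "c l = fst (L ! l)" for l
 define f where "f l = fst (snd (L ! l))" for l
 define a where "a l = fst (snd (snd (L ! l)))" for l
 define \<gamma> where "\<gamma> l = snd (snd (snd (L ! l)))" for l
 have "(\<Sum>l\<in>{..<length L}. c l * fls_X powi \<gamma> l * fls_const (integral\<^sup>L haar_E (f l))) = 0"
 proof (rule FM_zero)
  fix l assume "l : {..<length L}"
  hence "L ! l : set L" by simp
  thus "integrable haar_E (f l)" using L(1) by (auto simp: f_def case_prod_beta)
 next
  fix x
  have "\<phi> x = (\<Sum>l\<in>{..<length L}. c l * lift (f l) (a l) (\<gamma> l) x)"
   unfolding L(2) sum_list_index by (simp add: c_def f_def a_def \<gamma>_def case_prod_beta)
  thus "(\<Sum>l\<in>{..<length L}. c l * lift (f l) (a l) (\<gamma> l) x) = 0" using assms(2) by simp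
 qed simp
 thus ?thesis
  unfolding L(3) sum_list_index by (simp add: c_def f_def a_def \<gamma>_def case_prod_beta)
qed

lemma FMint_lin:
 assumes "FMint \<phi> v" "FMint \<psi> w"
 shows "FMint (%x. c * \<phi> x + d * \<psi> x) (c * v + d * w)"
proof -
 obtain L where L: "\<forall>(c, f, a, \<gamma>)\<in>set L. integrable haar_E f"
   "\<phi> = (%x. \<Sum>(c, f, a, \<gamma>)\<leftarrow>L. c * lift f a \<gamma> x)"
   "v = (\<Sum>(c, f, a, \<gamma>)\<leftarrow>L. c * fls_X powi \<gamma> * fls_const (integral\<^sup>L haar_E f))"
  using assms(1) unfolding FMint_def by blast
 obtain M where M: "\<forall>(c, f, a, \<gamma>)\<in>set M. integrable haar_E f"
   "\<psi> = (%x. \<Sum>(c, f, a, \<gamma>)\<leftarrow>M. c * lift f a \<gamma> x)"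
   "w = (\<Sum>(c, f, a, \<gamma>)\<leftarrow>M. c * fls_X powi \<gamma> * fls_const (integral\<^sup>L haar_E f))"
  using assms(2) unfolding FMint_def by blast
 let ?N = "map (%(b, r). (c * b, r)) L @ map (%(b, r). (d * b, r)) M"
 show ?thesis
  unfolding FMint_def
 proof (intro exI[of _ ?N] conjI)
  show "\<forall>(c, f, a, \<gamma>)\<in>set ?N. integrable haar_E f" using L(1) M(1) by auto
  show "(%x. c * \<phi> x + d * \<psi> x) = (%x. \<Sum>(c, f, a, \<gamma>)\<leftarrow>?N. c * lift f a \<gamma> x)"
   unfolding L(2) M(2) by (simp only: map_append sum_list_append map_map o_def case_prod_unfold fst_conv snd_conv mult.assoc sum_list_const_mult)
  show "c * v + d * w = (\<Sum>(c, f, a, \<gamma>)\<leftarrow>?N. c * fls_X powi \<gamma> * fls_const (integral\<^sup>L haar_E f))"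
   unfolding L(3) M(3) by (simp only: map_append sum_list_append map_map o_def case_prod_unfold fst_conv snd_conv mult.assoc sum_list_const_mult)
 qed
qed

lemma FMint_locally_constant:
 assumes "FMint \<phi> v"
 shows "EX N. ALL x x'. (\<forall>i<N. fls_nth x i = fls_nth x' i) --> \<phi> x = \<phi> x'"
proof -
 obtain L where L: "\<phi> = (%x. \<Sum>(c, f, a, \<gamma>)\<leftarrow>L. c * lift f a \<gamma> x)"
  using assms unfolding FMint_def by blast
 define N where "N = Max (insert 0 ((%p. snd (snd (snd p))) ` set L)) + 1"
 have N: "\<gamma> < N" if "(c, f, a, \<gamma>) : set L" for c f a \<gamma>
 proof -
  have "\<gamma> : (%p. snd (snd (snd p))) ` set L" using that by force
  hence "\<gamma> <= Max (insert 0 ((%p. snd (snd (snd p))) ` set L))" by (intro Max_ge) auto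
  thus ?thesis by (simp add: N_def)
 qed
 have "\<phi> x = \<phi> x'" if x: "\<forall>i<N. fls_nth x i = fls_nth x' i" for x x'
 proof -
  have "map (%(c, f, a, \<gamma>). c * lift f a \<gamma> x) L = map (%(c, f, a, \<gamma>). c * lift f a \<gamma> x') L"
  proof (rule map_cong[OF refl])
   fix p assume p: "p : set L"
   obtain c f a \<gamma> where pe: "p = (c, f, a, \<gamma>)" by (cases p) auto
   have "fls_nth x i = fls_nth x' i" if "i <= \<gamma>" for i using that x N p pe by force
   hence "lift f a \<gamma> x = lift f a \<gamma> x'" by (auto simp: lift_eq)
   thus "(case p of (c, f, a, \<gamma>) => c * lift f a \<gamma> x) = (case p of (c, f, a, \<gamma>) => c * lift f a \<gamma> x')"
    by (simp add: pe)
  qed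
  thus ?thesis unfolding L by (simp only:)
 qed
 thus ?thesis by blast
qed

lemma infinite_E: "infinite (UNIV :: 'k::field fls set)"
proof
 assume "finite (UNIV :: 'k fls set)"
 moreover have "inj (%n. fls_X ^ n :: 'k fls)"
  by (rule injI) (metis fls_subdegree_fls_X_pow of_nat_eq_iff)
 ultimately have "finite (UNIV :: nat set)"
  by (meson finite_subset subset_UNIV finite_imageD)
 thus False by simp
qed

text \<open>Integrable functions are locally constant, so an integrable function with finite support is
 zero.\<close>

lemma FMint_finite_support:
 fixes \<phi> :: "'k::{field,finite} F => lam"
 assumes "FMint \<phi> v" "finite {x. \<phi> x ~= 0}"
 shows "\<phi> x = 0"
proof (rule ccontr)
 assume x: "\<phi> x ~= 0"
 obtain N where N: "!!x x'. (\<forall>i<N. fls_nth x i = fls_nth x' i) ==> \<phi> x = \<phi> x'"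
  using FMint_locally_constant[OF assms(1)] by blast
 define X where "X y = x + fls_const y * tt powi N" for y :: "'k fls"
 have nX: "fls_nth (X y) i = fls_nth x i + (if i = N then y else 0)" for y i
  by (simp add: X_def tt_powi_mult)
 have "inj X" by (rule injI) (drule arg_cong[where f = "%z. fls_nth z N"], simp add: nX)
 moreover have "range X <= {x. \<phi> x ~= 0}"
 proof
  fix z assume "z : range X"
  then obtain y where "z = X y" by blast
  moreover have "\<phi> (X y) = \<phi> x" by (rule N) (simp add: nX)
  ultimately show "z : {x. \<phi> x ~= 0}" using x by simp
 qed
 ultimately have "finite (UNIV :: 'k fls set)"
  using assms(2) by (meson finite_imageD finite_subset)
 thus False using infinite_E by blast
qed

lemma has_int_F_imp_FMint: "has_int_F \<phi> v ==> FMint \<phi> v"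
proof -
 assume "has_int_F \<phi> v"
 then obtain L where "\<forall>(c, f, a, \<gamma>)\<in>set L. c : CX & integrable haar_E f"
   "\<phi> = (%x. \<Sum>(c, f, a, \<gamma>)\<leftarrow>L. c * lift f a \<gamma> x)"
   "v = (\<Sum>(c, f, a, \<gamma>)\<leftarrow>L. c * fls_X powi \<gamma> * fls_const (integral\<^sup>L haar_E f))"
  unfolding has_int_F_def by blast
 thus ?thesis unfolding FMint_def by (intro exI[of _ L]) auto
qed

section \<open>Linearity and the basic volume\<close>

lemma CX_mult: "c : CX ==> d : CX ==> c * d : CX"
proof -
 assume "c : CX" "d : CX"
 then obtain p q p' q' :: "complex poly" where *: "q ~= 0" "q' ~= 0"
  "c = fps_to_fls (fps_of_poly p) / fps_to_fls (fps_of_poly q)"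
  "d = fps_to_fls (fps_of_poly p') / fps_to_fls (fps_of_poly q')"
  unfolding CX_def by blast
 have "c * d = fps_to_fls (fps_of_poly (p * p')) / fps_to_fls (fps_of_poly (q * q'))"
  by (simp add: * fps_of_poly_mult fls_times_fps_to_fls)
 thus ?thesis using *(1,2) unfolding CX_def by (metis (mono_tags, lifting) mem_Collect_eq mult_eq_0_iff)
qed

lemma CX_const [simp]: "fls_const z : CX"
 unfolding CX_def by (rule CollectI, rule exI[of _ "[:z:]"], rule exI[of _ 1]) (simp add: fps_of_poly_const)

lemma CX_1 [simp]: "1 : CX" and CX_0 [simp]: "0 : CX" and CX_m1 [simp]: "- 1 : CX"
 using CX_const[of 1] CX_const[of 0] CX_const[of "- 1"] by simp_all

lemma CX_X [simp]: "fls_X powi m : CX"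
proof (cases m rule: int_cases2)
 case (nonneg k)
 show ?thesis unfolding CX_def
  by (rule CollectI, rule exI[of _ "monom 1 k"], rule exI[of _ 1])
   (simp add: nonneg fps_of_poly_monom fps_to_fls_power del: fls_X_power_int)
next
 case (nonpos k)
 show ?thesis unfolding CX_def
  by (rule CollectI, rule exI[of _ 1], rule exI[of _ "monom 1 k"])
   (simp add: nonpos fps_of_poly_monom fps_to_fls_power power_int_minus field_simps del: fls_X_power_int)
qed

lemma abs_F_CX [simp]: "abs_F a : CX"
 by (cases "a = 0") (simp_all add: abs_F_eq CX_mult del: fls_X_power_int)

lemma has_int_F_lin:
 assumes "has_int_F \<phi> v" "has_int_F \<psi> w" "c : CX" "d : CX"
 shows "has_int_F (%x. c * \<phi> x + d * \<psi> x) (c * v + d * w)"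
proof -
 obtain L where L: "\<forall>(c, f, a, \<gamma>)\<in>set L. c : CX & integrable haar_E f"
   "\<phi> = (%x. \<Sum>(c, f, a, \<gamma>)\<leftarrow>L. c * lift f a \<gamma> x)"
   "v = (\<Sum>(c, f, a, \<gamma>)\<leftarrow>L. c * fls_X powi \<gamma> * fls_const (integral\<^sup>L haar_E f))"
  using assms(1) unfolding has_int_F_def by blast
 obtain M where M: "\<forall>(c, f, a, \<gamma>)\<in>set M. c : CX & integrable haar_E f"
   "\<psi> = (%x. \<Sum>(c, f, a, \<gamma>)\<leftarrow>M. c * lift f a \<gamma> x)"
   "w = (\<Sum>(c, f, a, \<gamma>)\<leftarrow>M. c * fls_X powi \<gamma> * fls_const (integral\<^sup>L haar_E f))"
  using assms(2) unfolding has_int_F_def by blast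
 let ?N = "map (%(b, r). (c * b, r)) L @ map (%(b, r). (d * b, r)) M"
 show ?thesis
  unfolding has_int_F_def
 proof (intro exI[of _ ?N] conjI)
  show "\<forall>(c, f, a, \<gamma>)\<in>set ?N. c : CX & integrable haar_E f"
   using L(1) M(1) assms(3,4) by (auto intro!: CX_mult)
  show "(%x. c * \<phi> x + d * \<psi> x) = (%x. \<Sum>(c, f, a, \<gamma>)\<leftarrow>?N. c * lift f a \<gamma> x)"
   unfolding L(2) M(2) by (simp only: map_append sum_list_append map_map o_def case_prod_unfold fst_conv snd_conv mult.assoc sum_list_const_mult)
  show "c * v + d * w = (\<Sum>(c, f, a, \<gamma>)\<leftarrow>?N. c * fls_X powi \<gamma> * fls_const (integral\<^sup>L haar_E f))"
   unfolding L(3) M(3) by (simp only: map_append sum_list_append map_map o_def case_prod_unfold fst_conv snd_conv mult.assoc sum_list_const_mult)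
 qed
qed

lemma has_int_F_zero: "has_int_F (%x. 0) 0"
 unfolding has_int_F_def by (rule exI[of _ "[]"]) simp

lemma has_int_F_affine:
 fixes d s :: "'k::{field,finite} F"
 assumes d: "d ~= 0"
 shows "has_int_F (%x. if x * d + s : O2 then 1 else 0) (abs_F (inverse d))"
proof -
 define j where "j = - sdeg d"
 define i where "i = - vu d"
 define a where "a = - s / d"
 have mem: "x * d + s : O2 \<longleftrightarrow> (\<forall>l<j. fls_nth x l = fls_nth a l) & fls_nth x j - fls_nth a j : bE 0 i" for x
 proof -
  define y where "y = x - a"
  have "x * d + s = y * d" using d by (simp add: y_def a_def field_simps)
  moreover have "y * d : O2 \<longleftrightarrow> y = 0 | sdeg y > j | sdeg y = j & vu y >= i"
   using d by (cases "y = 0") (auto simp: O2_iff vu_mult j_def i_def)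
  moreover have "y = 0 | sdeg y > j | sdeg y = j & vu y >= i \<longleftrightarrow>
    (\<forall>l<j. fls_nth y l = 0) & fls_nth y j : bE 0 i"
  proof (cases "y = 0")
   case False
   have lt: "(\<forall>l<j. fls_nth y l = 0) \<longleftrightarrow> j <= sdeg y"
    using False fls_subdegree_geI[of y j] by auto
   have "sdeg y > j ==> fls_nth y j = 0" by simp
   moreover have "fls_nth y j : bE 0 i \<longleftrightarrow> vu y >= i" if "sdeg y = j"
   proof -
    have e: "fls_nth y j = lc y" using that by (simp add: lc_def)
    show ?thesis unfolding e bE_iff_subdegree vu_def using False by simp
   qed
   ultimately show ?thesis using lt by (auto simp: bE_def)
  qed (simp add: bE_def)
  ultimately show ?thesis by (simp add: y_def)
 qed
 have "abs_F (inverse d) = fls_const (of_nat CARD('k) powi (- i)) * fls_X powi j"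
  using d by (simp add: abs_F_eq vu_inverse i_def j_def del: fls_X_power_int)
 thus ?thesis
  unfolding has_int_F_def
  by (intro exI[of _ "[(1, %x. indicator (bE 0 i) x, a, j)]"])
   (auto simp: integral_bE[unfolded indicator_def] lift_eq mem indicator_def fun_eq_iff mult.commute
     simp del: fls_X_power_int)
qed

section \<open>Uniqueness of repeated integrals\<close>

fun Rint :: "(nat \<times> nat) list => ((nat \<times> nat => 'k::field F) => lam) => lam => bool" where
 "Rint [] g v \<longleftrightarrow> (ALL y. g y = v)"
| "Rint (p # ps) g v \<longleftrightarrow> (EX g'. (ALL y. FMint (%x. g (y(p := x))) (g' y)) & Rint ps g' v)"

lemma has_repeated_int_imp_Rint: "has_repeated_int ps g v ==> Rint ps g v"
proof (induction ps arbitrary: g)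
 case (Cons p ps)
 then obtain g' where "ALL y. has_int_F (%x. g (y(p := x))) (g' y)" "Rint ps g' v"
  by auto
 thus ?case using has_int_F_imp_FMint by (simp only: Rint.simps) blast
qed simp

lemma Rint_lin: "Rint ps g v ==> Rint ps h w ==> Rint ps (%y. c * g y + d * h y) (c * v + d * w)"
proof (induction ps arbitrary: g h)
 case (Cons p ps)
 obtain g' h' where *: "ALL y. FMint (%x. g (y(p := x))) (g' y)" "Rint ps g' v"
   "ALL y. FMint (%x. h (y(p := x))) (h' y)" "Rint ps h' w"
  using Cons.prems by auto
 have "ALL y. FMint (%x. c * g (y(p := x)) + d * h (y(p := x))) (c * g' y + d * h' y)"
  using *(1,3) FMint_lin by blast
 moreover have "Rint ps (%y. c * g' y + d * h' y) (c * v + d * w)" using *(2,4) by (rule Cons.IH)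
 ultimately show ?case unfolding Rint.simps by (intro exI conjI)
qed simp

fun thin :: "(nat \<times> nat) list => (nat \<times> nat => 'k::field F) set => bool" where
 "thin [] Z \<longleftrightarrow> Z = {}"
| "thin (p # ps) Z \<longleftrightarrow> (EX Z'. thin ps Z' & (ALL y. y ~: Z' --> finite {x. y(p := x) : Z}))"

lemma Rint_thin:
 fixes g :: "(nat \<times> nat => 'k::{field,finite} F) => lam"
 shows "thin ps Z ==> (!!y. y ~: Z ==> g y = 0) ==> Rint ps g v ==> v = 0"
proof (induction ps arbitrary: Z g)
 case (Cons p ps)
 obtain Z' where Z': "thin ps Z'" "!!y. y ~: Z' ==> finite {x. y(p := x) : Z}"
  using Cons.prems(1) by auto
 obtain g' where g': "!!y. FMint (%x. g (y(p := x))) (g' y)" "Rint ps g' v"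
  using Cons.prems(3) by auto
 have "g' y = 0" if "y ~: Z'" for y
 proof (rule FMint_zero[OF g'(1)])
  have "{x. g (y(p := x)) ~= 0} <= {x. y(p := x) : Z}" using Cons.prems(2) by blast
  hence "finite {x. g (y(p := x)) ~= 0}" using Z'(2)[OF that] finite_subset by blast
  thus "g (y(p := x)) = 0" for x by (rule FMint_finite_support[OF g'(1)])
 qed
 thus ?case using Cons.IH[OF Z'(1) _ g'(2)] by blast
qed simp

lemma thin_empty: "thin ps {}"
proof (induction ps)
 case (Cons p ps)
 thus ?case by (auto intro!: exI[of _ "{}"])
qed simp

definition diag_first :: "nat => (nat \<times> nat) list" where
 "diag_first n = map (%k. (k, k)) [0..<n] @ filter (%(i, j). i ~= j) (List.product [0..<n] [0..<n])"

lemma diag_first: "distinct (diag_first n)" "set (diag_first n) = {..<n} \<times> {..<n}"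
 by (auto simp: diag_first_def distinct_map inj_on_def intro!: distinct_filter distinct_product)

definition sub_mat :: "nat => nat => (nat \<times> nat => 'a) => 'a mat" where
 "sub_mat n k y = mat (n - k) (n - k) (%(i, j). y (i + k, j + k))"

text \<open>Integrating first over the diagonal entries, the determinant is at each step affine in the
 current entry, and its leading coefficient is the determinant of the next smaller block.\<close>

lemma thin_det:
 "thin (diag_first n) {y. ddet (sub_mat n 0 y) = (0 :: 'k::field F)}"
proof -
 define rest where "rest = filter (%(i, j). i ~= j) (List.product [0..<n] [0..<n])"
 have "k <= n ==> thin (map (%k. (k, k)) [k..<n] @ rest) {y. ddet (sub_mat n k y) = (0 :: 'k F)}" for k
 proof (induction rule: inc_induct)
  case base
  have "{y. ddet (sub_mat n n y) = (0 :: 'k F)} = {}"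
   by (simp add: sub_mat_def det_dim_zero)
  thus ?case by (simp add: thin_empty)
 next
  case (step k)
  have "finite {x. ddet (sub_mat n k (y((k, k) := x))) = 0}"
   if y: "ddet (sub_mat n (Suc k) y) ~= (0 :: 'k F)" for y
  proof -
   define D where "D x = ddet (sub_mat n k (y((k, k) := x)))" for x
   define m where "m = n - k"
   have m: "m > 0" using step by (simp add: m_def)
   have car: "sub_mat n k z : carrier_mat m m" for z :: "nat \<times> nat => 'k F" by (simp add: sub_mat_def m_def)
   have cof: "cofactor (sub_mat n k (y((k, k) := x))) 0 j = cofactor (sub_mat n k y) 0 j" if "j < m" for x j
   proof -
    have "mat_delete (sub_mat n k (y((k, k) := x))) 0 j = mat_delete (sub_mat n k y) 0 j"
     unfolding mat_delete_def by (rule eq_matI) (auto simp: sub_mat_def)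
    thus ?thesis by (simp add: cofactor_def)
   qed
   have "mat_delete (sub_mat n k y) 0 0 = sub_mat n (Suc k) y"
    unfolding mat_delete_def by (rule eq_matI) (auto simp: sub_mat_def)
   hence c0: "cofactor (sub_mat n k y) 0 0 = ddet (sub_mat n (Suc k) y)"
    by (simp add: cofactor_def)
   have D: "D x = (\<Sum>j<m. sub_mat n k (y((k, k) := x)) $$ (0, j) * cofactor (sub_mat n k y) 0 j)" for x
    unfolding D_def laplace_expansion_row[OF car m, of "y((k, k) := x)"]
    by (intro sum.cong refl arg_cong2[where f = times] cof) simp
   have inj: "x = x'" if "D x = 0" "D x' = 0" for x x'
   proof -
    have "0 = D x - D x'" using that by simp
    also have "... = (\<Sum>j<m. (if j = 0 then (x - x') * cofactor (sub_mat n k y) 0 0 else 0))"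
     unfolding D sum_subtractf[symmetric] using m
     by (intro sum.cong) (auto simp: sub_mat_def m_def left_diff_distrib)
    also have "... = (x - x') * ddet (sub_mat n (Suc k) y)"
     using m by (simp add: sum.delta c0)
    finally show ?thesis using y by simp
   qed
   have "{x. D x = 0} <= {SOME x. D x = 0}"
   proof
    fix x assume "x : {x. D x = 0}"
    hence x: "D x = 0" by simp
    hence "D (SOME x. D x = 0) = 0" by (rule someI)
    thus "x : {SOME x. D x = 0}" using inj[OF x] by simp
   qed
   thus ?thesis unfolding D_def using finite_subset by blast
  qed
  thus ?case using step
   by (auto simp: upt_conv_Cons intro!: exI[of _ "{y. ddet (sub_mat n (Suc k) y) = 0}"])
 qed
 from this[of 0] show ?thesis by (simp add: diag_first_def rest_def)
qed

section \<open>Uniqueness of the integral on the group\<close>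

lemma GLF_carrier_iff: "g : carrier (GLF n) \<longleftrightarrow> g : MN n & ddet g ~= 0"
 for g :: "'k::field F mat"
proof -
 have "invertible_mat g \<longleftrightarrow> ddet g ~= 0" if g: "g : MN n"
 proof
  assume "invertible_mat g"
  then obtain B where B: "inverts_mat g B" "inverts_mat B g" by (auto simp: invertible_mat_def)
  have "dim_row B = dim_col (B * g)" using B g by (auto simp: inverts_mat_def)
  hence "B : MN n"
   using B g unfolding inverts_mat_def
   by (metis carrier_matD(1) carrier_matI index_mult_mat(2,3) index_one_mat(2,3) carrier_matD(2))
  hence "ddet g * ddet B = 1"
   using B(1) g det_mult[OF g, of B] by (simp add: inverts_mat_def)
  thus "ddet g ~= 0" by auto
 next
  assume "ddet g ~= 0"
  then obtain B where "B : MN n" "B * g = 1\<^sub>m n" "g * B = 1\<^sub>m n"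
   using det_non_zero_imp_unit[OF g] by (auto simp: Units_def ring_mat_def)
  thus "invertible_mat g" using g by (auto simp: invertible_mat_def inverts_mat_def square_mat.simps)
 qed
 thus ?thesis by (auto simp: GLF_def)
qed

text \<open>The integral with \<open>\<Lambda>\<close>-coefficients, for one order of integration.\<close>

definition GI :: "nat => ('k::{field,finite} F mat => lam) => lam => bool" where
 "GI n \<phi> v \<longleftrightarrow> (EX f. (ALL g:carrier (GLF n). f g = \<phi> g * abs_F (ddet g) powi (- int n))
  & Rint (diag_first n) (%y. f (mat n n y)) v)"

lemma has_int_G_imp_GI: "has_int_G n \<phi> v ==> GI n \<phi> v"
 unfolding has_int_G_def GI_def has_int_M_def
 using diag_first has_repeated_int_imp_Rint by metis

lemma GI_lin: "GI n \<phi> v ==> GI n \<psi> w ==> GI n (%g. c * \<phi> g + d * \<psi> g) (c * v + d * w)"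
 unfolding GI_def
proof (elim exE conjE)
 fix f f'
 assume *: "ALL g:carrier (GLF n). f g = \<phi> g * abs_F (ddet g) powi (- int n)"
  "Rint (diag_first n) (%y. f (mat n n y)) v"
  "ALL g:carrier (GLF n). f' g = \<psi> g * abs_F (ddet g) powi (- int n)"
  "Rint (diag_first n) (%y. f' (mat n n y)) w"
 show "EX f. (ALL g:carrier (GLF n). f g = (c * \<phi> g + d * \<psi> g) * abs_F (ddet g) powi (- int n)) \<and>
    Rint (diag_first n) (%y. f (mat n n y)) (c * v + d * w)"
  using * by (intro exI[of _ "%g. c * f g + d * f' g"]) (auto simp: algebra_simps Rint_lin)
qed

lemma Rint_0: "Rint ps (%y. 0) 0"
proof (induction ps)
 case (Cons p ps)
 thus ?case unfolding Rint.simps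
  using has_int_F_imp_FMint[OF has_int_F_zero] by (intro exI[of _ "%y. 0"]) auto
qed simp

lemma GI_0: "GI n (%g. 0) 0"
 unfolding GI_def using Rint_0 by (intro exI[of _ "%g. 0"]) auto

lemma GI_sum: "(!!l. l : I ==> GI n (\<phi> l) (w l)) ==> GI n (%g. \<Sum>l\<in>I. c l * \<phi> l g) (\<Sum>l\<in>I. c l * w l)"
proof (induction I rule: infinite_finite_induct)
 case (insert l I)
 from GI_lin[of n "\<phi> l" "w l" "%g. \<Sum>l\<in>I. c l * \<phi> l g" "\<Sum>l\<in>I. c l * w l" "c l" 1] insert
 show ?case by simp
qed (simp_all add: GI_0)

lemma GI_zero:
 assumes "GI n \<phi> v" "!!g. g : carrier (GLF n) ==> \<phi> g = 0"
 shows "v = 0"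
proof -
 obtain f where f: "ALL g:carrier (GLF n). f g = \<phi> g * abs_F (ddet g) powi (- int n)"
  "Rint (diag_first n) (%y. f (mat n n y)) v"
  using assms(1) unfolding GI_def by blast
 show ?thesis
 proof (rule Rint_thin[OF thin_det _ f(2)])
  fix y :: "nat \<times> nat => 'a F"
  assume "y ~: {y. ddet (sub_mat n 0 y) = 0}"
  moreover have "sub_mat n 0 y = mat n n y" by (simp add: sub_mat_def)
  ultimately have "mat n n y : carrier (GLF n)" by (simp add: GLF_carrier_iff)
  thus "f (mat n n y) = 0" using f(1) assms(2) by simp
 qed
qed

text \<open>A vanishing combination of products is integrated one factor at a time.\<close>

lemma GI_tensor_zero:
 assumes "!!l. l : I ==> GI n (\<phi> l) (a l)" "!!l. l : I ==> GI n (\<psi> l) (b l)"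
  and zero: "!!g h. g : carrier (GLF n) ==> h : carrier (GLF n) ==> (\<Sum>l\<in>I. c l * \<phi> l g * \<psi> l h) = 0"
 shows "(\<Sum>l\<in>I. c l * a l * b l) = 0"
proof -
 have "(\<Sum>l\<in>I. c l * \<psi> l h * a l) = 0" if h: "h : carrier (GLF n)" for h
 proof (rule GI_zero)
  show "GI n (%g. \<Sum>l\<in>I. (c l * \<psi> l h) * \<phi> l g) (\<Sum>l\<in>I. c l * \<psi> l h * a l)"
   by (intro GI_sum assms(1))
  show "(\<Sum>l\<in>I. (c l * \<psi> l h) * \<phi> l g) = 0" if "g : carrier (GLF n)" for g
   using zero[OF that h] by (simp add: mult_ac)
 qed
 hence "(\<Sum>l\<in>I. (c l * a l) * \<psi> l h) = 0" if "h : carrier (GLF n)" for h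
  using that by (simp add: mult_ac)
 thus ?thesis
  by (intro GI_zero[OF GI_sum[of I n \<psi> b "%l. c l * a l"]] assms(2))
qed

lemma has_mu_n_imp_GI: "has_mu_n n \<phi> v ==> EX w. GI n \<phi> w & v = fls_const (c_const n CARD('k)) * w"
 for \<phi> :: "'k::{field,finite} F mat => lam"
 unfolding has_mu_n_def using has_int_G_imp_GI by blast

lemma Hgrp_carrier: "carrier (Hgrp n) = carrier (GLF n) \<times> carrier (GLF n)"
 by (simp add: Hgrp_def DirProd_def)

lemma has_mu_0_lin:
 fixes \<Phi> \<Psi> :: "'k::{field,finite} HH => lam"
 assumes "has_mu_0 n \<Phi> v" "has_mu_0 n \<Psi> w"
 shows "has_mu_0 n (%k. c * \<Phi> k + d * \<Psi> k) (c * v + d * w)"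
proof -
 obtain L where L: "\<forall>(c, \<phi>, \<psi>, a, b)\<in>set L. has_mu_n n \<phi> a & has_mu_n n \<psi> b"
  "\<forall>(g, h)\<in>carrier (Hgrp n). \<Phi> (g, h) = (\<Sum>(c, \<phi>, \<psi>, a, b)\<leftarrow>L. c * \<phi> g * \<psi> h)"
  "v = (\<Sum>(c, \<phi>, \<psi>, a, b)\<leftarrow>L. c * a * b)"
  using assms(1) unfolding has_mu_0_def by blast
 obtain M where M: "\<forall>(c, \<phi>, \<psi>, a, b)\<in>set M. has_mu_n n \<phi> a & has_mu_n n \<psi> b"
  "\<forall>(g, h)\<in>carrier (Hgrp n). \<Psi> (g, h) = (\<Sum>(c, \<phi>, \<psi>, a, b)\<leftarrow>M. c * \<phi> g * \<psi> h)"
  "w = (\<Sum>(c, \<phi>, \<psi>, a, b)\<leftarrow>M. c * a * b)"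
  using assms(2) unfolding has_mu_0_def by blast
 let ?N = "map (%(b, r). (c * b, r)) L @ map (%(b, r). (d * b, r)) M"
 show ?thesis
  unfolding has_mu_0_def
 proof (intro exI[of _ ?N] conjI)
  show "\<forall>(c, \<phi>, \<psi>, a, b)\<in>set ?N. has_mu_n n \<phi> a & has_mu_n n \<psi> b" using L(1) M(1) by auto
  show "\<forall>(g, h)\<in>carrier (Hgrp n). c * \<Phi> (g, h) + d * \<Psi> (g, h) = (\<Sum>(c, \<phi>, \<psi>, a, b)\<leftarrow>?N. c * \<phi> g * \<psi> h)"
  proof (intro ballI, clarify)
   fix g h :: "'k F mat" assume gh: "(g, h) : carrier (Hgrp n)"
   have "\<Phi> (g, h) = (\<Sum>(c, \<phi>, \<psi>, a, b)\<leftarrow>L. c * \<phi> g * \<psi> h)"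
     "\<Psi> (g, h) = (\<Sum>(c, \<phi>, \<psi>, a, b)\<leftarrow>M. c * \<phi> g * \<psi> h)"
    using gh L(2) M(2) by auto
   thus "c * \<Phi> (g, h) + d * \<Psi> (g, h) = (\<Sum>(c, \<phi>, \<psi>, a, b)\<leftarrow>?N. c * \<phi> g * \<psi> h)"
    by (simp only: map_append sum_list_append map_map o_def case_prod_unfold fst_conv snd_conv mult.assoc sum_list_const_mult)
  qed
  show "c * v + d * w = (\<Sum>(c, \<phi>, \<psi>, a, b)\<leftarrow>?N. c * a * b)"
   unfolding L(3) M(3)
   by (simp only: map_append sum_list_append map_map o_def case_prod_unfold fst_conv snd_conv mult.assoc sum_list_const_mult)
 qed
qed

lemma has_mu_0_0: "has_mu_0 n (%k. 0) 0"
 unfolding has_mu_0_def by (rule exI[of _ "[]"]) simp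

lemma has_mu_0_zero:
 fixes \<Phi> :: "'k::{field,finite} HH => lam"
 assumes "has_mu_0 n \<Phi> v" "!!k. k : carrier (Hgrp n) ==> \<Phi> k = 0"
 shows "v = 0"
proof -
 let ?\<kappa> = "fls_const (c_const n CARD('k))"
 obtain L :: "(lam \<times> ('k F mat => lam) \<times> ('k F mat => lam) \<times> lam \<times> lam) list" where
  L: "\<forall>(c, \<phi>, \<psi>, a, b)\<in>set L. has_mu_n n \<phi> a & has_mu_n n \<psi> b"
  "\<forall>(g, h)\<in>carrier (Hgrp n). \<Phi> (g, h) = (\<Sum>(c, \<phi>, \<psi>, a, b)\<leftarrow>L. c * \<phi> g * \<psi> h)"
  "v = (\<Sum>(c, \<phi>, \<psi>, a, b)\<leftarrow>L. c * a * b)"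
  using assms(1) unfolding has_mu_0_def by blast
 define c where "c l = fst (L ! l)" for l
 define \<phi> where "\<phi> l = fst (snd (L ! l))" for l
 define \<psi> where "\<psi> l = fst (snd (snd (L ! l)))" for l
 define a where "a l = fst (snd (snd (snd (L ! l))))" for l
 define b where "b l = snd (snd (snd (snd (L ! l))))" for l
 have mu: "has_mu_n n (\<phi> l) (a l)" "has_mu_n n (\<psi> l) (b l)" if "l : {..<length L}" for l
 proof -
  have "L ! l : set L" using that by simp
  thus "has_mu_n n (\<phi> l) (a l)" "has_mu_n n (\<psi> l) (b l)"
   using L(1) by (auto simp: \<phi>_def \<psi>_def a_def b_def case_prod_beta)
 qed
 have "ALL l:{..<length L}. EX w. GI n (\<phi> l) w & a l = ?\<kappa> * w"
  using has_mu_n_imp_GI mu(1) by blast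
 then obtain a' where a': "!!l. l : {..<length L} ==> GI n (\<phi> l) (a' l) & a l = ?\<kappa> * a' l" by metis
 have "ALL l:{..<length L}. EX w. GI n (\<psi> l) w & b l = ?\<kappa> * w"
  using has_mu_n_imp_GI mu(2) by blast
 then obtain b' where b': "!!l. l : {..<length L} ==> GI n (\<psi> l) (b' l) & b l = ?\<kappa> * b' l" by metis
 have "(\<Sum>l\<in>{..<length L}. c l * a' l * b' l) = 0"
 proof (rule GI_tensor_zero)
  fix g h :: "'k F mat" assume gh: "g : carrier (GLF n)" "h : carrier (GLF n)"
  have "\<Phi> (g, h) = (\<Sum>l\<in>{..<length L}. c l * \<phi> l g * \<psi> l h)"
   using L(2) gh unfolding Hgrp_carrier sum_list_index by (simp add: c_def \<phi>_def \<psi>_def case_prod_beta)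
  thus "(\<Sum>l\<in>{..<length L}. c l * \<phi> l g * \<psi> l h) = 0"
   using assms(2)[of "(g, h)"] gh by (simp add: Hgrp_carrier)
 qed (use a' b' in auto)
 hence "(\<Sum>l\<in>{..<length L}. ?\<kappa> * ?\<kappa> * (c l * a' l * b' l)) = 0"
  by (simp only: sum_distrib_left[symmetric] mult_zero_right)
 moreover have "(\<Sum>l\<in>{..<length L}. ?\<kappa> * ?\<kappa> * (c l * a' l * b' l)) = (\<Sum>l\<in>{..<length L}. c l * a l * b l)"
  by (intro sum.cong refl) (simp add: a' b' mult_ac)
 moreover have "(\<Sum>l\<in>{..<length L}. c l * a l * b l) = v"
  unfolding L(3) sum_list_index by (simp add: c_def a_def b_def case_prod_beta)
 ultimately show ?thesis by simp
qed

lemma has_mu_0_unique: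
 fixes \<Phi> :: "'k::{field,finite} HH => lam"
 assumes "has_mu_0 n \<Phi> v" "has_mu_0 n \<Psi> w" "!!k. k : carrier (Hgrp n) ==> \<Phi> k = \<Psi> k"
 shows "v = w"
 using has_mu_0_zero[OF has_mu_0_lin[OF assms(1,2), of 1 "- 1"]] assms(3) by simp

section \<open>Linearity of the repeated integral\<close>

lemma has_repeated_int_lin:
 assumes "c : CX" "d : CX"
 shows "has_repeated_int ps g v ==> has_repeated_int ps h w
  ==> has_repeated_int ps (%y. c * g y + d * h y) (c * v + d * w)"
proof (induction ps arbitrary: g h)
 case (Cons p ps)
 obtain g' h' where *: "ALL y. has_int_F (%x. g (y(p := x))) (g' y)" "has_repeated_int ps g' v"
   "ALL y. has_int_F (%x. h (y(p := x))) (h' y)" "has_repeated_int ps h' w"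
  using Cons.prems by auto
 have "ALL y. has_int_F (%x. c * g (y(p := x)) + d * h (y(p := x))) (c * g' y + d * h' y)"
  using *(1,3) has_int_F_lin assms by blast
 moreover have "has_repeated_int ps (%y. c * g' y + d * h' y) (c * v + d * w)"
  using *(2,4) by (rule Cons.IH)
 ultimately show ?case unfolding has_repeated_int.simps by (intro exI conjI)
qed simp

lemma has_repeated_int_0: "has_repeated_int ps (%y. 0) 0"
proof (induction ps)
 case (Cons p ps)
 thus ?case using has_int_F_zero by (auto intro!: exI[of _ "%y. 0"])
qed simp

lemma has_repeated_int_sum:
 assumes "!!l. l : I ==> has_repeated_int ps (g l) (v l)" "!!l. l : I ==> c l : CX"
 shows "has_repeated_int ps (%y. \<Sum>l\<in>I. c l * g l y) (\<Sum>l\<in>I. c l * v l)"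
 using assms
proof (induction I rule: infinite_finite_induct)
 case (insert l I)
 from has_repeated_int_lin[of "c l" 1 ps "g l" "v l" "%y. \<Sum>l\<in>I. c l * g l y" "\<Sum>l\<in>I. c l * v l"] insert
 show ?case by simp
qed (simp_all add: has_repeated_int_0)

section \<open>Volumes of lattices\<close>

lemma ex_min_div:
 assumes "finite S" "S ~= {}" "!!b. b : S ==> w b ~= (0 :: 'k::field F)"
 shows "EX k:S. ALL b:S. w b / w k : O2"
 using assms
proof (induction S rule: finite_ne_induct)
 case (singleton x)
 thus ?case by simp
next
 case (insert x S)
 then obtain k where k: "k : S" "ALL b:S. w b / w k : O2" by auto
 have k0: "w k ~= 0" "w x ~= 0" using insert.prems k(1) by auto
 show ?case
 proof (cases "w x / w k : O2")
  case True
  thus ?thesis using k by auto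
 next
  case False
  hence kx: "w k / w x : O2" using O2_total by blast
  have "w b / w x : O2" if "b : S" for b
  proof -
   have "w b / w x = (w b / w k) * (w k / w x)" using k0 by simp
   thus ?thesis using k(2) that kx O2_mult by metis
  qed
  thus ?thesis using k0 by auto
 qed
qed

lemma O2u_uminus [simp]: "- x : O2u \<longleftrightarrow> x : O2u"
 by (simp add: O2u_iff)

lemma abs_F_minus1_power: "abs_F ((- 1) ^ m) = 1"
proof -
 have "(- 1 :: 'a F) ^ m : O2u" by (induction m) simp_all
 thus ?thesis by (rule abs_F_O2u)
qed

text \<open>The pivot step: choose the entry of the first row with the least valuation and clear the others in that
 row by column operations with coefficients in the valuation ring.\<close>

lemma det_pivot:
 fixes W :: "'k::{field,finite} F mat"
 assumes W: "W : carrier_mat (Suc N) (Suc N)" and k: "k < Suc N" and W0k: "W $$ (0, k) ~= 0"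
 defines "r \<equiv> %b. W $$ (0, b) / W $$ (0, k)"
 defines "W' \<equiv> mat N N (%(a, b). W $$ (Suc a, insert_index k b) - r (insert_index k b) * W $$ (Suc a, k))"
 shows "abs_F (ddet W) = abs_F (W $$ (0, k)) * abs_F (ddet W')"
proof -
 define C where "C = mat (Suc N) (Suc N) (%(a, b). if a = b then 1 else if a = k then - r b else 0)"
 have C: "C : carrier_mat (Suc N) (Suc N)" by (simp add: C_def)
 have detC: "ddet C = 1"
 proof -
  have del: "mat_delete C k k = 1\<^sub>m N"
   unfolding mat_delete_def C_def by (rule eq_matI) auto
  have "ddet C = (\<Sum>i<Suc N. C $$ (i, k) * cofactor C i k)"
   by (rule laplace_expansion_column[OF C k])
  also have "... = (\<Sum>i<Suc N. if i = k then cofactor C i k else 0)"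
   using k by (intro sum.cong refl) (auto simp: C_def)
  also have "... = cofactor C k k" using k by (subst sum.delta) auto
  also have "... = 1" by (simp add: cofactor_def del)
  finally show ?thesis .
 qed
 define V where "V = W * C"
 have V: "V : carrier_mat (Suc N) (Suc N)" unfolding V_def using W C by (rule mult_carrier_mat)
 have Vij: "V $$ (a, b) = (if b = k then W $$ (a, k) else W $$ (a, b) - r b * W $$ (a, k))"
  if a: "a < Suc N" and b: "b < Suc N" for a b
 proof -
  have "V $$ (a, b) = (\<Sum>i<Suc N. W $$ (a, i) * C $$ (i, b))"
   unfolding V_def using W C a b by (simp add: scalar_prod_def atLeast0LessThan)
  also have "... = (\<Sum>i<Suc N. (if i = b then W $$ (a, b) else 0) + (if i = k then (if b = k then 0 else - r b * W $$ (a, k)) else 0))"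
   using b by (intro sum.cong refl) (auto simp: C_def)
  also have "... = W $$ (a, b) + (if b = k then 0 else - r b * W $$ (a, k))"
   using b k by (simp only: sum.distrib sum.delta finite_lessThan lessThan_iff if_True)
  finally show ?thesis by auto
 qed
 have del: "mat_delete V 0 k = W'"
  unfolding mat_delete_def W'_def using V k
  by (intro eq_matI) (auto simp: Vij insert_index_def)
 have "ddet W = ddet V"
  unfolding V_def det_mult[OF W C] detC by simp
 also have "... = (\<Sum>b<Suc N. V $$ (0, b) * cofactor V 0 b)"
  by (rule laplace_expansion_row[OF V]) simp
 also have "... = (\<Sum>b<Suc N. if b = k then W $$ (0, k) * cofactor V 0 k else 0)"
  using W0k by (intro sum.cong refl) (auto simp: Vij r_def)
 also have "... = W $$ (0, k) * cofactor V 0 k" using k by (subst sum.delta) auto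
 also have "... = W $$ (0, k) * ((- 1) ^ k * ddet W')" by (simp add: cofactor_def del)
 finally show ?thesis by (simp add: abs_F_mult abs_F_minus1_power)
qed

text \<open>The affine lattice \<open>{y. y W + s \<in> O2\<^sup>N}\<close> has volume \<open>1/|det W|\<close>, in every order of integration.\<close>

lemma lattice_volume:
 fixes W :: "'k::{field,finite} F mat"
 shows "distinct ps ==> length ps = N ==> W : carrier_mat N N ==> ddet W ~= 0 ==>
  has_repeated_int ps (%y. if \<forall>b<N. (\<Sum>a<N. y (ps ! a) * W $$ (a, b)) + s b : O2 then 1 else 0)
   (abs_F (inverse (ddet W)))"
proof (induction N arbitrary: ps W s)
 case 0
 thus ?case by (simp add: det_dim_zero abs_F_O2u)
next
 case (Suc N)
 obtain p qs where ps: "ps = p # qs" using Suc.prems(2) by (cases ps) auto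
 have qs: "distinct qs" "length qs = N" "p ~: set qs" using Suc.prems(1,2) by (auto simp: ps)
 have W: "W : carrier_mat (Suc N) (Suc N)" by fact
 define S where "S = {b. b < Suc N & W $$ (0, b) ~= 0}"
 have "S ~= {}"
 proof
  assume "S = {}"
  hence "!!b. b < Suc N ==> W $$ (0, b) = 0" by (auto simp: S_def)
  hence "ddet W = 0"
   using laplace_expansion_row[OF W, of 0] by simp
  thus False using Suc.prems(4) by simp
 qed
 hence "EX k:S. ALL b:S. W $$ (0, b) / W $$ (0, k) : O2"
  by (intro ex_min_div[of S "%b. W $$ (0, b)"]) (simp_all add: S_def)
 then obtain k where k: "k : S" "ALL b:S. W $$ (0, b) / W $$ (0, k) : O2" by blast
 have kN: "k < Suc N" and d0: "W $$ (0, k) ~= 0" using k(1) by (auto simp: S_def)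
 define r where "r b = W $$ (0, b) / W $$ (0, k)" for b
 have r: "r b : O2" if "b < Suc N" for b
  using k(2) that by (cases "W $$ (0, b) = 0") (auto simp: r_def S_def)
 define W' where "W' = mat N N (%(a, b). W $$ (Suc a, insert_index k b) - r (insert_index k b) * W $$ (Suc a, k))"
 define s' where "s' b = s (insert_index k b) - r (insert_index k b) * s k" for b
 have det: "abs_F (ddet W) = abs_F (W $$ (0, k)) * abs_F (ddet W')"
  unfolding W'_def r_def by (rule det_pivot[OF W kN d0])
 have W': "W' : carrier_mat N N" by (simp add: W'_def)
 have det0: "ddet W' ~= 0"
  using det abs_F_neq_0[OF Suc.prems(4)] by auto
 define P where "P y \<longleftrightarrow> (\<forall>b<N. (\<Sum>a<N. y (qs ! a) * W' $$ (a, b)) + s' b : O2)" for y :: "nat \<times> nat => 'k F"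
 define T where "T y b = (\<Sum>a<N. y (qs ! a) * W $$ (Suc a, b)) + s b" for y :: "nat \<times> nat => 'k F" and b
 have IH: "has_repeated_int qs (%y. if P y then 1 else 0) (abs_F (inverse (ddet W')))"
  unfolding P_def by (rule Suc.IH[OF qs(1,2) W' det0])
 have P_T: "P y \<longleftrightarrow> (\<forall>b<Suc N. b ~= k --> T y b - r b * T y k : O2)" for y
 proof -
  have "(\<Sum>a<N. y (qs ! a) * W' $$ (a, b)) + s' b = T y (insert_index k b) - r (insert_index k b) * T y k"
   if "b < N" for b
   using that by (simp add: W'_def s'_def T_def algebra_simps sum.distrib sum_subtractf sum_distrib_left)
  hence "P y \<longleftrightarrow> (\<forall>b<N. T y (insert_index k b) - r (insert_index k b) * T y k : O2)"
   by (simp add: P_def)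
  also have "... \<longleftrightarrow> (ALL b:insert_index k ` {..<N}. T y b - r b * T y k : O2)" by auto
  also have "insert_index k ` {..<N} = {b. b < Suc N & b ~= k}"
  proof (intro equalityI subsetI)
   fix b assume "b : {b. b < Suc N & b ~= k}"
   hence "b = insert_index k (delete_index k b)" "delete_index k b < N"
    using kN by (auto simp: insert_index_def delete_index_def)
   thus "b : insert_index k ` {..<N}" by blast
  qed (use kN in \<open>auto simp: insert_index_def\<close>)
  finally show ?thesis by auto
 qed
 have upd: "(\<Sum>a<Suc N. (y(p := x)) (ps ! a) * W $$ (a, b)) + s b = x * W $$ (0, b) + T y b" for y x b
 proof -
  have "qs ! a ~= p" if "a < N" for a
   using that qs nth_mem[of a qs] by auto
  hence "(\<Sum>a<N. (y(p := x)) (qs ! a) * W $$ (Suc a, b)) = (\<Sum>a<N. y (qs ! a) * W $$ (Suc a, b))"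
   by (intro sum.cong refl) simp
  thus ?thesis
   by (simp add: fun_upd_same sum.lessThan_Suc_shift ps T_def add.assoc del: sum.lessThan_Suc fun_upd_apply)
 qed
 have cond: "(\<forall>b<Suc N. x * W $$ (0, b) + T y b : O2) \<longleftrightarrow> P y & x * W $$ (0, k) + T y k : O2" for x y
 proof -
  have e: "x * W $$ (0, b) + T y b = r b * (x * W $$ (0, k) + T y k) + (T y b - r b * T y k)" for b
   using d0 by (simp add: r_def field_simps)
  have e': "T y b - r b * T y k = (x * W $$ (0, b) + T y b) - r b * (x * W $$ (0, k) + T y k)" for b
   unfolding e[of b] by simp
  show ?thesis
  proof (intro iffI conjI)
   assume *: "\<forall>b<Suc N. x * W $$ (0, b) + T y b : O2"
   thus "x * W $$ (0, k) + T y k : O2" using kN by blast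
   hence xk: "x * W $$ (0, k) + T y k : O2" .
   show "P y" unfolding P_T
   proof (intro allI impI)
    fix b assume b: "b < Suc N"
    have "r b * (x * W $$ (0, k) + T y k) : O2" using r[OF b] xk by (rule O2_mult)
    thus "T y b - r b * T y k : O2" using * b by (subst e') (intro O2_diff, blast+)
   qed
  next
   assume *: "P y & x * W $$ (0, k) + T y k : O2"
   show "\<forall>b<Suc N. x * W $$ (0, b) + T y b : O2"
   proof (intro allI impI)
    fix b assume b: "b < Suc N"
    show "x * W $$ (0, b) + T y b : O2"
    proof (cases "b = k")
     case False
     hence "T y b - r b * T y k : O2" using * b P_T by blast
     moreover have "r b * (x * W $$ (0, k) + T y k) : O2" using r[OF b] * by (intro O2_mult) auto
     ultimately show ?thesis by (subst e) (intro O2_add)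
    qed (use * in simp)
   qed
  qed
 qed
 define c where "c = abs_F (inverse (W $$ (0, k)))"
 have "has_int_F (%x. if P y & x * W $$ (0, k) + T y k : O2 then 1 else 0) (c * (if P y then 1 else 0) + 0 * 0)" for y
 proof (cases "P y")
  case True
  thus ?thesis using has_int_F_affine[OF d0, of "T y k"] by (simp add: c_def)
 qed (simp add: has_int_F_zero)
 hence inner: "has_int_F (%x. if \<forall>b<Suc N. (\<Sum>a<Suc N. (y(p := x)) (ps ! a) * W $$ (a, b)) + s b : O2 then 1 else 0)
   (c * (if P y then 1 else 0) + 0 * 0)" for y
  unfolding upd cond .
 have outer: "has_repeated_int qs (%y. c * (if P y then 1 else 0) + 0 * 0) (c * abs_F (inverse (ddet W')) + 0 * 0)"
  by (rule has_repeated_int_lin[OF _ _ IH has_repeated_int_0]) (simp_all add: c_def)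
 have "abs_F (inverse (ddet W)) = c * abs_F (inverse (ddet W')) + 0 * 0"
  by (simp add: abs_F_inverse det c_def)
 thus ?case
  unfolding ps has_repeated_int.simps
  using inner outer unfolding ps by (intro exI[of _ "%y. c * (if P y then 1 else 0) + 0 * 0"]) auto
qed

section \<open>Matrix groups over the valuation ring\<close>

definition matS :: "nat => 'a set => 'a mat set" where
 "matS n S = {A : MN n. \<forall>a<n. \<forall>b<n. A $$ (a, b) : S}"

lemma matS_carrier: "A : matS n S ==> A : MN n"
 by (simp add: matS_def)

lemmas matS_carrier_O2 = matS_carrier[of _ _ O2]

lemma elements_mat_matS: "A : MN n ==> elements_mat A <= S \<longleftrightarrow> A : matS n S"
proof -
 assume A: "A : MN n"
 show "elements_mat A <= S \<longleftrightarrow> A : matS n S"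
 proof
  assume *: "elements_mat A <= S"
  have "A $$ (a, b) : S" if "a < n" "b < n" for a b
   using elements_matI[OF A that refl] * by (rule subsetD[rotated])
  thus "A : matS n S" using A by (simp add: matS_def)
 next
  assume *: "A : matS n S"
  show "elements_mat A <= S"
  proof
   fix x assume "x : elements_mat A"
   from elements_matD[OF this] obtain a b where "a < n" "b < n" "x = A $$ (a, b)" using A by auto
   thus "x : S" using * by (simp add: matS_def)
  qed
 qed
qed

lemma index_mult_sum: "A : MN n ==> B : MN n ==> a < n ==> b < n ==>
  (A * B) $$ (a, b) = (\<Sum>c<n. A $$ (a, c) * B $$ (c, b))"
 by (simp add: scalar_prod_def atLeast0LessThan)

lemma matS_mult:
 assumes "A : matS n O2" "B : matS n O2"
 shows "A * B : matS n O2"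
proof -
 have c: "A : MN n" "B : MN n" using assms by (auto simp: matS_def)
 have "(A * B) $$ (a, b) : O2" if "a < n" "b < n" for a b
  unfolding index_mult_sum[OF c that] using assms that by (intro O2_sum O2_mult) (auto simp: matS_def)
 thus ?thesis using c by (simp add: matS_def del: index_mult_mat(1))
qed

lemma matS_mult_J1:
 assumes "A : matS n O2" "B : matS n (Jid i j)"
 shows "A * B : matS n (Jid i j)"
proof -
 have c: "A : MN n" "B : MN n" using assms by (auto simp: matS_def)
 have "(A * B) $$ (a, b) : Jid i j" if "a < n" "b < n" for a b
  unfolding index_mult_sum[OF c that] using assms that by (intro Jid_sum Jid_mult) (auto simp: matS_def)
 thus ?thesis using c by (simp add: matS_def del: index_mult_mat(1))
qed

lemma matS_mult_J2:
 assumes "A : matS n (Jid i j)" "B : matS n O2"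
 shows "A * B : matS n (Jid i j)"
proof -
 have c: "A : MN n" "B : MN n" using assms by (auto simp: matS_def)
 have "(A * B) $$ (a, b) : Jid i j" if "a < n" "b < n" for a b
  unfolding index_mult_sum[OF c that] using assms that by (intro Jid_sum Jid_mult_right) (auto simp: matS_def)
 thus ?thesis using c by (simp add: matS_def del: index_mult_mat(1))
qed

lemmas matS_mult_J = matS_mult_J1 matS_mult_J2

lemma matS_add_J:
 assumes "A : matS n (Jid i j)" "B : matS n (Jid i j)"
 shows "A + B : matS n (Jid i j)"
proof -
 have c: "A : MN n" "B : MN n" using assms by (auto simp: matS_def)
 have "(A + B) $$ (a, b) : Jid i j" if "a < n" "b < n" for a b
 proof -
  have "(A + B) $$ (a, b) = A $$ (a, b) + B $$ (a, b)" using c that by simp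
  moreover have "A $$ (a, b) : Jid i j" "B $$ (a, b) : Jid i j"
   using assms that unfolding matS_def by blast+
  ultimately show ?thesis by (simp only: Jid_add)
 qed
 thus ?thesis using c by (simp add: matS_def)
qed

lemma matS_uminus_J:
 assumes "A : matS n (Jid i j)"
 shows "- A : matS n (Jid i j)"
proof -
 have c: "A : MN n" using assms by (auto simp: matS_def)
 have "(- A) $$ (a, b) : Jid i j" if "a < n" "b < n" for a b
 proof -
  have "(- A) $$ (a, b) = - (A $$ (a, b))" using c that by simp
  moreover have "A $$ (a, b) : Jid i j" using assms that unfolding matS_def by blast
  ultimately show ?thesis by (simp only: Jid_uminus)
 qed
 thus ?thesis using c by (simp add: matS_def)
qed

lemma matS_mono: "S <= T ==> matS n S <= matS n T"
 by (auto simp: matS_def)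

lemma one_matS [simp]: "1\<^sub>m n : matS n O2"
 by (auto simp: matS_def)

lemma permutes_lt: "p permutes {0..<n} ==> i < n ==> p i < (n :: nat)"
 using permutes_in_image[of p "{0..<n}" i] by (simp only: atLeastLessThan_iff le0 simp_thms)

lemma det_O2: assumes "A : matS n O2" shows "ddet A : O2"
proof -
 have A: "A : MN n" by (rule matS_carrier[OF assms])
 have "signof p * (\<Prod>i = 0..<n. A $$ (i, p i)) : O2" if p: "p permutes {0..<n}" for p
 proof -
  have "signof p : (O2 :: 'a F set)" by (simp add: sign_def)
  moreover have "(\<Prod>i = 0..<n. A $$ (i, p i)) : O2"
   using assms permutes_lt[OF p] by (intro O2_prod) (simp add: matS_def)
  ultimately show ?thesis by (rule O2_mult)
 qed
 hence "(\<Sum>p | p permutes {0..<n}. signof p * (\<Prod>i = 0..<n. A $$ (i, p i))) : O2"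
  by (intro O2_sum) simp
 thus ?thesis by (simp only: det_def'[OF A])
qed

lemma res_det: assumes "A : matS n O2" shows "ddet (map_mat res A) = res (ddet A)"
proof -
 have A: "A : MN n" by (rule matS_carrier[OF assms])
 have ent: "A $$ (i, p i) : O2" if "p permutes {0..<n}" "i < n" for p i
  using permutes_lt[OF that] that(2) assms by (simp add: matS_def)
 have sg: "signof p : (O2 :: 'a F set)" "res (signof p :: 'a F) = signof p" for p :: "nat => nat"
  by (simp_all add: sign_def res_uminus)
 have "res (ddet A) = (\<Sum>p | p permutes {0..<n}. signof p * (\<Prod>i = 0..<n. res (A $$ (i, p i))))"
  unfolding det_def'[OF A] res_sum
 proof (intro sum.cong refl)
  fix p assume "p : {p. p permutes {0..<n}}"
  hence e: "A $$ (i, p i) : O2" if "i : {0..<n}" for i using ent that by auto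
  have "res (signof p * (\<Prod>i = 0..<n. A $$ (i, p i))) = res (signof p :: 'a F) * res (\<Prod>i = 0..<n. A $$ (i, p i))"
   by (rule res_mult[OF sg(1) O2_prod[OF e]])
  thus "res (signof p * (\<Prod>i = 0..<n. A $$ (i, p i))) = signof p * (\<Prod>i = 0..<n. res (A $$ (i, p i)))"
   by (simp only: sg(2) res_prod[OF e])
 qed
 also have "... = ddet (map_mat res A)"
 proof -
  have "map_mat res A : MN n" using A by simp
  moreover have "map_mat res A $$ (i, p i) = res (A $$ (i, p i))" if "p permutes {0..<n}" "i < n" for p i
   using A that(2) permutes_lt[OF that] by simp
  ultimately show ?thesis by (simp add: det_def')
 qed
 finally show ?thesis by simp
qed

lemma group_GLF: "group (GLF n :: 'k::field F mat monoid)"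
proof (rule groupI)
 fix A B C :: "'k F mat"
 assume A: "A : carrier (GLF n)" and B: "B : carrier (GLF n)" and C: "C : carrier (GLF n)"
 have c: "A : MN n" "B : MN n" "C : MN n"
  using A B C by (simp_all add: GLF_carrier_iff)
 show "A \<otimes>\<^bsub>GLF n\<^esub> B \<otimes>\<^bsub>GLF n\<^esub> C = A \<otimes>\<^bsub>GLF n\<^esub> (B \<otimes>\<^bsub>GLF n\<^esub> C)"
  using c by (simp add: GLF_def assoc_mult_mat)
next
 fix A B :: "'k F mat"
 assume "A : carrier (GLF n)" "B : carrier (GLF n)"
 hence *: "A : MN n" "B : MN n" "ddet A ~= 0" "ddet B ~= 0"
  by (simp_all add: GLF_carrier_iff)
 hence "A * B : carrier (GLF n)" by (simp add: GLF_carrier_iff det_mult[OF *(1,2)])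
 thus "A \<otimes>\<^bsub>GLF n\<^esub> B : carrier (GLF n)" by (simp add: GLF_def)
next
 have "1\<^sub>m n : carrier (GLF n :: 'k F mat monoid)" by (simp add: GLF_carrier_iff)
 thus "\<one>\<^bsub>GLF n\<^esub> : carrier (GLF n :: 'k F mat monoid)" by (simp add: GLF_def)
next
 fix A :: "'k F mat"
 assume A': "A : carrier (GLF n)"
 hence A: "A : MN n" "ddet A ~= 0" by (simp_all add: GLF_carrier_iff)
 show "\<one>\<^bsub>GLF n\<^esub> \<otimes>\<^bsub>GLF n\<^esub> A = A" using A by (simp add: GLF_def)
 obtain B where B: "B : MN n" "B * A = 1\<^sub>m n"
  using det_non_zero_imp_unit[OF A] by (auto simp: Units_def ring_mat_def)
 have "ddet B * ddet A = 1" using det_mult[OF B(1) A(1)] B(2) by simp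
 hence "B : carrier (GLF n)" using B(1) by (auto simp: GLF_carrier_iff)
 thus "EX y:carrier (GLF n). y \<otimes>\<^bsub>GLF n\<^esub> A = \<one>\<^bsub>GLF n\<^esub>"
  using B by (intro bexI[of _ B]) (simp_all add: GLF_def)
qed

lemma GLF_mult [simp]: "A \<otimes>\<^bsub>GLF n\<^esub> B = A * B" and GLF_one [simp]: "\<one>\<^bsub>GLF n\<^esub> = 1\<^sub>m n"
 by (simp_all add: GLF_def)

interpretation GL: group "GLF n :: 'k::field F mat monoid" for n by (rule group_GLF)

lemma GLF_mat: "A : carrier (GLF n) ==> A : MN n"
 by (simp add: GLF_carrier_iff)

text \<open>By Cramer's rule the inverse is integral if and only if the determinant is a unit.\<close>

lemma K0_iff: "A : K0 n \<longleftrightarrow> A : matS n O2 & ddet A : O2u" for A :: "'k::field F mat"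
proof
 assume "A : K0 n"
 hence A: "A : carrier (GLF n)" "elements_mat A <= O2" "elements_mat (inv\<^bsub>GLF n\<^esub> A) <= O2"
  by (auto simp: K0_def)
 have Ai: "inv\<^bsub>GLF n\<^esub> A : carrier (GLF n)" using A(1) by simp
 have m: "A : matS n O2" "inv\<^bsub>GLF n\<^esub> A : matS n O2"
  using A Ai by (auto simp flip: elements_mat_matS simp: GLF_mat)
 have "A * inv\<^bsub>GLF n\<^esub> A = 1\<^sub>m n" using GL.r_inv[OF A(1)] by simp
 hence d: "ddet A * ddet (inv\<^bsub>GLF n\<^esub> A) = 1"
  using det_mult[of A n "inv\<^bsub>GLF n\<^esub> A"] A(1) Ai by (simp add: GLF_mat)
 hence "inverse (ddet A) = ddet (inv\<^bsub>GLF n\<^esub> A)"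
  by (rule inverse_unique)
 thus "A : matS n O2 & ddet A : O2u"
  using m d det_O2 by (auto simp: O2u_iff)
next
 assume *: "A : matS n O2 & ddet A : O2u"
 hence A: "A : MN n" "A : matS n O2" "ddet A ~= 0"
  by (auto simp: O2u_def dest: matS_carrier)
 have AG: "A : carrier (GLF n)" using A by (simp add: GLF_carrier_iff)
 have adj: "adj_mat A : matS n O2"
  unfolding matS_def
 proof (intro CollectI conjI allI impI)
  show "adj_mat A : MN n" using adj_mat[OF A(1)] by simp
  fix a b assume ab: "a < n" "b < n"
  have "adj_mat A $$ (a, b) = cofactor A b a" using ab A(1) by (simp add: adj_mat_def)
  also have "... : O2"
  proof -
   have "mat_delete A b a : matS (n - 1) O2"
    using A(2) ab unfolding matS_def mat_delete_def by auto
   hence d: "ddet (mat_delete A b a) : O2" by (rule det_O2)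
   have "(- 1 :: 'k F) ^ m : O2" for m by (induction m) auto
   thus ?thesis unfolding cofactor_def using d by (rule O2_mult)
  qed
  finally show "adj_mat A $$ (a, b) : O2" .
 qed
 define B where "B = inverse (ddet A) \<cdot>\<^sub>m adj_mat A"
 have Bc: "B : MN n" using matS_carrier[OF adj] by (simp add: B_def)
 have "inverse (ddet A) : O2" using * by (simp add: O2u_iff)
 hence B: "B : matS n O2" using adj unfolding B_def matS_def by (auto intro!: O2_mult)
 have "A * B = inverse (ddet A) \<cdot>\<^sub>m (A * adj_mat A)"
  unfolding B_def using A(1) matS_carrier[OF adj] by (rule mult_smult_distrib)
 also have "... = 1\<^sub>m n" using adj_mat(2)[OF A(1)] A(3) by (intro eq_matI) auto
 finally have AB: "A * B = 1\<^sub>m n" .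
 hence "ddet A * ddet B = 1" using det_mult[OF A(1) Bc] by simp
 hence BG: "B : carrier (GLF n)" using Bc by (auto simp: GLF_carrier_iff)
 have "inv\<^bsub>GLF n\<^esub> A = B" using GL.inv_equality[OF _ AG BG] GL.inv_comm[OF _ AG BG] AB by simp
 thus "A : K0 n"
  unfolding K0_def using AG A B Bc by (simp add: elements_mat_matS)
qed

lemma K0_subgroup: "subgroup (K0 n) (GLF n :: 'k::field F mat monoid)"
proof (rule GL.subgroupI)
 show "K0 n <= carrier (GLF n :: 'k F mat monoid)" by (auto simp: K0_def)
 show "K0 n ~= ({} :: 'k F mat set)"
 proof -
  have "1\<^sub>m n : (K0 n :: 'k F mat set)" by (simp add: K0_iff)
  thus ?thesis by blast
 qed
 show "inv\<^bsub>GLF n\<^esub> A : K0 n" if "A : K0 n" for A :: "'k F mat"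
  using that by (auto simp: K0_def)
 show "A \<otimes>\<^bsub>GLF n\<^esub> B : K0 n" if "A : K0 n" "B : K0 n" for A B :: "'k F mat"
 proof -
  have *: "A : matS n O2" "B : matS n O2" "ddet A : O2u" "ddet B : O2u"
   using that by (simp_all add: K0_iff)
  show ?thesis
   using *(3,4) det_mult[OF *(1,2)[THEN matS_carrier]] matS_mult[OF *(1,2)] by (simp add: K0_iff O2u_mult)
 qed
qed

section \<open>Upper triangular matrices\<close>

lemma ut_index: "A : MN n ==> upper_triangular A \<longleftrightarrow> (\<forall>a<n. \<forall>b<a. A $$ (a, b) = 0)"
 by (simp add: upper_triangular_def)

lemma det_ut: "A : MN n ==> upper_triangular A ==> ddet A = (\<Prod>a<n. A $$ (a, a))"
 by (subst det_upper_triangular)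
  (auto simp: diag_mat_def prod.list_conv_set_nth atLeast0LessThan intro!: prod.cong)

lemma ut_mult_diag:
 assumes "A : MN n" "B : MN n" "upper_triangular A" "upper_triangular B"
 shows "upper_triangular (A * B)" "!!a. a < n ==> (A * B) $$ (a, a) = A $$ (a, a) * B $$ (a, a :: nat)"
proof -
 have z: "A $$ (a, c) * B $$ (c, b) = 0" if "a < n" "b < n" "c < n" "b < a | a = b & c ~= a" for a b c
 proof (cases "c < a")
  case True
  thus ?thesis using that assms(1,3) by (simp add: ut_index)
 next
  case False
  hence "b < c" using that by auto
  thus ?thesis using that assms(2,4) by (simp add: ut_index)
 qed
 show "upper_triangular (A * B)"
 proof -
  have "(A * B) $$ (a, b) = 0" if "a < n" "b < a" for a b
   using that assms(1,2) z[of a b] by (subst index_mult_sum[of A n B]) (auto intro!: sum.neutral)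
  moreover have "A * B : MN n" using assms(1,2) by simp
  ultimately show ?thesis by (simp add: ut_index del: index_mult_mat)
 qed
 show "(A * B) $$ (a, a) = A $$ (a, a) * B $$ (a, a)" if a: "a < n" for a
 proof -
  have "(A * B) $$ (a, a) = (\<Sum>c<n. A $$ (a, c) * B $$ (c, a))"
   using assms a by (intro index_mult_sum)
  also have "... = (\<Sum>c\<in>{a}. A $$ (a, c) * B $$ (c, a))"
   using a z[of a a] by (intro sum.mono_neutral_right) auto
  finally show ?thesis by simp
 qed
qed

lemma Bor_iff: "A : Bor n \<longleftrightarrow> A : MN n & upper_triangular A & (\<forall>a<n. A $$ (a, a) ~= 0)"
 for A :: "'k::field F mat"
 by (auto simp: Bor_def GLF_carrier_iff det_ut)

lemma Bor_subgroup: "subgroup (Bor n) (GLF n :: 'k::field F mat monoid)"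
proof (rule GL.subgroupI)
 show "Bor n <= carrier (GLF n :: 'k F mat monoid)" by (auto simp: Bor_def)
 show "Bor n ~= ({} :: 'k F mat set)"
 proof -
  have "1\<^sub>m n : (Bor n :: 'k F mat set)" by (simp add: Bor_iff ut_index)
  thus ?thesis by blast
 qed
 show "A \<otimes>\<^bsub>GLF n\<^esub> B : Bor n" if "A : Bor n" "B : Bor n" for A B :: "'k F mat"
  using that ut_mult_diag[of A n B] mult_carrier_mat[of A n n B n] by (simp add: Bor_iff del: index_mult_mat)
 show "inv\<^bsub>GLF n\<^esub> A : Bor n" if A: "A : Bor n" for A :: "'k F mat"
 proof -
  define C where "C = inv\<^bsub>GLF n\<^esub> A"
  have AG: "A : carrier (GLF n)" using A by (simp add: Bor_def)
  have CG: "C : carrier (GLF n)" using AG by (simp add: C_def)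
  have cm: "A : MN n" "C : MN n" using AG CG by (simp_all add: GLF_mat)
  have CA: "C * A = 1\<^sub>m n" using GL.l_inv[OF AG] by (simp add: C_def)
  have "b < a --> C $$ (a, b) = 0" if "a < n" "b < n" for a b
   using that(2)
  proof (induction b rule: less_induct)
   case (less b)
   show ?case
   proof
    assume ba: "b < a"
    have "0 = (C * A) $$ (a, b)" using CA that(1) less.prems ba by simp
    also have "... = (\<Sum>c<n. C $$ (a, c) * A $$ (c, b))"
     using cm that(1) less.prems by (intro index_mult_sum)
    also have "... = (\<Sum>c\<in>{b}. C $$ (a, c) * A $$ (c, b))"
    proof (rule sum.mono_neutral_right)
     show "ALL c:{..<n} - {b}. C $$ (a, c) * A $$ (c, b) = 0"
     proof
      fix c assume c: "c : {..<n} - {b}"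
      show "C $$ (a, c) * A $$ (c, b) = 0"
      proof (cases "c < b")
       case True
       thus ?thesis using less.IH[OF True] less.prems ba by simp
      next
       case False
       hence "b < c" using c by auto
       thus ?thesis using A c ut_index[of A n] by (auto simp: Bor_iff)
      qed
     qed
    qed (use less.prems in auto)
    finally show "C $$ (a, b) = 0" using A less.prems by (simp add: Bor_iff)
   qed
  qed
  hence "upper_triangular C" using cm by (simp add: ut_index)
  thus ?thesis using CG by (simp add: Bor_def flip: C_def)
 qed
qed

lemma Bor_diag_mult: "A : Bor n ==> B : Bor n ==> a < n ==> (A * B) $$ (a, a) = A $$ (a, a) * B $$ (a, a)"
 using ut_mult_diag[of A n B] by (simp add: Bor_iff)

definition Q1 :: "nat => 'k::field F mat set" where
 "Q1 n = Bor n Int K0 n"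

lemma Q1_iff: "A : Q1 n \<longleftrightarrow> A : matS n O2 & upper_triangular A & (\<forall>a<n. A $$ (a, a) : O2u)"
 for A :: "'k::field F mat"
proof
 assume "A : Q1 n"
 hence A: "A : matS n O2" "upper_triangular A" "ddet A : O2u" by (auto simp: Q1_def Bor_iff K0_iff)
 have "(\<Prod>a\<in>{..<n}. A $$ (a, a)) : O2u" using A det_ut[OF matS_carrier[OF A(1)] A(2)] by simp
 moreover have "A $$ (a, a) : O2" if "a < n" for a using A that by (simp add: matS_def)
 moreover have "(\<Prod>a\<in>I. f a) : O2u ==> (!!a. a : I ==> f a : O2) ==> ALL a:I. f a : O2u" if "finite I"
  for I :: "nat set" and f :: "nat => 'k F"
  using that by (induction I rule: finite_induct) (auto simp: O2u_mult_iff O2_prod)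
 ultimately have "ALL a:{..<n}. A $$ (a, a) : O2u" by (metis (no_types, lifting) finite_lessThan lessThan_iff)
 thus "A : matS n O2 & upper_triangular A & (\<forall>a<n. A $$ (a, a) : O2u)" using A by simp
next
 assume *: "A : matS n O2 & upper_triangular A & (\<forall>a<n. A $$ (a, a) : O2u)"
 hence c: "A : MN n" by (auto dest: matS_carrier)
 have "ddet A : O2u" using det_ut[OF c] O2u_prod[of "{..<n}" "%a. A $$ (a, a)"] * by simp
 moreover have "\<forall>a<n. A $$ (a, a) ~= 0" using * by (auto simp: O2u_def)
 ultimately show "A : Q1 n" using * c by (simp add: Q1_def Bor_iff K0_iff)
qed

section \<open>Congruence subgroups\<close>

lemma Kij_iff: "A : Kij n i j \<longleftrightarrow> A : MN n & A - 1\<^sub>m n : matS n (Jid i j)"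
proof
 assume "A : Kij n i j"
 then obtain M where M: "A = 1\<^sub>m n + M" "M : MN n" "elements_mat M <= Jid i j"
  by (auto simp: Kij_def)
 have "A - 1\<^sub>m n = M" using M(2) unfolding M(1) by (intro eq_matI) auto
 thus "A : MN n & A - 1\<^sub>m n : matS n (Jid i j)"
  using M by (simp add: elements_mat_matS)
next
 assume *: "A : MN n & A - 1\<^sub>m n : matS n (Jid i j)"
 have "A = 1\<^sub>m n + (A - 1\<^sub>m n)" using * by (intro eq_matI) auto
 thus "A : Kij n i j" using * unfolding Kij_def
  using elements_mat_matS[of "A - 1\<^sub>m n" n "Jid i j"] matS_carrier[of "A - 1\<^sub>m n" n "Jid i j"]
  by (intro CollectI exI[of _ "A - 1\<^sub>m n"]) blast
qed

text \<open>The product of the integral Borel subgroup with the congruence subgroup.\<close>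

definition Pij :: "nat => nat => nat => 'k::field F mat set" where
 "Pij n i j = {A : matS n O2. (\<forall>a<n. \<forall>b<a. A $$ (a, b) : Jid i j) & (\<forall>a<n. A $$ (a, a) : O2u)}"

lemma O2u_add_m2: "x : O2u ==> y : m2 ==> x + y : O2u"
proof -
 assume x: "x : O2u" and y: "y : m2"
 have "y : O2" using y O2_eq by blast
 moreover from this have "res y = 0" using m2_iff_res y by blast
 ultimately show ?thesis using x by (simp add: O2u_iff_res res_add O2_add)
qed

lemma O2u_O2: "x : O2u ==> x : O2"
 by (simp add: O2u_iff)

lemma Pij_subset_K0: "1 <= i ==> 1 <= j ==> Pij n i j <= K0 n"
proof
 fix A :: "'k::field F mat" assume ij: "1 <= i" "1 <= j" and A: "A : Pij n i j"
 have m: "A : matS n O2" using A by (auto simp: Pij_def)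
 have c: "A : MN n" by (rule matS_carrier[OF m])
 have "res (A $$ (a, b)) = 0" if "a < n" "b < a" for a b
 proof -
  have "A $$ (a, b) : m2" using A that Jid_m2[OF ij] by (auto simp: Pij_def)
  thus ?thesis using m2_iff_res O2_eq by blast
 qed
 hence ut: "upper_triangular (map_mat res A)" using c by (auto simp: upper_triangular_def)
 have "res (ddet A) = (\<Prod>a<n. res (A $$ (a, a)))"
  unfolding res_det[OF m, symmetric] using det_ut[of "map_mat res A" n] ut c by simp
 also have "... ~= 0" using A by (auto simp: Pij_def O2u_iff_res)
 finally show "A : K0 n" using m det_O2[OF m] by (simp add: K0_iff O2u_iff_res)
qed

lemma Kij_subset_Pij: "1 <= i ==> 1 <= j ==> Kij n i j <= Pij n i j"
proof
 fix A :: "'k::field F mat" assume ij: "1 <= i" "1 <= j" and A: "A : Kij n i j"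
 have c: "A : MN n" using A by (simp add: Kij_iff)
 have e: "A $$ (a, b) - (if a = b then 1 else 0) : Jid i j" if "a < n" "b < n" for a b
  using A c that by (force simp: Kij_iff matS_def)
 have o: "A $$ (a, b) : Jid i j" if "a < n" "b < n" "a ~= b" for a b using e[of a b] that by simp
 have d: "A $$ (a, a) : O2u" if "a < n" for a
  using O2u_add_m2[of 1 "A $$ (a, a) - 1"] e[of a a] that Jid_m2[OF ij] by auto
 show "A : Pij n i j"
  unfolding Pij_def matS_def
 proof (intro CollectI conjI allI impI)
  fix a b assume "a < n" "b < n"
  thus "A $$ (a, b) : O2" using o[of a b] d[of a] Jid_O2[of i j] O2u_O2 by (cases "a = b") auto
 qed (use c o d in auto)
qed

lemma Kij_subset_K0: "1 <= i ==> 1 <= j ==> Kij n i j <= K0 n"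
 using Kij_subset_Pij Pij_subset_K0 by blast

lemma Kij_conj:
 assumes ij: "1 <= i" "1 <= j" and g: "g : K0 n" and A: "A : Kij n i j"
 shows "g * A * inv\<^bsub>GLF n\<^esub> g : Kij n i j"
proof -
 define h where "h = inv\<^bsub>GLF n\<^esub> g"
 have gG: "g : carrier (GLF n)" using g by (simp add: K0_def)
 have h: "h : K0 n" using subgroup.m_inv_closed[OF K0_subgroup g] by (simp add: h_def)
 have cm: "g : MN n" "h : MN n" "A : MN n"
  using g h A by (auto simp: K0_iff Kij_iff dest: matS_carrier)
 have gh: "g * h = 1\<^sub>m n" using GL.r_inv[OF gG] by (simp add: h_def)
 have "g * A * h - 1\<^sub>m n = g * (A - 1\<^sub>m n) * h"
 proof -
  have "g * (A - 1\<^sub>m n) * h = (g * A - g * 1\<^sub>m n) * h"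
   using cm by (subst mult_minus_distrib_mat[of _ n n _ n]) auto
  also have "... = g * A * h - g * 1\<^sub>m n * h"
   using cm by (subst minus_mult_distrib_mat[of _ n n _ _ n]) auto
  finally show ?thesis using cm gh by simp
 qed
 moreover have "g * (A - 1\<^sub>m n) * h : matS n (Jid i j)"
  using g h A by (intro matS_mult_J) (auto simp: K0_iff Kij_iff)
 ultimately show ?thesis using cm by (simp add: Kij_iff flip: h_def)
qed

lemma Kij_subgroup:
 assumes ij: "1 <= i" "1 <= j"
 shows "subgroup (Kij n i j) (GLF n :: 'k::field F mat monoid)"
proof (rule GL.subgroupI)
 have K: "Kij n i j <= (K0 n :: 'k F mat set)" by (rule Kij_subset_K0[OF ij])
 show "Kij n i j <= carrier (GLF n :: 'k F mat monoid)" using K by (auto simp: K0_def)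
 have "1\<^sub>m n : (Kij n i j :: 'k F mat set)" by (auto simp: Kij_iff matS_def)
 thus "Kij n i j ~= ({} :: 'k F mat set)" by blast
 show "A \<otimes>\<^bsub>GLF n\<^esub> B : Kij n i j" if AB: "A : Kij n i j" "B : Kij n i j" for A B :: "'k F mat"
 proof -
  have cm: "A : MN n" "B : MN n" using AB by (auto simp: Kij_iff)
  have "A * B - 1\<^sub>m n = (A - 1\<^sub>m n) * B + (B - 1\<^sub>m n)"
  proof -
   have "(A - 1\<^sub>m n) * B = A * B - B"
    using cm by (subst minus_mult_distrib_mat[of _ n n _ _ n]) auto
   thus ?thesis using cm by (intro eq_matI) auto
  qed
  moreover have "(A - 1\<^sub>m n) * B : matS n (Jid i j)"
   using AB K by (intro matS_mult_J) (auto simp: K0_iff Kij_iff)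
  moreover have "B - 1\<^sub>m n : matS n (Jid i j)" using AB by (simp add: Kij_iff)
  ultimately have "A * B - 1\<^sub>m n : matS n (Jid i j)"
   by (simp only: matS_add_J)
  thus ?thesis using cm by (simp add: Kij_iff)
 qed
 show "inv\<^bsub>GLF n\<^esub> A : Kij n i j" if A: "A : Kij n i j" for A :: "'k F mat"
 proof -
  define h where "h = inv\<^bsub>GLF n\<^esub> A"
  have AK: "A : K0 n" using A K by blast
  hence AG: "A : carrier (GLF n)" by (simp add: K0_def)
  have h: "h : K0 n" using subgroup.m_inv_closed[OF K0_subgroup AK] by (simp add: h_def)
  have cm: "A : MN n" "h : MN n" using AK h by (auto simp: K0_iff dest: matS_carrier)
  have hA: "h * A = 1\<^sub>m n" using GL.l_inv[OF AG] by (simp add: h_def)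
  have "h - 1\<^sub>m n = - (h * (A - 1\<^sub>m n))"
  proof -
   have "h * (A - 1\<^sub>m n) = h * A - h"
    using cm by (subst mult_minus_distrib_mat[of _ n n _ n]) auto
   thus ?thesis using cm unfolding hA by (intro eq_matI) auto
  qed
  moreover have "h * (A - 1\<^sub>m n) : matS n (Jid i j)"
   using h A by (intro matS_mult_J) (auto simp: K0_iff Kij_iff)
  ultimately have "h - 1\<^sub>m n : matS n (Jid i j)"
   by (simp only: matS_uminus_J)
  thus ?thesis using cm by (simp add: Kij_iff h_def)
 qed
qed

lemma Kij_mono: "j < j' | j = j' & i <= i' ==> Kij n i' j' <= Kij n i j"
 using matS_mono[OF Jid_mono, of j j' i i' n] by (auto simp: Kij_iff)

lemma Pij_eq:
 assumes ij: "1 <= i" "1 <= j"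
 shows "Pij n i j = {b * k | b k. b : Q1 n & k : (Kij n i j :: 'k::field F mat set)}"
proof (intro equalityI subsetI)
 fix A :: "'k F mat" assume A: "A : Pij n i j"
 have cA: "A : MN n" using A by (auto simp: Pij_def dest: matS_carrier)
 define b where "b = mat n n (%(a, c). if c < a then 0 else A $$ (a, c))"
 have b: "b : Q1 n"
  unfolding Q1_iff b_def using A by (auto simp: Pij_def matS_def upper_triangular_def)
 define L where "L = A - b"
 have L: "L : matS n (Jid i j)"
  unfolding L_def b_def using A cA by (auto simp: Pij_def matS_def)
 have bK: "b : K0 n" using b by (simp add: Q1_def)
 define h where "h = inv\<^bsub>GLF n\<^esub> b"
 have h: "h : K0 n" using subgroup.m_inv_closed[OF K0_subgroup bK] by (simp add: h_def)
 have cm: "b : MN n" "h : MN n" "L : MN n"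
  using bK h matS_carrier[OF L] by (auto simp: K0_iff dest: matS_carrier)
 have bG: "b : carrier (GLF n)" using bK by (simp add: K0_def)
 have bh: "b * h = 1\<^sub>m n" "h * b = 1\<^sub>m n" using GL.r_inv[OF bG] GL.l_inv[OF bG] by (simp_all add: h_def)
 have "h * A - 1\<^sub>m n = h * L"
  unfolding L_def using cm cA by (subst mult_minus_distrib_mat[of _ n n _ n]) (auto simp: bh)
 hence k: "h * A : Kij n i j"
  using matS_mult_J(1)[of h n L i j] h L cm cA by (simp add: Kij_iff K0_iff)
 have "b * (h * A) = (b * h) * A" using cm cA by (intro assoc_mult_mat[symmetric])
 also have "... = A" using cA by (simp add: bh)
 finally show "A : {b * k | b k. b : Q1 n & k : Kij n i j}" using b k by (metis (mono_tags, lifting) mem_Collect_eq)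
next
 fix A :: "'k F mat" assume "A : {b * k | b k. b : Q1 n & k : Kij n i j}"
 then obtain b k where bk: "A = b * k" "b : Q1 n" "k : Kij n i j" by blast
 have bQ: "b : matS n O2" "upper_triangular b" "\<forall>a<n. b $$ (a, a) : O2u" using bk(2) by (auto simp: Q1_iff)
 have cm: "b : MN n" "k : MN n" using bQ bk(3) by (auto simp: Kij_iff dest: matS_carrier)
 define N where "N = b * (k - 1\<^sub>m n)"
 have N: "N : matS n (Jid i j)" unfolding N_def using bQ bk(3) by (intro matS_mult_J) (auto simp: Kij_iff)
 have "N = b * k - b" unfolding N_def using cm by (subst mult_minus_distrib_mat[of _ n n _ n]) auto
 hence A: "A = b + N" unfolding bk(1) using cm by (intro eq_matI) auto
 have cN: "N : MN n" by (rule matS_carrier[OF N])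
 have Aij: "A $$ (a, c) = b $$ (a, c) + N $$ (a, c)" if "a < n" "c < n" for a c
  unfolding A using cm cN that by simp
 have NJ: "N $$ (a, c) : Jid i j" if "a < n" "c < n" for a c using N that by (simp add: matS_def)
 show "A : Pij n i j"
  unfolding Pij_def matS_def
 proof (intro CollectI conjI allI impI)
  show "A : MN n" unfolding A using cm cN by simp
  fix a assume a: "a < n"
  show "A $$ (a, c) : O2" if "c < n" for c
   using Aij[OF a that] NJ[OF a that] bQ(1) a that Jid_O2 by (auto simp: matS_def intro!: O2_add)
  show "A $$ (a, c) : Jid i j" if "c < a" for c
   using Aij[of a c] NJ[of a c] bQ(2) a that cm by (simp add: ut_index)
  show "A $$ (a, a) : O2u"
   using Aij[OF a a] NJ[OF a a] bQ(3) a Jid_m2[OF ij] by (auto intro!: O2u_add_m2)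
 qed
qed

section \<open>The group and its levels\<close>

lemma group_Hgrp: "group (Hgrp n :: 'k::field HH monoid)"
 unfolding Hgrp_def by (intro DirProd_group group_GLF)

interpretation HG: group "Hgrp n :: 'k::field HH monoid" for n by (rule group_Hgrp)

lemma Hgrp_mult: "x \<otimes>\<^bsub>Hgrp n\<^esub> y = (fst x * fst y, snd x * snd y)"
 unfolding Hgrp_def mult_DirProd' GLF_mult ..

lemma Hgrp_inv: "x : carrier (Hgrp n) ==> inv\<^bsub>Hgrp n\<^esub> x = (inv\<^bsub>GLF n\<^esub> (fst x), inv\<^bsub>GLF n\<^esub> (snd x))"
 for x :: "'k::field HH"
 using inv_DirProd[OF group_GLF group_GLF, of "fst x" n "snd x" n] unfolding Hgrp_carrier
 by (metis Hgrp_def mem_Times_iff prod.collapse)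

lemma Hgrp_subgroup_Times:
 assumes "subgroup A (GLF n)" "subgroup B (GLF n)"
 shows "subgroup (A \<times> B) (Hgrp n :: 'k::field HH monoid)"
proof (rule HG.subgroupI)
 show "A \<times> B <= carrier (Hgrp n)"
  using assms[THEN subgroup.subset] unfolding Hgrp_carrier by blast
 show "A \<times> B ~= {}" using assms[THEN subgroup.one_closed] by blast
 show "inv\<^bsub>Hgrp n\<^esub> x : A \<times> B" if x: "x : A \<times> B" for x
 proof -
  have "x : carrier (Hgrp n)" using x assms[THEN subgroup.subset] unfolding Hgrp_carrier by auto
  thus ?thesis unfolding Hgrp_inv[OF \<open>x : carrier (Hgrp n)\<close>]
   using x subgroup.m_inv_closed[OF assms(1)] subgroup.m_inv_closed[OF assms(2)] by auto
 qed
 show "x \<otimes>\<^bsub>Hgrp n\<^esub> y : A \<times> B" if "x : A \<times> B" "y : A \<times> B" for x y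
  using that subgroup.m_closed[OF assms(1)] subgroup.m_closed[OF assms(2)] by (auto simp: Hgrp_mult)
qed

lemma H0_subgroup: "subgroup (H0 n) (Hgrp n :: 'k::field HH monoid)"
 unfolding H0_def by (intro Hgrp_subgroup_Times K0_subgroup)

lemma BH_subgroup: "subgroup (BH n) (Hgrp n :: 'k::field HH monoid)"
 unfolding BH_def by (intro Hgrp_subgroup_Times Bor_subgroup)

lemma Q0_subgroup: "subgroup (Q0 n) (Hgrp n :: 'k::field HH monoid)"
 unfolding Q0_def by (intro HG.subgroups_Inter_pair BH_subgroup H0_subgroup)

lemma Q0_eq: "Q0 n = Q1 n \<times> Q1 n"
 by (auto simp: Q0_def BH_def H0_def Q1_def)

lemma Cdbl_subgroup: "1 <= i ==> 1 <= j ==> subgroup (Cdbl n i j) (Hgrp n :: 'k::field HH monoid)"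
 unfolding Cdbl_def by (intro Hgrp_subgroup_Times Kij_subgroup)

lemma Cdbl_mono: "j < j' | j = j' & i <= i' ==> Cdbl n i' j' <= Cdbl n i j"
 using Kij_mono[of j j' i i' n] by (auto simp: Cdbl_def)

lemma lex_total: "(j < j' | j = j' & i <= i') | (j' < j | j' = j & i' <= (i :: nat))" for j j' :: nat
 by linarith

lemma Cdbl_total: "Cdbl n i j <= Cdbl n i' j' | Cdbl n i' j' <= (Cdbl n i j :: 'k::field HH set)"
 using lex_total[of j j' i i'] Cdbl_mono[of j j' i i' n] Cdbl_mono[of j' j i' i n] by blast

lemma chain_Inter_mem:
 assumes "finite \<C>" "\<C> ~= {}" "!!A B. A : \<C> ==> B : \<C> ==> A <= B | B <= A"
 shows "\<Inter>\<C> : \<C>"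
 using assms
proof (induction \<C> rule: finite_ne_induct)
 case (insert A \<C>)
 have "\<Inter>\<C> : \<C>" using insert.IH insert.prems by blast
 hence "A <= \<Inter>\<C> | \<Inter>\<C> <= A" using insert.prems by blast
 hence "A Int \<Inter>\<C> = A | A Int \<Inter>\<C> = \<Inter>\<C>" by blast
 thus ?case using \<open>\<Inter>\<C> : \<C>\<close> by auto
qed simp

text \<open>The levels in \<open>H0\<close> form a chain, because the ideals of a valuation ring do.\<close>

lemma CH0_eq: "CH0 n = {Cdbl n i j | i j. 1 <= i & 1 <= j}"
proof (intro equalityI subsetI)
 fix C :: "'a HH set" assume "C : CH0 n"
 then obtain \<C> where \<C>: "C = \<Inter>\<C>" "finite \<C>" "\<C> ~= {}" "\<C> <= {Cdbl n i j | i j. 1 <= i & 1 <= j}"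
  by (auto simp: CH0_def)
 have "\<Inter>\<C> : \<C>"
 proof (rule chain_Inter_mem[OF \<C>(2,3)])
  fix A B assume "A : \<C>" "B : \<C>"
  then obtain i j i' j' where "A = Cdbl n i j" "B = Cdbl n i' j'" using \<C>(4) by blast
  thus "A <= B | B <= A" using Cdbl_total by blast
 qed
 thus "C : {Cdbl n i j | i j. 1 <= i & 1 <= j}" using \<C>(1,4) by blast
next
 fix C :: "'a HH set" assume C: "C : {Cdbl n i j | i j. 1 <= i & 1 <= j}"
 thus "C : CH0 n" unfolding CH0_def
  by (intro CollectI exI[of _ "{C}"]) simp
qed

lemma CH0_cases:
 assumes "C : CH0 n"
 obtains i j where "C = Cdbl n i j" "1 <= i" "1 <= j"
 using assms unfolding CH0_eq by blast

lemma CH0_total: "C : CH0 n ==> D : CH0 n ==> C <= D | D <= C"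
 by (elim CH0_cases) (simp add: Cdbl_total)

lemma CH0_Int: assumes "C : CH0 n" "D : CH0 n" shows "C Int D : CH0 n"
proof -
 have "C Int D = C | C Int D = D" using CH0_total[OF assms] by blast
 thus ?thesis using assms by metis
qed

lemma CH0_subgroup: "C : CH0 n ==> subgroup C (Hgrp n)"
 by (elim CH0_cases) (simp add: Cdbl_subgroup)

lemma CH0_subset_H0: assumes "C : CH0 n" shows "C <= H0 n"
proof -
 obtain i j where "C = Cdbl n i j" "1 <= i" "1 <= j" using assms by (rule CH0_cases)
 thus ?thesis using Kij_subset_K0[of i j n] by (auto simp: Cdbl_def H0_def)
qed

lemma H0_carrier: "k : H0 n ==> k : carrier (Hgrp n)"
 using subgroup.subset[OF H0_subgroup] by blast

lemma BH_carrier: "b : BH n ==> b : carrier (Hgrp n)"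
 using subgroup.subset[OF BH_subgroup] by blast

lemma CH0_carrier: "C : CH0 n ==> c : C ==> c : carrier (Hgrp n)"
 using CH0_subset_H0 H0_carrier by blast

lemma CH0_conj_mem:
 assumes "C : CH0 n" "h : H0 n" "c : C"
 shows "h \<otimes>\<^bsub>Hgrp n\<^esub> c \<otimes>\<^bsub>Hgrp n\<^esub> inv\<^bsub>Hgrp n\<^esub> h : C"
proof -
 obtain i j where C: "C = Cdbl n i j" "1 <= i" "1 <= j" using assms(1) by (rule CH0_cases)
 have h: "fst h : K0 n" "snd h : K0 n" using assms(2) by (auto simp: H0_def)
 have c: "fst c : Kij n i j" "snd c : Kij n i j" using assms(3) by (auto simp: C Cdbl_def)
 show ?thesis
  unfolding Hgrp_inv[OF H0_carrier[OF assms(2)]] Hgrp_mult C(1) Cdbl_def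
  using Kij_conj[OF C(2,3) h(1) c(1)] Kij_conj[OF C(2,3) h(2) c(2)] by simp
qed

lemma CH0_conj_mem':
 assumes "C : CH0 n" "h : H0 n" "c : C"
 shows "inv\<^bsub>Hgrp n\<^esub> h \<otimes>\<^bsub>Hgrp n\<^esub> c \<otimes>\<^bsub>Hgrp n\<^esub> h : C"
 using CH0_conj_mem[OF assms(1) subgroup.m_inv_closed[OF H0_subgroup assms(2)] assms(3)]
  HG.inv_inv[OF H0_carrier[OF assms(2)]] by simp

lemma cj_eq: "cj n h C = {h \<otimes>\<^bsub>Hgrp n\<^esub> c \<otimes>\<^bsub>Hgrp n\<^esub> inv\<^bsub>Hgrp n\<^esub> h | c. c : C}"
 by (auto simp: cj_def l_coset_def r_coset_def)

lemma cj_CH0: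
 assumes C: "C : CH0 n" and h: "h : H0 n"
 shows "cj n h C = C"
proof (intro equalityI subsetI)
 fix x assume "x : cj n h C"
 thus "x : C" using CH0_conj_mem[OF C h] unfolding cj_eq by blast
next
 fix x assume x: "x : C"
 have c: "h : carrier (Hgrp n)" "x : carrier (Hgrp n)" using H0_carrier[OF h] CH0_carrier[OF C x] .
 have "h \<otimes>\<^bsub>Hgrp n\<^esub> (inv\<^bsub>Hgrp n\<^esub> h \<otimes>\<^bsub>Hgrp n\<^esub> x \<otimes>\<^bsub>Hgrp n\<^esub> h) \<otimes>\<^bsub>Hgrp n\<^esub> inv\<^bsub>Hgrp n\<^esub> h = x"
  using c by (simp add: HG.m_assoc) (simp add: HG.m_assoc[symmetric])
 from this[symmetric] show "x : cj n h C" using CH0_conj_mem'[OF C h x] unfolding cj_eq by blast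
qed

section \<open>The subgroups \<open>Q0 E\<close> and their cosets\<close>

abbreviation QE :: "nat => 'k::field HH set => 'k HH set" where
 "QE n E \<equiv> Q0 n <#>\<^bsub>Hgrp n\<^esub> E"

lemma QE_Cdbl: "1 <= i ==> 1 <= j ==> QE n (Cdbl n i j) = Pij n i j \<times> Pij n i j"
 unfolding set_mult_def Q0_eq Cdbl_def Pij_eq Hgrp_mult by fastforce

lemma QE_mem: "x : QE n E \<longleftrightarrow> (EX q:Q0 n. EX e:E. x = q \<otimes>\<^bsub>Hgrp n\<^esub> e)"
 by (auto simp: set_mult_def)

lemma Q0_H0: "q : Q0 n ==> q : H0 n"
 by (simp add: Q0_def)

lemma Q0_carrier: "q : Q0 n ==> q : carrier (Hgrp n)"
 using Q0_H0 H0_carrier by blast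

lemma QE_subset_H0: assumes "E : CH0 n" shows "QE n E <= H0 n"
proof
 fix x assume "x : QE n E"
 then obtain q e where "q : Q0 n" "e : E" "x = q \<otimes>\<^bsub>Hgrp n\<^esub> e" by (auto simp: QE_mem)
 thus "x : H0 n"
  using CH0_subset_H0[OF assms] Q0_H0 subgroup.m_closed[OF H0_subgroup] by blast
qed

text \<open>A subgroup because \<open>H0 n\<close> normalises each level.\<close>

lemma QE_subgroup:
 assumes E: "E : CH0 n"
 shows "subgroup (QE n E) (Hgrp n)"
proof (rule HG.subgroupI)
 show "QE n E <= carrier (Hgrp n)" using QE_subset_H0[OF E] H0_carrier by blast
 show "QE n E ~= {}"
  using subgroup.one_closed[OF Q0_subgroup] subgroup.one_closed[OF CH0_subgroup[OF E]]
  unfolding set_mult_def by blast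
 fix x assume "x : QE n E"
 then obtain q e where x: "q : Q0 n" "e : E" "x = q \<otimes>\<^bsub>Hgrp n\<^esub> e" by (auto simp: QE_mem)
 have c: "q : carrier (Hgrp n)" "e : carrier (Hgrp n)" using Q0_carrier[OF x(1)] CH0_carrier[OF E x(2)] .
 have qi: "inv\<^bsub>Hgrp n\<^esub> q : Q0 n" using subgroup.m_inv_closed[OF Q0_subgroup x(1)] .
 have ei: "inv\<^bsub>Hgrp n\<^esub> e : E" using subgroup.m_inv_closed[OF CH0_subgroup[OF E] x(2)] .
 have "inv\<^bsub>Hgrp n\<^esub> x = inv\<^bsub>Hgrp n\<^esub> q \<otimes>\<^bsub>Hgrp n\<^esub> (q \<otimes>\<^bsub>Hgrp n\<^esub> inv\<^bsub>Hgrp n\<^esub> e \<otimes>\<^bsub>Hgrp n\<^esub> inv\<^bsub>Hgrp n\<^esub> q)"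
  unfolding x(3) using c by (simp add: HG.inv_mult_group HG.m_assoc[symmetric])
 thus "inv\<^bsub>Hgrp n\<^esub> x : QE n E"
  using qi CH0_conj_mem[OF E Q0_H0[OF x(1)] ei] unfolding QE_mem by blast
 fix y assume "y : QE n E"
 then obtain q' e' where y: "q' : Q0 n" "e' : E" "y = q' \<otimes>\<^bsub>Hgrp n\<^esub> e'" by (auto simp: QE_mem)
 have c': "q' : carrier (Hgrp n)" "e' : carrier (Hgrp n)" using Q0_carrier[OF y(1)] CH0_carrier[OF E y(2)] .
 have "x \<otimes>\<^bsub>Hgrp n\<^esub> y = (q \<otimes>\<^bsub>Hgrp n\<^esub> q') \<otimes>\<^bsub>Hgrp n\<^esub>
   ((inv\<^bsub>Hgrp n\<^esub> q' \<otimes>\<^bsub>Hgrp n\<^esub> e \<otimes>\<^bsub>Hgrp n\<^esub> q') \<otimes>\<^bsub>Hgrp n\<^esub> e')"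
 proof -
  have "q' \<otimes>\<^bsub>Hgrp n\<^esub> (inv\<^bsub>Hgrp n\<^esub> q' \<otimes>\<^bsub>Hgrp n\<^esub> z) = z" if "z : carrier (Hgrp n)" for z
   using that c' by (simp add: HG.m_assoc[symmetric])
  thus ?thesis unfolding x(3) y(3) using c c' by (simp add: HG.m_assoc)
 qed
 moreover have "q \<otimes>\<^bsub>Hgrp n\<^esub> q' : Q0 n" using subgroup.m_closed[OF Q0_subgroup x(1) y(1)] .
 moreover have "(inv\<^bsub>Hgrp n\<^esub> q' \<otimes>\<^bsub>Hgrp n\<^esub> e \<otimes>\<^bsub>Hgrp n\<^esub> q') \<otimes>\<^bsub>Hgrp n\<^esub> e' : E"
  using subgroup.m_closed[OF CH0_subgroup[OF E] CH0_conj_mem'[OF E Q0_H0[OF y(1)] x(2)] y(2)] .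
 ultimately show "x \<otimes>\<^bsub>Hgrp n\<^esub> y : QE n E" unfolding QE_mem by blast
qed

lemma QE_mono: "E <= E' ==> QE n E <= QE n E'"
 by (auto simp: set_mult_def)

lemma E_subset_QE: assumes "E : CH0 n" shows "E <= QE n E"
proof
 fix e assume e: "e : E"
 hence "e = \<one>\<^bsub>Hgrp n\<^esub> \<otimes>\<^bsub>Hgrp n\<^esub> e" using CH0_carrier[OF assms] by simp
 thus "e : QE n E" using e subgroup.one_closed[OF Q0_subgroup] unfolding QE_mem by blast
qed

text \<open>The sets whose indicator functions span the cylindrical functions, for the levels in \<open>\<E>\<close>.\<close>

definition cyl_sets :: "nat => 'k::field HH set set => 'k HH set set" where
 "cyl_sets n \<E> = insert (H0 n) {QE n E #>\<^bsub>Hgrp n\<^esub> g | E g. E : \<E> & g : H0 n}"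

lemma coset_mem: "x : P #>\<^bsub>Hgrp n\<^esub> g \<longleftrightarrow> (EX p:P. x = p \<otimes>\<^bsub>Hgrp n\<^esub> g)"
 by (auto simp: r_coset_def)

lemma QE_coset_subset_H0:
 assumes "E : CH0 n" "g : H0 n"
 shows "QE n E #>\<^bsub>Hgrp n\<^esub> g <= H0 n"
 using QE_subset_H0[OF assms(1)] subgroup.m_closed[OF H0_subgroup _ assms(2)]
 unfolding r_coset_def by blast

lemma QE_coset_repr:
 assumes "E : CH0 n" "g : H0 n" "x : QE n E #>\<^bsub>Hgrp n\<^esub> g"
 shows "QE n E #>\<^bsub>Hgrp n\<^esub> g = QE n E #>\<^bsub>Hgrp n\<^esub> x"
 by (rule HG.repr_independence[OF assms(3) H0_carrier[OF assms(2)] QE_subgroup[OF assms(1)]])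

lemma coset_mono: "P <= P' ==> P #>\<^bsub>Hgrp n\<^esub> g <= P' #>\<^bsub>Hgrp n\<^esub> g"
 by (auto simp: r_coset_def)

lemma QE_coset_laminar:
 assumes "E : CH0 n" "E' : CH0 n" "E <= E'" "g : H0 n" "g' : H0 n"
  "(QE n E #>\<^bsub>Hgrp n\<^esub> g) Int (QE n E' #>\<^bsub>Hgrp n\<^esub> g') ~= {}"
 shows "QE n E #>\<^bsub>Hgrp n\<^esub> g <= QE n E' #>\<^bsub>Hgrp n\<^esub> g'"
proof -
 obtain x where x: "x : QE n E #>\<^bsub>Hgrp n\<^esub> g" "x : QE n E' #>\<^bsub>Hgrp n\<^esub> g'" using assms(6) by blast
 show ?thesis
  unfolding QE_coset_repr[OF assms(1,4) x(1)] QE_coset_repr[OF assms(2,5) x(2)]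
  by (intro coset_mono QE_mono assms(3))
qed

lemma cyl_sets_laminar:
 assumes \<E>: "\<E> <= CH0 n" and A: "A : cyl_sets n \<E>" and B: "B : cyl_sets n \<E>"
 shows "A <= B | B <= A | A Int B = {}"
proof -
 have sub: "A <= H0 n" if "A : cyl_sets n \<E>" for A
  using that QE_coset_subset_H0 \<E> unfolding cyl_sets_def by blast
 show ?thesis
 proof (cases "A = H0 n | B = H0 n")
  case True
  thus ?thesis using sub[OF A] sub[OF B] by blast
 next
  case False
  then obtain E g E' g' where *: "A = QE n E #>\<^bsub>Hgrp n\<^esub> g" "E : CH0 n" "g : H0 n"
    "B = QE n E' #>\<^bsub>Hgrp n\<^esub> g'" "E' : CH0 n" "g' : H0 n"
   using A B \<E> unfolding cyl_sets_def by blast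
  thus ?thesis
   using CH0_total[OF *(2,5)] QE_coset_laminar[OF *(2,5) _ *(3,6)] QE_coset_laminar[OF *(5,2) _ *(6,3)]
   by blast
 qed
qed

lemma cyl_sets_subset_H0: "\<E> <= CH0 n ==> A : cyl_sets n \<E> ==> A <= H0 n"
 using QE_coset_subset_H0 unfolding cyl_sets_def by blast

text \<open>Cosets for two levels with the same \<open>t\<close>-exponent: the index is finite.\<close>

lemma Kij_coset_finite:
 assumes ij: "1 <= i" "1 <= j" "i <= i'"
 shows "\<exists>f :: 'k::{field,finite} F mat => (nat \<times> nat \<times> nat => 'k). finite (f ` Kij n i j) \<and>
  (ALL k:Kij n i j. ALL l:Kij n i j. f k = f l --> k * inv\<^bsub>GLF n\<^esub> l : Kij n i' j)"
proof -
 define f where "f k = (\<lambda>(a, b, d)\<in>{..<n} \<times> {..<n} \<times> {..<i'}. fls_nth (fls_nth (k $$ (a, b)) (int j)) (int d))"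
  for k :: "'k F mat"
 have "f ` Kij n i j <= ({..<n} \<times> {..<n} \<times> {..<i'}) \<rightarrow>\<^sub>E UNIV"
  unfolding f_def by (intro image_subsetI) (simp add: restrict_PiE_iff)
 moreover have "finite (({..<n} \<times> {..<n} \<times> {..<i'}) \<rightarrow>\<^sub>E (UNIV :: 'k set))" by (intro finite_PiE) auto
 ultimately have fin: "finite (f ` Kij n i j)" by (rule finite_subset)
 have "k * inv\<^bsub>GLF n\<^esub> l : Kij n i' j" if k: "k : Kij n i j" and l: "l : Kij n i j" and e: "f k = f l" for k l
 proof -
  define h where "h = inv\<^bsub>GLF n\<^esub> l"
  have lK: "l : K0 n" using l Kij_subset_K0[OF ij(1,2)] by blast
  hence lG: "l : carrier (GLF n)" by (simp add: K0_def)
  have h: "h : K0 n" using subgroup.m_inv_closed[OF K0_subgroup lK] by (simp add: h_def)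
  have lh: "l * h = 1\<^sub>m n" using GL.r_inv[OF lG] by (simp add: h_def)
  have cm: "k : MN n" "l : MN n" "h : MN n"
   using k l h by (auto simp: Kij_iff K0_iff dest: matS_carrier)
  have "k - l : matS n (Jid i' j)"
   unfolding matS_def
  proof (intro CollectI conjI allI impI)
   show "k - l : MN n" using cm by auto
   fix a b assume ab: "a < n" "b < n"
   define x where "x = k $$ (a, b) - l $$ (a, b)"
   have "k $$ (a, b) - (1\<^sub>m n) $$ (a, b) : Jid i j" "l $$ (a, b) - (1\<^sub>m n) $$ (a, b) : Jid i j"
    using k l ab cm unfolding Kij_iff matS_def by auto
   hence "k $$ (a, b) - (1\<^sub>m n) $$ (a, b) - (l $$ (a, b) - (1\<^sub>m n) $$ (a, b)) : Jid i j"
    by (rule Jid_diff)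
   hence xJ: "x : Jid i j" by (simp add: x_def)
   have xz: "fls_nth (fls_nth x (int j)) (int d) = 0" if "d < i'" for d
    using fun_cong[OF e, of "(a, b, d)"] ab that by (simp add: f_def x_def)
   have "x : Jid i' j"
   proof (cases "x ~= 0 & sdeg x = int j")
    case True
    hence v: "vu x >= int i" using xJ by (auto simp: Jid_iff_val)
    have lx: "lc x = fls_nth x (int j)" using True by (simp add: lc_def)
    have "int i' <= vu x"
    proof (rule ccontr)
     assume "~ int i' <= vu x"
     hence "nat (vu x) < i'" "int (nat (vu x)) = vu x" using v by linarith+
     hence "fls_nth (lc x) (vu x) = 0" using xz[of "nat (vu x)"] lx by simp
     hence "lc x = 0" unfolding vu_def by (simp add: nth_fls_subdegree_zero_iff)
     thus False using True by simp
    qed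
    thus ?thesis using True by (simp add: Jid_iff_val)
   qed (use xJ in \<open>auto simp: Jid_iff_val\<close>)
   thus "(k - l) $$ (a, b) : Jid i' j" using ab cm by (simp add: x_def)
  qed
  hence "(k - l) * h : matS n (Jid i' j)" using h by (intro matS_mult_J2) (simp_all add: K0_iff)
  moreover have "(k - l) * h = k * h - 1\<^sub>m n"
   using cm by (subst minus_mult_distrib_mat[of _ n n _ _ n]) (auto simp: lh)
  ultimately show ?thesis using cm by (simp add: Kij_iff flip: h_def)
 qed
 thus ?thesis using fin by blast
qed

lemma QE_cosets_finite:
 assumes ij: "1 <= i" "1 <= j" "i <= i'" and g: "g : H0 n"
 defines "P' \<equiv> QE n (Cdbl n i' j :: 'k::{field,finite} HH set)"
 defines "A \<equiv> QE n (Cdbl n i j :: 'k HH set) #>\<^bsub>Hgrp n\<^esub> g"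
 shows "finite {P' #>\<^bsub>Hgrp n\<^esub> x | x. x : A}" "A = \<Union>{P' #>\<^bsub>Hgrp n\<^esub> x | x. x : A}"
proof -
 have i': "1 <= i'" using ij by simp
 have E: "Cdbl n i j : CH0 n" "Cdbl n i' j : CH0 n" unfolding CH0_eq using ij i' by blast+
 have sub: "Cdbl n i' j <= Cdbl n i j" using ij by (intro Cdbl_mono) simp
 have gc: "g : carrier (Hgrp n)" by (rule H0_carrier[OF g])
 have P'sg: "subgroup P' (Hgrp n)" unfolding P'_def by (rule QE_subgroup[OF E(2)])
 obtain f :: "'k F mat => (nat \<times> nat \<times> nat => 'k)" where f: "finite (f ` Kij n i j)"
  "!!k l. k : Kij n i j ==> l : Kij n i j ==> f k = f l ==> k * inv\<^bsub>GLF n\<^esub> l : Kij n i' j"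
  using Kij_coset_finite[OF ij, where 'k = 'k and n = n] by blast
 define F where "F k = (f (fst k), f (snd k))" for k
 have "F ` Cdbl n i j <= f ` Kij n i j \<times> f ` Kij n i j" by (auto simp: F_def Cdbl_def)
 hence finF: "finite (F ` Cdbl n i j)" using f(1) finite_subset by blast
 have same: "P' #>\<^bsub>Hgrp n\<^esub> k = P' #>\<^bsub>Hgrp n\<^esub> l" if k: "k : Cdbl n i j" and l: "l : Cdbl n i j" and e: "F k = F l" for k l
 proof -
  have c: "k : carrier (Hgrp n)" "l : carrier (Hgrp n)" using CH0_carrier[OF E(1)] k l by blast+
  have "k \<otimes>\<^bsub>Hgrp n\<^esub> inv\<^bsub>Hgrp n\<^esub> l : Cdbl n i' j"
   unfolding Hgrp_inv[OF c(2)] Hgrp_mult Cdbl_def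
   using k l e f(2) by (auto simp: F_def Cdbl_def)
  hence m: "k \<otimes>\<^bsub>Hgrp n\<^esub> inv\<^bsub>Hgrp n\<^esub> l : P'" using E_subset_QE[OF E(2)] unfolding P'_def by blast
  have "k = k \<otimes>\<^bsub>Hgrp n\<^esub> inv\<^bsub>Hgrp n\<^esub> l \<otimes>\<^bsub>Hgrp n\<^esub> l" using c by (simp add: HG.m_assoc)
  hence "k : P' #>\<^bsub>Hgrp n\<^esub> l" using m unfolding coset_mem by blast
  thus ?thesis using HG.repr_independence[OF _ c(2) P'sg] by simp
 qed
 define R where "R \<kappa> = P' #>\<^bsub>Hgrp n\<^esub> ((SOME k. k : Cdbl n i j & F k = \<kappa>) \<otimes>\<^bsub>Hgrp n\<^esub> g)" for \<kappa>
 have "{P' #>\<^bsub>Hgrp n\<^esub> x | x. x : A} <= R ` F ` Cdbl n i j"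
 proof
  fix Z assume "Z : {P' #>\<^bsub>Hgrp n\<^esub> x | x. x : A}"
  then obtain x where x: "Z = P' #>\<^bsub>Hgrp n\<^esub> x" "x : A" by blast
  then obtain p where p: "p : QE n (Cdbl n i j)" "x = p \<otimes>\<^bsub>Hgrp n\<^esub> g"
   unfolding A_def coset_mem by blast
  from p(1) obtain q k where "q : Q0 n" "k : Cdbl n i j" "p = q \<otimes>\<^bsub>Hgrp n\<^esub> k"
   unfolding QE_mem by blast
  hence qk: "q : Q0 n" "k : Cdbl n i j" "x = q \<otimes>\<^bsub>Hgrp n\<^esub> k \<otimes>\<^bsub>Hgrp n\<^esub> g"
   using p(2) by simp_all
  have c: "q : carrier (Hgrp n)" "k : carrier (Hgrp n)"
   using Q0_carrier[OF qk(1)] CH0_carrier[OF E(1) qk(2)] .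
  define l where "l = (SOME l. l : Cdbl n i j & F l = F k)"
  have l: "l : Cdbl n i j & F l = F k" unfolding l_def by (rule someI[of _ k]) (use qk(2) in simp)
  hence lc: "l : carrier (Hgrp n)" using CH0_carrier[OF E(1)] by blast
  have "q \<otimes>\<^bsub>Hgrp n\<^esub> \<one>\<^bsub>Hgrp n\<^esub> : P'"
   using qk(1) subgroup.one_closed[OF CH0_subgroup[OF E(2)]] unfolding P'_def QE_mem by blast
  hence qP: "q : P'" using c by simp
  have P'c: "P' <= carrier (Hgrp n)" using subgroup.subset[OF P'sg] .
  have "Z = ((P' #>\<^bsub>Hgrp n\<^esub> q) #>\<^bsub>Hgrp n\<^esub> k) #>\<^bsub>Hgrp n\<^esub> g"
   unfolding x(1) qk(3) using c gc P'c by (simp add: HG.coset_mult_assoc)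
  also have "... = (P' #>\<^bsub>Hgrp n\<^esub> k) #>\<^bsub>Hgrp n\<^esub> g" by (simp add: HG.coset_join2[OF c(1) P'sg qP])
  also have "... = (P' #>\<^bsub>Hgrp n\<^esub> l) #>\<^bsub>Hgrp n\<^esub> g" using same[of k l] l qk(2) by simp
  also have "... = P' #>\<^bsub>Hgrp n\<^esub> (l \<otimes>\<^bsub>Hgrp n\<^esub> g)" using lc gc P'c by (simp add: HG.coset_mult_assoc)
  also have "... = R (F k)" by (simp add: R_def l_def)
  finally show "Z : R ` F ` Cdbl n i j" using qk(2) by blast
 qed
 thus "finite {P' #>\<^bsub>Hgrp n\<^esub> x | x. x : A}" using finF finite_subset by blast
 show "A = \<Union>{P' #>\<^bsub>Hgrp n\<^esub> x | x. x : A}"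
 proof (intro equalityI subsetI)
  fix x assume x: "x : A"
  have "x : carrier (Hgrp n)"
   using x QE_coset_subset_H0[OF E(1) g] H0_carrier unfolding A_def by blast
  hence "x : P' #>\<^bsub>Hgrp n\<^esub> x" using HG.rcos_self[OF _ P'sg] by blast
  thus "x : \<Union>{P' #>\<^bsub>Hgrp n\<^esub> x | x. x : A}" using x by blast
 next
  fix y assume "y : \<Union>{P' #>\<^bsub>Hgrp n\<^esub> x | x. x : A}"
  then obtain x where x: "x : A" "y : P' #>\<^bsub>Hgrp n\<^esub> x" by blast
  have "A = QE n (Cdbl n i j) #>\<^bsub>Hgrp n\<^esub> x" using QE_coset_repr[OF E(1) g] x(1) unfolding A_def by blast
  thus "y : A" using x(2) coset_mono[OF QE_mono[OF sub]] unfolding P'_def by blast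
 qed
qed

section \<open>Counting invertible matrices over a finite field\<close>

definition GLk :: "nat => 'k::field mat set" where
 "GLk n = {A : MN n. ddet A ~= 0}"

lemma card_mat: "card (carrier_mat m n :: 'k::finite mat set) = CARD('k) ^ (m * n)"
 and finite_mat: "finite (carrier_mat m n :: 'k::finite mat set)"
proof -
 let ?S = "({..<m} \<times> {..<n}) \<rightarrow>\<^sub>E (UNIV :: 'k set)"
 have bij: "bij_betw (%f. mat m n f) ?S (carrier_mat m n)"
 proof (rule bij_betwI[where g = "%A. \<lambda>p\<in>{..<m} \<times> {..<n}. A $$ p"])
  fix f assume f: "f : ?S"
  show "(\<lambda>p\<in>{..<m} \<times> {..<n}. mat m n f $$ p) = f"
  proof
   fix p show "(\<lambda>p\<in>{..<m} \<times> {..<n}. mat m n f $$ p) p = f p"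
    using f by (cases p) (auto simp: PiE_def extensional_def)
  qed
 next
  fix A :: "'k mat" assume "A : carrier_mat m n"
  thus "mat m n (\<lambda>p\<in>{..<m} \<times> {..<n}. A $$ p) = A" by (intro eq_matI) auto
 qed auto
 show "finite (carrier_mat m n :: 'k mat set)"
  using bij_betw_finite[OF bij] finite_PiE[of "{..<m} \<times> {..<n}" "%_. UNIV :: 'k set"] by simp
 show "card (carrier_mat m n :: 'k mat set) = CARD('k) ^ (m * n)"
  using bij_betw_same_card[OF bij] by (simp add: card_PiE)
qed

lemma finite_GLk: "finite (GLk n :: 'k::{field,finite} mat set)"
 by (rule finite_subset[OF _ finite_mat[of n n]]) (auto simp: GLk_def)

lemma GLk_col_exists:
 fixes v :: "nat => 'k::field"
 assumes i: "i <= n" "v i ~= 0"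
 shows "EX g:GLk (Suc n). \<forall>a<Suc n. g $$ (a, 0) = v a"
proof -
 define w where "w a = v (Transposition.transpose 0 i a)" for a
 define T where "T = mat (Suc n) (Suc n) (%(a, b). if b = 0 then w a else if a = b then 1 else (0 :: 'k))"
 have T: "T : carrier_mat (Suc n) (Suc n)" by (simp add: T_def)
 have "ddet T = prod_list (diag_mat T)"
  by (rule det_lower_triangular[of "Suc n"]) (auto simp: T_def)
 also have "... ~= 0" using i by (auto simp: prod_list_zero_iff diag_mat_def T_def w_def)
 finally have dT: "ddet T ~= 0" .
 show ?thesis
 proof (cases "i = 0")
  case True
  thus ?thesis using T dT by (intro bexI[of _ T]) (auto simp: GLk_def T_def w_def)
 next
  case False
  define S where "S = swaprows_mat (Suc n) 0 i *  T"
  have sc: "swaprows_mat (Suc n) 0 i : carrier_mat (Suc n) (Suc n)" by simp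
  have S: "S : carrier_mat (Suc n) (Suc n)" unfolding S_def using sc T by (rule mult_carrier_mat)
  have "ddet S = - ddet T"
   unfolding S_def det_mult[OF sc T] using False i by (subst det_swaprows_mat) auto
  hence "S : GLk (Suc n)" using S dT by (simp add: GLk_def)
  moreover have "S $$ (a, 0) = v a" if a: "a < Suc n" for a
  proof -
   have "S = swaprows 0 i T" unfolding S_def using T i by (intro swaprows_mat[symmetric]) auto
   hence "S $$ (a, 0) = w (if 0 = a then i else if i = a then 0 else a)"
    using a i by (simp add: T_def mat_swaprows_def)
   thus ?thesis by (auto simp: w_def Transposition.transpose_def)
  qed
  ultimately show ?thesis by blast
 qed
qed

lemma det_col_unit:
 fixes A :: "'k::field mat"
 assumes A: "A : carrier_mat (Suc n) (Suc n)" and col: "!!a. a < Suc n ==> A $$ (a, 0) = (if a = 0 then 1 else 0)"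
 shows "ddet A = ddet (mat n n (%(a, b). A $$ (Suc a, Suc b)))"
proof -
 have "ddet A = (\<Sum>a<Suc n. A $$ (a, 0) * cofactor A a 0)"
  by (rule laplace_expansion_column[OF A]) simp
 also have "... = (\<Sum>a<Suc n. if a = 0 then cofactor A 0 0 else 0)"
  by (intro sum.cong refl) (simp add: col)
 also have "... = cofactor A 0 0" by (subst sum.delta) auto
 also have "mat_delete A 0 0 = mat n n (%(a, b). A $$ (Suc a, Suc b))"
  unfolding mat_delete_def using A by (intro eq_matI) auto
 hence "cofactor A 0 0 = ddet (mat n n (%(a, b). A $$ (Suc a, Suc b)))"
  by (simp add: cofactor_def)
 finally show ?thesis .
qed

lemma card_GLk_unit_col:
 "card {A : GLk (Suc n) :: 'k::{field,finite} mat set. \<forall>a<Suc n. A $$ (a, 0) = (if a = 0 then 1 else 0)}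
  = CARD('k) ^ n * card (GLk n :: 'k mat set)"
proof -
 let ?T = "{A : GLk (Suc n) :: 'k mat set. \<forall>a<Suc n. A $$ (a, 0) = (if a = 0 then 1 else 0)}"
 let ?f = "%(w, A). mat (Suc n) (Suc n) (%(a, b).
   if b = 0 then (if a = 0 then 1 else 0) else if a = 0 then w $$ (0, b - 1) else A $$ (a - 1, b - 1)) :: 'k mat"
 let ?g = "%A. (mat 1 n (%(_, b). A $$ (0, Suc b)), mat n n (%(a, b). A $$ (Suc a, Suc b)))"
 have "bij_betw ?f (carrier_mat 1 n \<times> GLk n) ?T"
 proof (rule bij_betwI[where g = ?g])
  show "?f : carrier_mat 1 n \<times> GLk n \<rightarrow> ?T"
  proof (rule funcsetI)
   fix p :: "'k mat \<times> 'k mat" assume p: "p : carrier_mat 1 n \<times> GLk n"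
   obtain w A where wA: "p = (w, A)" by (cases p)
   have A: "A : MN n" "ddet A ~= 0" using p by (auto simp: wA GLk_def)
   have "mat n n (%(a, b). ?f p $$ (Suc a, Suc b)) = A" using A by (intro eq_matI) (auto simp: wA)
   hence "ddet (?f p) = ddet A"
    using det_col_unit[of "?f p" n] by (simp add: wA)
   thus "?f p : ?T" using A by (auto simp: wA GLk_def)
  qed
  show "?g : ?T \<rightarrow> carrier_mat 1 n \<times> GLk n"
  proof (rule funcsetI)
   fix A :: "'k mat" assume A: "A : ?T"
   hence "ddet A = ddet (mat n n (%(a, b). A $$ (Suc a, Suc b)))"
    by (intro det_col_unit) (auto simp: GLk_def)
   thus "?g A : carrier_mat 1 n \<times> GLk n" using A by (auto simp: GLk_def)
  qed
  show "?g (?f p) = p" if p: "p : carrier_mat 1 n \<times> GLk n" for p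
  proof -
   obtain w A where wA: "p = (w, A)" by (cases p)
   have "w : carrier_mat 1 n" "A : MN n" using p by (auto simp: wA GLk_def)
   thus ?thesis unfolding wA by (auto intro!: eq_matI)
  qed
  show "?f (?g A) = A" if A: "A : ?T" for A
  proof -
   have "A : carrier_mat (Suc n) (Suc n)" using A by (auto simp: GLk_def)
   thus ?thesis using A by (intro eq_matI) (auto simp: gr0_conv_Suc)
  qed
 qed
 from bij_betw_same_card[OF this] show ?thesis
  by (simp add: card_cartesian_product card_mat)
qed

text \<open>Left multiplication moves any nonzero first column to the first unit vector, so all nonzero columns occur equally often.\<close>

lemma card_GLk_Suc:
 "card (GLk (Suc n) :: 'k::{field,finite} mat set) = (CARD('k) ^ Suc n - 1) * (CARD('k) ^ n * card (GLk n :: 'k mat set))"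
proof -
 let ?G = "GLk (Suc n) :: 'k mat set"
 let ?T = "{A : ?G. \<forall>a<Suc n. A $$ (a, 0) = (if a = 0 then 1 else 0)}"
 define col where "col A = (\<lambda>a\<in>{..<Suc n}. A $$ (a, 0 :: nat))" for A :: "'k mat"
 let ?V = "({..<Suc n} \<rightarrow>\<^sub>E (UNIV :: 'k set)) - {\<lambda>a\<in>{..<Suc n}. 0}"
 have finV: "finite ?V" by (simp add: finite_PiE)
 have cV: "card ?V = CARD('k) ^ Suc n - 1"
  by (subst card_Diff_singleton) (auto simp: card_PiE)
 have colV: "col ` ?G <= ?V"
 proof
  fix v assume "v : col ` ?G"
  then obtain A where A: "A : ?G" "v = col A" by blast
  have "v ~= (\<lambda>a\<in>{..<Suc n}. 0)"
  proof
   assume v: "v = (\<lambda>a\<in>{..<Suc n}. 0)"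
   have "A $$ (a, 0) = 0" if "a < Suc n" for a
    using fun_cong[OF v[unfolded A(2)], of a] that by (simp add: col_def)
   hence "ddet A = 0"
    using laplace_expansion_column[of A "Suc n" 0] A(1) by (simp add: GLk_def)
   thus False using A(1) by (simp add: GLk_def)
  qed
  thus "v : ?V" by (auto simp: A(2) col_def)
 qed
 have fiber: "card {A : ?G. col A = v} = card ?T" if v: "v : ?V" for v
 proof -
  have "\<exists>i<Suc n. v i ~= 0"
  proof (rule ccontr)
   assume "~ ?thesis"
   hence "v = (\<lambda>a\<in>{..<Suc n}. 0)" using v by (intro extensionalityI[of _ "{..<Suc n}"]) (auto simp: PiE_def)
   thus False using v by blast
  qed
  then obtain i where i: "i <= n" "v i ~= 0" by (auto simp: less_Suc_eq_le)
  obtain g where g: "g : ?G" "!!a. a < Suc n ==> g $$ (a, 0) = v a"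
   using GLk_col_exists[of i n v, OF i] by blast
  have gc: "g : carrier_mat (Suc n) (Suc n)" "ddet g ~= 0" using g(1) by (auto simp: GLk_def)
  obtain h where h: "h : carrier_mat (Suc n) (Suc n)" "h * g = 1\<^sub>m (Suc n)" "g * h = 1\<^sub>m (Suc n)"
   using det_non_zero_imp_unit[OF gc] by (auto simp: Units_def ring_mat_def)
  have "ddet h * ddet g = 1" using det_mult[OF h(1) gc(1)] h(2) by simp
  hence dh: "ddet h ~= 0" by auto
  have mcol: "(M * A) $$ (a, 0) = (\<Sum>c<Suc n. M $$ (a, c) * A $$ (c, 0))"
   if "M : carrier_mat (Suc n) (Suc n)" "A : carrier_mat (Suc n) (Suc n)" "a < Suc n" for M A :: "'k mat" and a
   using that by (intro index_mult_sum) auto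
  have "bij_betw (%A. g * A) ?T {A : ?G. col A = v}"
  proof (rule bij_betwI[where g = "%A. h * A"])
   show "(%A. g * A) : ?T \<rightarrow> {A : ?G. col A = v}"
   proof (rule funcsetI)
    fix A assume A: "A : ?T"
    hence Ac: "A : carrier_mat (Suc n) (Suc n)" "ddet A ~= 0" by (auto simp: GLk_def)
    have "(g * A) $$ (a, 0) = v a" if a: "a < Suc n" for a
    proof -
     have "(g * A) $$ (a, 0) = (\<Sum>c<Suc n. if c = 0 then g $$ (a, 0) else 0)"
      unfolding mcol[OF gc(1) Ac(1) a] using A by (intro sum.cong refl) auto
     also have "... = g $$ (a, 0)" by (subst sum.delta) auto
     finally show ?thesis using g(2)[OF a] by simp
    qed
    hence "col (g * A) = v"
     using v by (intro extensionalityI[of _ "{..<Suc n}"]) (auto simp: col_def PiE_def)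
    thus "g * A : {A : ?G. col A = v}"
     using gc Ac det_mult[OF gc(1) Ac(1)] by (simp add: GLk_def)
   qed
   show "(%A. h * A) : {A : ?G. col A = v} \<rightarrow> ?T"
   proof (rule funcsetI)
    fix A assume A: "A : {A : ?G. col A = v}"
    hence Ac: "A : carrier_mat (Suc n) (Suc n)" "ddet A ~= 0" by (auto simp: GLk_def)
    have Av: "A $$ (c, 0) = g $$ (c, 0)" if c: "c < Suc n" for c
    proof -
     have "col A c = v c" using A by simp
     thus ?thesis using c g(2)[OF c] by (simp add: col_def)
    qed
    have "(h * A) $$ (a, 0) = (if a = 0 then 1 else 0)" if a: "a < Suc n" for a
    proof -
     have "(h * A) $$ (a, 0) = (h * g) $$ (a, 0)"
      unfolding mcol[OF h(1) Ac(1) a] mcol[OF h(1) gc(1) a] using Av by (intro sum.cong refl) simp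
     also have "... = (if a = 0 then 1 else 0)" unfolding h(2) using a by simp
     finally show ?thesis .
    qed
    moreover have "ddet (h * A) ~= 0" using dh Ac det_mult[OF h(1) Ac(1)] by simp
    moreover have "h * A : carrier_mat (Suc n) (Suc n)" using h(1) Ac(1) by (rule mult_carrier_mat)
    ultimately show "h * A : ?T" by (simp add: GLk_def del: index_mult_mat)
   qed
   show "h * (g * A) = A" if "A : ?T" for A
   proof -
    have "A : carrier_mat (Suc n) (Suc n)" using that by (auto simp: GLk_def)
    thus ?thesis using assoc_mult_mat[OF h(1) gc(1), of A] h(2) by simp
   qed
   show "g * (h * A) = A" if "A : {A : ?G. col A = v}" for A
   proof -
    have "A : carrier_mat (Suc n) (Suc n)" using that by (auto simp: GLk_def)
    thus ?thesis using assoc_mult_mat[OF gc(1) h(1), of A] h(3) by simp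
   qed
  qed
  thus ?thesis by (rule bij_betw_same_card[symmetric])
 qed
 have "card ?G = (\<Sum>A\<in>?G. 1)" by simp
 also have "... = (\<Sum>v\<in>?V. \<Sum>A\<in>{A : ?G. col A = v}. 1)"
  by (rule sum.group[OF finite_GLk finV colV, symmetric])
 also have "... = (\<Sum>v\<in>?V. card ?T)" using fiber by (intro sum.cong refl) simp
 also have "... = card ?V * card ?T" by simp
 finally show ?thesis using cV card_GLk_unit_col[of n, where 'k = 'k] by simp
qed

lemma card_GLk_c_const:
 "c_const n CARD('k) * of_nat (card (GLk n :: 'k::{field,finite} mat set)) = of_nat CARD('k) ^ (n * n)"
proof (induction n)
 case 0
 have "(GLk 0 :: 'k mat set) = carrier_mat 0 0" by (auto simp: GLk_def det_dim_zero)
 thus ?case by (simp add: c_const_def card_mat)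
next
 case (Suc n)
 define q where "q = (of_nat CARD('k) :: complex)"
 have q2: "CARD('k) >= 2" by (rule CARD_ge_2)
 hence q0: "q ~= 0" by (simp add: q_def)
 have qn: "q ^ Suc n ~= 1"
 proof -
  have "1 < CARD('k) ^ Suc n" using q2 by (intro one_less_power) auto
  hence "CARD('k) ^ Suc n ~= 1" by (metis less_irrefl)
  thus ?thesis unfolding q_def by (metis of_nat_1 of_nat_eq_iff of_nat_power)
 qed
 have c: "c_const (Suc n) CARD('k) = c_const n CARD('k) * inverse (1 - q powi (- int (Suc n)))"
  by (simp add: c_const_def q_def)
 have "of_nat (CARD('k) ^ Suc n - 1) = q ^ Suc n - 1"
  using q2 by (subst of_nat_diff) (auto simp: q_def)
 hence "c_const (Suc n) CARD('k) * of_nat (card (GLk (Suc n) :: 'k mat set))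
  = inverse (1 - q powi (- int (Suc n))) * (q ^ Suc n - 1) * q ^ n * (c_const n CARD('k) * of_nat (card (GLk n :: 'k mat set)))"
  unfolding card_GLk_Suc c by (simp add: q_def mult_ac)
 also have "... = inverse (1 - q powi (- int (Suc n))) * (q ^ Suc n - 1) * q ^ n * q ^ (n * n)"
  unfolding Suc.IH q_def ..
 finally have e: "c_const (Suc n) CARD('k) * of_nat (card (GLk (Suc n) :: 'k mat set))
   = inverse (1 - q powi (- int (Suc n))) * (q ^ Suc n - 1) * q ^ n * q ^ (n * n)" .
 define Y where "Y = q ^ Suc n"
 have Y: "Y ~= 0" "Y ~= 1" using q0 qn by (simp_all add: Y_def)
 have "1 - q powi (- int (Suc n)) = 1 - inverse Y"
  unfolding Y_def by (simp only: power_int_minus power_int_of_nat)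
 moreover have "inverse (1 - inverse Y) * (Y - 1) = Y"
  using Y by (simp add: field_simps)
 ultimately have "inverse (1 - q powi (- int (Suc n))) * (Y - 1) = Y"
  by (simp only:)
 hence "c_const (Suc n) CARD('k) * of_nat (card (GLk (Suc n) :: 'k mat set)) = q ^ Suc n * q ^ n * q ^ (n * n)"
  unfolding e Y_def by (simp only:)
 also have "... = q ^ (Suc n * Suc n)" unfolding power_add[symmetric] by (rule arg_cong[of _ _ "power q"]) simp
 finally show ?case by (simp add: q_def)
qed

section \<open>Volumes of lattices in the space of matrices\<close>

lemma sum_nth_distinct: "distinct ps ==> (\<Sum>a<length ps. f (ps ! a)) = (\<Sum>p\<in>set ps. f p)"
 by (rule sum.reindex_bij_betw[OF bij_betw_nth]) auto

lemma prod_nth_distinct: "distinct ps ==> (\<Prod>a<length ps. f (ps ! a)) = (\<Prod>p\<in>set ps. f p)"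
 by (rule prod.reindex_bij_betw[OF bij_betw_nth]) auto

lemma det_diag: "ddet (mat N N (%(a, b). if a = b then f a else 0)) = (\<Prod>a<N. f a :: 'a::field)"
 by (subst det_ut[of _ N]) (auto simp: upper_triangular_def)

text \<open>The map \<open>A \<mapsto> A G\<close> with \<open>G\<close> in \<open>GL\<^sub>n\<close> of the valuation ring has unit determinant with respect to
 any order of the coordinates, because its inverse has integral entries as well. So a box
 transported by it has the volume of the box.\<close>

lemma box_volume:
 fixes G :: "'k::{field,finite} F mat" and d :: "nat \<times> nat => 'k F"
 assumes G: "G : K0 n" and d: "!!p. d p ~= 0"
 shows "has_int_M n (%A. if \<forall>r<n. \<forall>c<n. ((A * G) $$ (r, c) + s (r, c)) / d (r, c) : O2 then 1 else 0)
  (\<Prod>p\<in>{..<n} \<times> {..<n}. abs_F (d p))"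
 unfolding has_int_M_def
proof (intro allI impI)
 fix ps :: "(nat \<times> nat) list"
 assume ps: "distinct ps & set ps = {..<n} \<times> {..<n}"
 define N where "N = length ps"
 define g where "g = inv\<^bsub>GLF n\<^esub> G"
 have gK: "g : K0 n" using subgroup.m_inv_closed[OF K0_subgroup G] by (simp add: g_def)
 have GG: "G : carrier (GLF n)" using G by (simp add: K0_def)
 have cm: "G : MN n" "g : MN n" using G gK by (auto simp: K0_iff dest: matS_carrier)
 have Gg: "G * g = 1\<^sub>m n" using GL.r_inv[OF GG] by (simp add: g_def)
 have lt: "fst (ps ! a) < n" "snd (ps ! a) < n" if "a < N" for a
 proof -
  have "ps ! a : {..<n} \<times> {..<n}" using nth_mem[of a ps] that ps by (simp add: N_def)
  thus "fst (ps ! a) < n" "snd (ps ! a) < n" by (auto simp: mem_Times_iff)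
 qed
 have inj: "ps ! a = ps ! b \<longleftrightarrow> a = b" if "a < N" "b < N" for a b
  using that ps by (simp add: N_def nth_eq_iff_index_eq)
 define K where "K M = mat N N (%(a, b). if fst (ps ! a) = fst (ps ! b) then M $$ (snd (ps ! a), snd (ps ! b)) else 0)"
  for M :: "'k F mat"
 have KO: "K M : matS N O2" if "M : K0 n" for M
 proof -
  have "M $$ (x, y) : O2" if "x < n" "y < n" for x y
   using \<open>M : K0 n\<close> that by (simp add: K0_iff matS_def)
  thus ?thesis using lt by (auto simp: matS_def K_def)
 qed
 have split_sum: "(\<Sum>b<N. f (ps ! b)) = (\<Sum>r<n. \<Sum>c<n. f (r, c))" for f :: "nat \<times> nat => 'k F"
  using sum_nth_distinct[of ps f] ps by (simp add: N_def sum.cartesian_product)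
 have "K G * K g = 1\<^sub>m N"
 proof (rule eq_matI)
  fix a c assume "a < dim_row (1\<^sub>m N :: 'k F mat)" "c < dim_col (1\<^sub>m N :: 'k F mat)"
  hence ac: "a < N" "c < N" by auto
  obtain r1 c1 where p1: "ps ! a = (r1, c1)" by (cases "ps ! a")
  obtain r2 c2 where p2: "ps ! c = (r2, c2)" by (cases "ps ! c")
  have l: "r1 < n" "c1 < n" "r2 < n" "c2 < n" using lt[OF ac(1)] lt[OF ac(2)] p1 p2 by auto
  have "(K G * K g) $$ (a, c) = (\<Sum>b<N. K G $$ (a, b) * K g $$ (b, c))"
   using ac by (intro index_mult_sum) (auto simp: K_def)
  also have "... = (\<Sum>b<N. (%p. (if r1 = fst p then G $$ (c1, snd p) else 0) * (if fst p = r2 then g $$ (snd p, c2) else 0)) (ps ! b))"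
   using ac p1 p2 by (intro sum.cong refl) (simp add: K_def)
  also have "... = (\<Sum>r<n. \<Sum>x<n. (if r1 = r then G $$ (c1, x) else 0) * (if r = r2 then g $$ (x, c2) else 0))"
   by (subst split_sum) (simp only: fst_conv snd_conv)
  also have "... = (\<Sum>r<n. if r = r1 then (if r1 = r2 then (\<Sum>x<n. G $$ (c1, x) * g $$ (x, c2)) else 0) else 0)"
   by (intro sum.cong refl) auto
  also have "... = (if r1 = r2 then (\<Sum>x<n. G $$ (c1, x) * g $$ (x, c2)) else 0)"
   using l by (subst sum.delta) auto
  also have "... = (if r1 = r2 then (G * g) $$ (c1, c2) else 0)"
   using index_mult_sum[OF cm l(2,4)] by simp
  also have "... = (if ps ! a = ps ! c then 1 else 0)" unfolding Gg p1 p2 using l by auto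
  finally show "(K G * K g) $$ (a, c) = 1\<^sub>m N $$ (a, c)" using ac inj[OF ac] by auto
 qed (auto simp: K_def)
 moreover have Kc: "K G : carrier_mat N N" "K g : carrier_mat N N" by (simp_all add: K_def)
 ultimately have dd: "ddet (K G) * ddet (K g) = 1"
  using det_mult[OF Kc] by simp
 hence "inverse (ddet (K G)) = ddet (K g)" by (rule inverse_unique)
 hence dG: "ddet (K G) : O2u"
  using dd det_O2[OF KO[OF G]] det_O2[OF KO[OF gK]] by (auto simp: O2u_iff)
 define Dm where "Dm = mat N N (%(a, b). if a = b then inverse (d (ps ! a)) else 0)"
 have Dm: "Dm : carrier_mat N N" by (simp add: Dm_def)
 define W where "W = K G * Dm"
 have W: "W : carrier_mat N N" unfolding W_def using Kc(1) Dm by (rule mult_carrier_mat)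
 have detDm: "ddet Dm = (\<Prod>p\<in>{..<n} \<times> {..<n}. inverse (d p))"
  unfolding Dm_def det_diag using prod_nth_distinct[of ps "%p. inverse (d p)"] ps by (simp add: N_def)
 have detW: "ddet W = ddet (K G) * (\<Prod>p\<in>{..<n} \<times> {..<n}. inverse (d p))"
  unfolding W_def det_mult[OF Kc(1) Dm] detDm ..
 have W0: "ddet W ~= 0"
  unfolding detW using dG d by (auto simp: O2u_def prod_zero_iff)
 have vol: "abs_F (inverse (ddet W)) = (\<Prod>p\<in>{..<n} \<times> {..<n}. abs_F (d p))"
  unfolding detW abs_F_inverse abs_F_mult abs_F_prod abs_F_O2u[OF dG]
  by (simp add: prod_inversef[symmetric] flip: prod_inversef)
 have Wab: "W $$ (a, b) = K G $$ (a, b) / d (ps ! b)" if ab: "a < N" "b < N" for a b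
 proof -
  have "W $$ (a, b) = (\<Sum>c<N. K G $$ (a, c) * Dm $$ (c, b))"
   unfolding W_def by (rule index_mult_sum[OF Kc(1) Dm ab])
  also have "... = (\<Sum>c<N. if c = b then K G $$ (a, b) / d (ps ! b) else 0)"
   using ab by (intro sum.cong refl) (simp add: Dm_def divide_inverse)
  also have "... = K G $$ (a, b) / d (ps ! b)" using ab by (subst sum.delta) auto
  finally show ?thesis .
 qed
 have lin: "(\<Sum>a<N. y (ps ! a) * W $$ (a, b)) = (mat n n y * G) $$ (ps ! b) / d (ps ! b)" if b: "b < N" for y b
 proof -
  obtain r c where p: "ps ! b = (r, c)" by (cases "ps ! b")
  have l: "r < n" "c < n" using lt[OF b] p by auto
  have "(\<Sum>a<N. y (ps ! a) * W $$ (a, b)) = (\<Sum>a<N. (%q. y q * (if fst q = r then G $$ (snd q, c) else 0) / d (r, c)) (ps ! a))"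
   using b p by (intro sum.cong refl) (simp add: Wab K_def)
  also have "... = (\<Sum>r'<n. \<Sum>x<n. y (r', x) * (if r' = r then G $$ (x, c) else 0) / d (r, c))"
   by (subst split_sum) (simp only: fst_conv snd_conv)
  also have "... = (\<Sum>r'<n. if r' = r then (\<Sum>x<n. y (r, x) * G $$ (x, c) / d (r, c)) else 0)"
   by (intro sum.cong refl) auto
  also have "... = (\<Sum>x<n. y (r, x) * G $$ (x, c) / d (r, c))"
   using l by (subst sum.delta) auto
  also have "... = (\<Sum>x<n. y (r, x) * G $$ (x, c)) / d (r, c)" by (rule sum_divide_distrib[symmetric])
  also have "(\<Sum>x<n. y (r, x) * G $$ (x, c)) = (mat n n y * G) $$ (r, c)"
   using index_mult_sum[of "mat n n y" n G r c] cm l by simp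
  finally show ?thesis by (simp add: p)
 qed
 have cond: "(\<forall>b<N. (\<Sum>a<N. y (ps ! a) * W $$ (a, b)) + s (ps ! b) / d (ps ! b) : O2)
   \<longleftrightarrow> (\<forall>r<n. \<forall>c<n. ((mat n n y * G) $$ (r, c) + s (r, c)) / d (r, c) : O2)" for y
 proof -
  define Q where "Q p \<longleftrightarrow> ((mat n n y * G) $$ p + s p) / d p : O2" for p
  have "(\<forall>b<N. (\<Sum>a<N. y (ps ! a) * W $$ (a, b)) + s (ps ! b) / d (ps ! b) : O2) \<longleftrightarrow> (\<forall>b<N. Q (ps ! b))"
   by (simp add: lin Q_def add_divide_distrib)
  also have "... \<longleftrightarrow> (ALL p:set ps. Q p)" unfolding N_def by (simp add: all_set_conv_all_nth)
  also have "... \<longleftrightarrow> (\<forall>r<n. \<forall>c<n. Q (r, c))" using ps by auto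
  finally show ?thesis by (simp add: Q_def)
 qed
 have "has_repeated_int ps (%y. if \<forall>b<N. (\<Sum>a<N. y (ps ! a) * W $$ (a, b)) + s (ps ! b) / d (ps ! b) : O2 then 1 else 0)
   (abs_F (inverse (ddet W)))"
  using ps by (intro lattice_volume[OF _ _ W W0]) (simp_all add: N_def)
 thus "has_repeated_int ps (%y. if \<forall>r<n. \<forall>c<n. ((mat n n y * G) $$ (r, c) + s (r, c)) / d (r, c) : O2 then 1 else 0)
   (\<Prod>p\<in>{..<n} \<times> {..<n}. abs_F (d p))"
  unfolding cond vol .
qed

lemma has_int_M_lin:
 assumes "has_int_M n f v" "has_int_M n g w" "c : CX" "d : CX"
 shows "has_int_M n (%A. c * f A + d * g A) (c * v + d * w)"
 using assms has_repeated_int_lin unfolding has_int_M_def by blast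

lemma has_int_M_sum:
 assumes "!!l. l : I ==> has_int_M n (f l) (v l)"
 shows "has_int_M n (%A. \<Sum>l\<in>I. f l A) (\<Sum>l\<in>I. v l)"
 unfolding has_int_M_def
proof (intro allI impI)
 fix ps :: "(nat \<times> nat) list"
 assume "distinct ps & set ps = {..<n} \<times> {..<n}"
 hence "has_repeated_int ps (%y. f l (mat n n y)) (v l)" if "l : I" for l
  using assms[OF that] unfolding has_int_M_def by blast
 from has_repeated_int_sum[of I ps "%l y. f l (mat n n y)" v "%_. 1", OF this]
 show "has_repeated_int ps (%y. \<Sum>l\<in>I. f l (mat n n y)) (\<Sum>l\<in>I. v l)" by simp
qed

lemma all_split_diag:
 "u < n ==> (\<forall>r<n. \<forall>c<n. X r c) \<longleftrightarrow> (\<forall>r<n. \<forall>c<n. (r, c) ~= (u, u) --> X r c) & X u (u :: nat)"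
 by blast

text \<open>The unit condition on a diagonal entry is the difference of two lattice conditions.\<close>

lemma Pij_volume_M:
 fixes G :: "'k::{field,finite} F mat"
 assumes G: "G : K0 n" and U: "finite U" "U <= {..<n}" and T: "T <= {..<n}" "U Int T = {}"
 defines "w \<equiv> fls_const (inverse (of_nat CARD('k)))"
 shows "has_int_M n (%A. if \<forall>r<n. \<forall>c<n. (A * G) $$ (r, c) \<in>
   (if c < r then Jid i j else if r = c & r : U then O2u else if r = c & r : T then m2 else O2) then 1 else 0)
  (w ^ card T * (1 - w) ^ card U * (\<Prod>p\<in>{..<n} \<times> {..<n}. if snd p < fst p then abs_F (pu i j :: 'k F) else 1))"
 using U T
proof (induction U arbitrary: T rule: finite_induct)
 case empty
 define d :: "nat \<times> nat => 'k F" where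
  "d p = (if snd p < fst p then pu i j else if fst p = snd p & fst p : T then uu else 1)" for p
 have d0: "d p ~= 0" for p by (simp add: d_def)
 have finT: "finite T" using empty.prems(2) finite_subset by blast
 have e: "x : (if c < r then Jid i j else if r = c & r : {} then O2u else if r = c & r : T then m2 else O2)
   \<longleftrightarrow> (x + (%_. 0) (r, c)) / d (r, c) : O2" for x :: "'k F" and r c
  by (auto simp: d_def Jid_iff m2_eq)
 have abs: "abs_F (d p) = (if snd p < fst p then abs_F (pu i j :: 'k F) else 1) * (if fst p = snd p & fst p : T then w else 1)" for p
  by (auto simp: d_def abs_F_O2u abs_F_eq w_def power_int_minus simp del: fls_X_power_int)
 have "(\<Prod>p\<in>{..<n} \<times> {..<n}. if fst p = snd p & fst p : T then w else 1) = (\<Prod>p\<in>(%t. (t, t)) ` T. w)"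
 proof -
  have "{p : {..<n} \<times> {..<n}. fst p = snd p & fst p : T} = (%t. (t, t)) ` T"
   using empty.prems(2) by (auto simp: image_iff)
  thus ?thesis by (subst prod.inter_filter[symmetric]) (simp_all only: finite_cartesian_product finite_lessThan)
 qed
 also have "... = w ^ card T" by (simp add: card_image inj_on_def)
 finally have v: "(\<Prod>p\<in>{..<n} \<times> {..<n}. abs_F (d p)) =
   w ^ card T * (1 - w) ^ card {} * (\<Prod>p\<in>{..<n} \<times> {..<n}. if snd p < fst p then abs_F (pu i j :: 'k F) else 1)"
  unfolding abs prod.distrib by simp
 show ?case
  unfolding e v[symmetric] by (rule box_volume[OF G d0])
next
 case (insert u U)
 let ?V = "\<Prod>p\<in>{..<n} \<times> {..<n}. if snd p < fst p then abs_F (pu i j :: 'k F) else 1"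
 define P where "P U T A \<longleftrightarrow> (\<forall>r<n. \<forall>c<n. (A * G) $$ (r, c) \<in>
   (if c < r then Jid i j else if r = c & r : U then O2u else if r = c & r : T then m2 else O2))" for U T and A :: "'k F mat"
 have u: "u < n" "u ~: T" "u ~: U" using insert.prems insert.hyps by auto
 have finT: "finite T" using insert.prems(2) finite_subset by blast
 have 1: "has_int_M n (%A. if P U T A then 1 else 0) (w ^ card T * (1 - w) ^ card U * ?V)"
  unfolding P_def using insert.prems by (intro insert.IH) auto
 have 2: "has_int_M n (%A. if P U (insert u T) A then 1 else 0) (w ^ card (insert u T) * (1 - w) ^ card U * ?V)"
  unfolding P_def using insert.prems insert.hyps by (intro insert.IH) auto
 have split: "(if P (insert u U) T A then 1 else 0 :: lam) = 1 * (if P U T A then 1 else 0) + (- 1) * (if P U (insert u T) A then 1 else 0)" for A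
 proof -
  define S where "S U T r c = (if c < r then Jid i j else if r = c & r : U then O2u else if r = c & r : T then m2 else (O2 :: 'k F set))"
   for U T and r c :: nat
  have P: "P U T A \<longleftrightarrow> (\<forall>r<n. \<forall>c<n. (r, c) ~= (u, u) --> (A * G) $$ (r, c) : S U T r c) & (A * G) $$ (u, u) : S U T u u" for U T
   unfolding P_def S_def[symmetric] by (rule all_split_diag[OF u(1)])
  have S1: "S (insert u U) T r c = S U T r c" "S U (insert u T) r c = S U T r c" if "(r, c) ~= (u, u)" for r c
   using that by (auto simp: S_def)
  have S2: "S (insert u U) T u u = O2u" "S U T u u = O2" "S U (insert u T) u u = m2"
   using u by (auto simp: S_def)
  define B where "B \<longleftrightarrow> (\<forall>r<n. \<forall>c<n. (r, c) ~= (u, u) --> (A * G) $$ (r, c) : S U T r c)"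
  have a: "P (insert u U) T A \<longleftrightarrow> B & (A * G) $$ (u, u) : O2u"
   unfolding P S2 B_def using S1(1) by metis
  have b: "P U T A \<longleftrightarrow> B & (A * G) $$ (u, u) : O2"
   unfolding P S2 B_def ..
  have c: "P U (insert u T) A \<longleftrightarrow> B & (A * G) $$ (u, u) : m2"
   unfolding P S2 B_def using S1(2) by metis
  have "x : O2 \<longleftrightarrow> x : O2u | x : m2" "~ (x : O2u & x : m2)" for x :: "'k F"
   using O2_eq O2u_m2 by blast+
  thus ?thesis unfolding a b c by auto
 qed
 have val: "w ^ card T * (1 - w) ^ card (insert u U) * ?V
  = 1 * (w ^ card T * (1 - w) ^ card U * ?V) + (- 1) * (w ^ card (insert u T) * (1 - w) ^ card U * ?V)"
  using insert.hyps u finT by (simp add: algebra_simps)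
 have "has_int_M n (%A. if P (insert u U) T A then 1 else 0) (w ^ card T * (1 - w) ^ card (insert u U) * ?V)"
  unfolding split val by (rule has_int_M_lin[OF 1 2]) simp_all
 thus ?case unfolding P_def .
qed

section \<open>Volumes of cosets\<close>

lemma has_mu_n_indicator:
 fixes S :: "'k::{field,finite} F mat set"
 assumes S: "S <= K0 n" and f: "has_int_M n f v"
  and e: "!!A. A : carrier (GLF n) ==> f A = (if A : S then 1 else 0)"
 shows "has_mu_n n (%A. if A : S then 1 else 0) (fls_const (c_const n CARD('k)) * v)"
proof -
 have "abs_F (ddet A) powi (- int n) = 1" if "A : S" for A
 proof -
  have "ddet A : O2u" using S that by (auto simp: K0_iff)
  thus ?thesis by (simp add: abs_F_O2u)
 qed
 hence "has_int_G n (%A. if A : S then 1 else 0) v"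
  unfolding has_int_G_def using e f by (intro exI[of _ f]) auto
 thus ?thesis unfolding has_mu_n_def by blast
qed

definition below :: "nat => nat" where
 "below n = card {p : {..<n} \<times> {..<n}. snd p < fst p}"

text \<open>\<open>rvol n q i * X ^ (below n * j)\<close> is the volume, in one factor, of a coset of \<open>Pij n i j\<close>.\<close>

definition rvol :: "nat => nat => nat => real" where
 "rvol n q i = (\<Prod>r=1..n. inverse (1 - real q powi (- int r))) * (1 - inverse (real q)) ^ n * (inverse (real q) ^ i) ^ below n"

lemma Pij_coset_volume:
 fixes g :: "'k::{field,finite} F mat"
 assumes ij: "1 <= i" "1 <= j" and g: "g : K0 n"
 shows "has_mu_n n (%A. if A : (%p. p * g) ` Pij n i j then 1 else 0)
  (fls_const (of_real (rvol n CARD('k) i)) * fls_X powi (int (below n * j)))"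
proof -
 let ?w = "fls_const (inverse (of_nat CARD('k))) :: lam"
 define G where "G = inv\<^bsub>GLF n\<^esub> g"
 have G: "G : K0 n" using subgroup.m_inv_closed[OF K0_subgroup g] by (simp add: G_def)
 have gG: "g : carrier (GLF n)" using g by (simp add: K0_def)
 have cm: "G : MN n" "g : MN n" using G g by (auto simp: K0_iff dest: matS_carrier)
 have inv: "G * g = 1\<^sub>m n" "g * G = 1\<^sub>m n" using GL.r_inv[OF gG] GL.l_inv[OF gG] by (simp_all add: G_def)
 have mem: "A : (%p. p * g) ` Pij n i j \<longleftrightarrow> A * G : Pij n i j" if A: "A : MN n" for A
 proof
  assume "A : (%p. p * g) ` Pij n i j"
  then obtain p where p: "A = p * g" "p : Pij n i j" by blast
  hence "p : MN n" by (auto simp: Pij_def dest: matS_carrier)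
  hence "A * G = p" unfolding p(1) using cm inv by (simp add: assoc_mult_mat)
  thus "A * G : Pij n i j" using p by simp
 next
  assume *: "A * G : Pij n i j"
  have "A = (A * G) * g" using A cm inv by (simp add: assoc_mult_mat)
  thus "A : (%p. p * g) ` Pij n i j" using * by blast
 qed
 have PP: "M : Pij n i j \<longleftrightarrow> (\<forall>r<n. \<forall>c<n. M $$ (r, c) \<in>
   (if c < r then Jid i j else if r = c & r : {..<n} then O2u else if r = c & r : {} then m2 else O2))"
  if M: "M : MN n" for M :: "'k F mat"
 proof
  assume M': "M : Pij n i j"
  thus "\<forall>r<n. \<forall>c<n. M $$ (r, c) \<in>
   (if c < r then Jid i j else if r = c & r : {..<n} then O2u else if r = c & r : {} then m2 else O2)"
   by (auto simp: Pij_def matS_def)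
 next
  assume *: "\<forall>r<n. \<forall>c<n. M $$ (r, c) \<in>
   (if c < r then Jid i j else if r = c & r : {..<n} then O2u else if r = c & r : {} then m2 else O2)"
  have **: "M $$ (r, c) : (if c < r then Jid i j else if r = c then O2u else O2)" if "r < n" "c < n" for r c
   using *[rule_format, OF that] that by (auto split: if_splits)
  show "M : Pij n i j"
   unfolding Pij_def matS_def
  proof (intro CollectI conjI allI impI)
   fix a b assume "a < n" "b < n"
   thus "M $$ (a, b) : O2" using **[of a b] Jid_O2[of i j] O2u_O2 by (auto split: if_splits)
  next
   fix a b assume "a < n" "b < a"
   thus "M $$ (a, b) : Jid i j" using **[of a b] by simp
  next
   fix a assume "a < n"
   thus "M $$ (a, a) : O2u" using **[of a a] by simp
  qed (rule M)
 qed
 have "(\<Prod>p\<in>{..<n} \<times> {..<n}. if snd p < fst p then abs_F (pu i j :: 'k F) else 1) = abs_F (pu i j :: 'k F) ^ below n"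
  by (subst prod.inter_filter[symmetric]) (simp_all add: below_def)
 moreover have "has_int_M n (%A. if \<forall>r<n. \<forall>c<n. (A * G) $$ (r, c) \<in>
   (if c < r then Jid i j else if r = c & r : {..<n} then O2u else if r = c & r : {} then m2 else O2) then 1 else 0)
  (?w ^ card ({} :: nat set) * (1 - ?w) ^ card {..<n} * (\<Prod>p\<in>{..<n} \<times> {..<n}. if snd p < fst p then abs_F (pu i j :: 'k F) else 1))"
  by (rule Pij_volume_M[OF G]) auto
 ultimately have V: "has_int_M n (%A. if \<forall>r<n. \<forall>c<n. (A * G) $$ (r, c) \<in>
   (if c < r then Jid i j else if r = c & r : {..<n} then O2u else if r = c & r : {} then m2 else O2) then 1 else 0)
  ((1 - ?w) ^ n * abs_F (pu i j :: 'k F) ^ below n)" by simp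
 have "has_mu_n n (%A. if A : (%p. p * g) ` Pij n i j then 1 else 0)
   (fls_const (c_const n CARD('k)) * ((1 - ?w) ^ n * abs_F (pu i j :: 'k F) ^ below n))"
 proof (rule has_mu_n_indicator[OF _ V])
  show "(%p. p * g) ` Pij n i j <= K0 n"
   using Pij_subset_K0[OF ij] subgroup.m_closed[OF K0_subgroup _ g] by auto
  fix A :: "'k F mat" assume "A : carrier (GLF n)"
  hence A: "A : MN n" by (rule GLF_mat)
  hence AG: "A * G : MN n" using cm by auto
  show "(if \<forall>r<n. \<forall>c<n. (A * G) $$ (r, c) \<in>
   (if c < r then Jid i j else if r = c & r : {..<n} then O2u else if r = c & r : {} then m2 else O2) then 1 else 0)
   = (if A : (%p. p * g) ` Pij n i j then 1 else 0 :: lam)"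
   unfolding mem[OF A] PP[OF AG] ..
 qed
 moreover have "fls_const (c_const n CARD('k)) * ((1 - ?w) ^ n * abs_F (pu i j :: 'k F) ^ below n)
   = fls_const (of_real (rvol n CARD('k) i)) * fls_X powi (int (below n * j))"
 proof -
  have a: "abs_F (pu i j :: 'k F) = fls_const ((inverse (of_nat CARD('k))) ^ i) * fls_X ^ j"
   by (simp add: abs_F_eq power_int_minus power_inverse fls_X_power_conv_shift_1)
  have b: "1 - ?w = fls_const (1 - inverse (of_nat CARD('k)))"
   by (simp flip: fls_minus_const)
  have c: "of_real (rvol n CARD('k) i) = c_const n CARD('k) * (1 - inverse (of_nat CARD('k))) ^ n * ((inverse (of_nat CARD('k))) ^ i) ^ below n"
   by (simp add: rvol_def c_const_def)
  have x: "fls_X powi (int (below n * j)) = (fls_X ^ j) ^ below n"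
   by (simp only: power_int_of_nat power_mult[symmetric] mult.commute)
  show ?thesis
   unfolding a b c x power_mult_distrib fls_const_power[symmetric]
   by (simp only: fls_const_mult_const[symmetric] mult_ac)
 qed
 ultimately show ?thesis by simp
qed

lemma rvol_pos: "rvol n CARD('k::{field,finite}) i > 0"
proof -
 have q: "real CARD('k) > 1" using CARD_ge_2[where 'k = 'k] by simp
 have "real CARD('k) powi (- int r) < 1" if "r >= 1" for r
  using q that by (simp add: power_int_minus inverse_less_1_iff one_less_power)
 moreover have "inverse (real CARD('k)) < 1" using q by (simp add: inverse_less_1_iff)
 ultimately show ?thesis
  unfolding rvol_def using q by (intro mult_pos_pos prod_pos zero_less_power) auto
qed

text \<open>\<open>K0\<close> is the disjoint union of the residue classes of the invertible matrices over \<open>k\<close>.\<close>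

lemma K0_volume: "has_mu_n n (%A. if A : (K0 n :: 'k::{field,finite} F mat set) then 1 else 0) 1"
proof -
 let ?I = "%B (A :: 'k F mat). if \<forall>r<n. \<forall>c<n. ((A * 1\<^sub>m n) $$ (r, c) + (%p. - klift (B $$ p)) (r, c)) / uu : O2 then 1 else 0 :: lam"
 let ?v = "\<Prod>p\<in>{..<n} \<times> {..<n}. abs_F (uu :: 'k F)"
 have K1: "1\<^sub>m n : (K0 n :: 'k F mat set)" by (simp add: K0_iff)
 have "has_int_M n (%A. \<Sum>B\<in>GLk n. ?I B A) (\<Sum>B\<in>(GLk n :: 'k mat set). ?v)"
  by (intro has_int_M_sum box_volume[OF K1]) simp
 have cond: "(\<forall>r<n. \<forall>c<n. ((A * 1\<^sub>m n) $$ (r, c) + (%p. - klift (B $$ p)) (r, c)) / uu : O2)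
   \<longleftrightarrow> A : matS n O2 & map_mat res A = B" if A: "A : MN n" and B: "B : MN n"
  for A :: "'k F mat" and B
 proof -
  have e: "(x + - klift b) / uu : O2 \<longleftrightarrow> x : O2 & res x = b" for x :: "'k F" and b
  proof -
   have "(x + - klift b) / uu : O2 \<longleftrightarrow> x - klift b : m2" by (simp add: m2_eq)
   also have "... \<longleftrightarrow> x : O2 & res x = b"
   proof
    assume m: "x - klift b : m2"
    hence o: "x - klift b : O2" using O2_eq by blast
    hence "x - klift b + klift b : O2" by (intro O2_add) auto
    moreover have "res (x - klift b) = 0" using m m2_iff_res[OF o] by simp
    ultimately show "x : O2 & res x = b" by (simp add: res_diff)
   next
    assume *: "x : O2 & res x = b"
    hence o: "x - klift b : O2" by (intro O2_diff) auto
    have "res (x - klift b) = 0" using * by (simp add: res_diff)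
    thus "x - klift b : m2" using m2_iff_res[OF o] by simp
   qed
   finally show ?thesis .
  qed
  have "(\<forall>r<n. \<forall>c<n. ((A * 1\<^sub>m n) $$ (r, c) + (%p. - klift (B $$ p)) (r, c)) / uu : O2)
   \<longleftrightarrow> (\<forall>r<n. \<forall>c<n. A $$ (r, c) : O2 & res (A $$ (r, c)) = B $$ (r, c))"
   using A by (simp only: right_mult_one_mat e)
  also have "... \<longleftrightarrow> A : matS n O2 & map_mat res A = B"
  proof -
   have "map_mat res A = B \<longleftrightarrow> (\<forall>r<n. \<forall>c<n. res (A $$ (r, c)) = B $$ (r, c))"
    using A B by (auto simp: mat_eq_iff)
   thus ?thesis using A by (auto simp: matS_def)
  qed
  finally show ?thesis .
 qed
 have "has_mu_n n (%A. if A : (K0 n :: 'k F mat set) then 1 else 0)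
   (fls_const (c_const n CARD('k)) * (\<Sum>B\<in>(GLk n :: 'k mat set). ?v))"
 proof (rule has_mu_n_indicator[OF subset_refl \<open>has_int_M n _ _\<close>])
  fix A :: "'k F mat" assume "A : carrier (GLF n)"
  hence A: "A : MN n" by (rule GLF_mat)
  have "(\<Sum>B\<in>GLk n. ?I B A) = (\<Sum>B\<in>GLk n. if B = map_mat res A then (if A : matS n O2 then 1 else 0) else 0)"
  proof (intro sum.cong refl)
   fix B :: "'k mat" assume "B : GLk n"
   hence B: "B : MN n" by (simp add: GLk_def)
   show "?I B A = (if B = map_mat res A then (if A : matS n O2 then 1 else 0) else 0)"
    unfolding cond[OF A B] by auto
  qed
  also have "... = (if map_mat res A : GLk n then (if A : matS n O2 then 1 else 0) else 0)"
   by (rule sum.delta[OF finite_GLk])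
  also have "... = (if A : K0 n then 1 else 0)"
  proof (cases "A : matS n O2")
   case True
   have "map_mat res A : GLk n \<longleftrightarrow> res (ddet A) ~= 0"
    unfolding GLk_def using A res_det[OF True] by simp
   thus ?thesis using True det_O2[OF True] by (simp add: K0_iff O2u_iff_res)
  qed (simp add: K0_iff)
  finally show "(\<Sum>B\<in>GLk n. ?I B A) = (if A : K0 n then 1 else 0)" .
 qed
 moreover have "fls_const (c_const n CARD('k)) * (\<Sum>B\<in>(GLk n :: 'k mat set). ?v) = 1"
 proof -
  have a: "abs_F (uu :: 'k F) = fls_const (inverse (of_nat CARD('k)))"
   by (simp add: abs_F_eq power_int_minus)
  have "(\<Sum>B\<in>(GLk n :: 'k mat set). ?v) = fls_const (of_nat (card (GLk n :: 'k mat set)) * inverse (of_nat CARD('k)) ^ (n * n))"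
   by (simp add: a fls_const_power[symmetric] fls_of_nat fls_const_mult_const card_cartesian_product)
  hence "fls_const (c_const n CARD('k)) * (\<Sum>B\<in>(GLk n :: 'k mat set). ?v)
    = fls_const (c_const n CARD('k) * of_nat (card (GLk n :: 'k mat set)) * inverse (of_nat CARD('k)) ^ (n * n))"
   by (simp only: fls_const_mult_const mult.assoc)
  also have "c_const n CARD('k) * of_nat (card (GLk n :: 'k mat set)) * inverse (of_nat CARD('k)) ^ (n * n) = 1"
   unfolding card_GLk_c_const by (simp add: power_inverse)
  finally show ?thesis by simp
 qed
 ultimately show ?thesis by simp
qed

section \<open>The ordered field of real Laurent series\<close>

lemma lam_dag_nth [simp]: "fls_nth (lam_dag a) i = cnj (fls_nth a i)"
 unfolding lam_dag_def by (rule nth_Abs_fls_lower_bound[of "sdeg a"]) simp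

lemma lam_dag_0 [simp]: "lam_dag 0 = 0" and lam_dag_1 [simp]: "lam_dag 1 = 1"
 and lam_dag_dag [simp]: "lam_dag (lam_dag a) = a"
 by (rule fls_eqI, simp)+

lemma lam_dag_add: "lam_dag (a + b) = lam_dag a + lam_dag b"
 by (rule fls_eqI) simp

lemma lam_dag_sum: "lam_dag (sum f I) = (\<Sum>i\<in>I. lam_dag (f i))"
 by (induction I rule: infinite_finite_induct) (simp_all add: lam_dag_add)

lemma lam_dag_eq_0 [simp]: "lam_dag a = 0 \<longleftrightarrow> a = 0"
 by (metis lam_dag_0 lam_dag_dag)

lemma lam_dag_subdegree [simp]: "sdeg (lam_dag a) = sdeg a"
 by (cases "a = 0") (auto intro: fls_subdegree_eqI)

lemma lam_dag_mult: "lam_dag (a * b) = lam_dag a * lam_dag b"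
 by (rule fls_eqI) (simp add: fls_times_nth(1) cnj_sum)

lemma lam_nonneg_iff: "lam_nonneg a \<longleftrightarrow> (ALL i. fls_nth a i : \<real>) & (a = 0 | (EX i. Re (fls_nth a i) > 0 & (\<forall>l<i. fls_nth a l = 0)))"
proof -
 have "i = sdeg a" if "Re (fls_nth a i) > 0" "\<forall>l<i. fls_nth a l = 0" for i
  using that by (intro fls_subdegree_eqI[symmetric]) auto
 moreover have "\<forall>l<sdeg a. fls_nth a l = 0" by simp
 ultimately show ?thesis unfolding lam_nonneg_def by metis
qed

lemma lam_nonneg_0 [simp]: "lam_nonneg 0"
 by (simp add: lam_nonneg_def)

lemma lam_nonneg_add:
 assumes "lam_nonneg a" "lam_nonneg b"
 shows "lam_nonneg (a + b)" "a + b = 0 ==> a = 0 & b = 0"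
proof -
 have "lam_nonneg (a + b) & (a + b = 0 --> a = 0 & b = 0)"
 proof (cases "a = 0 | b = 0")
  case False
  then obtain i j where i: "Re (fls_nth a i) > 0" "\<forall>l<i. fls_nth a l = 0"
   and j: "Re (fls_nth b j) > 0" "\<forall>l<j. fls_nth b l = 0"
   using assms unfolding lam_nonneg_iff by blast
  define m where "m = min i j"
  consider "i < j" | "i = j" | "j < i" by linarith
  hence "Re (fls_nth (a + b) m) > 0" by cases (use i j in \<open>auto simp: m_def min_def\<close>)
  moreover have "\<forall>l<m. fls_nth (a + b) l = 0" using i j by (simp add: m_def)
  moreover have "ALL l. fls_nth (a + b) l : \<real>" using assms by (simp add: lam_nonneg_def)
  moreover have "a + b ~= 0" using \<open>Re (fls_nth (a + b) m) > 0\<close> by force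
  ultimately show ?thesis unfolding lam_nonneg_iff by blast
 qed (use assms in auto)
 thus "lam_nonneg (a + b)" "a + b = 0 ==> a = 0 & b = 0" by blast+
qed

lemma lam_nonneg_sum:
 assumes "finite I" "!!i. i : I ==> lam_nonneg (f i)"
 shows "lam_nonneg (sum f I) & (sum f I = 0 --> (ALL i:I. f i = 0))"
 using assms
proof (induction I rule: finite_induct)
 case (insert i I)
 hence "lam_nonneg (sum f I)" "sum f I = 0 --> (ALL i:I. f i = 0)" "lam_nonneg (f i)" by auto
 note add = lam_nonneg_add[OF this(3,1)]
 have e: "sum f (insert i I) = f i + sum f I" using insert.hyps by simp
 show ?case unfolding e
 proof (intro conjI impI)
  assume "f i + sum f I = 0"
  hence "f i = 0 & sum f I = 0" by (rule add(2))
  thus "ALL i:insert i I. f i = 0" using \<open>sum f I = 0 --> (ALL i:I. f i = 0)\<close> by simp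
 qed (rule add(1))
qed simp

lemma lam_nonneg_mult:
 assumes "lam_nonneg a" "lam_nonneg b"
 shows "lam_nonneg (a * b)"
proof (cases "a = 0 | b = 0")
 case False
 have r: "fls_nth a i : \<real>" "fls_nth b i : \<real>" for i using assms by (auto simp: lam_nonneg_def)
 have p: "Re (fls_nth a (sdeg a)) > 0" "Re (fls_nth b (sdeg b)) > 0"
  using assms False by (auto simp: lam_nonneg_def)
 have "fls_nth (a * b) i : \<real>" for i
  unfolding fls_times_nth(1) using r by (intro sum_in_Reals Reals_mult)
 moreover have "Re (fls_nth (a * b) (sdeg (a * b))) > 0"
 proof -
  have "sdeg (a * b) = sdeg a + sdeg b" using False by simp
  hence "fls_nth (a * b) (sdeg (a * b)) = fls_nth a (sdeg a) * fls_nth b (sdeg b)"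
   by simp
  thus ?thesis using r p by (simp add: complex_is_Real_iff)
 qed
 ultimately show ?thesis by (simp add: lam_nonneg_def)
qed auto

lemma lam_nonneg_norm: "lam_nonneg (lam_dag v * v)"
proof (cases "v = 0")
 case False
 let ?x = "lam_dag v * v"
 have "lam_dag ?x = ?x" by (simp add: lam_dag_mult mult.commute)
 hence "cnj (fls_nth ?x i) = fls_nth ?x i" for i by (metis lam_dag_nth)
 hence r: "fls_nth ?x i : \<real>" for i by (simp add: Reals_cnj_iff)
 have "sdeg ?x = sdeg (lam_dag v) + sdeg v"
  using False by (intro fls_subdegree_mult) auto
 hence "fls_nth ?x (sdeg ?x) = fls_nth (lam_dag v) (sdeg (lam_dag v)) * fls_nth v (sdeg v)"
  by (simp only: fls_times_base)
 also have "... = cnj (fls_nth v (sdeg v)) * fls_nth v (sdeg v)" by simp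
 also have "... = of_real ((cmod (fls_nth v (sdeg v)))\<^sup>2)"
  by (simp only: complex_norm_square mult.commute)
 finally have "fls_nth ?x (sdeg ?x) = of_real ((cmod (fls_nth v (sdeg v)))\<^sup>2)" .
 moreover have "(cmod (fls_nth v (sdeg v)))\<^sup>2 > 0" using False by simp
 ultimately show ?thesis using r unfolding lam_nonneg_def by simp
qed simp

lemma lam_lead_positive:
 fixes r :: real and rB :: "'b => real" and eB :: "'b => int"
 assumes r: "r > 0" and e: "!!B. B : D ==> e < eB B"
 defines "p \<equiv> fls_const (of_real r) * fls_X powi e - (\<Sum>B\<in>D. fls_const (of_real (rB B)) * fls_X powi eB B)"
 shows "lam_nonneg p" "p ~= 0"
proof -
 have x: "fls_nth (fls_const z * fls_X powi k) l = (if l = k then z else 0)" for z :: complex and k l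
  unfolding fls_nth_mult_X_powi fls_const_nth by auto
 have p: "fls_nth p l = (if l = e then of_real r else 0) - (\<Sum>B\<in>D. if l = eB B then of_real (rB B) else 0)" for l
  unfolding p_def fls_minus_nth fls_nth_sum x ..
 have low: "(\<Sum>B\<in>D. if l = eB B then complex_of_real (rB B) else 0) = 0" if "l <= e" for l
  using e that by (intro sum.neutral ballI) force
 have "fls_nth p l : \<real>" for l unfolding p by (intro Reals_diff sum_in_Reals) auto
 moreover have pe: "Re (fls_nth p e) > 0" unfolding p using low[of e] r by simp
 moreover have "\<forall>l<e. fls_nth p l = 0" unfolding p using low by simp
 ultimately show "lam_nonneg p" unfolding lam_nonneg_iff by blast
 show "p ~= 0" using pe by force
qed

section \<open>Volumes of the cylindrical sets\<close>

definition ind :: "'a set => 'a => lam" where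
 "ind A k = (if k : A then 1 else 0)"

lemma has_mu_0_Times:
 assumes "has_mu_n n (%x. if x : A then 1 else 0) a" "has_mu_n n (%x. if x : B then 1 else 0) b"
 shows "has_mu_0 n (ind (A \<times> B)) (a * b)"
 unfolding has_mu_0_def using assms
 by (intro exI[of _ "[(1, %x. if x : A then 1 else 0, %x. if x : B then 1 else 0, a, b)]"])
  (auto simp: ind_def)

lemma H0_volume: "has_mu_0 n (ind (H0 n :: 'k::{field,finite} HH set)) 1"
 using has_mu_0_Times[OF K0_volume K0_volume, of n] by (simp add: H0_def)

definition wvol :: "nat => nat => nat => nat => lam" where
 "wvol n q i j = fls_const (of_real ((rvol n q i)\<^sup>2)) * fls_X powi (int (2 * below n * j))"

lemma coset_volume:
 fixes g :: "'k::{field,finite} HH"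
 assumes ij: "1 <= i" "1 <= j" and g: "g : H0 n"
 shows "has_mu_0 n (ind (QE n (Cdbl n i j) #>\<^bsub>Hgrp n\<^esub> g)) (wvol n CARD('k) i j)"
proof -
 have g': "fst g : K0 n" "snd g : K0 n" using g by (auto simp: H0_def)
 have "QE n (Cdbl n i j) #>\<^bsub>Hgrp n\<^esub> g = (%p. p * fst g) ` Pij n i j \<times> (%p. p * snd g) ` Pij n i j"
  unfolding QE_Cdbl[OF ij] r_coset_def Hgrp_mult by auto
 moreover have "fls_const (of_real (rvol n CARD('k) i)) * fls_X powi (int (below n * j))
   * (fls_const (of_real (rvol n CARD('k) i)) * fls_X powi (int (below n * j))) = wvol n CARD('k) i j"
 proof -
  have "fls_const (of_real ((rvol n CARD('k) i)\<^sup>2)) = fls_const (of_real (rvol n CARD('k) i)) * (fls_const (of_real (rvol n CARD('k) i)) :: lam)"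
   unfolding fls_const_mult_const by (simp add: power2_eq_square)
  moreover have "fls_X powi (int (2 * below n * j)) = fls_X powi (int (below n * j)) * (fls_X powi (int (below n * j)) :: lam)"
   unfolding fls_X_powi_add[symmetric] by (rule arg_cong[of _ _ "power_int fls_X"]) simp
  ultimately show ?thesis unfolding wvol_def by (simp only: mult_ac)
 qed
 ultimately show ?thesis
  using has_mu_0_Times[OF Pij_coset_volume[OF ij g'(1)] Pij_coset_volume[OF ij g'(2)]] by (simp only:)
qed

lemma below_0_coset:
 assumes b: "below n = 0" and ij: "1 <= i" "1 <= j" and g: "g : H0 n"
 shows "QE n (Cdbl n i j) #>\<^bsub>Hgrp n\<^esub> g = (H0 n :: 'k::field HH set)"
proof -
 have n: "n <= 1"
 proof (rule ccontr)
  assume "~ n <= 1"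
  hence "(1, 0) : {p : {..<n} \<times> {..<n}. snd p < fst p}" by simp
  moreover have "finite {p : {..<n} \<times> {..<n}. snd p < fst p}" by simp
  ultimately show False using b unfolding below_def by (metis card_0_eq empty_iff)
 qed
 have "Pij n i j = (K0 n :: 'k F mat set)"
 proof
  show "Pij n i j <= (K0 n :: 'k F mat set)" by (rule Pij_subset_K0[OF ij])
  show "K0 n <= (Pij n i j :: 'k F mat set)"
  proof
   fix A :: "'k F mat" assume A: "A : K0 n"
   hence c: "A : MN n" by (auto simp: K0_iff dest: matS_carrier)
   hence "upper_triangular A" using n by (auto simp: ut_index)
   moreover have "A : carrier (GLF n)" using A by (simp add: K0_def)
   ultimately have "A : Q1 n" using A by (simp add: Q1_def Bor_def)
   hence "A : matS n O2" "\<forall>a<n. A $$ (a, a) : O2u" by (auto simp: Q1_iff)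
   moreover have "~ (a < n & b < a)" for a b using n by linarith
   ultimately show "A : Pij n i j" unfolding Pij_def by blast
  qed
 qed
 hence "QE n (Cdbl n i j) = (H0 n :: 'k HH set)" unfolding QE_Cdbl[OF ij] H0_def by simp
 thus ?thesis using HG.coset_join2[OF H0_carrier[OF g] H0_subgroup g] by simp
qed

section \<open>Cylindrical functions\<close>

text \<open>The set of levels is a parameter so that the functions at a fixed level and those at all levels are treated together.\<close>

definition Cyl :: "nat => 'k::field HH set set => ('k HH => lam) set" where
 "Cyl n \<E> = {F. \<exists>\<T> c. finite \<T> & \<T> <= cyl_sets n \<E> & F = (%k. \<Sum>A\<in>\<T>. c A * ind A k)}"

lemma CylI: "finite \<T> ==> \<T> <= cyl_sets n \<E> ==> (%k. \<Sum>A\<in>\<T>. c A * ind A k) : Cyl n \<E>"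
 unfolding Cyl_def by blast

lemma CylE:
 assumes "F : Cyl n \<E>"
 obtains \<T> c where "finite \<T>" "\<T> <= cyl_sets n \<E>" "F = (%k. \<Sum>A\<in>\<T>. c A * ind A k)"
 using assms unfolding Cyl_def by blast

lemma Cyl_0 [simp]: "(%k. 0) : Cyl n \<E>"
 using CylI[of "{}" n \<E>] by simp

lemma Cyl_ind: "A : cyl_sets n \<E> ==> ind A : Cyl n \<E>"
 using CylI[of "{A}" n \<E> "%_. 1"] by simp

lemma Cyl_add:
 assumes "F : Cyl n \<E>" "G : Cyl n \<E>"
 shows "(%k. F k + G k) : Cyl n \<E>"
proof -
 obtain \<T> c where 1: "finite \<T>" "\<T> <= cyl_sets n \<E>" "F = (%k. \<Sum>A\<in>\<T>. c A * ind A k)"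
  using assms(1) by (rule CylE)
 obtain \<U> d where 2: "finite \<U>" "\<U> <= cyl_sets n \<E>" "G = (%k. \<Sum>A\<in>\<U>. d A * ind A k)"
  using assms(2) by (rule CylE)
 have "F k + G k = (\<Sum>A\<in>\<T> Un \<U>. ((if A : \<T> then c A else 0) + (if A : \<U> then d A else 0)) * ind A k)" for k
 proof -
  have "(\<Sum>A\<in>\<T> Un \<U>. (if A : \<T> then c A else 0) * ind A k) = F k"
   unfolding 1(3) using 1(1) 2(1) by (intro sum.mono_neutral_cong_right) auto
  moreover have "(\<Sum>A\<in>\<T> Un \<U>. (if A : \<U> then d A else 0) * ind A k) = G k"
   unfolding 2(3) using 1(1) 2(1) by (intro sum.mono_neutral_cong_right) auto
  ultimately show ?thesis by (simp only: distrib_right sum.distrib)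
 qed
 moreover have "(%k. \<Sum>A\<in>\<T> Un \<U>. ((if A : \<T> then c A else 0) + (if A : \<U> then d A else 0)) * ind A k) : Cyl n \<E>"
  using 1 2 by (intro CylI) auto
 ultimately show ?thesis by simp
qed

lemma Cyl_scale: "F : Cyl n \<E> ==> (%k. c * F k) : Cyl n \<E>"
 by (elim CylE) (auto simp: sum_distrib_left mult.assoc[symmetric] intro!: CylI)

lemma Cyl_sum: "(!!i. i : I ==> F i : Cyl n \<E>) ==> (%k. \<Sum>i\<in>I. F i k) : Cyl n \<E>"
 by (induction I rule: infinite_finite_induct) (simp_all add: Cyl_add)

lemma Cyl_dag: "F : Cyl n \<E> ==> (%k. lam_dag (F k)) : Cyl n \<E>"
proof (elim CylE)
 fix \<T> c assume *: "finite \<T>" "\<T> <= cyl_sets n \<E>" "F = (%k. \<Sum>A\<in>\<T>. c A * ind A k)"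
 have "(%k. lam_dag (F k)) = (%k. \<Sum>A\<in>\<T>. lam_dag (c A) * ind A k)"
  unfolding *(3) by (auto simp: lam_dag_sum lam_dag_mult ind_def intro!: sum.cong)
 thus ?thesis using CylI[OF *(1,2), of "%A. lam_dag (c A)"] by simp
qed

lemma Cyl_mult:
 assumes \<E>: "\<E> <= CH0 n" and F: "F : Cyl n \<E>" and G: "G : Cyl n \<E>"
 shows "(%k. F k * G k) : Cyl n \<E>"
proof -
 obtain \<T> c where 1: "finite \<T>" "\<T> <= cyl_sets n \<E>" "F = (%k. \<Sum>A\<in>\<T>. c A * ind A k)"
  using F by (rule CylE)
 obtain \<U> d where 2: "finite \<U>" "\<U> <= cyl_sets n \<E>" "G = (%k. \<Sum>A\<in>\<U>. d A * ind A k)"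
  using G by (rule CylE)
 have "(%k. ind A k * ind B k) : Cyl n \<E>" if "A : \<T>" "B : \<U>" for A B
 proof -
  have AB: "A : cyl_sets n \<E>" "B : cyl_sets n \<E>" using 1 2 that by auto
  consider "A <= B" | "B <= A" | "A Int B = {}" using cyl_sets_laminar[OF \<E> AB] by blast
  thus ?thesis
  proof cases
   case 1
   hence "(%k. ind A k * ind B k) = ind A" by (auto simp: ind_def fun_eq_iff)
   thus ?thesis using Cyl_ind[OF AB(1)] by simp
  next
   case 2
   hence "(%k. ind A k * ind B k) = ind B" by (auto simp: ind_def fun_eq_iff)
   thus ?thesis using Cyl_ind[OF AB(2)] by simp
  next
   case 3
   hence "(%k. ind A k * ind B k) = (%k. 0)" by (auto simp: ind_def fun_eq_iff)
   thus ?thesis by simp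
  qed
 qed
 hence "(%k. \<Sum>A\<in>\<T>. \<Sum>B\<in>\<U>. (c A * d B) * (ind A k * ind B k)) : Cyl n \<E>"
  by (intro Cyl_sum Cyl_scale)
 moreover have "F k * G k = (\<Sum>A\<in>\<T>. \<Sum>B\<in>\<U>. (c A * d B) * (ind A k * ind B k))" for k
  unfolding 1(3) 2(3) sum_product by (intro sum.cong refl) (simp add: mult_ac)
 ultimately show ?thesis by simp
qed

lemma Cyl_mono: "\<E> <= \<E>' ==> Cyl n \<E> <= Cyl n \<E>'"
proof
 fix F assume sub: "\<E> <= \<E>'" and "F : Cyl n \<E>"
 then obtain \<T> c where *: "finite \<T>" "\<T> <= cyl_sets n \<E>" "F = (%k. \<Sum>A\<in>\<T>. c A * ind A k)"
  by (elim CylE)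
 have "cyl_sets n \<E> <= cyl_sets n \<E>'"
  unfolding cyl_sets_def using sub by (intro insert_mono) blast
 thus "F : Cyl n \<E>'" unfolding *(3) by (intro CylI *(1) subset_trans[OF *(2)])
qed

lemma Cyl_support:
 assumes "\<E> <= CH0 n" "F : Cyl n \<E>" "k ~: H0 n"
 shows "F k = 0"
 using assms(2)
proof (elim CylE)
 fix \<T> c assume *: "finite \<T>" "\<T> <= cyl_sets n \<E>" "F = (%k. \<Sum>A\<in>\<T>. c A * ind A k)"
 have "k ~: A" if "A : \<T>" for A using cyl_sets_subset_H0[OF assms(1)] that *(2) assms(3) by blast
 thus ?thesis unfolding *(3) by (intro sum.neutral) (simp add: ind_def)
qed

section \<open>The integral of a cylindrical function\<close>

lemma cyl_set_volume:
 assumes "\<E> <= CH0 n" "A : cyl_sets n (\<E> :: 'k::{field,finite} HH set set)"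
 shows "EX v. has_mu_0 n (ind A) v"
proof -
 consider "A = H0 n" | E g where "A = QE n E #>\<^bsub>Hgrp n\<^esub> g" "E : CH0 n" "g : H0 n"
  using assms unfolding cyl_sets_def by blast
 thus ?thesis
 proof cases
  case 2
  from 2(2) obtain i j where "E = Cdbl n i j" "1 <= i" "1 <= j" by (rule CH0_cases)
  thus ?thesis using coset_volume[of i j g n] 2 by blast
 qed (use H0_volume in blast)
qed

lemma has_mu_0_sum:
 assumes "!!i. i : I ==> has_mu_0 n (F i) (v i)"
 shows "has_mu_0 n (%k. \<Sum>i\<in>I. c i * F i k) (\<Sum>i\<in>I. c i * v i)"
 using assms
proof (induction I rule: infinite_finite_induct)
 case (insert i I)
 from has_mu_0_lin[of n "F i" "v i" "%k. \<Sum>i\<in>I. c i * F i k" "\<Sum>i\<in>I. c i * v i" "c i" 1] insert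
 show ?case by simp
qed (simp_all add: has_mu_0_0)

definition tauH :: "nat => ('k::{field,finite} HH => lam) => lam" where
 "tauH n F = (THE v. has_mu_0 n F v)"

lemma tauH_eq: "has_mu_0 n F v ==> tauH n F = v"
 unfolding tauH_def using has_mu_0_unique by blast

lemma Cyl_has_mu_0:
 assumes \<E>: "\<E> <= CH0 n" and F: "F : Cyl n \<E>"
 shows "has_mu_0 n F (tauH n F)"
 using F
proof (elim CylE)
 fix \<T> c assume *: "finite \<T>" "\<T> <= cyl_sets n \<E>" "F = (%k. \<Sum>A\<in>\<T>. c A * ind A k)"
 obtain v where v: "!!A. A : \<T> ==> has_mu_0 n (ind A) (v A)"
  using cyl_set_volume[OF \<E>] *(2) by (metis subsetD)
 have "has_mu_0 n F (\<Sum>A\<in>\<T>. c A * v A)" unfolding *(3) by (intro has_mu_0_sum v)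
 thus ?thesis using tauH_eq by metis
qed

lemma tauH_lin:
 assumes \<E>: "\<E> <= CH0 n" and "F : Cyl n \<E>" "G : Cyl n \<E>"
 shows "tauH n (%k. c * F k + d * G k) = c * tauH n F + d * tauH n G"
 using has_mu_0_lin[OF Cyl_has_mu_0[OF assms(1,2)] Cyl_has_mu_0[OF assms(1,3)]] by (rule tauH_eq)

lemma tauH_sum:
 assumes \<E>: "\<E> <= CH0 n" and "!!i. i : I ==> F i : Cyl n \<E>"
 shows "tauH n (%k. \<Sum>i\<in>I. F i k) = (\<Sum>i\<in>I. tauH n (F i))"
 using has_mu_0_sum[of I n F "%i. tauH n (F i)" "%_. 1"] Cyl_has_mu_0[OF \<E>] assms(2)
 by (intro tauH_eq) simp

text \<open>Hermitian symmetry: the integral of a real-volume combination commutes with the involution.\<close>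

lemma wvol_dag: "lam_dag (wvol n q i j) = wvol n q i j"
proof -
 have "fls_nth (wvol n q i j) l = (if l = int (2 * below n * j) then of_real ((rvol n q i)\<^sup>2) else 0)" for l
  unfolding wvol_def fls_nth_mult_X_powi fls_const_nth by auto
 thus ?thesis by (intro fls_eqI) simp
qed

lemma cyl_set_volume_dag:
 assumes "\<E> <= CH0 n" "A : cyl_sets n (\<E> :: 'k::{field,finite} HH set set)"
 shows "lam_dag (tauH n (ind A)) = tauH n (ind A)"
proof -
 consider "A = H0 n" | E g where "A = QE n E #>\<^bsub>Hgrp n\<^esub> g" "E : CH0 n" "g : H0 n"
  using assms unfolding cyl_sets_def by blast
 thus ?thesis
 proof cases
  case 1
  thus ?thesis by (simp add: tauH_eq[OF H0_volume])
 next
  case 2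
  from 2(2) obtain i j where ij: "E = Cdbl n i j" "1 <= i" "1 <= j" by (rule CH0_cases)
  show ?thesis unfolding 2(1) ij(1) tauH_eq[OF coset_volume[OF ij(2,3) 2(3)]] by (rule wvol_dag)
 qed
qed

lemma tauH_dag:
 assumes \<E>: "\<E> <= CH0 n" and F: "F : Cyl n \<E>"
 shows "tauH n (%k. lam_dag (F k)) = lam_dag (tauH n F)"
 using F
proof (elim CylE)
 fix \<T> c assume *: "finite \<T>" "\<T> <= cyl_sets n \<E>" "F = (%k. \<Sum>A\<in>\<T>. c A * ind A k)"
 have v: "has_mu_0 n (ind A) (tauH n (ind A))" "lam_dag (tauH n (ind A)) = tauH n (ind A)" if "A : \<T>" for A
  using Cyl_has_mu_0[OF \<E> Cyl_ind] cyl_set_volume_dag[OF \<E>] *(2) that by blast+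
 have "has_mu_0 n F (\<Sum>A\<in>\<T>. c A * tauH n (ind A))" unfolding *(3) by (intro has_mu_0_sum v)
 hence 1: "tauH n F = (\<Sum>A\<in>\<T>. c A * tauH n (ind A))" by (rule tauH_eq)
 have e: "(%k. lam_dag (F k)) = (%k. \<Sum>A\<in>\<T>. lam_dag (c A) * ind A k)"
  unfolding *(3) by (auto simp: lam_dag_sum lam_dag_mult ind_def intro!: sum.cong)
 have "has_mu_0 n (%k. lam_dag (F k)) (\<Sum>A\<in>\<T>. lam_dag (c A) * tauH n (ind A))"
  unfolding e by (intro has_mu_0_sum v)
 hence "tauH n (%k. lam_dag (F k)) = (\<Sum>A\<in>\<T>. lam_dag (c A) * tauH n (ind A))" by (rule tauH_eq)
 also have "... = lam_dag (tauH n F)" unfolding 1 by (simp add: lam_dag_sum lam_dag_mult v(2))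
 finally show ?thesis .
qed

text \<open>Right translation by \<open>H0\<close> permutes the cosets of each level, and these have equal volume.\<close>

definition sh :: "nat => 'k::field HH => ('k HH => lam) => 'k HH => lam" where
 "sh n h F = (%k. if k : H0 n then F (k \<otimes>\<^bsub>Hgrp n\<^esub> h) else 0)"

lemma sh_ind:
 assumes \<E>: "\<E> <= CH0 n" and A: "A : cyl_sets n (\<E> :: 'k::{field,finite} HH set set)" and h: "h : H0 n"
 shows "EX B:cyl_sets n \<E>. sh n h (ind A) = ind B & tauH n (ind B) = tauH n (ind A)"
proof -
 consider "A = H0 n" | E g where "A = QE n E #>\<^bsub>Hgrp n\<^esub> g" "E : \<E>" "E : CH0 n" "g : H0 n"
  using \<E> A unfolding cyl_sets_def by blast
 thus ?thesis
 proof cases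
  case 1
  have "sh n h (ind A) = ind A"
   unfolding sh_def ind_def 1 using subgroup.m_closed[OF H0_subgroup _ h] by (auto simp: fun_eq_iff)
  thus ?thesis using A by auto
 next
  case 2
  define g' where "g' = g \<otimes>\<^bsub>Hgrp n\<^esub> inv\<^bsub>Hgrp n\<^esub> h"
  have g': "g' : H0 n"
   unfolding g'_def using 2(4) subgroup.m_inv_closed[OF H0_subgroup h] subgroup.m_closed[OF H0_subgroup] by blast
  let ?B = "QE n E #>\<^bsub>Hgrp n\<^esub> g'"
  have c: "g : carrier (Hgrp n)" "h : carrier (Hgrp n)" using H0_carrier[OF 2(4)] H0_carrier[OF h] by auto
  have Pc: "p : carrier (Hgrp n)" if "p : QE n E" for p using QE_subset_H0[OF 2(3)] H0_carrier that by blast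
  have "k \<otimes>\<^bsub>Hgrp n\<^esub> h : A \<longleftrightarrow> k : ?B" if k: "k : H0 n" for k
  proof -
   have kc: "k : carrier (Hgrp n)" using H0_carrier[OF k] .
   have "k \<otimes>\<^bsub>Hgrp n\<^esub> h = p \<otimes>\<^bsub>Hgrp n\<^esub> g \<longleftrightarrow> k = p \<otimes>\<^bsub>Hgrp n\<^esub> g'" if "p : QE n E" for p
   proof -
    have pc: "p : carrier (Hgrp n)" by (rule Pc[OF that])
    have "k = p \<otimes>\<^bsub>Hgrp n\<^esub> g \<otimes>\<^bsub>Hgrp n\<^esub> inv\<^bsub>Hgrp n\<^esub> h \<longleftrightarrow> p \<otimes>\<^bsub>Hgrp n\<^esub> g = k \<otimes>\<^bsub>Hgrp n\<^esub> h"
     using kc c pc by (intro HG.inv_solve_right HG.m_closed)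
    moreover have "p \<otimes>\<^bsub>Hgrp n\<^esub> g \<otimes>\<^bsub>Hgrp n\<^esub> inv\<^bsub>Hgrp n\<^esub> h = p \<otimes>\<^bsub>Hgrp n\<^esub> g'"
     unfolding g'_def using c pc by (intro HG.m_assoc HG.inv_closed)
    ultimately show ?thesis by metis
   qed
   thus ?thesis unfolding 2(1) coset_mem by blast
  qed
  hence "sh n h (ind A) = ind ?B"
   unfolding sh_def ind_def using QE_coset_subset_H0[OF 2(3) g'] by (auto simp: fun_eq_iff)
  moreover have "?B : cyl_sets n \<E>" unfolding cyl_sets_def using 2(2) g' by blast
  moreover have "tauH n (ind ?B) = tauH n (ind A)"
  proof -
   from 2(3) obtain i j where ij: "E = Cdbl n i j" "1 <= i" "1 <= j" by (rule CH0_cases)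
   show ?thesis
    unfolding 2(1) ij(1) tauH_eq[OF coset_volume[OF ij(2,3) 2(4)]] tauH_eq[OF coset_volume[OF ij(2,3) g']] ..
  qed
  ultimately show ?thesis by blast
 qed
qed

lemma sh_Cyl:
 assumes \<E>: "\<E> <= CH0 n" and F: "F : Cyl n (\<E> :: 'k::{field,finite} HH set set)" and h: "h : H0 n"
 shows "sh n h F : Cyl n \<E>" "tauH n (sh n h F) = tauH n F"
proof -
 obtain \<T> c where *: "finite \<T>" "\<T> <= cyl_sets n \<E>" "F = (%k. \<Sum>A\<in>\<T>. c A * ind A k)"
  using F by (rule CylE)
 have "ALL A:\<T>. EX B. B : cyl_sets n \<E> & sh n h (ind A) = ind B & tauH n (ind B) = tauH n (ind A)"
  using sh_ind[OF \<E> _ h] *(2) by blast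
 from bchoice[OF this] obtain B where B: "!!A. A : \<T> ==> B A : cyl_sets n \<E> & sh n h (ind A) = ind (B A) & tauH n (ind (B A)) = tauH n (ind A)"
  by blast
 have "sh n h F k = (\<Sum>A\<in>\<T>. c A * sh n h (ind A) k)" for k
  unfolding *(3) sh_def by simp
 hence e: "sh n h F = (%k. \<Sum>A\<in>\<T>. c A * ind (B A) k)"
  using B by (auto simp: fun_eq_iff intro!: sum.cong)
 show "sh n h F : Cyl n \<E>" unfolding e using B by (intro Cyl_sum Cyl_scale Cyl_ind) blast
 have "has_mu_0 n (ind (B A)) (tauH n (ind A))" if "A : \<T>" for A
  using Cyl_has_mu_0[OF \<E> Cyl_ind] B[OF that] by metis
 hence "tauH n (sh n h F) = (\<Sum>A\<in>\<T>. c A * tauH n (ind A))"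
  unfolding e by (intro tauH_eq has_mu_0_sum)
 also have "... = tauH n F"
 proof -
  have "has_mu_0 n (ind A) (tauH n (ind A))" if "A : \<T>" for A
   using Cyl_has_mu_0[OF \<E> Cyl_ind] *(2) that by blast
  thus ?thesis unfolding *(3) by (intro tauH_eq[symmetric] has_mu_0_sum)
 qed
 finally show "tauH n (sh n h F) = tauH n F" .
qed

section \<open>Positivity\<close>

text \<open>A coset minus finitely many disjoint smaller cosets has positive volume unless it is empty: the
 smaller ones of the same \<open>t\<close>-level are counted in a common finite refinement, and the ones of deeper
 \<open>t\<close>-level are infinitesimally small.\<close>

lemma piece_volume_positive:
 fixes \<M> :: "'k::{field,finite} HH set set"
 assumes \<M>: "finite \<M>" "\<M> <= cyl_sets n (CH0 n)" and A: "A : cyl_sets n (CH0 n)"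
  and sub: "!!B. B : \<M> ==> B \<subset> A" and disj: "!!B B'. B : \<M> ==> B' : \<M> ==> B ~= B' ==> B Int B' = {}"
  and ne: "A - \<Union>\<M> ~= {}"
 defines "p \<equiv> tauH n (ind A) - (\<Sum>B\<in>\<M>. tauH n (ind B))"
 shows "lam_nonneg p & p ~= 0"
proof -
 have AH: "A <= H0 n" using cyl_sets_subset_H0[OF subset_refl A] .
 have "EX i j g. 1 <= i & 1 <= j & g : H0 n & B = QE n (Cdbl n i j) #>\<^bsub>Hgrp n\<^esub> g"
  if "B : cyl_sets n (CH0 n)" "B ~= H0 n" for B
  using that unfolding cyl_sets_def CH0_eq by blast
 moreover have "B ~= H0 n" if "B : \<M>" for B using sub[OF that] AH by blast
 ultimately have "ALL B:\<M>. EX i j g. 1 <= i & 1 <= j & g : H0 n & B = QE n (Cdbl n i j) #>\<^bsub>Hgrp n\<^esub> g"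
  using \<M>(2) by blast
 then obtain iB jB gB where B: "!!B. B : \<M> ==> 1 <= iB B & 1 <= jB B & gB B : H0 n \<and>
   B = QE n (Cdbl n (iB B) (jB B)) #>\<^bsub>Hgrp n\<^esub> gB B" by metis
 have volB: "tauH n (ind B) = wvol n CARD('k) (iB B) (jB B)" if "B : \<M>" for B
  using tauH_eq[OF coset_volume[of "iB B" "jB B" "gB B" n]] B[OF that] by metis
 have below: "below n > 0" if "B : \<M>" for B
 proof (rule ccontr)
  assume "~ below n > 0"
  hence "B = H0 n" using below_0_coset[of n "iB B" "jB B" "gB B"] B[OF that] by (metis gr0I)
  thus False using sub[OF that] AH by blast
 qed
 show ?thesis
 proof (cases "A = H0 n")
  case True
  have pe: "p = fls_const (of_real 1) * fls_X powi 0
    - (\<Sum>B\<in>\<M>. fls_const (of_real ((rvol n CARD('k) (iB B))\<^sup>2)) * fls_X powi (int (2 * below n * jB B)))"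
   unfolding p_def True tauH_eq[OF H0_volume] using volB by (simp add: wvol_def)
  have e: "0 < int (2 * below n * jB B)" if "B : \<M>" for B using below[OF that] B[OF that] by simp
  show ?thesis
   unfolding pe
   by (intro conjI lam_lead_positive[where rB = "%B. (rvol n CARD('k) (iB B))\<^sup>2"] e) simp_all
 next
  case False
  then obtain i j g where Ag: "1 <= i" "1 <= j" "g : H0 n" "A = QE n (Cdbl n i j) #>\<^bsub>Hgrp n\<^esub> g"
   using A unfolding cyl_sets_def CH0_eq by blast
  have ECH: "Cdbl n a b : CH0 n" if "1 <= a" "1 <= b" for a b unfolding CH0_eq using that by blast
  have ord: "j < jB B | j = jB B & i < iB B" if BM: "B : \<M>" for B
  proof (rule ccontr)
   assume "~ ?thesis"
   hence "jB B < j | jB B = j & iB B <= i" by linarith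
   hence s: "Cdbl n i j <= (Cdbl n (iB B) (jB B) :: 'k HH set)" by (rule Cdbl_mono)
   have b: "1 <= iB B" "1 <= jB B" "gB B : H0 n" "B = QE n (Cdbl n (iB B) (jB B)) #>\<^bsub>Hgrp n\<^esub> gB B"
    using B[OF BM] by blast+
   have "gB B : B"
    using HG.rcos_self[OF H0_carrier[OF b(3)] QE_subgroup[OF ECH[OF b(1,2)]]] b(4) by metis
   hence "A Int B ~= {}" using sub[OF BM] by blast
   hence "A <= B"
    using QE_coset_laminar[OF ECH[OF Ag(1,2)] ECH[OF b(1,2)] s Ag(3) b(3)] Ag(4) b(4) by metis
   thus False using sub[OF BM] by blast
  qed
  define S where "S = {B : \<M>. jB B = j}"
  define D where "D = {B : \<M>. j < jB B}"
  have SD: "\<M> = S Un D" "S Int D = {}" "finite S" "finite D"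
   using ord \<M>(1) by (auto simp: S_def D_def)
  define I where "I = Max (insert i (iB ` S))"
  have Ii: "i <= I" and IB: "!!B. B : S ==> iB B <= I" using SD(3) by (auto simp: I_def)
  have I1: "1 <= I" using Ii Ag(1) by simp
  define P' where "P' = QE n (Cdbl n I j :: 'k HH set)"
  define \<Q> where "\<Q> B = {P' #>\<^bsub>Hgrp n\<^esub> x | x. x : B}" for B
  define w where "w = wvol n CARD('k) I j"
  have level: "finite (\<Q> B) & B = \<Union>(\<Q> B) & tauH n (ind B) = of_nat (card (\<Q> B)) * w" if "B : insert A S" for B
  proof -
   obtain i' g' where b: "1 <= i'" "i' <= I" "g' : H0 n" "B = QE n (Cdbl n i' j) #>\<^bsub>Hgrp n\<^esub> g'"
   proof (cases "B = A")
    case True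
    thus ?thesis using that Ag Ii by blast
   next
    case False
    hence "B : S" using \<open>B : insert A S\<close> by simp
    thus ?thesis using that[of "iB B" "gB B"] B[of B] IB[of B] by (simp add: S_def)
   qed
   have fin: "finite (\<Q> B)" "B = \<Union>(\<Q> B)"
    unfolding \<Q>_def P'_def using QE_cosets_finite[OF b(1) Ag(2) b(2,3)] b(4) by metis+
   have BH: "B <= H0 n" unfolding b(4) by (rule QE_coset_subset_H0[OF ECH[OF b(1) Ag(2)] b(3)])
   have "ind B k = (\<Sum>Z\<in>\<Q> B. 1 * ind Z k)" for k
   proof (cases "k : B")
    case True
    then obtain Z where Z: "Z : \<Q> B" "k : Z" using fin(2) by blast
    have uniq: "Z' = Z" if "Z' : \<Q> B" "k : Z'" for Z'
    proof -
     have "EX x. Z = P' #>\<^bsub>Hgrp n\<^esub> x & x : B" using Z(1) unfolding \<Q>_def mem_Collect_eq .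
     then obtain x where x: "Z = P' #>\<^bsub>Hgrp n\<^esub> x" "x : B" by (elim exE conjE)
     have "EX x. Z' = P' #>\<^bsub>Hgrp n\<^esub> x & x : B" using that(1) unfolding \<Q>_def mem_Collect_eq .
     then obtain x' where x': "Z' = P' #>\<^bsub>Hgrp n\<^esub> x'" "x' : B" by (elim exE conjE)
     have xH: "x : H0 n" "x' : H0 n" using x(2) x'(2) BH by auto
     have "Z = P' #>\<^bsub>Hgrp n\<^esub> k"
      unfolding x(1) P'_def
      by (rule QE_coset_repr[OF ECH[OF I1 Ag(2)] xH(1)]) (use Z(2) in \<open>simp add: x(1) P'_def\<close>)
     moreover have "Z' = P' #>\<^bsub>Hgrp n\<^esub> k"
      unfolding x'(1) P'_def
      by (rule QE_coset_repr[OF ECH[OF I1 Ag(2)] xH(2)]) (use that(2) in \<open>simp add: x'(1) P'_def\<close>)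
     ultimately show ?thesis by simp
    qed
    have "(\<Sum>Z'\<in>\<Q> B. 1 * ind Z' k) = (\<Sum>Z'\<in>\<Q> B. if Z' = Z then 1 else 0)"
    proof (intro sum.cong refl)
     fix Z' assume "Z' : \<Q> B"
     hence "k : Z' \<longleftrightarrow> Z' = Z" using uniq Z(2) by blast
     thus "1 * ind Z' k = (if Z' = Z then 1 else 0)" by (simp add: ind_def)
    qed
    thus ?thesis using True Z(1) fin(1) by (simp add: ind_def)
   next
    case False
    hence "k ~: Z" if "Z : \<Q> B" for Z using fin(2) that by blast
    thus ?thesis using False by (simp add: ind_def)
   qed
   hence e: "ind B = (%k. \<Sum>Z\<in>\<Q> B. 1 * ind Z k)" by (rule ext)
   have "has_mu_0 n (ind Z) w" if "Z : \<Q> B" for Z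
    using that BH coset_volume[OF I1 Ag(2)] unfolding \<Q>_def w_def P'_def by blast
   hence "has_mu_0 n (ind B) (\<Sum>Z\<in>\<Q> B. 1 * w)" unfolding e by (intro has_mu_0_sum)
   hence "tauH n (ind B) = of_nat (card (\<Q> B)) * w" using tauH_eq by fastforce
   thus ?thesis using fin by blast
  qed
  have UA: "A <= \<Union>(\<Q> A)"
   by (rule equalityD1[OF level[THEN conjunct2, THEN conjunct1, OF insertI1]])
  have UB: "\<Union>(\<Q> B) <= B" if "B : S" for B
   by (rule equalityD2[OF level[THEN conjunct2, THEN conjunct1, OF insertI2[OF that]]])
  have volQ: "tauH n (ind A) = of_nat (card (\<Q> A)) * w"
   "B : S ==> tauH n (ind B) = of_nat (card (\<Q> B)) * w"
   "finite (\<Q> A)" "B : S ==> finite (\<Q> B)" for B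
   using level[of A] level[of B] by (simp_all only: insert_iff simp_thms)
  have QS: "\<Q> B <= \<Q> A" if "B : S" for B using sub that unfolding \<Q>_def S_def by blast
  have Zne: "Z ~= {}" if "Z : \<Q> B" "B <= H0 n" for Z B
   using that HG.rcos_self[OF H0_carrier QE_subgroup[OF ECH[OF I1 Ag(2)]]] unfolding \<Q>_def P'_def by blast
  have Qdisj: "\<Q> B Int \<Q> B' = {}" if "B : S" "B' : S" "B ~= B'" for B B'
  proof (rule ccontr)
   assume "\<Q> B Int \<Q> B' ~= {}"
   then obtain Z where Z: "Z : \<Q> B" "Z : \<Q> B'" by blast
   have "B <= H0 n" using sub[of B] AH that(1) by (auto simp: S_def)
   hence "Z ~= {}" using Zne Z(1) by blast
   moreover have "Z <= B" "Z <= B'" using UB[OF that(1)] UB[OF that(2)] Z by blast+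
   moreover have "B Int B' = {}" using disj that by (simp add: S_def)
   ultimately show False by blast
  qed
  define \<R> where "\<R> = \<Q> A - (\<Union>B\<in>S. \<Q> B)"
  note finA = volQ(3)
  have "\<R> ~= {}"
  proof
   assume "\<R> = {}"
   hence R: "\<Q> A <= (\<Union>B\<in>S. \<Q> B)" unfolding \<R>_def by blast
   have "A <= \<Union>S"
   proof
    fix k assume "k : A"
    then obtain Z where "Z : \<Q> A" "k : Z" using UA by blast
    then obtain B where "B : S" "Z : \<Q> B" using R by blast
    thus "k : \<Union>S" using UB \<open>k : Z\<close> by blast
   qed
   thus False using ne SD(1) by blast
  qed
  hence N: "card \<R> > 0" using finA by (simp add: \<R>_def card_gt_0_iff)
  have "card (\<Q> A) = card \<R> + (\<Sum>B\<in>S. card (\<Q> B))"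
  proof -
   have "card (\<Union>B\<in>S. \<Q> B) = (\<Sum>B\<in>S. card (\<Q> B))"
    by (intro card_UN_disjoint SD(3) ballI volQ(4) impI Qdisj)
   moreover have "card \<R> = card (\<Q> A) - card (\<Union>B\<in>S. \<Q> B)"
    unfolding \<R>_def using QS finA by (intro card_Diff_subset) (auto intro: finite_subset)
   moreover have "card (\<Union>B\<in>S. \<Q> B) <= card (\<Q> A)" using QS finA by (intro card_mono) auto
   ultimately show ?thesis by simp
  qed
  hence "tauH n (ind A) = of_nat (card \<R>) * w + (\<Sum>B\<in>S. tauH n (ind B))"
   by (simp add: volQ(1,2) distrib_right sum_distrib_right)
  hence "p = of_nat (card \<R>) * w - (\<Sum>B\<in>D. tauH n (ind B))"
   unfolding p_def SD(1) sum.union_disjoint[OF SD(3,4,2)] by simp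
  also have "... = fls_const (of_real (real (card \<R>) * (rvol n CARD('k) I)\<^sup>2)) * fls_X powi (int (2 * below n * j))
    - (\<Sum>B\<in>D. fls_const (of_real ((rvol n CARD('k) (iB B))\<^sup>2)) * fls_X powi (int (2 * below n * jB B)))"
  proof -
   have "of_nat (card \<R>) * w = fls_const (of_real (real (card \<R>) * (rvol n CARD('k) I)\<^sup>2)) * fls_X powi (int (2 * below n * j))"
    unfolding w_def wvol_def fls_of_nat of_real_mult of_real_of_nat_eq fls_const_mult_const[symmetric]
    by (simp only: mult.assoc)
   moreover have "(\<Sum>B\<in>D. tauH n (ind B)) = (\<Sum>B\<in>D. fls_const (of_real ((rvol n CARD('k) (iB B))\<^sup>2)) * fls_X powi (int (2 * below n * jB B)))"
    using volB by (intro sum.cong refl) (simp add: D_def wvol_def)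
   ultimately show ?thesis by simp
  qed
  finally have pe: "p = fls_const (of_real (real (card \<R>) * (rvol n CARD('k) I)\<^sup>2)) * fls_X powi (int (2 * below n * j))
    - (\<Sum>B\<in>D. fls_const (of_real ((rvol n CARD('k) (iB B))\<^sup>2)) * fls_X powi (int (2 * below n * jB B)))" .
  have r: "real (card \<R>) * (rvol n CARD('k) I)\<^sup>2 > 0" using N rvol_pos[of n I, where 'k = 'k] by simp
  have e: "int (2 * below n * j) < int (2 * below n * jB B)" if "B : D" for B
   using that below[of B] by (simp add: D_def)
  show ?thesis
   unfolding pe
   by (intro conjI lam_lead_positive[where rB = "%B. (rvol n CARD('k) (iB B))\<^sup>2"] e r)
 qed
qed

lemma sum_singleton_ind: "finite \<T> ==> A0 : \<T> ==> (!!A. A : \<T> ==> P A \<longleftrightarrow> A = A0)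
  ==> (\<Sum>A\<in>\<T>. f A * (if P A then 1 else 0)) = (f A0 :: lam)"
proof -
 assume *: "finite \<T>" "A0 : \<T>" "!!A. A : \<T> ==> P A \<longleftrightarrow> A = A0"
 have "(\<Sum>A\<in>\<T>. f A * (if P A then 1 else 0)) = (\<Sum>A\<in>\<T>. if A = A0 then f A else 0)"
  by (intro sum.cong refl) (simp add: *(3))
 thus ?thesis using *(1,2) by simp
qed

text \<open>Decompose the sets of a finite laminar family into the disjoint pieces obtained by removing from
 each member its maximal proper submembers; a cylindrical function is constant on each piece.\<close>

theorem tauH_positive:
 fixes F :: "'k::{field,finite} HH => lam"
 assumes F: "F : Cyl n (CH0 n)"
 shows "lam_nonneg (tauH n (%k. lam_dag (F k) * F k))"
  and "tauH n (%k. lam_dag (F k) * F k) = 0 ==> F = (%k. 0)"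
proof -
 obtain \<T>' c' where T': "finite \<T>'" "\<T>' <= cyl_sets n (CH0 n)" "F = (%k. \<Sum>A\<in>\<T>'. c' A * ind A k)"
  using F by (rule CylE)
 define \<T> where "\<T> = insert (H0 n) \<T>'"
 define c where "c A = (if A : \<T>' then c' A else 0)" for A
 have T: "finite \<T>" "\<T> <= cyl_sets n (CH0 n)" "H0 n : \<T>" using T' by (auto simp: \<T>_def cyl_sets_def)
 have Fc: "F k = (\<Sum>A\<in>\<T>. c A * ind A k)" for k
  unfolding T'(3) using T'(1) by (intro sum.mono_neutral_cong_left) (auto simp: \<T>_def c_def)
 have lam: "A <= B | B <= A | A Int B = {}" if "A : \<T>" "B : \<T>" for A B
  using cyl_sets_laminar[OF subset_refl] T(2) that by blast
 have TH: "A <= H0 n" if "A : \<T>" for A using cyl_sets_subset_H0[OF subset_refl] T(2) that by blast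
 define sb where "sb A = {B : \<T>. B \<subset> A}" for A
 define mx where "mx A = {B : sb A. ~ (EX B':sb A. B \<subset> B')}" for A
 define piece where "piece A = A - \<Union>(sb A)" for A
 have mxT: "mx A <= \<T>" "!!B. B : mx A ==> B \<subset> A" "finite (mx A)" for A
  using T(1) by (auto simp: mx_def sb_def)
 have mxdisj: "B Int B' = {}" if "B : mx A" "B' : mx A" "B ~= B'" for A B B'
 proof -
  have "B : sb A" "B' : sb A" "~ B \<subset> B'" "~ B' \<subset> B" using that by (auto simp: mx_def)
  thus ?thesis using lam[of B B'] that(3) by (auto simp: sb_def)
 qed
 have mxUn: "\<Union>(mx A) = \<Union>(sb A)" for A
 proof
  show "\<Union>(sb A) <= \<Union>(mx A)"
  proof
   fix k assume "k : \<Union>(sb A)"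
   hence "{B : sb A. k : B} ~= {}" by blast
   moreover have "finite {B : sb A. k : B}" using T(1) by (simp add: sb_def)
   ultimately obtain B where Bm: "B : {B : sb A. k : B}" "!!B'. B' : {B : sb A. k : B} ==> B <= B' ==> B = B'"
    using finite_has_maximal[of "{B : sb A. k : B}"] by blast
   have "B : mx A" unfolding mx_def using Bm by blast
   thus "k : \<Union>(mx A)" using Bm(1) by blast
  qed
 qed (auto simp: mx_def)
 define pv where "pv A = tauH n (ind A) - (\<Sum>B\<in>mx A. tauH n (ind B))" for A
 have pos: "lam_nonneg (pv A) & pv A ~= 0" if "A : \<T>" "piece A ~= {}" for A
  unfolding pv_def
 proof (rule piece_volume_positive[OF mxT(3)])
  show "mx A <= cyl_sets n (CH0 n)" "A : cyl_sets n (CH0 n)" using mxT(1) T(2) that(1) by blast+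
  show "A - \<Union>(mx A) ~= {}" using that(2) unfolding mxUn piece_def .
 qed (use mxT(2) mxdisj in blast)+
 have ip: "ind (piece A) k = 1 * ind A k + (- 1) * (\<Sum>B\<in>mx A. 1 * ind B k)" for A k
 proof (cases "k : \<Union>(sb A)")
  case True
  then obtain B where Bk: "B : mx A" "k : B" using mxUn by blast
  have "(\<Sum>B\<in>mx A. 1 * (if k : B then 1 else 0 :: lam)) = 1"
   using mxdisj Bk by (intro sum_singleton_ind[OF mxT(3) Bk(1)]) blast
  moreover have "k : A" using Bk mxT(2) by blast
  ultimately show ?thesis using True unfolding ind_def piece_def by simp
 next
  case False
  hence "k ~: B" if "B : mx A" for B using mxUn that by blast
  thus ?thesis using False by (simp add: ind_def piece_def)
 qed
 have vT: "has_mu_0 n (ind A) (tauH n (ind A))" if "A : \<T>" for A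
  using Cyl_has_mu_0[OF subset_refl Cyl_ind] T(2) that by blast
 have pmu: "has_mu_0 n (ind (piece A)) (pv A)" if "A : \<T>" for A
 proof -
  have "has_mu_0 n (%k. \<Sum>B\<in>mx A. 1 * ind B k) (\<Sum>B\<in>mx A. 1 * tauH n (ind B))"
   using vT mxT(1) by (intro has_mu_0_sum) blast
  from has_mu_0_lin[OF vT[OF that] this, of 1 "- 1"]
  have "has_mu_0 n (%k. 1 * ind A k + (- 1) * (\<Sum>B\<in>mx A. 1 * ind B k)) (pv A)" by (simp add: pv_def)
  thus ?thesis unfolding ip[symmetric] .
 qed
 define v where "v A = (\<Sum>B\<in>{B : \<T>. A <= B}. c B)" for A
 have point: "EX A0:\<T>. F k = v A0 & k : piece A0 & (ALL A:\<T>. k : piece A \<longleftrightarrow> A = A0)" if k: "k : H0 n" for k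
 proof -
  let ?X = "{A : \<T>. k : A}"
  have "?X ~= {}" "finite ?X" using T k by auto
  then obtain A0 where A0: "A0 : ?X" "!!A. A : ?X ==> A <= A0 ==> A0 = A"
   using finite_has_minimal[of ?X] by blast
  have le: "A0 <= A" if "A : \<T>" "k : A" for A
   using lam[of A0 A] A0 that by blast
  have p0: "k : piece A0" using A0 unfolding piece_def sb_def by blast
  have "A = A0" if "A : \<T>" "k : piece A" for A
  proof (rule ccontr)
   assume "A ~= A0"
   moreover have "A0 <= A" using le that unfolding piece_def by blast
   ultimately have "A0 : sb A" using A0(1) unfolding sb_def by blast
   thus False using that(2) A0(1) unfolding piece_def by blast
  qed
  moreover have "F k = v A0"
  proof -
   have "F k = (\<Sum>A\<in>\<T>. if k : A then c A else 0)"
    unfolding Fc by (intro sum.cong refl) (simp add: ind_def)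
   also have "... = (\<Sum>A\<in>?X. c A)" using T(1) by (simp add: sum.inter_filter)
   also have "?X = {B : \<T>. A0 <= B}" using le A0(1) by blast
   finally show ?thesis by (simp add: v_def)
  qed
  ultimately show ?thesis using p0 A0(1) by blast
 qed
 define nv where "nv A = lam_dag (v A) * v A" for A
 have sq: "lam_dag (F k) * F k = (\<Sum>A\<in>\<T>. nv A * ind (piece A) k)" for k
 proof (cases "k : H0 n")
  case True
  then obtain A0 where A0: "A0 : \<T>" "F k = v A0" "ALL A:\<T>. k : piece A \<longleftrightarrow> A = A0"
   using point by blast
  have "(\<Sum>A\<in>\<T>. nv A * (if k : piece A then 1 else 0)) = nv A0"
   using A0(3) by (intro sum_singleton_ind[OF T(1) A0(1)]) blast
  thus ?thesis unfolding ind_def using A0(2) by (simp add: nv_def)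
 next
  case False
  hence "k ~: piece A" if "A : \<T>" for A using TH[OF that] unfolding piece_def by blast
  moreover have "F k = 0" by (rule Cyl_support[OF subset_refl F False])
  ultimately show ?thesis by (simp add: ind_def)
 qed
 have "has_mu_0 n (%k. lam_dag (F k) * F k) (\<Sum>A\<in>\<T>. nv A * pv A)"
  unfolding sq using pmu by (intro has_mu_0_sum)
 hence tau: "tauH n (%k. lam_dag (F k) * F k) = (\<Sum>A\<in>\<T>. nv A * pv A)" by (rule tauH_eq)
 have sqpos: "lam_nonneg (nv A * pv A)" if "A : \<T>" for A
 proof (cases "piece A = {}")
  case True
  have "pv A = 0" using has_mu_0_zero[OF pmu[OF that]] True by (simp add: ind_def)
  thus ?thesis by simp
 next
  case False
  thus ?thesis using pos[OF that] lam_nonneg_mult[OF lam_nonneg_norm] unfolding nv_def by blast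
 qed
 from lam_nonneg_sum[where I = \<T> and f = "%A. nv A * pv A", OF T(1) sqpos]
 have s: "lam_nonneg (\<Sum>A\<in>\<T>. nv A * pv A)" "(\<Sum>A\<in>\<T>. nv A * pv A) = 0 ==> ALL A:\<T>. nv A * pv A = 0"
  by blast+
 show "lam_nonneg (tauH n (%k. lam_dag (F k) * F k))" unfolding tau by (rule s(1))
 assume "tauH n (%k. lam_dag (F k) * F k) = 0"
 hence z: "ALL A:\<T>. nv A * pv A = 0" using s(2) tau by simp
 show "F = (%k. 0)"
 proof
  fix k
  show "F k = 0"
  proof (cases "k : H0 n")
   case True
   then obtain A0 where A0: "A0 : \<T>" "F k = v A0" "k : piece A0" using point by blast
   hence "pv A0 ~= 0" using pos by blast
   hence "nv A0 = 0" using z A0(1) by auto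
   thus ?thesis using A0(2) by (simp add: nv_def)
  qed (rule Cyl_support[OF subset_refl F])
 qed
qed

section \<open>The spherical family and its morphisms\<close>

lemma nuF_mult_left: "a ~= 0 ==> a' ~= 0 ==> c ~= 0 ==> nuF (a * a') c = nuF a c + nuF a' c"
 for a :: "'k::field F"
 by (simp add: nuF_eq vu_mult algebra_simps)

lemma nuF_mult_right: "c ~= 0 ==> a ~= 0 ==> a' ~= 0 ==> nuF c (a * a') = nuF c a + nuF c a'"
 for a :: "'k::field F"
 by (simp add: nuF_eq vu_mult algebra_simps)

lemma BH_fst_diag:
 assumes "b : BH n" "r < n"
 shows "fst b $$ (r, r) ~= 0" "snd b $$ (r, r) ~= 0"
 using assms Bor_iff[of "fst b" n] Bor_iff[of "snd b" n] by (auto simp: BH_def)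

locale unitary_param =
 fixes n :: nat and \<alpha> :: "nat => lam"
 assumes unitary: "r < n ==> lam_dag (\<alpha> r) * \<alpha> r = 1"
begin

abbreviation gm (infixl "\<odot>" 70) where "x \<odot> y \<equiv> x \<otimes>\<^bsub>Hgrp n\<^esub> y"
abbreviation gi where "gi x \<equiv> inv\<^bsub>Hgrp n\<^esub> x"
abbreviation g1 where "g1 \<equiv> \<one>\<^bsub>Hgrp n\<^esub>"
abbreviation lco (infixr "<|" 71) where "x <| s \<equiv> x <#\<^bsub>Hgrp n\<^esub> s"
abbreviation \<sigma> where "\<sigma> \<equiv> sigma n \<alpha>"
abbreviation GG where "GG \<equiv> carrier (Hgrp n)"

abbreviation SC where "SC \<equiv> S_cat n \<alpha>"
abbreviation SFc where "SFc \<equiv> SF_cat n \<alpha>"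
abbreviation vp where "vp \<equiv> sph_pow n \<alpha>"
abbreviation Sh where "Sh \<equiv> S_hom n \<alpha>"
abbreviation Ih where "Ih C r s \<equiv> I_hom n C (sph_pow n \<alpha> C r) (sph_pow n \<alpha> C s)"

lemma \<alpha>_nonzero: "r < n ==> \<alpha> r ~= 0"
 using unitary[of r] by auto

text \<open>\<open>nuF\<close> is additive in both arguments and the diagonal entries of triangular matrices multiply, so \<open>\<sigma>\<close> is a bicharacter.\<close>

lemma \<sigma>_mult_left: "b : BH n ==> b' : BH n ==> c : BH n ==> \<sigma> (b \<odot> b') c = \<sigma> b c * \<sigma> b' c"
 unfolding sigma_def prod.distrib[symmetric]
proof (rule prod.cong[OF refl])
 fix r assume bc: "b : BH n" "b' : BH n" "c : BH n" and r: "r : {..<n}"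
 have "fst (b \<odot> b') $$ (r, r) = fst b $$ (r, r) * fst b' $$ (r, r)"
  using bc r Bor_diag_mult[of "fst b" n "fst b'" r] by (auto simp: Hgrp_mult BH_def)
 thus "\<alpha> r powi - nuF (fst (b \<odot> b') $$ (r, r)) (snd c $$ (r, r))
  = \<alpha> r powi - nuF (fst b $$ (r, r)) (snd c $$ (r, r)) * \<alpha> r powi - nuF (fst b' $$ (r, r)) (snd c $$ (r, r))"
  using nuF_mult_left[OF BH_fst_diag(1)[OF bc(1)] BH_fst_diag(1)[OF bc(2)] BH_fst_diag(2)[OF bc(3)], of r r r]
   r \<alpha>_nonzero[of r] by (simp add: power_int_add[symmetric])
qed

lemma \<sigma>_mult_right: "c : BH n ==> b : BH n ==> b' : BH n ==> \<sigma> c (b \<odot> b') = \<sigma> c b * \<sigma> c b'"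
 unfolding sigma_def prod.distrib[symmetric]
proof (rule prod.cong[OF refl])
 fix r assume bc: "c : BH n" "b : BH n" "b' : BH n" and r: "r : {..<n}"
 have "snd (b \<odot> b') $$ (r, r) = snd b $$ (r, r) * snd b' $$ (r, r)"
  using bc r Bor_diag_mult[of "snd b" n "snd b'" r] by (auto simp: Hgrp_mult BH_def)
 thus "\<alpha> r powi - nuF (fst c $$ (r, r)) (snd (b \<odot> b') $$ (r, r))
  = \<alpha> r powi - nuF (fst c $$ (r, r)) (snd b $$ (r, r)) * \<alpha> r powi - nuF (fst c $$ (r, r)) (snd b' $$ (r, r))"
  using nuF_mult_right[OF BH_fst_diag(1)[OF bc(1)] BH_fst_diag(2)[OF bc(2)] BH_fst_diag(2)[OF bc(3)], of r r r]
   r \<alpha>_nonzero[of r] by (simp add: power_int_add[symmetric])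
qed

lemma \<sigma>_nonzero: "\<sigma> b c ~= 0"
 unfolding sigma_def using \<alpha>_nonzero by (simp add: power_int_eq_0_iff)

lemma \<sigma>_Q0: assumes "q : Q0 n" "q' : Q0 n" shows "\<sigma> q q' = 1"
 unfolding sigma_def
proof (rule prod.neutral, intro ballI)
 fix r assume r: "r : {..<n}"
 have "fst q $$ (r, r) : O2u" "snd q' $$ (r, r) : O2u"
  using assms r Q1_iff[of "fst q" n] Q1_iff[of "snd q'" n] unfolding Q0_eq by auto
 hence "nuF (fst q $$ (r, r)) (snd q' $$ (r, r)) = 0"
  by (simp add: O2u_def nuF_eq)
 thus "\<alpha> r powi - nuF (fst q $$ (r, r)) (snd q' $$ (r, r)) = 1" by simp
qed

lemmas BH_closed [simp] = subgroup.m_closed[OF BH_subgroup] subgroup.m_inv_closed[OF BH_subgroup]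
 subgroup.one_closed[OF BH_subgroup]
lemmas H0_closed [simp] = subgroup.m_closed[OF H0_subgroup] subgroup.m_inv_closed[OF H0_subgroup]
 subgroup.one_closed[OF H0_subgroup]
lemmas Q0_closed [simp] = subgroup.m_closed[OF Q0_subgroup] subgroup.m_inv_closed[OF Q0_subgroup]
 subgroup.one_closed[OF Q0_subgroup]
lemmas GG_of [simp] = BH_carrier H0_carrier Q0_carrier

lemma Q0_BH [simp]: "q : Q0 n ==> q : BH n" by (simp add: Q0_def)

lemma \<sigma>_one: "b : BH n ==> \<sigma> g1 b = 1" "b : BH n ==> \<sigma> b g1 = 1"
proof -
 show "b : BH n ==> \<sigma> g1 b = 1"
  using \<sigma>_mult_left[of g1 g1 b] \<sigma>_nonzero[of g1 b] by simp
 show "b : BH n ==> \<sigma> b g1 = 1"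
  using \<sigma>_mult_right[of b g1 g1] \<sigma>_nonzero[of b g1] by simp
qed

lemma inv_mult_cancel [simp]: "x : GG ==> y : GG ==> gi x \<odot> (x \<odot> y) = y"
 "x : GG ==> y : GG ==> x \<odot> (gi x \<odot> y) = y"
 by (simp_all add: HG.m_assoc[symmetric])

lemma lco_eq_iff:
 assumes "C : CH0 n" "g : GG" "g' : GG"
 shows "g <| C = g' <| C \<longleftrightarrow> (EX c:C. g' = g \<odot> c)"
proof
 assume e: "g <| C = g' <| C"
 have "g' \<odot> g1 : g' <| C" using subgroup.one_closed[OF CH0_subgroup[OF assms(1)]]
  unfolding l_coset_def by blast
 thus "EX c:C. g' = g \<odot> c" unfolding e[symmetric] using assms by (simp add: l_coset_def)
next
 assume "EX c:C. g' = g \<odot> c"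
 then obtain c where c: "c : C" "g' = g \<odot> c" by blast
 have sub: "subgroup C (Hgrp n)" using assms(1) by (rule CH0_subgroup)
 hence CG: "C <= GG" by (rule subgroup.subset)
 have "c <| C = C"
  by (rule HG.coset_join3[OF subsetD[OF CG c(1)] sub c(1)])
 thus "g <| C = g' <| C" using HG.lcos_m_assoc[OF CG assms(2), of c] c CG by (metis subsetD)
qed

lemma lco_XX_iff:
 assumes C: "C : CH0 n" and g: "g : GG"
 shows "g <| C : XX n C \<longleftrightarrow> g : H0 n"
proof
 assume "g <| C : XX n C"
 then obtain k where k: "k : H0 n" "k <| C = g <| C" unfolding XX_def by blast
 then obtain c where "c : C" "g = k \<odot> c" using lco_eq_iff[OF C _ g, of k] by auto
 thus "g : H0 n" using CH0_subset_H0[OF C] H0_closed(1)[OF k(1)] by (metis subsetD)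
qed (simp add: XX_def)

lemma lco_SS: "g : GG ==> g <| C : SS n C"
 unfolding SS_def by blast

lemma lco_lco: "C : CH0 n ==> x : GG ==> g : GG ==> x <| g <| C = (x \<odot> g) <| C"
 by (rule HG.lcos_m_assoc[OF subgroup.subset[OF CH0_subgroup]])

text \<open>For a level \<open>C\<close> inside \<open>H0 n\<close> the fibre of the spherical family at \<open>gC\<close> depends only on \<open>g\<close>:
 the condition \<open>b\<^sup>-\<^sup>1gC \<in> X\<^sub>C\<close> means \<open>b\<^sup>-\<^sup>1g \<in> H0 n\<close>. This is what makes the
 refinement maps and the structure maps \<open>phi\<close> equalities.\<close>

definition Fb :: "'k::{field,finite} HH => ('k HH => lam) set" where
 "Fb g = {w. (ALL b. w b ~= 0 --> b : BH n & gi b \<odot> g : H0 n)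
  & (ALL b:BH n. ALL q:Q0 n. w (b \<odot> q) = \<sigma> b q * w b)}"

lemma Fb_iff: "w : Fb g \<longleftrightarrow> (ALL b. w b ~= 0 --> b : BH n & gi b \<odot> g : H0 n)
  & (ALL b:BH n. ALL q:Q0 n. w (b \<odot> q) = \<sigma> b q * w b)"
 unfolding Fb_def by simp

lemma sph_fib_eq:
 assumes "C : CH0 n" "g : GG"
 shows "sph_fib n \<alpha> C (g <| C) = mk_module (Fb g) (%b. 0) (%v w b. v b + w b) (%c w b. c * w b)"
proof -
 have "b : BH n & gi b <| g <| C : XX n C \<longleftrightarrow> b : BH n & gi b \<odot> g : H0 n" for b
  using assms lco_lco[of C "gi b" g] lco_XX_iff[of C "gi b \<odot> g"] by auto
 thus ?thesis unfolding sph_fib_def Fb_def by simp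
qed

definition actF :: "'k::{field,finite} HH => ('k HH => lam) => 'k HH => lam" where
 "actF b w = (%c. if c : BH n then \<sigma> b (gi b \<odot> c) * w (gi b \<odot> c) else 0)"

lemma actF_Fb:
 fixes b :: "'k::{field,finite} HH"
 assumes b: "b : BH n" and g: "g : GG" and w: "w : Fb g"
 shows "actF b w : Fb (b \<odot> g)"
 unfolding Fb_iff
proof (intro conjI allI impI ballI)
 fix c assume nz: "actF b w c ~= 0"
 thus c: "c : BH n" unfolding actF_def by (simp split: if_splits)
 from nz c have "w (gi b \<odot> c) ~= 0" unfolding actF_def by auto
 hence "gi (gi b \<odot> c) \<odot> g : H0 n" using w unfolding Fb_iff by blast
 thus "gi c \<odot> (b \<odot> g) : H0 n"
  using b c g by (simp add: HG.inv_mult_group HG.m_assoc)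
next
 fix c q :: "'k HH" assume c: "c : BH n" and q: "q : Q0 n"
 have e: "gi b \<odot> (c \<odot> q) = (gi b \<odot> c) \<odot> q" using b c q by (simp add: HG.m_assoc)
 have "\<sigma> c q = \<sigma> (b \<odot> (gi b \<odot> c)) q" using b c by simp
 hence 1: "\<sigma> c q = \<sigma> b q * \<sigma> (gi b \<odot> c) q" using b c q \<sigma>_mult_left[of b "gi b \<odot> c" q] by simp
 have 2: "w ((gi b \<odot> c) \<odot> q) = \<sigma> (gi b \<odot> c) q * w (gi b \<odot> c)" using w b c q unfolding Fb_iff by simp
 show "actF b w (c \<odot> q) = \<sigma> c q * actF b w c"
  using b c q 1 2 \<sigma>_mult_right[of b "gi b \<odot> c" q] by (simp add: actF_def e)
qed

lemma actF_actF:
 assumes b: "b : BH n" "b' : BH n"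
 shows "actF b (actF b' w) = (%c. \<sigma> b b' * actF (b \<odot> b') w c)"
proof
 fix c
 show "actF b (actF b' w) c = \<sigma> b b' * actF (b \<odot> b') w c"
 proof (cases "c : BH n")
  case True
  define x where "x = gi b' \<odot> (gi b \<odot> c)"
  have x: "x : BH n" "gi (b \<odot> b') \<odot> c = x" "gi b \<odot> c = b' \<odot> x"
   using b True by (simp_all add: x_def HG.inv_mult_group HG.m_assoc)
  show ?thesis using b True x \<sigma>_mult_left[of b b' x] \<sigma>_mult_right[of b b' x]
   by (simp add: actF_def x(2,3))
 qed (simp add: actF_def)
qed

lemma actF_one: "w : Fb g ==> actF g1 w = w"
 unfolding Fb_iff actF_def using \<sigma>_one by (intro ext) auto

lemma Fb_scale: "w : Fb g ==> (%b. c * w b) : Fb g"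
 unfolding Fb_iff by (auto simp: algebra_simps)

lemma Fb_0: "(%b. 0) : Fb g" unfolding Fb_iff by simp

lemma Fb_add:
 fixes w :: "'a::{field,finite} HH => lam"
 assumes w: "w : Fb g" "w' : Fb g"
 shows "(%b. w b + w' b) : Fb g"
 unfolding Fb_iff
proof (intro conjI allI impI ballI)
 fix b assume "w b + w' b ~= 0"
 hence "w b ~= 0 | w' b ~= 0" by auto
 thus "b : BH n" "gi b \<odot> g : H0 n" using w unfolding Fb_iff by blast+
next
 fix b q :: "'a HH" assume "b : BH n" "q : Q0 n"
 hence "w (b \<odot> q) = \<sigma> b q * w b" "w' (b \<odot> q) = \<sigma> b q * w' b"
  using w unfolding Fb_iff by blast+
 thus "w (b \<odot> q) + w' (b \<odot> q) = \<sigma> b q * (w b + w' b)" by (simp add: distrib_left)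
qed

lemma actF_scale: "actF b (%c. a * w c) = (%c. a * actF b w c)"
 by (auto simp: actF_def)

lemma actF_add: "actF b (%c. v c + w c) = (%c. actF b v c + actF b w c)"
 by (auto simp: actF_def algebra_simps)

text \<open>By the cocycle identity the actions of \<open>b\<close> and of its inverse are inverse to each other up to the scalar \<open>\<sigma> b b\<^sup>-\<^sup>1\<close>.\<close>

lemma actF_inverse:
 assumes b: "b : BH n" and w: "w : Fb g"
 shows "actF b (%c. inverse (\<sigma> b (gi b)) * actF (gi b) w c) = w"
  "(%c. inverse (\<sigma> b (gi b)) * actF (gi b) (actF b w) c) = w"
proof -
 show "actF b (%c. inverse (\<sigma> b (gi b)) * actF (gi b) w c) = w"
  unfolding actF_scale actF_actF[OF b BH_closed(2)[OF b]]
  using b actF_one[OF w] \<sigma>_nonzero[of b "gi b"] by (simp add: mult.assoc[symmetric])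
 have "\<sigma> b (gi b) * \<sigma> b b = 1" "\<sigma> (gi b) b * \<sigma> b b = 1"
  using \<sigma>_mult_right[of b "gi b" b] \<sigma>_mult_left[of "gi b" b b] b \<sigma>_one[OF b] by simp_all
 hence "\<sigma> b (gi b) = \<sigma> (gi b) b" using \<sigma>_nonzero[of b b] by (metis mult_cancel_right)
 thus "(%c. inverse (\<sigma> b (gi b)) * actF (gi b) (actF b w) c) = w"
  unfolding actF_actF[OF BH_closed(2)[OF b] b]
  using b actF_one[OF w] \<sigma>_nonzero[of "gi b" b] by (simp add: mult.assoc[symmetric])
qed

end

text \<open>Fibres and spaces of morphisms are recognised as modules by an injection into functions that respects the pointwise
 operations; the equational axioms are then inherited.\<close>

lemma module_transport:
 fixes M :: "(lam, 'm) module" and \<beta> :: "'m => 'i => lam"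
 assumes inj: "inj_on \<beta> (carrier M)"
  and zero: "\<zero>\<^bsub>M\<^esub> : carrier M" "\<beta> \<zero>\<^bsub>M\<^esub> = (%i. 0)"
  and add: "!!x y. x : carrier M ==> y : carrier M ==> x \<oplus>\<^bsub>M\<^esub> y : carrier M"
   "!!x y. x : carrier M ==> y : carrier M ==> \<beta> (x \<oplus>\<^bsub>M\<^esub> y) = (%i. \<beta> x i + \<beta> y i)"
  and smult: "!!c x. x : carrier M ==> c \<odot>\<^bsub>M\<^esub> x : carrier M"
   "!!c x. x : carrier M ==> \<beta> (c \<odot>\<^bsub>M\<^esub> x) = (%i. c * \<beta> x i)"
 shows "module lam_ring M"
proof -
 note eqI = inj_onD[OF inj]
 have "cring lam_ring"
 proof (rule cringI)
  show "abelian_group lam_ring"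
   by (rule abelian_groupI) (auto simp: lam_ring_def algebra_simps intro: exI[of _ "- _"] add.left_inverse)
  show "Group.comm_monoid lam_ring"
   by (rule comm_monoidI) (auto simp: lam_ring_def algebra_simps)
 qed (auto simp: lam_ring_def algebra_simps)
 moreover have "abelian_group M"
 proof (rule abelian_groupI)
  fix x y z assume x: "x : carrier M" and y: "y : carrier M" and z: "z : carrier M"
  show "x \<oplus>\<^bsub>M\<^esub> y : carrier M" by (rule add(1)[OF x y])
  show "x \<oplus>\<^bsub>M\<^esub> y \<oplus>\<^bsub>M\<^esub> z = x \<oplus>\<^bsub>M\<^esub> (y \<oplus>\<^bsub>M\<^esub> z)"
   by (rule eqI) (simp_all add: add x y z add.assoc)
  show "x \<oplus>\<^bsub>M\<^esub> y = y \<oplus>\<^bsub>M\<^esub> x"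
   by (rule eqI) (simp_all add: add x y add.commute)
  show "\<zero>\<^bsub>M\<^esub> \<oplus>\<^bsub>M\<^esub> x = x"
   by (rule eqI) (simp_all add: add x zero)
  have "(- 1) \<odot>\<^bsub>M\<^esub> x \<oplus>\<^bsub>M\<^esub> x = \<zero>\<^bsub>M\<^esub>"
   by (rule eqI) (simp_all add: add x zero smult)
  thus "EX y:carrier M. y \<oplus>\<^bsub>M\<^esub> x = \<zero>\<^bsub>M\<^esub>" using smult(1)[OF x] by blast
 qed (rule zero(1))
 ultimately show ?thesis
 proof (rule moduleI)
  fix a b x y assume x: "x : carrier M" and y: "y : carrier M"
  show "a \<odot>\<^bsub>M\<^esub> x : carrier M" by (rule smult(1)[OF x])
  show "(a \<oplus>\<^bsub>lam_ring\<^esub> b) \<odot>\<^bsub>M\<^esub> x = a \<odot>\<^bsub>M\<^esub> x \<oplus>\<^bsub>M\<^esub> b \<odot>\<^bsub>M\<^esub> x"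
   by (rule eqI) (simp_all add: add smult x lam_ring_def algebra_simps)
  show "a \<odot>\<^bsub>M\<^esub> (x \<oplus>\<^bsub>M\<^esub> y) = a \<odot>\<^bsub>M\<^esub> x \<oplus>\<^bsub>M\<^esub> a \<odot>\<^bsub>M\<^esub> y"
   by (rule eqI) (simp_all add: add smult x y algebra_simps)
  show "(a \<otimes>\<^bsub>lam_ring\<^esub> b) \<odot>\<^bsub>M\<^esub> x = a \<odot>\<^bsub>M\<^esub> (b \<odot>\<^bsub>M\<^esub> x)"
   by (rule eqI) (simp_all add: smult x lam_ring_def algebra_simps)
  show "\<one>\<^bsub>lam_ring\<^esub> \<odot>\<^bsub>M\<^esub> x = x"
   by (rule eqI) (simp_all add: smult x lam_ring_def)
 qed
qed

context unitary_param begin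

definition PF :: "nat => 'k::{field,finite} HH => (nat => 'k HH => lam) set" where
 "PF r g = {..<r} \<rightarrow>\<^sub>E Fb g"

definition actP :: "nat => 'k::{field,finite} HH => (nat => 'k HH => lam) => nat => 'k HH => lam" where
 "actP r b v = (\<lambda>i\<in>{..<r}. actF b (v i))"

lemma PF_nth: "v : PF r g ==> i < r ==> v i : Fb g"
 unfolding PF_def by auto

lemma PF_I: "(!!i. i < r ==> v i : Fb g) ==> (\<lambda>i\<in>{..<r}. v i) : PF r g"
 unfolding PF_def by auto

lemma PF_eqI:
 fixes v :: "nat => 'a::{field,finite} HH => lam"
 assumes v: "v : PF r g" "w : PF r g'" and e: "!!i b. i < r ==> v i b = w i b"
 shows "v = w"
proof (rule extensionalityI[of _ "{..<r}"])
 show "v i = w i" if "i : {..<r}" for i using e that by (intro ext) simp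
qed (use v in \<open>auto simp: PF_def PiE_iff\<close>)

context
 fixes C :: "'k::{field,finite} HH set"
 assumes C: "C : CH0 n"
begin

lemma vpow_fib: "g : GG ==> fib (vp C r) (g <| C) =
  mk_module (PF r g) (\<lambda>i\<in>{..<r}. %b. 0) (%v w. \<lambda>i\<in>{..<r}. %b. v i b + w i b) (%c v. \<lambda>i\<in>{..<r}. %b. c * v i b)"
 unfolding sph_pow_def pow_fam_def sph_def using lco_SS[of g C] sph_fib_eq[OF C, of g]
 by (simp add: PF_def mk_module_def)

lemma vpow_carrier: "g : GG ==> carrier (fib (vp C r) (g <| C)) = PF r g"
 by (simp add: vpow_fib mk_module_def)

lemma vpow_act: "b : BH n ==> g : GG ==> act (vp C r) b (g <| C) = (\<lambda>v\<in>PF r g. actP r b v)"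
proof (rule ext)
 fix v assume b: "b : BH n" and g: "g : GG"
 have 1: "carrier (sph_fib n \<alpha> C (g <| C)) = Fb g" using sph_fib_eq[OF C g] by (simp add: mk_module_def)
 show "act (vp C r) b (g <| C) v = (\<lambda>v\<in>PF r g. actP r b v) v"
  using b lco_SS[OF g, of C] unfolding sph_pow_def pow_fam_def sph_def actP_def actF_def PF_def
  by (auto simp: 1 fun_eq_iff PiE_iff restrict_def)
qed

lemma SS_ball: "(ALL s:SS n C. P s) \<longleftrightarrow> (ALL g:GG. P (g <| C))"
 unfolding SS_def by blast

lemma XX_ball: "(ALL s:XX n C. P s) \<longleftrightarrow> (ALL k:H0 n. P (k <| C))"
 unfolding XX_def by blast

lemma SS_ext: "f : extensional (SS n C) ==> f' : extensional (SS n C) ==>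
  (!!g. g : GG ==> f (g <| C) = f' (g <| C)) ==> f = f'"
 by (rule extensionalityI) (auto simp: SS_def)

end

lemma actP_PF: "b : BH n ==> g : GG ==> v : PF r g ==> actP r b v : PF r (b \<odot> g)"
 unfolding actP_def by (intro PF_I actF_Fb PF_nth)

lemma actP_bij:
 fixes b :: "'k::{field,finite} HH"
 assumes b: "b : BH n" and g: "g : GG"
 shows "bij_betw (actP r b) (PF r g) (PF r (b \<odot> g))"
proof (rule bij_betwI)
 let ?inv = "%v. \<lambda>i\<in>{..<r}. %c. inverse (\<sigma> b (gi b)) * actF (gi b) (v i) c"
 have gb: "gi b \<odot> (b \<odot> g) = g" using b g by simp
 show "actP r b : PF r g \<rightarrow> PF r (b \<odot> g)" using actP_PF[OF b g] by blast
 show "?inv : PF r (b \<odot> g) \<rightarrow> PF r g"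
 proof
  fix v assume v: "v : PF r (b \<odot> g)"
  have "actF (gi b) (v i) : Fb g" if "i < r" for i
   using actF_Fb[of "gi b" "b \<odot> g" "v i"] PF_nth[OF v that] b g gb by simp
  thus "?inv v : PF r g" by (intro PF_I Fb_scale)
 qed
 show "?inv (actP r b v) = v" if v: "v : PF r g" for v
 proof (rule extensionalityI[of _ "{..<r}"])
  fix i assume i: "i : {..<r}"
  thus "?inv (actP r b v) i = v i"
   using actF_inverse(2)[OF b PF_nth[OF v, of i]] by (simp add: actP_def)
 qed (use v in \<open>auto simp: PF_def PiE_iff\<close>)
 show "actP r b (?inv v) = v" if v: "v : PF r (b \<odot> g)" for v
 proof (rule extensionalityI[of _ "{..<r}"])
  fix i assume i: "i : {..<r}"
  thus "actP r b (?inv v) i = v i"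
   using actF_inverse(1)[OF b PF_nth[OF v, of i]] by (simp add: actP_def)
 qed (use v in \<open>auto simp: PF_def PiE_iff actP_def\<close>)
qed

lemma PF_add: "v : PF r g ==> w : PF r g ==> (\<lambda>i\<in>{..<r}. %b. v i b + w i b) : PF r g"
 by (intro PF_I Fb_add PF_nth)

lemma PF_scale: "v : PF r g ==> (\<lambda>i\<in>{..<r}. %b. c * v i b) : PF r g"
 by (intro PF_I Fb_scale PF_nth)

lemma PF_0: "(\<lambda>i\<in>{..<r}. %b. 0) : PF r g"
 by (intro PF_I Fb_0)

lemma vpow_module:
 fixes C :: "'a::{field,finite} HH set"
 assumes C: "C : CH0 n" and g: "g : GG"
 shows "module lam_ring (fib (vp C r) (g <| C))"
proof (rule module_transport[where \<beta> = "%v (i, b). if i < r then v i b else 0"])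
 show "inj_on (%v (i, b). if i < r then v i b else 0) (carrier (fib (vp C r) (g <| C)))"
  unfolding vpow_carrier[OF C g]
 proof (rule inj_onI)
  fix v w assume v: "v : PF r g" "w : PF r g"
   and e: "(%(i, b). if i < r then v i b else 0) = (%(i, b). if i < r then w i b else 0)"
  show "v = w" using v
  proof (rule PF_eqI)
   fix i b assume "i < r"
   thus "v i b = w i b" using fun_cong[OF e, of "(i, b)"] by simp
  qed
 qed
qed (auto simp: vpow_fib[OF C g] mk_module_def PF_add PF_scale PF_0 fun_eq_iff)

lemma vpow_fam_obj:
 fixes C :: "'a::{field,finite} HH set"
 assumes C: "C : CH0 n"
 shows "fam_obj n \<alpha> C (vp C r)"
 unfolding fam_obj_def SS_ball[OF C]
proof (intro conjI ballI)
 show "fib (vp C r) : extensional (SS n C)" "act (vp C r) : extensional (BH n)"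
  by (simp_all add: sph_pow_def pow_fam_def)
next
 fix b :: "'a HH" assume "b : BH n"
 thus "act (vp C r) b : extensional (SS n C)"
  by (simp add: sph_pow_def pow_fam_def)
next
 fix b g :: "'a HH" assume b: "b : BH n" and g: "g : GG"
 have bg: "b \<odot> g : GG" "b <| g <| C = (b \<odot> g) <| C" using b g lco_lco[OF C] by simp_all
 show "act (vp C r) b (g <| C) : extensional (carrier (fib (vp C r) (g <| C)))"
  by (simp add: vpow_act[OF C b g] vpow_carrier[OF C g])
 show "bij_betw (act (vp C r) b (g <| C)) (carrier (fib (vp C r) (g <| C)))
  (carrier (fib (vp C r) (b <| g <| C)))"
  unfolding bg(2) vpow_carrier[OF C g] vpow_carrier[OF C bg(1)] vpow_act[OF C b g]
  using actP_bij[OF b g, of r] by (simp add: bij_betw_def)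
 show "lin_map (fib (vp C r) (g <| C)) (fib (vp C r) (b <| g <| C)) (act (vp C r) b (g <| C))"
  unfolding lin_map_def bg(2) vpow_act[OF C b g] vpow_fib[OF C g] vpow_fib[OF C bg(1)]
  using actP_PF[OF b g]
  by (auto simp: mk_module_def PF_add PF_scale actP_def actF_add actF_scale)
next
 fix b b' g :: "'a HH" and v
 assume b: "b : BH n" "b' : BH n" and g: "g : GG" and v: "v : carrier (fib (vp C r) (g <| C))"
 have v: "v : PF r g" using v by (simp add: vpow_carrier[OF C g])
 have bg: "b' \<odot> g : GG" "b \<odot> b' \<odot> g : GG" "b' <| g <| C = (b' \<odot> g) <| C" "(b \<odot> b') <| g <| C = (b \<odot> b' \<odot> g) <| C"
  using b g lco_lco[OF C] by simp_all
 show "\<sigma> b b' \<odot>\<^bsub>fib (vp C r) ((b \<odot> b') <| g <| C)\<^esub> act (vp C r) (b \<odot> b') (g <| C) v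
   = act (vp C r) b (b' <| g <| C) (act (vp C r) b' (g <| C) v)"
  unfolding bg(3,4) vpow_act[OF C b(2) g] vpow_act[OF C b(1) bg(1)]
   vpow_act[OF C BH_closed(1)[OF b] g] vpow_fib[OF C bg(2)]
  using v actP_PF[OF b(2) g v] by (auto simp: mk_module_def actP_def actF_actF[OF b])
next
 fix g :: "'a HH" and v assume g: "g : GG" and v: "v : carrier (fib (vp C r) (g <| C))"
 have v: "v : PF r g" using v by (simp add: vpow_carrier[OF C g])
 show "act (vp C r) g1 (g <| C) v = v"
  unfolding vpow_act[OF C BH_closed(3) g] actP_def using v actF_one[OF PF_nth[OF v]]
  by (auto simp: PF_def PiE_iff extensional_def)
qed (auto intro: vpow_module[OF C])

end

section \<open>Morphisms as matrix functions\<close>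

context unitary_param begin

text \<open>The pointwise conditions on a morphism, with the fibres written out.\<close>

definition linF :: "nat => nat => 'k::{field,finite} HH => ((nat => 'k HH => lam) => nat => 'k HH => lam) => bool" where
 "linF r s g T \<longleftrightarrow> T : extensional (PF r g) & T : PF r g \<rightarrow> PF s g
  & (ALL v:PF r g. ALL w:PF r g. T (\<lambda>i\<in>{..<r}. %b. v i b + w i b) = (\<lambda>i\<in>{..<s}. %b. T v i b + T w i b))
  & (ALL c. ALL v:PF r g. T (\<lambda>i\<in>{..<r}. %b. c * v i b) = (\<lambda>i\<in>{..<s}. %b. c * T v i b))"

lemma I_hom_iff:
 fixes C :: "'k::{field,finite} HH set"
 assumes C: "C : CH0 n"
 shows "f : Ih C r s \<longleftrightarrow> f : extensional (SS n C)
  & (ALL g:GG. linF r s g (f (g <| C)))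
  & (ALL b:BH n. ALL g:GG. ALL v:PF r g. f ((b \<odot> g) <| C) (actP r b v) = actP s b (f (g <| C) v))"
proof -
 have 1: "f (g <| C) : extensional (carrier (fib (vp C r) (g <| C)))
   & lin_map (fib (vp C r) (g <| C)) (fib (vp C s) (g <| C)) (f (g <| C))
   \<longleftrightarrow> linF r s g (f (g <| C))" if "g : GG" for g
  unfolding linF_def lin_map_def vpow_fib[OF C that] by (simp add: mk_module_def)
 have 2: "(ALL v:carrier (fib (vp C r) (g <| C)).
   f (b <| g <| C) (act (vp C r) b (g <| C) v) = act (vp C s) b (g <| C) (f (g <| C) v))
   \<longleftrightarrow> (ALL v:PF r g. f ((b \<odot> g) <| C) (actP r b v) = actP s b (f (g <| C) v))"
  if "g : GG" "b : BH n" "linF r s g (f (g <| C))" for g b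
  using that unfolding vpow_carrier[OF C that(1)] vpow_act[OF C that(2,1)] lco_lco[OF C GG_of(1)[OF that(2)] that(1)]
  by (auto simp: linF_def)
 show ?thesis unfolding I_hom_def SS_ball[OF C] mem_Collect_eq using 1 2 by blast
qed

lemma line_unit_Fb:
 fixes k :: "'k::{field,finite} HH"
 assumes k: "k : H0 n"
 shows "line_unit n : Fb k"
 unfolding Fb_iff
proof (intro conjI allI impI ballI)
 fix b :: "'k HH" assume "line_unit n b ~= 0"
 hence "b : Q0 n" by (simp add: line_unit_def split: if_splits)
 thus "b : BH n" "gi b \<odot> k : H0 n" using k Q0_H0[of b n] by simp_all
next
 fix b q :: "'k HH" assume b: "b : BH n" and q: "q : Q0 n"
 have "b \<odot> q : Q0 n \<longleftrightarrow> b : Q0 n"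
 proof
  assume "b \<odot> q : Q0 n"
  hence "(b \<odot> q) \<odot> gi q : Q0 n" using q by simp
  thus "b : Q0 n" using b q by (simp add: HG.m_assoc)
 qed (use q in simp)
 thus "line_unit n (b \<odot> q) = \<sigma> b q * line_unit n b"
  using q \<sigma>_Q0[of b q] by (simp add: line_unit_def)
qed

lemma Fb_line:
 fixes k :: "'k::{field,finite} HH"
 assumes k: "k : H0 n" and w: "w : Fb k"
 shows "w = (%b. w g1 * line_unit n b)"
proof
 fix b :: "'k HH"
 show "w b = w g1 * line_unit n b"
 proof (cases "b : Q0 n")
  case True
  hence "w (g1 \<odot> b) = \<sigma> g1 b * w g1" using w BH_closed(3) unfolding Fb_iff by blast
  thus ?thesis using True \<sigma>_one(1)[of b] by (simp add: line_unit_def)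
 next
  case False
  have "w b = 0"
  proof (rule ccontr)
   assume "w b ~= 0"
   hence b: "b : BH n" "gi b \<odot> k : H0 n" using w unfolding Fb_iff by blast+
   hence "k \<odot> gi (gi b \<odot> k) : H0 n" using k by simp
   hence "b : H0 n" using b k by (simp add: HG.inv_mult_group)
   thus False using False b by (simp add: Q0_def)
  qed
  thus ?thesis using False by (simp add: line_unit_def)
 qed
qed

lemma pow_unit_PF:
 assumes "k : H0 n" shows "pow_unit n r j : PF r k"
 unfolding pow_unit_def using line_unit_Fb[OF assms] by (auto intro!: PF_I Fb_0)

text \<open>Over an element of \<open>H0 n\<close> the fibre is spanned by \<open>line_unit\<close>, so linear maps are matrices.\<close>

lemma linF_expand:
 fixes k :: "'k::{field,finite} HH"
 assumes T: "linF r s k T" and k: "k : H0 n" and v: "v : PF r k" and i: "i < s"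
 shows "T v i b = (\<Sum>j<r. T (pow_unit n r j) i b * v j g1)"
proof -
 have add: "!!v w. v : PF r k ==> w : PF r k ==> T (\<lambda>i\<in>{..<r}. %b. v i b + w i b) = (\<lambda>i\<in>{..<s}. %b. T v i b + T w i b)"
  and scale: "!!c v. v : PF r k ==> T (\<lambda>i\<in>{..<r}. %b. c * v i b) = (\<lambda>i\<in>{..<s}. %b. c * T v i b)"
  using T unfolding linF_def by blast+
 define part where "part m = (\<lambda>i\<in>{..<r}. if i < m then v i else (%b. 0))" for m
 have part: "part m : PF r k" for m
  unfolding part_def using PF_nth[OF v] by (auto intro!: PF_I Fb_0)
 have "m <= r ==> T (part m) i b = (\<Sum>j<m. T (pow_unit n r j) i b * v j g1)" for m
 proof (induction m)
  case 0
  have p0: "part 0 = (\<lambda>i\<in>{..<r}. %b. 0 * v i b)" by (auto simp: part_def)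
  show ?case unfolding p0 scale[OF v] using i by simp
 next
  case (Suc m)
  let ?u = "\<lambda>i\<in>{..<r}. %b. v m g1 * pow_unit n r m i b"
  have u: "?u : PF r k" by (rule PF_scale[OF pow_unit_PF[OF k]])
  have "part (Suc m) = (\<lambda>i\<in>{..<r}. %b. part m i b + ?u i b)"
  proof (rule PF_eqI[OF part PF_add[OF part u]])
   fix i b assume "i < r"
   moreover have "v m b = v m g1 * line_unit n b"
    using fun_cong[OF Fb_line[OF k PF_nth[OF v]], of m b] Suc.prems by simp
   ultimately show "part (Suc m) i b = (\<lambda>i\<in>{..<r}. %b. part m i b + ?u i b) i b"
    by (auto simp: part_def pow_unit_def less_Suc_eq)
  qed
  hence "T (part (Suc m)) i b = T (part m) i b + T ?u i b" using add[OF part u] i by simp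
  also have "T ?u i b = v m g1 * T (pow_unit n r m) i b" using scale[OF pow_unit_PF[OF k]] i by simp
  finally show ?case using Suc by (simp add: mult.commute)
 qed
 from this[of r] have "T (part r) i b = (\<Sum>j<r. T (pow_unit n r j) i b * v j g1)" by simp
 moreover have "part r = v"
  by (rule PF_eqI[OF part v]) (simp add: part_def)
 ultimately show ?thesis by simp
qed

definition md :: "'k::{field,finite} HH set => nat => nat => ('k HH set => (nat => 'k HH => lam) => (nat => 'k HH => lam))
  => 'k HH => nat => nat => lam" where
 "md C r s f k i j = (if k : H0 n & i < s & j < r then f (k <| C) (pow_unit n r j) i g1 else 0)"

lemma actP_at: "b : BH n ==> i < r ==> actP r b v i b = v i g1"
 using \<sigma>_one(2)[of b] by (simp add: actP_def actF_def)

text \<open>Transport by \<open>b\<close> reduces the claim to the fibre over \<open>k \<in> H0 n\<close>, and there to the previous expansion.\<close>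

lemma I_hom_recon:
 fixes C :: "'k::{field,finite} HH set"
 assumes C: "C : CH0 n" and f: "f : Ih C r s"
  and b: "b : BH n" and k: "k : H0 n" and v: "v : PF r (b \<odot> k)" and i: "i < s"
 shows "f ((b \<odot> k) <| C) v i b = (\<Sum>j<r. md C r s f k i j * v j b)"
proof -
 have kG: "k : GG" using k by simp
 obtain v' where v': "v' : PF r k" "v = actP r b v'"
  using actP_bij[OF b kG, of r] v unfolding bij_betw_def by blast
 have lin: "linF r s k (f (k <| C))" and eq: "f ((b \<odot> k) <| C) v = actP s b (f (k <| C) v')"
  using f kG b v' unfolding I_hom_iff[OF C] by blast+
 have "f ((b \<odot> k) <| C) v i b = (\<Sum>j<r. f (k <| C) (pow_unit n r j) i g1 * v' j g1)"
  unfolding eq actP_at[OF b i] by (rule linF_expand[OF lin k v'(1) i])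
 also have "... = (\<Sum>j<r. md C r s f k i j * v j b)"
  using k i actP_at[OF b, of _ r v'] v'(2) by (intro sum.cong) (auto simp: md_def)
 finally show ?thesis .
qed

text \<open>The operator on the fibre over \<open>g\<close> given by a matrix function.\<close>

definition opv :: "nat => nat => ('k::{field,finite} HH => nat => nat => lam) => 'k HH => (nat => 'k HH => lam) => nat => 'k HH => lam" where
 "opv r s M g v = (\<lambda>i\<in>{..<s}. %b. if b : BH n & gi b \<odot> g : H0 n then \<Sum>j<r. M (gi b \<odot> g) i j * v j b else 0)"

lemma I_hom_eq_opv:
 fixes C :: "'k::{field,finite} HH set"
 assumes C: "C : CH0 n" and f: "f : Ih C r s"
  and g: "g : GG" and v: "v : PF r g"
 shows "f (g <| C) v = opv r s (md C r s f) g v"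
proof (rule extensionalityI[of _ "{..<s}"])
 have fv: "f (g <| C) v : PF s g" using f g v unfolding I_hom_iff[OF C] linF_def by blast
 thus "f (g <| C) v : extensional {..<s}" by (simp add: PF_def PiE_iff)
 show "opv r s (md C r s f) g v : extensional {..<s}" by (simp add: opv_def)
 fix i assume i: "i : {..<s}"
 show "f (g <| C) v i = opv r s (md C r s f) g v i"
 proof
  fix b
  show "f (g <| C) v i b = opv r s (md C r s f) g v i b"
  proof (cases "b : BH n & gi b \<odot> g : H0 n")
   case True
   hence e: "b \<odot> (gi b \<odot> g) = g" using g by simp
   show ?thesis
    using I_hom_recon[OF C f, of b "gi b \<odot> g" v i] True v i by (simp add: e opv_def)
  next
   case False
   hence "f (g <| C) v i b = 0" using PF_nth[OF fv, of i] i unfolding Fb_iff by blast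
   thus ?thesis using False i by (auto simp: opv_def)
  qed
 qed
qed

lemma md_inj:
 fixes C :: "'k::{field,finite} HH set"
 assumes C: "C : CH0 n"
 shows "inj_on (md C r s) (Ih C r s)"
proof (rule inj_onI)
 fix f f' assume f: "f : Ih C r s"
  and f': "f' : Ih C r s" and e: "md C r s f = md C r s f'"
 show "f = f'"
 proof (rule SS_ext[OF C])
  show "f : extensional (SS n C)" "f' : extensional (SS n C)" using f f' unfolding I_hom_iff[OF C] by blast+
  fix g :: "'k HH" assume g: "g : GG"
  have ex: "f (g <| C) : extensional (PF r g)" "f' (g <| C) : extensional (PF r g)"
   using f f' g unfolding I_hom_iff[OF C] linF_def by blast+
  show "f (g <| C) = f' (g <| C)"
  proof (rule extensionalityI[OF ex])
   fix v assume "v : PF r g"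
   thus "f (g <| C) v = f' (g <| C) v"
    using I_hom_eq_opv[OF C f g] I_hom_eq_opv[OF C f' g] e by simp
  qed
 qed
qed

lemma actF_0: "actF q (%b. 0) = (%b. 0)"
 by (auto simp: actF_def)

lemma actF_unit:
 fixes q :: "'k::{field,finite} HH"
 assumes q: "q : Q0 n"
 shows "actF q (line_unit n) = line_unit n"
proof
 fix c :: "'k HH"
 show "actF q (line_unit n) c = line_unit n c"
 proof (cases "c : Q0 n")
  case True
  thus ?thesis using q \<sigma>_Q0[of q "gi q \<odot> c"] by (simp add: actF_def line_unit_def)
 next
  case False
  have "gi q \<odot> c ~: Q0 n" if c: "c : BH n"
  proof
   assume "gi q \<odot> c : Q0 n"
   hence "q \<odot> (gi q \<odot> c) : Q0 n" using q by (rule_tac Q0_closed(1))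
   thus False using False q c by simp
  qed
  thus ?thesis using False by (auto simp: actF_def line_unit_def)
 qed
qed

text \<open>Left invariance reflects equivariance under \<open>Q0 n\<close>, right invariance the level \<open>C\<close>.\<close>

definition good :: "'k::{field,finite} HH set => ('k HH => nat => nat => lam) => bool" where
 "good C M \<longleftrightarrow> (ALL k:H0 n. (ALL q:Q0 n. M (q \<odot> k) = M k) & (ALL c:C. M (k \<odot> c) = M k))"

lemma md_good:
 fixes C :: "'k::{field,finite} HH set"
 assumes C: "C : CH0 n" and f: "f : Ih C r s"
 shows "good C (md C r s f)"
 unfolding good_def
proof (intro ballI conjI ext)
 fix k c :: "'k HH" and i j assume k: "k : H0 n" and c: "c : C"
 hence c': "c : H0 n" using CH0_subset_H0[OF C] by blast
 have "(k \<odot> c) <| C = k <| C" using lco_eq_iff[OF C, of k "k \<odot> c"] k c c' by auto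
 thus "md C r s f (k \<odot> c) i j = md C r s f k i j" using k c' by (simp add: md_def)
next
 fix k q :: "'k HH" and i j assume k: "k : H0 n" and q: "q : Q0 n"
 have qk: "q \<odot> k : H0 n" using k Q0_H0[OF q] by simp
 have u: "actP r q (pow_unit n r j) = pow_unit n r j"
  unfolding actP_def pow_unit_def by (rule restrict_ext) (simp add: actF_unit[OF q] actF_0)
 show "md C r s f (q \<odot> k) i j = md C r s f k i j"
 proof (cases "i < s & j < r")
  case True
  hence i: "i < s" by simp
  have eq: "f ((q \<odot> k) <| C) (actP r q (pow_unit n r j)) = actP s q (f (k <| C) (pow_unit n r j))"
   and fv: "f (k <| C) (pow_unit n r j) : PF s k"
   using f Q0_BH[OF q] GG_of(2)[OF k] pow_unit_PF[OF k, of r j] unfolding I_hom_iff[OF C] linF_def by blast+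
  have w: "f (k <| C) (pow_unit n r j) i : Fb k" (is "?w : _") by (rule PF_nth[OF fv i])
  have "actF q ?w g1 = ?w (gi q)" using q \<sigma>_Q0[of q "gi q"] by (simp add: actF_def)
  also have "?w (gi q) = ?w g1" using fun_cong[OF Fb_line[OF k w], of "gi q"] q by (simp add: line_unit_def)
  finally show ?thesis using True k qk eq unfolding u by (simp add: md_def actP_def)
 qed (auto simp: md_def)
qed

text \<open>For \<open>good\<close> matrix functions the chosen representative is irrelevant (\<open>op_eq\<close>).\<close>

definition op :: "'k::{field,finite} HH set => nat => nat => ('k HH => nat => nat => lam)
  => 'k HH set => (nat => 'k HH => lam) => nat => 'k HH => lam" where
 "op C r s M = (\<lambda>x\<in>SS n C. \<lambda>v\<in>carrier (fib (vp C r) x). opv r s M (SOME g. g : GG & x = g <| C) v)"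

lemma opv_right:
 fixes g c :: "'k::{field,finite} HH"
 assumes M: "good C M" and C: "C : CH0 n" and g: "g : GG" and c: "c : C"
 shows "opv r s M (g \<odot> c) v = opv r s M g v"
proof -
 have c': "c : H0 n" using CH0_subset_H0[OF C] c by blast
 have e: "gi b \<odot> (g \<odot> c) = (gi b \<odot> g) \<odot> c" if "b : BH n" for b
  using that g c' by (simp add: HG.m_assoc)
 have iff: "(gi b \<odot> g) \<odot> c : H0 n \<longleftrightarrow> gi b \<odot> g : H0 n" if "b : BH n" for b
 proof
  assume "(gi b \<odot> g) \<odot> c : H0 n"
  hence "((gi b \<odot> g) \<odot> c) \<odot> gi c : H0 n" using c' by simp
  thus "gi b \<odot> g : H0 n" using that g c' by (simp add: HG.m_assoc)
 qed (use c' in simp)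
 have "(if b : BH n & gi b \<odot> (g \<odot> c) : H0 n then \<Sum>j<r. M (gi b \<odot> (g \<odot> c)) i j * v j b else 0)
   = (if b : BH n & gi b \<odot> g : H0 n then \<Sum>j<r. M (gi b \<odot> g) i j * v j b else 0)" for b i
  using e[of b] iff[of b] M c unfolding good_def by (cases "b : BH n & gi b \<odot> g : H0 n") auto
 thus ?thesis unfolding opv_def by presburger
qed

lemma op_eq:
 fixes g :: "'k::{field,finite} HH"
 assumes M: "good C M" and C: "C : CH0 n" and g: "g : GG"
 shows "op C r s M (g <| C) = (\<lambda>v\<in>PF r g. opv r s M g v)"
proof -
 define g' where "g' = (SOME g'. g' : GG & g <| C = g' <| C)"
 have g': "g' : GG" "g <| C = g' <| C"
  using someI[of "%g'. g' : GG & g <| C = g' <| C" g] g unfolding g'_def by blast+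
 then obtain c where "c : C" "g' = g \<odot> c" using lco_eq_iff[OF C g] by blast
 hence "opv r s M g' = opv r s M g" using opv_right[OF M C g] by (intro ext) simp
 thus ?thesis
  unfolding op_def using lco_SS[OF g, of C] vpow_carrier[OF C g] by (simp add: g'_def[symmetric])
qed

lemma opv_PF:
 fixes g :: "'k::{field,finite} HH"
 assumes M: "good C M" and g: "g : GG" and v: "v : PF r g"
 shows "opv r s M g v : PF s g"
 unfolding opv_def
proof (rule PF_I)
 fix i assume "i < s"
 show "(%b. if b : BH n & gi b \<odot> g : H0 n then \<Sum>j<r. M (gi b \<odot> g) i j * v j b else 0) : Fb g"
  unfolding Fb_iff
 proof (intro conjI allI impI ballI)
  fix b q :: "'k HH" assume b: "b : BH n" and q: "q : Q0 n"
  have e: "gi (b \<odot> q) \<odot> g = gi q \<odot> (gi b \<odot> g)" using b q g by (simp add: HG.inv_mult_group HG.m_assoc)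
  have iff: "gi q \<odot> (gi b \<odot> g) : H0 n \<longleftrightarrow> gi b \<odot> g : H0 n"
  proof
   assume "gi q \<odot> (gi b \<odot> g) : H0 n"
   hence "q \<odot> (gi q \<odot> (gi b \<odot> g)) : H0 n" using Q0_H0[OF q] by (rule_tac H0_closed(1))
   thus "gi b \<odot> g : H0 n" using b q g by simp
  qed (use Q0_H0[OF q] in simp)
  have "v j (b \<odot> q) = \<sigma> b q * v j b" if "j < r" for j
   using PF_nth[OF v that] b q unfolding Fb_iff by blast
  moreover have "M (gi q \<odot> (gi b \<odot> g)) = M (gi b \<odot> g)" if "gi b \<odot> g : H0 n"
   using M that q unfolding good_def by simp
  ultimately show "(if b \<odot> q : BH n & gi (b \<odot> q) \<odot> g : H0 n then \<Sum>j<r. M (gi (b \<odot> q) \<odot> g) i j * v j (b \<odot> q) else 0)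
   = \<sigma> b q * (if b : BH n & gi b \<odot> g : H0 n then \<Sum>j<r. M (gi b \<odot> g) i j * v j b else 0)"
   unfolding e iff using b q by (auto simp: sum_distrib_left algebra_simps intro!: sum.cong)
 qed (auto split: if_splits)
qed

lemma op_mem:
 fixes C :: "'k::{field,finite} HH set"
 assumes M: "good C M" and C: "C : CH0 n"
 shows "op C r s M : Ih C r s"
 unfolding I_hom_iff[OF C]
proof (intro conjI ballI)
 show "op C r s M : extensional (SS n C)" by (simp add: op_def)
next
 fix g :: "'k HH" assume g: "g : GG"
 show "linF r s g (op C r s M (g <| C))"
  unfolding linF_def op_eq[OF M C g]
 proof (intro conjI ballI allI)
  show "restrict (opv r s M g) (PF r g) : PF r g \<rightarrow> PF s g" using opv_PF[OF M g] by auto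
  fix v w assume v: "v : PF r g" and w: "w : PF r g"
  show "restrict (opv r s M g) (PF r g) (\<lambda>i\<in>{..<r}. %b. v i b + w i b)
   = (\<lambda>i\<in>{..<s}. %b. restrict (opv r s M g) (PF r g) v i b + restrict (opv r s M g) (PF r g) w i b)"
   using v w PF_add[OF v w] by (auto simp: opv_def fun_eq_iff sum.distrib[symmetric] algebra_simps intro!: sum.cong)
 next
  fix c v assume v: "v : PF r g"
  show "restrict (opv r s M g) (PF r g) (\<lambda>i\<in>{..<r}. %b. c * v i b)
   = (\<lambda>i\<in>{..<s}. %b. c * restrict (opv r s M g) (PF r g) v i b)"
   using v PF_scale[OF v] by (auto simp: opv_def fun_eq_iff sum_distrib_left algebra_simps intro!: sum.cong)
 qed simp
next
 fix b g :: "'k HH" and v assume b: "b : BH n" and g: "g : GG" and v: "v : PF r g"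
 have bg: "b \<odot> g : GG" using b g by simp
 have e: "gi (gi b \<odot> c) \<odot> g = gi c \<odot> (b \<odot> g)" if "c : BH n" for c
  using b g that by (simp add: HG.inv_mult_group HG.m_assoc)
 have "opv r s M (b \<odot> g) (actP r b v) = actP s b (opv r s M g v)"
 proof (rule PF_eqI[OF opv_PF[OF M bg actP_PF[OF b g v]] actP_PF[OF b g opv_PF[OF M g v]]])
  fix i c assume i: "i < s"
  show "opv r s M (b \<odot> g) (actP r b v) i c = actP s b (opv r s M g v) i c"
  proof (cases "c : BH n")
   case True
   thus ?thesis using i b e[OF True]
    by (auto simp: opv_def actP_def actF_def sum_distrib_left algebra_simps intro!: sum.cong)
  qed (use i in \<open>simp add: opv_def actP_def actF_def\<close>)
 qed
 thus "op C r s M ((b \<odot> g) <| C) (actP r b v) = actP s b (op C r s M (g <| C) v)"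
  unfolding op_eq[OF M C bg] op_eq[OF M C g] using actP_PF[OF b g v] v by simp
qed

lemma md_op:
 fixes C :: "'k::{field,finite} HH set"
 assumes M: "good C M" and C: "C : CH0 n"
 shows "md C r s (op C r s M) k i j = (if k : H0 n & i < s & j < r then M k i j else 0)"
proof (cases "k : H0 n & i < s & j < r")
 case True
 hence k: "k : H0 n" and "i < s" "j < r" by auto
 have "opv r s M k (pow_unit n r j) i g1 = (\<Sum>l<r. M k i l * pow_unit n r j l (g1 :: 'k HH))"
  using True by (simp add: opv_def)
 also have "... = (\<Sum>l<r. if l = j then M k i l else 0)"
  by (rule sum.cong[OF refl]) (auto simp: pow_unit_def line_unit_def)
 also have "... = M k i j" using \<open>j < r\<close> by simp
 finally show ?thesis using True pow_unit_PF[OF k, of r j] op_eq[OF M C GG_of(2)[OF k], of r s] by (simp add: md_def)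
qed (auto simp: md_def)

definition supp :: "nat => nat => ('k::{field,finite} HH => nat => nat => lam) => bool" where
 "supp r s M \<longleftrightarrow> (ALL k i j. ~ (k : H0 n & i < s & j < r) --> M k i j = 0)"

lemma md_supp: "supp r s (md C r s f)"
 by (simp add: supp_def md_def)

text \<open>It suffices to compute a morphism on fibres; sums, multiples, identities and pullbacks are identified in this way.\<close>

lemma I_hom_char:
 fixes C :: "'k::{field,finite} HH set"
 assumes C: "C : CH0 n" and M: "good C M" "supp r s M" and f: "f : extensional (SS n C)"
  "!!g. g : GG ==> f (g <| C) : extensional (PF r g)"
  "!!g v. g : GG ==> v : PF r g ==> f (g <| C) v = opv r s M g v"
 shows "f : Ih C r s" "md C r s f = M"
proof -
 have "f = op C r s M"
 proof (rule SS_ext[OF C f(1)])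
  fix g :: "'k HH" assume g: "g : GG"
  show "f (g <| C) = op C r s M (g <| C)"
   unfolding op_eq[OF M(1) C g] using f(2,3)[OF g] by (intro extensionalityI[of _ "PF r g"]) auto
 qed (simp add: op_def)
 moreover have "md C r s (op C r s M) = M"
  using M(2) by (intro ext) (auto simp: md_op[OF M(1) C] supp_def)
 ultimately show "f : Ih C r s" "md C r s f = M"
  using op_mem[OF M(1) C] by auto
qed

lemma md_op_eq: "good C M ==> supp r s M ==> C : CH0 n ==> md C r s (op C r s M) = M"
 for C :: "'k::{field,finite} HH set"
 using md_op[of C M] by (intro ext) (auto simp: supp_def)

definition mmul :: "nat => ('x => nat => nat => lam) => ('x => nat => nat => lam) => 'x => nat => nat => lam" where
 "mmul m N M k i j = (\<Sum>l<m. N k i l * M k l j)"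

definition mdag :: "('x => nat => nat => lam) => 'x => nat => nat => lam" where
 "mdag M k i j = lam_dag (M k j i)"

definition mid :: "nat => 'k::{field,finite} HH => nat => nat => lam" where
 "mid r k i j = (if k : H0 n & i = j & i < r then 1 else 0)"

lemma supp_mmul: "supp r s M ==> supp s t N ==> supp r t (mmul s N M)"
 unfolding supp_def mmul_def by (intro allI impI sum.neutral) (metis mult_zero_left mult_zero_right)

lemma good_mmul: "good C M ==> good C N ==> good C (mmul s N M)"
 unfolding good_def mmul_def by simp

lemma supp_mdag: "supp r s M ==> supp s r (mdag M)"
 unfolding supp_def mdag_def by auto

lemma supp_mid: "supp r r (mid r)"
 unfolding supp_def mid_def by auto

lemma I_comp_md:
 fixes C :: "'k::{field,finite} HH set"
 assumes C: "C : CH0 n" and f: "f : Ih C r s"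
  and h: "h : Ih C s t"
 shows "I_comp n C (vp C r) h f : Ih C r t"
  "md C r t (I_comp n C (vp C r) h f) = mmul s (md C s t h) (md C r s f)"
proof -
 let ?M = "mmul s (md C s t h) (md C r s f)"
 have 1: "opv s t (md C s t h) g (opv r s (md C r s f) g v) = opv r t ?M g v" for g v
 proof -
  have "(\<Sum>l<s. md C s t h k i l * (\<Sum>j<r. md C r s f k l j * v j b)) = (\<Sum>j<r. ?M k i j * v j b)" for k i b
   unfolding mmul_def sum_distrib_left sum_distrib_right by (subst sum.swap) (simp add: mult.assoc)
  thus ?thesis unfolding opv_def by (intro restrict_ext ext) simp
 qed
 have *: "I_comp n C (vp C r) h f (g <| C) = (\<lambda>v\<in>PF r g. h (g <| C) (f (g <| C) v))" if "g : GG" for g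
  using lco_SS[OF that, of C] by (simp add: I_comp_def vpow_carrier[OF C that])
 have **: "h (g <| C) (f (g <| C) v) = opv r t ?M g v" if "g : GG" "v : PF r g" for g v
 proof -
  have "f (g <| C) v : PF s g" using f that unfolding I_hom_iff[OF C] linF_def by blast
  from I_hom_eq_opv[OF C h that(1) this] show ?thesis unfolding I_hom_eq_opv[OF C f that] 1 .
 qed
 have ***: "I_comp n C (vp C r) h f : extensional (SS n C)" by (simp add: I_comp_def)
 note char = I_hom_char[OF C good_mmul[OF md_good[OF C f] md_good[OF C h]] supp_mmul[OF md_supp md_supp] ***]
 show "I_comp n C (vp C r) h f : Ih C r t"
  "md C r t (I_comp n C (vp C r) h f) = ?M"
  by (rule char; simp add: * **)+
qed

end

section \<open>Dagger categories of matrix functions\<close>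

context unitary_param begin

definition MM :: "'k::{field,finite} HH set set => nat => nat => ('k HH => nat => nat => lam) set" where
 "MM \<E> r s = {M. supp r s M & (ALL i j. (%k. M k i j) : Cyl n \<E>)}"

definition dens :: "nat => nat => ('x => nat => nat => lam) => ('x => nat => nat => lam) => 'x => lam" where
 "dens r s M N k = (\<Sum>j<r. \<Sum>i<s. lam_dag (M k i j) * N k i j)"

definition mform :: "nat => nat => ('k::{field,finite} HH => nat => nat => lam) => ('k HH => nat => nat => lam) => lam" where
 "mform r s M N = tauH n (dens r s M N)"

lemma MM_Cyl: "M : MM \<E> r s ==> (%k. M k i j) : Cyl n \<E>"
 unfolding MM_def by blast

lemma MM_supp: "M : MM \<E> r s ==> supp r s M"
 unfolding MM_def by blast

lemma MM_I: "supp r s M ==> (!!i j. (%k. M k i j) : Cyl n \<E>) ==> M : MM \<E> r s"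
 unfolding MM_def by blast

lemma MM_mono: "\<E> <= \<E>' ==> MM \<E> r s <= MM \<E>' r s"
 unfolding MM_def using Cyl_mono by blast

lemma MM_0: "(%k i j. 0) : MM \<E> r s"
 by (rule MM_I) (simp_all add: supp_def)

lemma MM_add: "M : MM \<E> r s ==> N : MM \<E> r s ==> (%k i j. M k i j + N k i j) : MM \<E> r s"
 by (rule MM_I) (use MM_supp[of M] MM_supp[of N] in \<open>auto simp: supp_def intro: Cyl_add MM_Cyl\<close>)

lemma MM_scale: "M : MM \<E> r s ==> (%k i j. c * M k i j) : MM \<E> r s"
 by (rule MM_I) (use MM_supp[of M] in \<open>auto simp: supp_def intro: Cyl_scale MM_Cyl\<close>)

lemma MM_mdag: "M : MM \<E> r s ==> mdag M : MM \<E> s r"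
 by (rule MM_I) (auto simp: mdag_def intro: supp_mdag MM_supp Cyl_dag MM_Cyl)

lemma MM_mmul:
 assumes "\<E> <= CH0 n" "M : MM \<E> r s" "N : MM \<E> s t"
 shows "mmul s N M : MM \<E> r t"
proof (rule MM_I)
 show "supp r t (mmul s N M)" using assms by (intro supp_mmul MM_supp)
 show "(%k. mmul s N M k i j) : Cyl n \<E>" for i j
  unfolding mmul_def by (intro Cyl_sum Cyl_mult[OF assms(1)] MM_Cyl[OF assms(2)] MM_Cyl[OF assms(3)])
qed

lemma MM_mid: "mid r : MM \<E> r r"
proof (rule MM_I[OF supp_mid])
 fix i j
 have e: "(%k. mid r k i j) = (if i = j & i < r then ind (H0 n) else (%k. 0))"
  by (auto simp: mid_def ind_def fun_eq_iff)
 show "(%k. mid r k i j) : Cyl n \<E>" unfolding e using Cyl_ind[of "H0 n" n \<E>] by (simp add: cyl_sets_def)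
qed

lemma supp_zero: "supp r s M ==> ~ (k : H0 n & i < s & j < r) ==> M k i j = 0"
 unfolding supp_def by blast

lemma mmul_mid_left: "supp r s M ==> mmul s (mid s) M = M"
proof (intro ext)
 fix k i j assume M: "supp r s M"
 have "mmul s (mid s) M k i j = (\<Sum>l<s. if l = i then mid s k i i * M k i j else 0)"
  unfolding mmul_def by (rule sum.cong) (auto simp: mid_def)
 thus "mmul s (mid s) M k i j = M k i j" using supp_zero[OF M, of k i j]
  by (cases "k : H0 n & i < s & j < r") (auto simp: mid_def)
qed

lemma mmul_mid_right: "supp r s M ==> mmul r M (mid r) = M"
proof (intro ext)
 fix k i j assume M: "supp r s M"
 have "mmul r M (mid r) k i j = (\<Sum>l<r. if l = j then M k i j * mid r k j j else 0)"
  unfolding mmul_def by (rule sum.cong) (auto simp: mid_def)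
 thus "mmul r M (mid r) k i j = M k i j" using supp_zero[OF M, of k i j]
  by (cases "k : H0 n & i < s & j < r") (auto simp: mid_def)
qed

lemma mmul_assoc: "mmul s (mmul t L N) M = mmul t L (mmul s N M)"
 by (intro ext) (simp add: mmul_def sum_distrib_left sum_distrib_right mult.assoc sum.swap[of _ "{..<s}"])

lemma mdag_mmul: "mdag (mmul s N M) = mmul s (mdag M) (mdag N)"
 by (intro ext) (simp add: mmul_def mdag_def lam_dag_sum lam_dag_mult mult.commute)

lemma mdag_mdag: "mdag (mdag M) = M"
 by (simp add: mdag_def[abs_def])

lemma mdag_mid: "mdag (mid r) = mid r"
 by (intro ext) (auto simp: mdag_def mid_def)

lemma dens_Cyl: "\<E> <= CH0 n ==> M : MM \<E> r s ==> N : MM \<E> r s ==> dens r s M N : Cyl n \<E>"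
 unfolding dens_def[abs_def] by (intro Cyl_sum Cyl_mult Cyl_dag MM_Cyl)

lemma mform_add:
 assumes "\<E> <= CH0 n" "M : MM \<E> r s" "N : MM \<E> r s" "N' : MM \<E> r s"
 shows "mform r s M (%k i j. N k i j + N' k i j) = mform r s M N + mform r s M N'"
 using tauH_lin[OF assms(1) dens_Cyl[OF assms(1,2,3)] dens_Cyl[OF assms(1,2,4)], of 1 1]
 unfolding mform_def by (simp add: dens_def[abs_def] sum.distrib distrib_left)

lemma mform_scale:
 assumes "\<E> <= CH0 n" "M : MM \<E> r s" "N : MM \<E> r s"
 shows "mform r s M (%k i j. c * N k i j) = c * mform r s M N"
 using tauH_lin[OF assms(1) dens_Cyl[OF assms] dens_Cyl[OF assms], of c 0]
 unfolding mform_def by (simp add: dens_def[abs_def] sum_distrib_left mult.left_commute)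

lemma mform_herm:
 assumes "\<E> <= CH0 n" "M : MM \<E> r s" "N : MM \<E> r s"
 shows "mform r s M N = lam_dag (mform r s N M)"
proof -
 have "dens r s M N = (%k. lam_dag (dens r s N M k))"
  by (intro ext) (simp add: dens_def lam_dag_sum lam_dag_mult mult.commute)
 thus ?thesis
  using tauH_dag[OF assms(1) dens_Cyl[OF assms(1,3,2)]] unfolding mform_def by simp
qed

text \<open>The form is a sum of integrals of \<open>F\<^sup>\<dagger>F\<close> over the entries \<open>F\<close>.\<close>

lemma mform_pos:
 assumes \<E>: "\<E> <= CH0 n" and M: "M : MM \<E> r s"
 shows "lam_nonneg (mform r s M M)" "mform r s M M = 0 ==> M = (%k i j. 0)"
proof -
 let ?a = "%j i. tauH n (%k. lam_dag (M k i j) * M k i j)"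
 have C: "(%k. M k i j) : Cyl n \<E>" for i j by (rule MM_Cyl[OF M])
 have C': "(%k. M k i j) : Cyl n (CH0 n)" for i j using Cyl_mono[OF \<E>] C by blast
 have "mform r s M M = (\<Sum>j<r. tauH n (%k. \<Sum>i<s. lam_dag (M k i j) * M k i j))"
  unfolding mform_def dens_def[abs_def] by (rule tauH_sum[OF \<E>]) (intro Cyl_sum Cyl_mult[OF \<E>] Cyl_dag C)
 also have "... = (\<Sum>j<r. \<Sum>i<s. ?a j i)"
  by (rule sum.cong[OF refl], rule tauH_sum[OF \<E>]) (intro Cyl_mult[OF \<E>] Cyl_dag C)
 finally have e: "mform r s M M = (\<Sum>j<r. \<Sum>i<s. ?a j i)" .
 have a: "lam_nonneg (?a j i)" for i j by (rule tauH_positive(1)[OF C'])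
 have inner: "lam_nonneg (\<Sum>i<s. ?a j i) & ((\<Sum>i<s. ?a j i) = 0 --> (ALL i:{..<s}. ?a j i = 0))" for j
  by (rule lam_nonneg_sum) (simp_all add: a)
 have outer: "lam_nonneg (\<Sum>j<r. \<Sum>i<s. ?a j i) & ((\<Sum>j<r. \<Sum>i<s. ?a j i) = 0 --> (ALL j:{..<r}. (\<Sum>i<s. ?a j i) = 0))"
  by (rule lam_nonneg_sum) (simp_all add: inner)
 thus "lam_nonneg (mform r s M M)" unfolding e by blast
 assume "mform r s M M = 0"
 hence z: "?a j i = 0" if "j < r" "i < s" for i j
  using outer inner that unfolding e by blast
 show "M = (%k i j. 0)"
 proof (intro ext)
  fix k i j
  show "M k i j = 0"
  proof (cases "i < s & j < r")
   case True
   hence "(%k. M k i j) = (%k. 0)" using tauH_positive(2)[OF C' z] by blast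
   thus ?thesis by (rule fun_cong)
  next
   case False
   thus ?thesis using MM_supp[OF M] unfolding supp_def by blast
  qed
 qed
qed

lemma mform_mmul_left: "mform r t (mmul s A M) N = mform r s M (mmul t (mdag A) N)"
proof -
 have "(\<Sum>i<t. lam_dag (\<Sum>l<s. A k i l * M k l j) * N k i j)
   = (\<Sum>l<s. lam_dag (M k l j) * (\<Sum>i<t. lam_dag (A k i l) * N k i j))" for k j
  by (simp add: lam_dag_sum lam_dag_mult sum_distrib_left sum_distrib_right mult_ac sum.swap[of _ "{..<t}"])
 thus ?thesis unfolding mform_def dens_def[abs_def] mmul_def mdag_def by simp
qed

lemma mform_mmul_right: "mform r' s (mmul r M B) N = mform r s M (mmul r' N (mdag B))"
proof -
 have "(\<Sum>j<r'. \<Sum>i<s. lam_dag (\<Sum>l<r. M k i l * B k l j) * N k i j)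
   = (\<Sum>l<r. \<Sum>i<s. lam_dag (M k i l) * (\<Sum>j<r'. N k i j * lam_dag (B k l j)))" for k
 proof -
  have "(\<Sum>j<r'. \<Sum>i<s. lam_dag (\<Sum>l<r. M k i l * B k l j) * N k i j)
   = (\<Sum>j<r'. \<Sum>l<r. \<Sum>i<s. lam_dag (M k i l) * (N k i j * lam_dag (B k l j)))"
   by (rule sum.cong[OF refl], subst sum.swap)
    (simp add: lam_dag_sum lam_dag_mult sum_distrib_left sum_distrib_right mult_ac)
  also have "... = (\<Sum>l<r. \<Sum>j<r'. \<Sum>i<s. lam_dag (M k i l) * (N k i j * lam_dag (B k l j)))"
   by (rule sum.swap)
  also have "... = (\<Sum>l<r. \<Sum>i<s. \<Sum>j<r'. lam_dag (M k i l) * (N k i j * lam_dag (B k l j)))"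
   by (rule sum.cong[OF refl], rule sum.swap)
  finally show ?thesis by (simp add: sum_distrib_left)
 qed
 thus ?thesis unfolding mform_def dens_def[abs_def] mmul_def mdag_def by simp
qed

lemma mform_mdag: "mform s r (mdag M) (mdag N) = mform r s N M"
proof -
 have "dens s r (mdag M) (mdag N) k = dens r s N M k" for k
  unfolding dens_def mdag_def by (subst sum.swap) (simp add: mult.commute)
 thus ?thesis unfolding mform_def by presburger
qed

end

text \<open>All categories in the theorem are instances: \<open>\<beta>\<close> sends a morphism to its matrix function. The axioms become pointwise
 identities between matrices, and statements about \<open>mform\<close>.\<close>

locale dag_model = unitary_param n \<alpha> for n \<alpha> +
 fixes \<S> :: "('o, 'm) dagcat" and \<E> :: "'k::{field,finite} HH set set" and d :: "'o => nat"
  and \<beta> :: "'o => 'o => 'm => 'k HH => nat => nat => lam" and p :: "'o => 'o => 'm => 'm => lam"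
 assumes levels: "\<E> <= CH0 n"
  and bij: "X : obs \<S> ==> Y : obs \<S> ==> bij_betw (\<beta> X Y) (Hom \<S> X Y) (MM \<E> (d X) (d Y))"
  and zero: "X : obs \<S> ==> Y : obs \<S> ==> \<zero>\<^bsub>hm \<S> X Y\<^esub> : Hom \<S> X Y"
   "X : obs \<S> ==> Y : obs \<S> ==> \<beta> X Y \<zero>\<^bsub>hm \<S> X Y\<^esub> = (%k i j. 0)"
  and add: "X : obs \<S> ==> Y : obs \<S> ==> f : Hom \<S> X Y ==> g : Hom \<S> X Y ==>
    f \<oplus>\<^bsub>hm \<S> X Y\<^esub> g : Hom \<S> X Y"
   "X : obs \<S> ==> Y : obs \<S> ==> f : Hom \<S> X Y ==> g : Hom \<S> X Y ==>
    \<beta> X Y (f \<oplus>\<^bsub>hm \<S> X Y\<^esub> g) = (%k i j. \<beta> X Y f k i j + \<beta> X Y g k i j)"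
  and smult: "X : obs \<S> ==> Y : obs \<S> ==> f : Hom \<S> X Y ==> c \<odot>\<^bsub>hm \<S> X Y\<^esub> f : Hom \<S> X Y"
   "X : obs \<S> ==> Y : obs \<S> ==> f : Hom \<S> X Y ==> \<beta> X Y (c \<odot>\<^bsub>hm \<S> X Y\<^esub> f) = (%k i j. c * \<beta> X Y f k i j)"
  and cmp: "X : obs \<S> ==> Y : obs \<S> ==> Z : obs \<S> ==> f : Hom \<S> X Y ==> g : Hom \<S> Y Z ==>
    cmp \<S> X Y Z g f : Hom \<S> X Z"
   "X : obs \<S> ==> Y : obs \<S> ==> Z : obs \<S> ==> f : Hom \<S> X Y ==> g : Hom \<S> Y Z ==>
    \<beta> X Z (cmp \<S> X Y Z g f) = mmul (d Y) (\<beta> Y Z g) (\<beta> X Y f)"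
  and idn: "X : obs \<S> ==> idn \<S> X : Hom \<S> X X" "X : obs \<S> ==> \<beta> X X (idn \<S> X) = mid (d X)"
  and dgr: "X : obs \<S> ==> Y : obs \<S> ==> f : Hom \<S> X Y ==> dgr \<S> X Y f : Hom \<S> Y X"
   "X : obs \<S> ==> Y : obs \<S> ==> f : Hom \<S> X Y ==> \<beta> Y X (dgr \<S> X Y f) = mdag (\<beta> X Y f)"
  and form: "X : obs \<S> ==> Y : obs \<S> ==> f : Hom \<S> X Y ==> g : Hom \<S> X Y ==>
    p X Y f g = mform (d X) (d Y) (\<beta> X Y f) (\<beta> X Y g)"
begin

lemma eqI:
 "X : obs \<S> ==> Y : obs \<S> ==> f : Hom \<S> X Y ==> g : Hom \<S> X Y ==> \<beta> X Y f = \<beta> X Y g ==> f = g"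
 using bij[of X Y] unfolding bij_betw_def inj_on_def by blast

lemma \<beta>_MM: "X : obs \<S> ==> Y : obs \<S> ==> f : Hom \<S> X Y ==> \<beta> X Y f : MM \<E> (d X) (d Y)"
 using bij[of X Y] unfolding bij_betw_def by blast

lemmas \<beta>_supp = MM_supp[OF \<beta>_MM]

lemma hom_module:
 assumes "X : obs \<S>" "Y : obs \<S>"
 shows "module lam_ring (hm \<S> X Y)"
proof (rule module_transport[where \<beta> = "%f (k, i, j). \<beta> X Y f k i j"])
 show "inj_on (%f (k, i, j). \<beta> X Y f k i j) (Hom \<S> X Y)"
 proof (rule inj_onI)
  fix f g assume fg: "f : Hom \<S> X Y" "g : Hom \<S> X Y"
   and "(%(k, i, j). \<beta> X Y f k i j) = (%(k, i, j). \<beta> X Y g k i j)"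
  hence "\<beta> X Y f k i j = \<beta> X Y g k i j" for k i j by (metis case_prod_conv)
  hence "\<beta> X Y f = \<beta> X Y g" by (intro ext)
  thus "f = g" by (rule eqI[OF assms fg])
 qed
qed (simp_all add: assms zero add smult fun_eq_iff)

lemma cmp_lin:
 assumes X: "X : obs \<S>" "Y : obs \<S>" "Z : obs \<S>"
 shows "g : Hom \<S> Y Z ==> lin_map (hm \<S> X Y) (hm \<S> X Z) (cmp \<S> X Y Z g)"
  "f : Hom \<S> X Y ==> lin_map (hm \<S> Y Z) (hm \<S> X Z) (%g. cmp \<S> X Y Z g f)"
proof -
 show "lin_map (hm \<S> X Y) (hm \<S> X Z) (cmp \<S> X Y Z g)" if g: "g : Hom \<S> Y Z"
  unfolding lin_map_def
 proof (intro conjI ballI allI)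
  fix c f f' assume f: "f : Hom \<S> X Y" "f' : Hom \<S> X Y"
  show "cmp \<S> X Y Z g (f \<oplus>\<^bsub>hm \<S> X Y\<^esub> f') = cmp \<S> X Y Z g f \<oplus>\<^bsub>hm \<S> X Z\<^esub> cmp \<S> X Y Z g f'"
   by (rule eqI[of X Z]) (simp_all add: X f g cmp add mmul_def[abs_def] distrib_left sum.distrib)
 next
  fix c f assume f: "f : Hom \<S> X Y"
  show "cmp \<S> X Y Z g (c \<odot>\<^bsub>hm \<S> X Y\<^esub> f) = c \<odot>\<^bsub>hm \<S> X Z\<^esub> cmp \<S> X Y Z g f"
   by (rule eqI[of X Z]) (simp_all add: X f g cmp smult mmul_def[abs_def] sum_distrib_left mult.left_commute)
 qed (simp add: X g cmp)
 show "lin_map (hm \<S> Y Z) (hm \<S> X Z) (%g. cmp \<S> X Y Z g f)" if f: "f : Hom \<S> X Y"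
  unfolding lin_map_def
 proof (intro conjI ballI allI)
  fix c g g' assume g: "g : Hom \<S> Y Z" "g' : Hom \<S> Y Z"
  show "cmp \<S> X Y Z (g \<oplus>\<^bsub>hm \<S> Y Z\<^esub> g') f = cmp \<S> X Y Z g f \<oplus>\<^bsub>hm \<S> X Z\<^esub> cmp \<S> X Y Z g' f"
   by (rule eqI[of X Z]) (simp_all add: X f g cmp add mmul_def[abs_def] distrib_right sum.distrib)
 next
  fix c g assume g: "g : Hom \<S> Y Z"
  show "cmp \<S> X Y Z (c \<odot>\<^bsub>hm \<S> Y Z\<^esub> g) f = c \<odot>\<^bsub>hm \<S> X Z\<^esub> cmp \<S> X Y Z g f"
   by (rule eqI[of X Z]) (simp_all add: X f g cmp smult mmul_def[abs_def] sum_distrib_left mult.assoc)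
 qed (simp add: X f cmp)
qed

lemma dagger: "dagger_category \<S>"
 unfolding dagger_category_def
proof (intro conjI ballI allI)
 fix X Y f g assume X: "X : obs \<S>" "Y : obs \<S>" and f: "f : Hom \<S> X Y"
 show "cmp \<S> X Y Y (idn \<S> Y) f = f"
  by (rule eqI[of X Y]) (simp_all add: X f cmp idn mmul_mid_left[OF \<beta>_supp])
 show "cmp \<S> X X Y f (idn \<S> X) = f"
  by (rule eqI[of X Y]) (simp_all add: X f cmp idn mmul_mid_right[OF \<beta>_supp])
 show "dgr \<S> X Y f : Hom \<S> Y X" using X f by (rule dgr)
 show "dgr \<S> Y X (dgr \<S> X Y f) = f"
  by (rule eqI[of X Y]) (simp_all add: X f dgr mdag_mdag)
 show "dgr \<S> X Y (c \<odot>\<^bsub>hm \<S> X Y\<^esub> f) = lam_dag c \<odot>\<^bsub>hm \<S> Y X\<^esub> dgr \<S> X Y f" for c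
  by (rule eqI[of Y X]) (simp_all add: X f dgr smult mdag_def[abs_def] lam_dag_mult)
 assume g: "g : Hom \<S> X Y"
 show "dgr \<S> X Y (f \<oplus>\<^bsub>hm \<S> X Y\<^esub> g) = dgr \<S> X Y f \<oplus>\<^bsub>hm \<S> Y X\<^esub> dgr \<S> X Y g"
  by (rule eqI[of Y X]) (simp_all add: X f g dgr add mdag_def[abs_def] lam_dag_add)
next
 fix X Y Z assume X: "X : obs \<S>" "Y : obs \<S>" "Z : obs \<S>"
 show "lin_map (hm \<S> X Y) (hm \<S> X Z) (cmp \<S> X Y Z g)" if "g : Hom \<S> Y Z" for g
  using X that by (rule cmp_lin)
 show "lin_map (hm \<S> Y Z) (hm \<S> X Z) (%g. cmp \<S> X Y Z g f)" if "f : Hom \<S> X Y" for f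
  using X that by (rule cmp_lin)
next
 fix W X Y Z f g h
 assume X: "W : obs \<S>" "X : obs \<S>" "Y : obs \<S>" "Z : obs \<S>" and f: "f : Hom \<S> W X"
  "g : Hom \<S> X Y" "h : Hom \<S> Y Z"
 show "cmp \<S> W X Z (cmp \<S> X Y Z h g) f = cmp \<S> W Y Z h (cmp \<S> W X Y g f)"
  by (rule eqI[of W Z]) (simp_all add: X f cmp mmul_assoc)
next
 fix X assume X: "X : obs \<S>"
 show "dgr \<S> X X (idn \<S> X) = idn \<S> X"
  by (rule eqI[of X X]) (simp_all add: X idn dgr mdag_mid)
next
 fix X Y Z f g
 assume X: "X : obs \<S>" "Y : obs \<S>" "Z : obs \<S>" and f: "f : Hom \<S> X Y" "g : Hom \<S> Y Z"
 show "dgr \<S> X Z (cmp \<S> X Y Z g f) = cmp \<S> Z Y X (dgr \<S> X Y f) (dgr \<S> Y Z g)"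
  by (rule eqI[of Z X]) (simp_all add: X f cmp dgr mdag_mmul)
qed (simp_all add: hom_module idn)

lemma antiunitary: "dagger_antiunitary \<S> p"
 unfolding dagger_antiunitary_def by (simp add: form dgr mform_mdag)

lemma adjointable: "composition_adjointable \<S> p"
 unfolding composition_adjointable_def
proof (intro conjI ballI)
 fix V W W' A f g assume "V : obs \<S>" "W : obs \<S>" "W' : obs \<S>" "A : Hom \<S> W W'"
  "f : Hom \<S> V W" "g : Hom \<S> V W'"
 thus "p V W' (cmp \<S> V W W' A f) g = p V W f (cmp \<S> V W' W (dgr \<S> W W' A) g)"
  by (simp add: form dgr cmp mform_mmul_left)
next
 fix V V' W B f g assume "V : obs \<S>" "V' : obs \<S>" "W : obs \<S>" "B : Hom \<S> V' V"
  "f : Hom \<S> V W" "g : Hom \<S> V' W"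
 thus "p V' W (cmp \<S> V' V W f B) g = p V W f (cmp \<S> V V' W g (dgr \<S> V' V B))"
  by (simp add: form dgr cmp mform_mmul_right)
qed

lemma pos_def:
 assumes X: "X : obs \<S>" "Y : obs \<S>"
 shows "pos_def_hermitian (hm \<S> X Y) (p X Y)"
 unfolding pos_def_hermitian_def
proof (intro conjI ballI allI impI)
 fix f g h assume f: "f : Hom \<S> X Y" "g : Hom \<S> X Y" "h : Hom \<S> X Y"
 show "p X Y f (g \<oplus>\<^bsub>hm \<S> X Y\<^esub> h) = p X Y f g + p X Y f h"
  using X f by (simp add: form add mform_add[OF levels \<beta>_MM[OF X f(1)] \<beta>_MM[OF X f(2)] \<beta>_MM[OF X f(3)]])
next
 fix c f g assume f: "f : Hom \<S> X Y" "g : Hom \<S> X Y"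
 show "p X Y f (c \<odot>\<^bsub>hm \<S> X Y\<^esub> g) = c * p X Y f g"
  using X f by (simp add: form smult mform_scale[OF levels \<beta>_MM[OF X f(1)] \<beta>_MM[OF X f(2)]])
 show "p X Y f g = lam_dag (p X Y g f)"
  using X f mform_herm[OF levels \<beta>_MM[OF X f(1)] \<beta>_MM[OF X f(2)]] by (simp add: form)
next
 fix f assume f: "f : Hom \<S> X Y"
 show "lam_nonneg (p X Y f f)"
  using X f mform_pos(1)[OF levels \<beta>_MM[OF X f]] by (simp add: form)
 assume "p X Y f f = 0"
 hence "\<beta> X Y f = (%k i j. 0)" using X f mform_pos(2)[OF levels \<beta>_MM[OF X f]] by (simp add: form)
 thus "f = \<zero>\<^bsub>hm \<S> X Y\<^esub>" using X f by (intro eqI[of X Y]) (simp_all add: zero)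
qed

lemma bifunctor: "hom_bifunctor \<S> p"
 unfolding hom_bifunctor_def
proof (intro conjI ballI)
 fix V V' W W' a b
 assume X: "V : obs \<S>" "V' : obs \<S>" "W : obs \<S>" "W' : obs \<S>" and a: "a : Hom \<S> V' V"
  and b: "b : Hom \<S> W W'"
 have lin: "lin_map (hm \<S> V W) (hm \<S> V' W') (hom_action \<S> V' V W W' a b)"
  if X: "V : obs \<S>" "V' : obs \<S>" "W : obs \<S>" "W' : obs \<S>" and a: "a : Hom \<S> V' V"
  and b: "b : Hom \<S> W W'" for V V' W W' a b
 proof -
  have 1: "lin_map (hm \<S> V W) (hm \<S> V' W) (%\<Phi>. cmp \<S> V' V W \<Phi> a)"
   and 2: "lin_map (hm \<S> V' W) (hm \<S> V' W') (cmp \<S> V' W W' b)"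
   by (rule cmp_lin[OF X(2,1,3)], rule a, rule cmp_lin[OF X(2,3,4)], rule b)
  thus ?thesis unfolding lin_map_def hom_action_def Pi_iff by simp
 qed
 have adj: "p V' W' (hom_action \<S> V' V W W' a b x) y = p V W x (hom_action \<S> V V' W' W (dgr \<S> V' V a) (dgr \<S> W W' b) y)"
  if x: "x : Hom \<S> V W" and y: "y : Hom \<S> V' W'" for x y
  using X a b x y unfolding hom_action_def
  by (simp add: form cmp dgr, subst mform_mmul_left, subst mform_mmul_right) (simp add: mmul_assoc)
 show "pre_hilbert_mor (hm \<S> V W) (p V W) (hm \<S> V' W') (p V' W') (hom_action \<S> V' V W W' a b)"
  unfolding pre_hilbert_mor_def
  using lin[OF X a b] lin[OF X(2,1,4,3) dgr(1)[OF X(2,1) a] dgr(1)[OF X(3,4) b]] adj by blast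
next
 fix V W \<Phi> assume X: "V : obs \<S>" "W : obs \<S>" and \<Phi>: "\<Phi> : Hom \<S> V W"
 show "hom_action \<S> V V W W (idn \<S> V) (idn \<S> W) \<Phi> = \<Phi>"
  unfolding hom_action_def
  by (rule eqI[of V W]) (simp_all add: X \<Phi> cmp idn mmul_mid_left[OF \<beta>_supp] mmul_mid_right[OF \<beta>_supp])
next
 fix V V' V'' W W' W'' a a' b b' \<Phi>
 assume X: "V : obs \<S>" "V' : obs \<S>" "V'' : obs \<S>" "W : obs \<S>" "W' : obs \<S>" "W'' : obs \<S>"
  and a: "a : Hom \<S> V' V" "a' : Hom \<S> V'' V'"
  and b: "b : Hom \<S> W W'" "b' : Hom \<S> W' W''" and \<Phi>: "\<Phi> : Hom \<S> V W"
 show "hom_action \<S> V'' V W W'' (cmp \<S> V'' V' V a a') (cmp \<S> W W' W'' b' b) \<Phi>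
   = hom_action \<S> V'' V' W' W'' a' b' (hom_action \<S> V' V W W' a b \<Phi>)"
  unfolding hom_action_def
  by (rule eqI[of V'' W'']) (simp_all add: X a b \<Phi> cmp mmul_assoc)
qed (simp add: pre_hilbert_def hom_module pos_def)

lemma two_ip: "two_inner_product \<S> p"
 unfolding two_inner_product_def using dagger bifunctor antiunitary adjointable by blast

end

context unitary_param begin

definition msh :: "'k::{field,finite} HH => ('k HH => nat => nat => lam) => 'k HH => nat => nat => lam" where
 "msh h M k i j = sh n h (%k. M k i j) k"

text \<open>Translation of matrix functions by \<open>h\<close>; refinement is the case \<open>h = 1\<close>.\<close>

lemma dag_functor:
 fixes \<S> :: "('o, 'm) dagcat" and \<T> :: "('o2, 'm2) dagcat" and \<E> :: "'k::{field,finite} HH set set"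
 assumes S: "dag_model n \<alpha> \<S> \<E> d \<beta> p" and T: "dag_model n \<alpha> \<T> \<E>' d' \<beta>' p'" and h: "h : H0 n"
  and Fo: "!!X. X : obs \<S> ==> Fo X : obs \<T> & d' (Fo X) = d X"
  and Fm: "!!X Y f. X : obs \<S> ==> Y : obs \<S> ==> f : Hom \<S> X Y ==> Fm X Y f : Hom \<T> (Fo X) (Fo Y)"
   "!!X Y f. X : obs \<S> ==> Y : obs \<S> ==> f : Hom \<S> X Y ==> \<beta>' (Fo X) (Fo Y) (Fm X Y f) = msh h (\<beta> X Y f)"
 shows "isometric_dagger_functor \<S> p \<T> p' Fo Fm"
proof -
 interpret S: dag_model n \<alpha> \<S> \<E> d \<beta> p by (rule S)
 interpret T: dag_model n \<alpha> \<T> \<E>' d' \<beta>' p' by (rule T)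
 have Fo': "!!X. X : obs \<S> ==> Fo X : obs \<T>" "!!X. X : obs \<S> ==> d' (Fo X) = d X" using Fo by blast+
 note F = Fo' Fm msh_def[abs_def] sh_def
 show ?thesis unfolding isometric_dagger_functor_def
 proof (intro conjI ballI)
  fix X Y assume X: "X : obs \<S>" "Y : obs \<S>"
  show "lin_map (hm \<S> X Y) (hm \<T> (Fo X) (Fo Y)) (Fm X Y)"
   unfolding lin_map_def
  proof (intro conjI ballI allI)
   fix f g assume f: "f : Hom \<S> X Y" "g : Hom \<S> X Y"
   show "Fm X Y (f \<oplus>\<^bsub>hm \<S> X Y\<^esub> g) = Fm X Y f \<oplus>\<^bsub>hm \<T> (Fo X) (Fo Y)\<^esub> Fm X Y g"
    by (rule T.eqI[of "Fo X" "Fo Y"]) (simp_all add: X f F S.add T.add fun_eq_iff)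
  next
   fix c f assume f: "f : Hom \<S> X Y"
   show "Fm X Y (c \<odot>\<^bsub>hm \<S> X Y\<^esub> f) = c \<odot>\<^bsub>hm \<T> (Fo X) (Fo Y)\<^esub> Fm X Y f"
    by (rule T.eqI[of "Fo X" "Fo Y"]) (simp_all add: X f F S.smult T.smult fun_eq_iff)
  qed (simp add: Fm(1) X)
 next
  fix X assume X: "X : obs \<S>"
  show "Fm X X (idn \<S> X) = idn \<T> (Fo X)"
   by (rule T.eqI[of "Fo X" "Fo X"]) (use h in \<open>auto simp: X F S.idn T.idn fun_eq_iff mid_def\<close>)
 next
  fix X Y Z f g assume X: "X : obs \<S>" "Y : obs \<S>" "Z : obs \<S>"
   and f: "f : Hom \<S> X Y" "g : Hom \<S> Y Z"
  show "Fm X Z (cmp \<S> X Y Z g f) = cmp \<T> (Fo X) (Fo Y) (Fo Z) (Fm Y Z g) (Fm X Y f)"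
   by (rule T.eqI[of "Fo X" "Fo Z"]) (simp_all add: X f F S.cmp T.cmp fun_eq_iff mmul_def)
 next
  fix X Y f assume X: "X : obs \<S>" "Y : obs \<S>" and f: "f : Hom \<S> X Y"
  show "Fm Y X (dgr \<S> X Y f) = dgr \<T> (Fo X) (Fo Y) (Fm X Y f)"
   by (rule T.eqI[of "Fo Y" "Fo X"]) (simp_all add: X f F S.dgr T.dgr fun_eq_iff mdag_def)
  fix g assume g: "g : Hom \<S> X Y"
  let ?D = "dens (d X) (d Y) (\<beta> X Y f) (\<beta> X Y g)"
  have D: "?D : Cyl n \<E>" by (rule dens_Cyl[OF S.levels S.\<beta>_MM[OF X f] S.\<beta>_MM[OF X g]])
  have "dens (d X) (d Y) (msh h (\<beta> X Y f)) (msh h (\<beta> X Y g)) = sh n h ?D"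
   by (simp add: fun_eq_iff dens_def msh_def sh_def)
  hence "p' (Fo X) (Fo Y) (Fm X Y f) (Fm X Y g) = tauH n (sh n h ?D)"
   using X f g by (simp add: T.form Fo' Fm mform_def)
  thus "p' (Fo X) (Fo Y) (Fm X Y f) (Fm X Y g) = p X Y f g"
   using sh_Cyl(2)[OF S.levels D h] X f g by (simp add: S.form mform_def)
 qed (simp add: Fo')
qed

end

section \<open>The cylindrical category at a fixed level\<close>

context unitary_param begin

lemma XX_I: "k : H0 n ==> k <| C : XX n C"
 unfolding XX_def by blast

text \<open>The cosets of \<open>Q0 E\<close> are unions of cosets of \<open>C\<close> when \<open>C \<subseteq> E\<close>, by normality of \<open>C\<close> in \<open>H0 n\<close>.\<close>

definition lv :: "'k::{field,finite} HH set => 'k HH set set" where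
 "lv C = {E : CH0 n. C <= E}"

lemma lv_CH0: "lv C <= CH0 n"
 unfolding lv_def by blast

lemma cyl_set_left:
 fixes \<E> :: "'k::{field,finite} HH set set"
 assumes A: "A : cyl_sets n \<E>" and \<E>: "\<E> <= CH0 n" and k: "k : A"
  and x: "x : H0 n" "!!E. E : \<E> ==> x : QE n E"
 shows "x \<odot> k : A"
proof -
 consider "A = H0 n" | E g where "A = QE n E #>\<^bsub>Hgrp n\<^esub> g" "E : \<E>" "g : H0 n"
  using A unfolding cyl_sets_def by blast
 thus ?thesis
 proof cases
  case 1
  thus ?thesis using k x by simp
 next
  case (2 E g)
  hence E: "subgroup (QE n E) (Hgrp n)" using \<E> QE_subgroup by blast
  obtain p where p: "p : QE n E" "k = p \<odot> g" using k unfolding 2(1) coset_mem by blast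
  have "x \<odot> k = (x \<odot> p) \<odot> g"
   using p x(1) 2(3) subgroup.mem_carrier[OF E p(1)] by (simp add: HG.m_assoc)
  thus ?thesis unfolding 2(1) coset_mem
   using subgroup.m_closed[OF E x(2)[OF 2(2)] p(1)] by blast
 qed
qed

lemma Cyl_left:
 fixes \<E> :: "'k::{field,finite} HH set set"
 assumes F: "F : Cyl n \<E>" and \<E>: "\<E> <= CH0 n" and k: "k : H0 n"
  and x: "x : H0 n" "!!E. E : \<E> ==> x : QE n E"
 shows "F (x \<odot> k) = F k"
proof -
 obtain \<T> c where *: "finite \<T>" "\<T> <= cyl_sets n \<E>" "F = (%k. \<Sum>A\<in>\<T>. c A * ind A k)"
  using F by (rule CylE)
 have "x \<odot> k : A \<longleftrightarrow> k : A" if "A : \<T>" for A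
 proof
  have A: "A : cyl_sets n \<E>" using that *(2) by blast
  assume "x \<odot> k : A"
  hence "gi x \<odot> (x \<odot> k) : A"
  proof (rule cyl_set_left[OF A \<E>])
   show "gi x : H0 n" using x(1) by simp
   show "gi x : QE n E" if "E : \<E>" for E
    using subgroup.m_inv_closed[OF QE_subgroup x(2)] \<E> that by blast
  qed
  thus "k : A" using x(1) k by simp
 qed (use that *(2) in \<open>blast intro: cyl_set_left[OF _ \<E> _ x]\<close>)
 thus ?thesis unfolding *(3) by (intro sum.cong refl) (simp add: ind_def)
qed

lemma Q0_QE: "q : Q0 n ==> E : CH0 n ==> q : QE n E"
 unfolding QE_mem using subgroup.one_closed[OF CH0_subgroup]
 by (intro bexI[of _ q] bexI[of _ g1]) auto

lemma MM_good:
 fixes C :: "'k::{field,finite} HH set"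
 assumes C: "C : CH0 n" and M: "M : MM (lv C) r s"
 shows "good C M"
 unfolding good_def
proof (intro ballI conjI ext)
 fix k q :: "'k HH" and i j assume k: "k : H0 n" and q: "q : Q0 n"
 show "M (q \<odot> k) i j = M k i j"
  by (rule Cyl_left[OF MM_Cyl[OF M] lv_CH0 k Q0_H0[OF q]]) (use q Q0_QE lv_CH0 in blast)
next
 fix k c :: "'k HH" and i j assume k: "k : H0 n" and c: "c : C"
 let ?x = "k \<odot> c \<odot> gi k"
 have cH: "c : H0 n" using c CH0_subset_H0[OF C] by blast
 have e: "?x \<odot> k = k \<odot> c" using k cH by (simp add: HG.m_assoc)
 have "M (?x \<odot> k) i j = M k i j"
 proof (rule Cyl_left[OF MM_Cyl[OF M] lv_CH0 k])
  show "?x : H0 n" using k cH by simp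
  show "?x : QE n E" if "E : lv C" for E
   using CH0_conj_mem[OF C k c] E_subset_QE[of E n] that unfolding lv_def by blast
 qed
 thus "M (k \<odot> c) i j = M k i j" unfolding e .
qed

lemma coset_image_iff:
 fixes C :: "'k::{field,finite} HH set"
 assumes C: "C : CH0 n" and A: "A : cyl_sets n (lv C)" and k: "k : H0 n"
 shows "k <| C : (%k. k <| C) ` A \<longleftrightarrow> k : A"
proof
 assume "k <| C : (%k. k <| C) ` A"
 then obtain l where l: "l : A" "k <| C = l <| C" by blast
 have lH: "l : H0 n" using cyl_sets_subset_H0[OF lv_CH0 A] l(1) by blast
 obtain c where c: "c : C" "k = l \<odot> c" using lco_eq_iff[OF C, of l k] l lH k by auto
 have cH: "c : H0 n" using c CH0_subset_H0[OF C] by blast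
 have "(l \<odot> c \<odot> gi l) \<odot> l : A"
 proof (rule cyl_set_left[OF A lv_CH0 l(1)])
  show "l \<odot> c \<odot> gi l : H0 n" using lH cH by simp
  show "l \<odot> c \<odot> gi l : QE n E" if "E : lv C" for E
   using CH0_conj_mem[OF C lH c(1)] E_subset_QE[of E n] that unfolding lv_def by blast
 qed
 thus "k : A" using lH cH c(2) by (simp add: HG.m_assoc)
qed blast

text \<open>Pulling back along \<open>k \<mapsto> kC\<close> identifies the algebra on \<open>X\<^sub>C\<close> with cylindrical functions on \<open>H0 n\<close>.\<close>

lemma A_cyl_iff:
 fixes C :: "'k::{field,finite} HH set"
 assumes C: "C : CH0 n"
 shows "f : A_cyl n C \<longleftrightarrow> f : extensional (XX n C) & (%k. if k : H0 n then f (k <| C) else 0) : Cyl n (lv C)"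
proof
 note img = coset_image_iff[OF C]
 assume "f : A_cyl n C"
 thus "f : extensional (XX n C) & (%k. if k : H0 n then f (k <| C) else 0) : Cyl n (lv C)"
 proof (induction rule: A_cyl.induct)
  case one
  have "(%k. if k : H0 n then (\<lambda>x\<in>XX n C. 1) (k <| C) else 0) = ind (H0 n)"
   using XX_I[of _ C] by (auto simp: ind_def fun_eq_iff)
  thus ?case using Cyl_ind[of "H0 n" n "lv C"]
   by (intro conjI restrict_extensional) (simp add: cyl_sets_def)
 next
  case (ind E g)
  let ?A = "QE n E #>\<^bsub>Hgrp n\<^esub> g"
  have A: "?A : cyl_sets n (lv C)" using ind unfolding cyl_sets_def lv_def by blast
  have e: "(%k. if k : H0 n then (\<lambda>x\<in>XX n C. if x : (%k. k <| C) ` ?A then 1 else 0) (k <| C) else 0) = ind ?A"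
  proof
   fix k
   show "(if k : H0 n then (\<lambda>x\<in>XX n C. if x : (%k. k <| C) ` ?A then 1 else 0) (k <| C) else 0) = ind ?A k"
   proof (cases "k : H0 n")
    case True
    thus ?thesis by (simp only: img[OF A True] XX_I[OF True] if_True ind_def restrict_apply)
   next
    case False
    hence "k ~: ?A" using cyl_sets_subset_H0[OF lv_CH0 A] by blast
    thus ?thesis using False by (simp only: ind_def if_False)
   qed
  qed
  show ?case unfolding e by (intro conjI restrict_extensional Cyl_ind[OF A])
 next
  case (add f g)
  have e: "(%k. if k : H0 n then (\<lambda>x\<in>XX n C. f x + g x) (k <| C) else 0)
   = (%k. (if k : H0 n then f (k <| C) else 0) + (if k : H0 n then g (k <| C) else 0))"
   using XX_I[of _ C] by auto
  show ?case unfolding e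
   by (intro conjI restrict_extensional Cyl_add[OF conjunct2[OF add.IH(1)] conjunct2[OF add.IH(2)]])
 next
  case (scale f c)
  have e: "(%k. if k : H0 n then (\<lambda>x\<in>XX n C. c * f x) (k <| C) else 0)
   = (%k. c * (if k : H0 n then f (k <| C) else 0))"
   using XX_I[of _ C] by auto
  show ?case unfolding e
   by (intro conjI restrict_extensional Cyl_scale[OF conjunct2[OF scale.IH]])
 qed
next
 note img = coset_image_iff[OF C]
 assume f: "f : extensional (XX n C) & (%k. if k : H0 n then f (k <| C) else 0) : Cyl n (lv C)"
 obtain \<T> c where *: "finite \<T>" "\<T> <= cyl_sets n (lv C)"
  "(%k. if k : H0 n then f (k <| C) else 0) = (%k. \<Sum>A\<in>\<T>. c A * ind A k)"
  using conjunct2[OF f] by (rule CylE)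
 let ?a = "%A x. if x : (%k. k <| C) ` A then 1 else (0 :: lam)"
 have a: "(\<lambda>x\<in>XX n C. ?a A x) : A_cyl n C" if A: "A : cyl_sets n (lv C)" for A
 proof (cases "A = H0 n")
  case True
  have "(\<lambda>x\<in>XX n C. ?a A x) = (\<lambda>x\<in>XX n C. 1)" unfolding True XX_def by auto
  thus ?thesis using A_cyl.one[of n C] by simp
 next
  case False
  then obtain E g where "A = QE n E #>\<^bsub>Hgrp n\<^esub> g" "E : CH0 n" "C <= E" "g : H0 n"
   using A unfolding cyl_sets_def lv_def by blast
  thus ?thesis using A_cyl.ind[of E n C g] by simp
 qed
 have "(\<lambda>x\<in>XX n C. \<Sum>A\<in>\<T>. c A * ?a A x) : A_cyl n C"
  using *(1,2)
 proof (induction \<T> rule: finite_induct)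
  case empty
  have e: "(\<lambda>x\<in>XX n C. \<Sum>A\<in>{}. c A * ?a A x) = (\<lambda>x\<in>XX n C. 0 * (\<lambda>x\<in>XX n C. 1) x)" by (rule restrict_ext) simp
  show ?case unfolding e by (intro A_cyl.scale A_cyl.one)
 next
  case (insert A \<T>)
  have e: "(\<lambda>x\<in>XX n C. \<Sum>A\<in>insert A \<T>. c A * ?a A x)
    = (\<lambda>x\<in>XX n C. (\<lambda>x\<in>XX n C. c A * (\<lambda>x\<in>XX n C. ?a A x) x) x + (\<lambda>x\<in>XX n C. \<Sum>A\<in>\<T>. c A * ?a A x) x)"
   using insert(1,2) by (intro restrict_ext) simp
  show ?case unfolding e
   by (intro A_cyl.add A_cyl.scale a insert.IH) (use insert.prems in blast)+
 qed
 moreover have "f = (\<lambda>x\<in>XX n C. \<Sum>A\<in>\<T>. c A * ?a A x)"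
 proof (rule extensionalityI[of _ "XX n C"])
  fix x assume x: "x : XX n C"
  then obtain k where k: "k : H0 n" "x = k <| C" unfolding XX_def by blast
  have "f x = (\<Sum>A\<in>\<T>. c A * ind A k)" using fun_cong[OF *(3), of k] k by simp
  also have "... = (\<Sum>A\<in>\<T>. c A * ?a A x)"
   using img[OF _ k(1)] *(2) unfolding k(2) by (intro sum.cong refl) (auto simp: ind_def simp del: image_iff)
  finally show "f x = (\<lambda>x\<in>XX n C. \<Sum>A\<in>\<T>. c A * ?a A x) x" using x by simp
 qed (use f in auto)
 ultimately show "f : A_cyl n C" by simp
qed

lemma picture_md:
 "k : H0 n ==> i < s ==> j < r ==> picture n C r s f (k <| C) $$ (i, j) = md C r s f k i j"
 using XX_I[of k C] by (simp add: picture_def md_def)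

lemma S_hom_iff:
 fixes C :: "'k::{field,finite} HH set"
 assumes C: "C : CH0 n"
 shows "f : Sh C r s \<longleftrightarrow> f : Ih C r s & md C r s f : MM (lv C) r s"
proof -
 have "(\<lambda>x\<in>XX n C. picture n C r s f x $$ (i, j)) : A_cyl n C \<longleftrightarrow> (%k. md C r s f k i j) : Cyl n (lv C)"
  if "i < s" "j < r" for i j
 proof -
  have "(%k. if k : H0 n then (\<lambda>x\<in>XX n C. picture n C r s f x $$ (i, j)) (k <| C) else 0) = (%k. md C r s f k i j)"
   using that XX_I[of _ C] picture_md[OF _ that, of _ C f] by (auto simp: md_def fun_eq_iff)
  thus ?thesis unfolding A_cyl_iff[OF C] by simp
 qed
 moreover have "(%k. md C r s f k i j) : Cyl n (lv C)" if "~ (i < s & j < r)" for i j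
 proof -
  have "(%k. md C r s f k i j) = (%k. 0)" using that by (auto simp: md_def)
  thus ?thesis by (simp only: Cyl_0)
 qed
 ultimately show ?thesis unfolding S_hom_def MM_def using md_supp[of r s C f] by blast
qed

lemma md_bij:
 fixes C :: "'k::{field,finite} HH set"
 assumes C: "C : CH0 n"
 shows "bij_betw (md C r s) (Sh C r s) (MM (lv C) r s)"
 unfolding bij_betw_def
proof (intro conjI subset_antisym subsetI)
 show "inj_on (md C r s) (Sh C r s)"
  by (rule inj_on_subset[OF md_inj[OF C]]) (simp add: S_hom_def)
 show "M : MM (lv C) r s" if "M : md C r s ` Sh C r s" for M
  using that S_hom_iff[OF C] by blast
 fix M :: "'k HH => nat => nat => lam" assume M: "M : MM (lv C) r s"
 have e: "md C r s (op C r s M) = M" by (rule md_op_eq[OF MM_good[OF C M] MM_supp[OF M] C])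
 have "op C r s M : Sh C r s"
  unfolding S_hom_iff[OF C] e using op_mem[OF MM_good[OF C M] C] M by blast
 thus "M : md C r s ` Sh C r s" using e by force
qed

lemma picture_bij:
 fixes C :: "'k::{field,finite} HH set"
 assumes C: "C : CH0 n"
 shows "bij_betw (picture n C r s) (Sh C r s)
  {M : XX n C \<rightarrow>\<^sub>E carrier_mat s r. \<forall>i<s. \<forall>j<r. (\<lambda>x\<in>XX n C. M x $$ (i, j)) : A_cyl n C}" (is "bij_betw _ _ ?T")
 unfolding bij_betw_def
proof (intro conjI subset_antisym subsetI)
 show "inj_on (picture n C r s) (Sh C r s)"
 proof (rule inj_onI)
  fix f f' assume f: "f : Sh C r s" "f' : Sh C r s" and e: "picture n C r s f = picture n C r s f'"
  have "md C r s f k i j = md C r s f' k i j" for k i j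
   by (cases "k : H0 n & i < s & j < r") (simp add: picture_md[symmetric] e, auto simp: md_def)
  hence "md C r s f = md C r s f'" by (intro ext)
  thus "f = f'" by (rule inj_onD[OF bij_betw_imp_inj_on[OF md_bij[OF C]] _ f])
 qed
 show "M : ?T" if "M : picture n C r s ` Sh C r s" for M
  using that unfolding S_hom_def by (auto simp: picture_def)
 fix M assume M: "M : ?T"
 define N where "N k i j = (if k : H0 n & i < s & j < r then M (k <| C) $$ (i, j) else 0)" for k i j
 have N: "N : MM (lv C) r s"
 proof (rule MM_I)
  show "supp r s N" by (simp add: supp_def N_def)
  show "(%k. N k i j) : Cyl n (lv C)" for i j
  proof (cases "i < s & j < r")
   case True
   hence "(\<lambda>x\<in>XX n C. M x $$ (i, j)) : A_cyl n C" using M by blast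
   moreover have "(%k. if k : H0 n then (\<lambda>x\<in>XX n C. M x $$ (i, j)) (k <| C) else 0) = (%k. N k i j)"
    using True XX_I[of _ C] by (auto simp: N_def fun_eq_iff)
   ultimately show ?thesis unfolding A_cyl_iff[OF C] by simp
  next
   case False
   hence "(%k. N k i j) = (%k. 0)" by (auto simp: N_def)
   thus ?thesis using Cyl_0 by metis
  qed
 qed
 have "N : md C r s ` Sh C r s"
  using N bij_betw_imp_surj_on[OF md_bij[OF C, of r s]] by simp
 then obtain f where f: "N = md C r s f" "f : Sh C r s" by (rule imageE)
 have "picture n C r s f = M"
 proof (rule extensionalityI[of _ "XX n C"])
  fix x assume x: "x : XX n C"
  then obtain k where k: "k : H0 n" "x = k <| C" unfolding XX_def by blast
  have Mx: "M x : carrier_mat s r" using M x by blast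
  show "picture n C r s f x = M x"
  proof (rule eq_matI)
   fix i j assume "i < dim_row (M x)" "j < dim_col (M x)"
   thus "picture n C r s f x $$ (i, j) = M x $$ (i, j)"
    using picture_md[OF k(1), of i s j r C f] Mx k by (simp add: f(1)[symmetric] N_def)
  qed (use Mx x in \<open>simp_all add: picture_def\<close>)
 qed (use M in \<open>auto simp: picture_def PiE_iff\<close>)
 thus "M : picture n C r s ` Sh C r s" using f(2) by blast
qed

lemma S_homI:
 fixes C :: "'k::{field,finite} HH set"
 assumes C: "C : CH0 n" and M: "M : MM (lv C) r s" and f: "f : extensional (SS n C)"
  "!!g. g : GG ==> f (g <| C) : extensional (PF r g)"
  "!!g v. g : GG ==> v : PF r g ==> f (g <| C) v = opv r s M g v"
 shows "f : Sh C r s" "md C r s f = M"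
 using I_hom_char[OF C MM_good[OF C M] MM_supp[OF M] f] M unfolding S_hom_iff[OF C] by blast+

lemma S_hom_opv:
 fixes C :: "'k::{field,finite} HH set"
 assumes C: "C : CH0 n" and f: "f : Sh C r s" and g: "g : GG" and v: "v : PF r g"
 shows "f (g <| C) v = opv r s (md C r s f) g v"
 using f I_hom_eq_opv[OF C _ g v] unfolding S_hom_def by blast

lemma I_id_md:
 fixes C :: "'k::{field,finite} HH set"
 assumes C: "C : CH0 n"
 shows "I_id n C (vp C r) : Sh C r r" "md C r r (I_id n C (vp C r)) = mid r"
proof -
 have e: "I_id n C (vp C r) (g <| C) = (\<lambda>v\<in>PF r g. v)" if "g : GG" for g
  using lco_SS[OF that, of C] by (simp add: I_id_def vpow_carrier[OF C that])
 have opv: "v = opv r r (mid r) g v" if "g : GG" "v : PF r g" for g v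
 proof (rule extensionalityI[of _ "{..<r}"])
  fix i assume i: "i : {..<r}"
  show "v i = opv r r (mid r) g v i"
  proof
   fix b
   have "(\<Sum>j<r. mid r (gi b \<odot> g) i j * v j b) = (\<Sum>j<r. if j = i then mid r (gi b \<odot> g) i i * v i b else 0)"
    by (rule sum.cong[OF refl]) (auto simp: mid_def)
   moreover have "v i b = 0" if "~ (b : BH n & gi b \<odot> g : H0 n)"
    using PF_nth[OF \<open>v : PF r g\<close>, of i] i that unfolding Fb_iff by blast
   ultimately show "v i b = opv r r (mid r) g v i b" using i by (auto simp: opv_def mid_def)
  qed
 qed (use that in \<open>auto simp: PF_def PiE_iff opv_def\<close>)
 have ext: "I_id n C (vp C r) : extensional (SS n C)" by (simp add: I_id_def)
 show "I_id n C (vp C r) : Sh C r r" "md C r r (I_id n C (vp C r)) = mid r"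
  by (rule S_homI[OF C MM_mid ext]; simp add: e opv[symmetric])+
qed

text \<open>The description in \<open>S_dag\<close> is unique because a morphism is determined by its matrix function.\<close>

lemma S_dag_md:
 fixes C :: "'k::{field,finite} HH set"
 assumes C: "C : CH0 n" and f: "f : Sh C r s"
 shows "S_dag n \<alpha> C r s f : Sh C s r" "md C s r (S_dag n \<alpha> C r s f) = mdag (md C r s f)"
proof -
 have iff: "(ALL x:XX n C. picture n C s r g x = mat_adj (picture n C r s f x)) \<longleftrightarrow> md C s r g = mdag (md C r s f)" for g
 proof
  assume e: "ALL x:XX n C. picture n C s r g x = mat_adj (picture n C r s f x)"
  show "md C s r g = mdag (md C r s f)"
  proof (intro ext)
   fix k :: "'k HH" and i j
   show "md C s r g k i j = mdag (md C r s f) k i j"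
   proof (cases "k : H0 n & i < r & j < s")
    case True
    hence k: "k <| C : XX n C" by (simp add: XX_I)
    have "md C s r g k i j = mat_adj (picture n C r s f (k <| C)) $$ (i, j)"
     using True e k picture_md[of k i r j s C g] by simp
    also have "... = lam_dag (picture n C r s f (k <| C) $$ (j, i))"
     using True k by (simp add: mat_adj_def picture_def)
    finally show ?thesis using True picture_md[of k j s i r C f] by (simp add: mdag_def)
   qed (auto simp: md_def mdag_def)
  qed
 next
  assume e: "md C s r g = mdag (md C r s f)"
  show "ALL x:XX n C. picture n C s r g x = mat_adj (picture n C r s f x)"
   unfolding XX_ball[OF C]
  proof
   fix k :: "'k HH" assume k: "k : H0 n"
   have K: "k <| C : XX n C" by (rule XX_I[OF k])
   show "picture n C s r g (k <| C) = mat_adj (picture n C r s f (k <| C))"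
   proof (rule eq_matI)
    fix i j assume "i < dim_row (mat_adj (picture n C r s f (k <| C)))" "j < dim_col (mat_adj (picture n C r s f (k <| C)))"
    hence ij: "i < r" "j < s" using K by (simp_all add: mat_adj_def picture_def)
    have "picture n C s r g (k <| C) $$ (i, j) = lam_dag (picture n C r s f (k <| C) $$ (j, i))"
     unfolding picture_md[OF k ij] picture_md[OF k ij(2,1)] e mdag_def ..
    thus "picture n C s r g (k <| C) $$ (i, j) = mat_adj (picture n C r s f (k <| C)) $$ (i, j)"
     using ij K by (simp add: mat_adj_def picture_def)
   qed (use K in \<open>simp_all add: mat_adj_def picture_def\<close>)
  qed
 qed
 have M: "mdag (md C r s f) : MM (lv C) s r" using f unfolding S_hom_iff[OF C] by (blast intro: MM_mdag)
 have "mdag (md C r s f) : md C s r ` Sh C s r"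
  using M bij_betw_imp_surj_on[OF md_bij[OF C, of s r]] by simp
 then obtain g where g: "mdag (md C r s f) = md C s r g" "g : Sh C s r" by (rule imageE)
 have g': "g : Ih C s r" using g(2) by (simp add: S_hom_def)
 have "S_dag n \<alpha> C r s f = g"
  unfolding S_dag_def iff
 proof (rule the_equality)
  show "g : Ih C s r & md C s r g = mdag (md C r s f)"
   using g' g(1) by simp
  show "g2 = g" if "g2 : Ih C s r & md C s r g2 = mdag (md C r s f)" for g2
   using that g(1) by (intro inj_onD[OF md_inj[OF C] _ _ g']) auto
 qed
 thus "S_dag n \<alpha> C r s f : Sh C s r" "md C s r (S_dag n \<alpha> C r s f) = mdag (md C r s f)"
  using g by simp_all
qed

lemma tr_fun_dens:
 "(%k. if k : H0 n then tr_fun n C r s \<Phi> \<Psi> (k <| C) else 0) = dens r s (md C r s \<Phi>) (md C r s \<Psi>)"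
proof
 fix k
 show "(if k : H0 n then tr_fun n C r s \<Phi> \<Psi> (k <| C) else 0) = dens r s (md C r s \<Phi>) (md C r s \<Psi>) k"
 proof (cases "k : H0 n")
  case True
  hence K: "k <| C : XX n C" by (rule XX_I)
  have d: "dim_row (picture n C r s \<Phi> (k <| C)) = s" "dim_col (picture n C r s \<Phi> (k <| C)) = r"
   "dim_row (picture n C r s \<Psi> (k <| C)) = s" "dim_col (picture n C r s \<Psi> (k <| C)) = r" for \<Phi> \<Psi>
   using K by (simp_all add: picture_def)
  have "tr_fun n C r s \<Phi> \<Psi> (k <| C)
    = (\<Sum>j<r. \<Sum>i<s. lam_dag (picture n C r s \<Phi> (k <| C) $$ (i, j)) * picture n C r s \<Psi> (k <| C) $$ (i, j))"
   using K by (simp add: tr_fun_def mat_tr_def mat_adj_def scalar_prod_def d atLeast0LessThan)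
  also have "... = dens r s (md C r s \<Phi>) (md C r s \<Psi>) k"
   unfolding dens_def using True by (intro sum.cong refl) (simp add: picture_md)
  finally show ?thesis using True by simp
 qed (simp add: dens_def md_def)
qed

lemma S_form_mform: "S_form n C r s \<Phi> \<Psi> = mform r s (md C r s \<Phi>) (md C r s \<Psi>)"
 unfolding S_form_def tau_def has_tau_def tr_fun_dens mform_def tauH_def ..

lemma has_tau_unique:
 fixes C :: "'k::{field,finite} HH set"
 assumes C: "C : CH0 n" and f: "\<Phi> : Sh C r s" "\<Psi> : Sh C r s"
 shows "\<exists>!v. has_tau n C (tr_fun n C r s \<Phi> \<Psi>) v"
proof -
 have "dens r s (md C r s \<Phi>) (md C r s \<Psi>) : Cyl n (lv C)"
  using f unfolding S_hom_iff[OF C] by (intro dens_Cyl[OF lv_CH0]) auto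
 from Cyl_has_mu_0[OF lv_CH0 this] show ?thesis
  unfolding has_tau_def tr_fun_dens using has_mu_0_unique by blast
qed

lemma opv_add: "(\<lambda>i\<in>{..<s}. %b. opv r s M g v i b + opv r s N g v i b) = opv r s (%k i j. M k i j + N k i j) g v"
 unfolding opv_def by (intro restrict_ext ext) (simp add: distrib_right sum.distrib)

lemma opv_scale: "(\<lambda>i\<in>{..<s}. %b. c * opv r s M g v i b) = opv r s (%k i j. c * M k i j) g v"
 unfolding opv_def by (intro restrict_ext ext) (simp add: sum_distrib_left mult.assoc)

lemma opv_0: "(\<lambda>i\<in>{..<s}. %b. 0) = opv r s (%k i j. 0) g v"
 unfolding opv_def by (intro restrict_ext ext) simp

lemma S_cat_model:
 fixes C :: "'k::{field,finite} HH set"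
 assumes C: "C : CH0 n"
 shows "dag_model n \<alpha> (SC C) (lv C) (%r. r) (md C) (S_form n C)"
proof -
 let ?S = "SC C"
 have carr: "Hom ?S r s = Sh C r s" for r s
  by (simp add: S_cat_def Let_def mk_module_def)
 have z: "\<zero>\<^bsub>hm ?S r s\<^esub> = (\<lambda>x\<in>SS n C. \<lambda>v\<in>carrier (fib (vp C r) x). \<zero>\<^bsub>fib (vp C s) x\<^esub>)" for r s
  by (simp add: S_cat_def Let_def mk_module_def)
 have a: "f \<oplus>\<^bsub>hm ?S r s\<^esub> f' = (\<lambda>x\<in>SS n C. \<lambda>v\<in>carrier (fib (vp C r) x). f x v \<oplus>\<^bsub>fib (vp C s) x\<^esub> f' x v)" for r s f f'
  by (simp add: S_cat_def Let_def mk_module_def)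
 have m: "c \<odot>\<^bsub>hm ?S r s\<^esub> f = (\<lambda>x\<in>SS n C. \<lambda>v\<in>carrier (fib (vp C r) x). c \<odot>\<^bsub>fib (vp C s) x\<^esub> f x v)" for r s f c
  by (simp add: S_cat_def Let_def mk_module_def)
 have z': "\<zero>\<^bsub>hm ?S r s\<^esub> (g <| C) = (\<lambda>v\<in>PF r g. \<lambda>i\<in>{..<s}. %b. 0)" if "g : GG" for r s g
  unfolding z using lco_SS[OF that, of C] by (simp add: vpow_fib[OF C that] mk_module_def)
 have a': "(f \<oplus>\<^bsub>hm ?S r s\<^esub> f') (g <| C) = (\<lambda>v\<in>PF r g. \<lambda>i\<in>{..<s}. %b. f (g <| C) v i b + f' (g <| C) v i b)"
  if "g : GG" for r s f f' g
  unfolding a using lco_SS[OF that, of C] by (simp add: vpow_fib[OF C that] mk_module_def)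
 have m': "(c \<odot>\<^bsub>hm ?S r s\<^esub> f) (g <| C) = (\<lambda>v\<in>PF r g. \<lambda>i\<in>{..<s}. %b. c * f (g <| C) v i b)"
  if "g : GG" for r s f c g
  unfolding m using lco_SS[OF that, of C] by (simp add: vpow_fib[OF C that] mk_module_def)
 have md: "md C r s f : MM (lv C) r s" if "f : Sh C r s" for r s f
  using that unfolding S_hom_iff[OF C] by blast
 have ext: "\<zero>\<^bsub>hm ?S r s\<^esub> : extensional (SS n C)" "f \<oplus>\<^bsub>hm ?S r s\<^esub> f' : extensional (SS n C)"
  "c \<odot>\<^bsub>hm ?S r s\<^esub> f : extensional (SS n C)" for r s f f' c
  unfolding z a m by simp_all
 have zero: "\<zero>\<^bsub>hm ?S r s\<^esub> : Sh C r s & md C r s \<zero>\<^bsub>hm ?S r s\<^esub> = (%k i j. 0)" for r s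
  by (rule conjI; rule S_homI[OF C MM_0]; simp add: ext z' opv_0[symmetric])
 have add: "f \<oplus>\<^bsub>hm ?S r s\<^esub> f' : Sh C r s
   & md C r s (f \<oplus>\<^bsub>hm ?S r s\<^esub> f') = (%k i j. md C r s f k i j + md C r s f' k i j)"
  if f: "f : Sh C r s" "f' : Sh C r s" for r s f f'
  by (rule conjI; rule S_homI[OF C MM_add[OF md[OF f(1)] md[OF f(2)]]];
   simp add: ext a' S_hom_opv[OF C f(1)] S_hom_opv[OF C f(2)] opv_add)
 have smult: "c \<odot>\<^bsub>hm ?S r s\<^esub> f : Sh C r s & md C r s (c \<odot>\<^bsub>hm ?S r s\<^esub> f) = (%k i j. c * md C r s f k i j)"
  if f: "f : Sh C r s" for r s f c
  by (rule conjI; rule S_homI[OF C MM_scale[OF md[OF f]]]; simp add: ext m' S_hom_opv[OF C f] opv_scale)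
 have cmp: "cmp ?S r s t h f : Sh C r t & md C r t (cmp ?S r s t h f) = mmul s (md C s t h) (md C r s f)"
  if f: "f : Sh C r s" "h : Sh C s t" for r s t f h
  using I_comp_md[OF C, of f r s h t] f MM_mmul[OF lv_CH0 md[OF f(1)] md[OF f(2)]]
  unfolding S_hom_iff[OF C] by (simp_all add: S_cat_def)
 show ?thesis
  by (unfold_locales; (unfold carr)?)
   (simp_all add: lv_CH0 md_bij[OF C] zero add smult cmp S_form_mform, simp_all add: S_cat_def I_id_md[OF C] S_dag_md[OF C])
qed

lemma S_form_id:
 fixes C :: "'k::{field,finite} HH set"
 assumes C: "C : CH0 n"
 shows "S_form n C 1 1 (idn (SC C) 1) (idn (SC C) 1) = 1"
proof -
 have "dens 1 1 (mid 1) (mid 1) = ind (H0 n :: 'k HH set)"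
  by (auto simp: dens_def mid_def ind_def fun_eq_iff)
 thus ?thesis using tauH_eq[OF H0_volume]
  unfolding S_form_mform S_cat_def by (simp add: I_id_md[OF C] mform_def)
qed

end

section \<open>Refinement and right translation\<close>

lemma pull_pow:
 assumes "p ` SS n D <= SS n C"
 shows "pull_fam n D p (pow_fam n C r V) = pow_fam n D r (pull_fam n D p V)"
proof -
 have p: "p s : SS n C" if "s : SS n D" for s using assms that by blast
 show ?thesis unfolding pull_fam_def pow_fam_def tfam.simps
  by (rule arg_cong2[where f = "%a b. \<lparr>fib = a, act = b\<rparr>"]; intro restrict_ext; simp add: p cong: restrict_cong)
qed

lemma pull_id:
 assumes "p ` SS n D <= SS n C"
 shows "pull_mor n D p (I_id n C V) = I_id n D (pull_fam n D p V)"
 using assms unfolding pull_mor_def I_id_def pull_fam_def by (intro restrict_ext) auto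

lemma I_comp_id:
 assumes f: "f : I_hom n C V W"
 shows "I_comp n C V (I_id n C W) f = f" "I_comp n C V f (I_id n C V) = f"
proof -
 have ext: "f : extensional (SS n C)" "!!s. s : SS n C ==> f s : extensional (carrier (fib V s))"
  "!!s v. s : SS n C ==> v : carrier (fib V s) ==> f s v : carrier (fib W s)"
  using f unfolding I_hom_def lin_map_def by blast+
 show "I_comp n C V (I_id n C W) f = f"
 proof (rule extensionalityI[OF _ ext(1)])
  fix s assume s: "s : SS n C"
  show "I_comp n C V (I_id n C W) f s = f s"
   by (rule extensionalityI[OF _ ext(2)[OF s]]) (simp_all add: I_comp_def I_id_def s ext(3))
 qed (simp add: I_comp_def)
 show "I_comp n C V f (I_id n C V) = f"
 proof (rule extensionalityI[OF _ ext(1)])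
  fix s assume s: "s : SS n C"
  show "I_comp n C V f (I_id n C V) s = f s"
   by (rule extensionalityI[OF _ ext(2)[OF s]]) (simp_all add: I_comp_def I_id_def s)
 qed (simp add: I_comp_def)
qed

context unitary_param begin

text \<open>A map of cosets which shifts representatives on the right by \<open>h \<in> H0 n\<close>. Refinement is the
 case \<open>h = 1\<close>, the action of \<open>h\<close> is the case \<open>D = C\<close>; both pull the spherical family back to itself.\<close>

definition shift_map :: "'k::{field,finite} HH => 'k HH set => 'k HH set => ('k HH set => 'k HH set) => bool" where
 "shift_map h D C p \<longleftrightarrow> (ALL g:GG. p (g <| D) = (g \<odot> h) <| C)"

lemma refine_coset:
 fixes D :: "'k::{field,finite} HH set"
 assumes D: "subgroup D (Hgrp n)" "D <= C" and C: "subgroup C (Hgrp n)" and g: "g : GG"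
 shows "(g <| D) <#>\<^bsub>Hgrp n\<^esub> C = g <| C"
proof
 have CG: "c : GG" if "c : C" for c using subgroup.subset[OF C] that by blast
 show "(g <| D) <#>\<^bsub>Hgrp n\<^esub> C <= g <| C"
 proof
  fix x assume "x : (g <| D) <#>\<^bsub>Hgrp n\<^esub> C"
  then obtain d c where d: "d : D" "c : C" "x = (g \<odot> d) \<odot> c" unfolding set_mult_def l_coset_def by blast
  hence "x = g \<odot> (d \<odot> c)" using g CG[OF subsetD[OF D(2) d(1)]] CG[OF d(2)] by (simp add: HG.m_assoc)
  moreover have "d \<odot> c : C" using d D(2) subgroup.m_closed[OF C] by blast
  ultimately show "x : g <| C" unfolding l_coset_def by blast
 qed
 show "g <| C <= (g <| D) <#>\<^bsub>Hgrp n\<^esub> C"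
 proof
  fix x assume "x : g <| C"
  then obtain c where c: "c : C" "x = (g \<odot> g1) \<odot> c" using g unfolding l_coset_def by auto
  thus "x : (g <| D) <#>\<^bsub>Hgrp n\<^esub> C"
   using subgroup.one_closed[OF D(1)] unfolding set_mult_def l_coset_def by blast
 qed
qed

lemma shift_refine:
 fixes C :: "'k::{field,finite} HH set"
 assumes "C : CH0 n" "D : CH0 n" "D <= C"
 shows "shift_map g1 D C (%s. s <#>\<^bsub>Hgrp n\<^esub> C)"
 unfolding shift_map_def
proof
 fix g :: "'k HH" assume g: "g : GG"
 show "(g <| D) <#>\<^bsub>Hgrp n\<^esub> C = (g \<odot> g1) <| C"
  unfolding refine_coset[OF CH0_subgroup[OF assms(2)] assms(3) CH0_subgroup[OF assms(1)] g] HG.r_one[OF g] ..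
qed

lemma translate_coset:
 fixes D :: "'k::{field,finite} HH set"
 assumes D: "D <= GG" and h: "h : GG" and g: "g : GG"
 shows "(g <| cj n h D) #>\<^bsub>Hgrp n\<^esub> h = (g \<odot> h) <| D"
proof -
 have e: "(g \<odot> (h \<odot> d \<odot> gi h)) \<odot> h = (g \<odot> h) \<odot> d" if "d : D" for d
  using subsetD[OF D that] h g by (simp add: HG.m_assoc)
 show ?thesis
 proof (intro equalityI subsetI)
  fix x assume "x : (g <| cj n h D) #>\<^bsub>Hgrp n\<^esub> h"
  then obtain d where "d : D" "x = (g \<odot> (h \<odot> d \<odot> gi h)) \<odot> h"
   unfolding r_coset_def l_coset_def cj_eq by blast
  thus "x : (g \<odot> h) <| D" using e[of d] unfolding l_coset_def by auto
 next
  fix x assume "x : (g \<odot> h) <| D"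
  then obtain d where d: "d : D" "x = (g \<odot> h) \<odot> d" unfolding l_coset_def by blast
  thus "x : (g <| cj n h D) #>\<^bsub>Hgrp n\<^esub> h"
   unfolding d(2) e[OF d(1), symmetric] r_coset_def l_coset_def cj_eq by blast
 qed
qed

lemma shift_translate:
 fixes C :: "'k::{field,finite} HH set"
 assumes C: "C : CH0 n" and h: "h : H0 n"
 shows "shift_map h C C (%s. s #>\<^bsub>Hgrp n\<^esub> h)"
 using translate_coset[of C h] subgroup.subset[OF CH0_subgroup[OF C]] h
 unfolding shift_map_def cj_CH0[OF C h] by simp

context
 fixes C D :: "'k::{field,finite} HH set" and h p
 assumes C: "C : CH0 n" and D: "D : CH0 n" and h: "h : H0 n" and p: "shift_map h D C p"
begin

lemma shift_SS: "p ` SS n D <= SS n C"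
 using p h unfolding shift_map_def SS_def by auto

lemma H0_shift: "g : GG ==> g \<odot> h : H0 n \<longleftrightarrow> g : H0 n"
proof
 assume g: "g : GG" "g \<odot> h : H0 n"
 hence "(g \<odot> h) \<odot> gi h : H0 n" using h by simp
 thus "g : H0 n" using g h by (simp add: HG.m_assoc)
qed (use h in simp)

lemma Fb_shift: assumes g: "g : GG" shows "Fb (g \<odot> h) = Fb g"
proof -
 have "b : BH n & gi b \<odot> (g \<odot> h) : H0 n \<longleftrightarrow> b : BH n & gi b \<odot> g : H0 n" for b
  using H0_shift[of "gi b \<odot> g"] g h by (auto simp: HG.m_assoc)
 thus ?thesis unfolding Fb_def by simp
qed

lemma PF_shift: "g : GG ==> PF r (g \<odot> h) = PF r g"
 unfolding PF_def by (simp add: Fb_shift)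

lemma pull_sph: "pull_fam n D p (sph n \<alpha> C) = sph n \<alpha> D"
proof -
 have e: "sph_fib n \<alpha> C (p s) = sph_fib n \<alpha> D s" "p s : SS n C" if s: "s : SS n D" for s
 proof -
  obtain g where g: "g : GG" "s = g <| D" using s unfolding SS_def by blast
  hence "p s = (g \<odot> h) <| C" using p unfolding shift_map_def by blast
  thus "sph_fib n \<alpha> C (p s) = sph_fib n \<alpha> D s"
   using g h sph_fib_eq[OF C, of "g \<odot> h"] sph_fib_eq[OF D g(1)] by (simp add: Fb_shift)
  show "p s : SS n C" using s shift_SS by blast
 qed
 show ?thesis unfolding pull_fam_def sph_def tfam.simps
  by (rule arg_cong2[where f = "%a b. \<lparr>fib = a, act = b\<rparr>"]; intro restrict_ext; simp add: e cong: restrict_cong)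
qed

lemma pull_sph_pow: "pull_fam n D p (vp C r) = vp D r"
 unfolding sph_pow_def pull_pow[OF shift_SS] pull_sph ..

lemma opv_shift:
 assumes g: "g : GG"
 shows "opv r s M (g \<odot> h) v = opv r s (msh h M) g v"
 unfolding opv_def
proof (intro restrict_ext ext)
 fix i b
 have "gi b \<odot> (g \<odot> h) = gi b \<odot> g \<odot> h" "gi b \<odot> g \<odot> h : H0 n \<longleftrightarrow> gi b \<odot> g : H0 n" if "b : BH n"
  using that g h H0_shift[of "gi b \<odot> g"] by (simp_all add: HG.m_assoc)
 thus "(if b : BH n & gi b \<odot> (g \<odot> h) : H0 n then \<Sum>j<r. M (gi b \<odot> (g \<odot> h)) i j * v j b else 0)
   = (if b : BH n & gi b \<odot> g : H0 n then \<Sum>j<r. msh h M (gi b \<odot> g) i j * v j b else 0)"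
  by (cases "b : BH n") (simp_all add: msh_def sh_def)
qed

lemma MM_msh:
 assumes "M : MM \<E> r s" "\<E> <= CH0 n"
 shows "msh h M : MM \<E> r s"
 unfolding MM_def
proof (intro CollectI conjI allI)
 show "supp r s (msh h M)" using supp_zero[OF MM_supp[OF assms(1)]] h by (simp add: supp_def msh_def sh_def)
 show "(%k. msh h M k i j) : Cyl n \<E>" for i j
  using sh_Cyl(1)[OF assms(2) MM_Cyl[OF assms(1), of i j] h] unfolding msh_def .
qed

lemma pull_mor_md:
 assumes sub: "D <= C" and f: "f : Sh C r s"
 shows "pull_mor n D p f : Sh D r s & md D r s (pull_mor n D p f) = msh h (md C r s f)"
proof -
 have "md C r s f : MM (lv C) r s" using f unfolding S_hom_iff[OF C] by blast
 moreover have "lv C <= lv D" using sub unfolding lv_def by blast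
 ultimately have "md C r s f : MM (lv D) r s" using MM_mono by blast
 note M = MM_msh[OF this lv_CH0]
 have e: "pull_mor n D p f (g <| D) = f ((g \<odot> h) <| C)" if "g : GG" for g
  using that lco_SS[OF that, of D] p unfolding pull_mor_def shift_map_def by simp
 have ext: "pull_mor n D p f (g <| D) : extensional (PF r g)" if g: "g : GG" for g
 proof -
  have "g \<odot> h : GG" using g h by simp
  hence "f ((g \<odot> h) <| C) : extensional (PF r (g \<odot> h))"
   using f unfolding S_hom_iff[OF C] I_hom_iff[OF C] linF_def by blast
  thus ?thesis unfolding e[OF g] PF_shift[OF g] .
 qed
 have val: "pull_mor n D p f (g <| D) v = opv r s (msh h (md C r s f)) g v" if g: "g : GG" and v: "v : PF r g" for g v
 proof -
  have "g \<odot> h : GG" using g h by simp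
  thus ?thesis unfolding e[OF g] opv_shift[OF g, symmetric]
   using S_hom_opv[OF C f] PF_shift[OF g] v by simp
 qed
 have ext0: "pull_mor n D p f : extensional (SS n D)" unfolding pull_mor_def by simp
 show ?thesis using S_homI[OF D M ext0 ext val] by blast
qed

end

lemma msh_one: "supp r s M ==> msh g1 M = M"
 using supp_zero[of r s M] by (intro ext) (simp add: msh_def sh_def)

lemma refine_fam:
 fixes C :: "'k::{field,finite} HH set"
 assumes "C : CH0 n" "D : CH0 n" "D <= C"
 shows "ref_fam n D C (vp C r) = vp D r"
 unfolding ref_fam_def by (rule pull_sph_pow[OF assms(1,2) H0_closed(3) shift_refine[OF assms]])

lemma refine_mor:
 fixes C :: "'k::{field,finite} HH set"
 assumes "C : CH0 n" "D : CH0 n" "D <= C" "f : Sh C r s"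
 shows "ref_mor n D C f : Sh D r s" "md D r s (ref_mor n D C f) = md C r s f"
 using pull_mor_md[OF assms(1,2) H0_closed(3) shift_refine[OF assms(1,2,3)] assms(3,4)]
  msh_one[OF md_supp[of r s C f]] unfolding ref_mor_def by simp_all

lemma refine_functor:
 fixes C :: "'k::{field,finite} HH set"
 assumes "C : CH0 n" "D : CH0 n" "D <= C"
 shows "isometric_dagger_functor (SC C) (S_form n C) (SC D) (S_form n D) (%r. r) (%r s. ref_mor n D C)"
proof (rule dag_functor[OF S_cat_model[OF assms(1)] S_cat_model[OF assms(2)] H0_closed(3)])
 have carr: "Hom (SC B) r s = Sh B r s" for B :: "'k HH set" and r s
  by (simp add: S_cat_def Let_def mk_module_def)
 show "ref_mor n D C f : Hom (SC D) r s"
  "md D r s (ref_mor n D C f) = msh g1 (md C r s f)" if "f : Hom (SC C) r s" for f r s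
  using refine_mor[OF assms, of f r s] that msh_one[OF md_supp[of r s C f]] unfolding carr by simp_all
qed (simp add: S_cat_def)

context
 fixes C :: "'k::{field,finite} HH set" and h :: "'k HH"
 assumes C: "C : CH0 n" and h: "h : H0 n"
begin

text \<open>Since \<open>b\<^sup>-\<^sup>1gh \<in> H0 n\<close> if and only if \<open>b\<^sup>-\<^sup>1g \<in> H0 n\<close>, translation by \<open>h\<close> fixes the family, and the structure maps
 are identities.\<close>

lemma R_fam_sph: "R_fam n h C (sph n \<alpha> C) = sph n \<alpha> C"
 unfolding R_fam_def cj_CH0[OF C h] by (rule pull_sph[OF C C h shift_translate[OF C h]])

lemma R_fam_sph_pow: "R_fam n h C (vp C r) = vp C r"
 unfolding R_fam_def cj_CH0[OF C h] by (rule pull_sph_pow[OF C C h shift_translate[OF C h]])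

lemma phi_id: "phi n \<alpha> C h = I_id n C (sph n \<alpha> C)"
 unfolding phi_def R_fam_sph I_id_def ..

lemma phi_pow_id: "phi_pow n \<alpha> C h r = I_id n C (vp C r)"
 unfolding phi_pow_def phi_id R_fam_sph
proof -
 have "pow_mor n C r V (I_id n C V) = I_id n C (pow_fam n C r V)" for V :: "('k HH, 'k HH => lam) tfam"
  unfolding pow_mor_def I_id_def pow_fam_def
  by (intro restrict_ext ext) (auto simp: mk_module_def PiE_iff extensional_def restrict_def)
 thus "pow_mor n C r (sph n \<alpha> C) (I_id n C (sph n \<alpha> C)) = I_id n C (vp C r)"
  unfolding sph_pow_def .
qed

lemma phi_pow_inv_id: "phi_pow_inv n \<alpha> C h r = I_id n C (vp C r)"
 unfolding phi_pow_inv_def R_fam_sph_pow phi_pow_id I_inv_def I_id_def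
proof (intro restrict_ext)
 fix s w assume s: "s : SS n C" and w: "w : carrier (fib (vp C r) s)"
 let ?i = "\<lambda>v\<in>carrier (fib (vp C r) s). v"
 have "inv_into (carrier (fib (vp C r) s)) ?i (?i w) = w"
  by (rule inv_into_f_f) (use w in \<open>auto simp: inj_on_def\<close>)
 thus "inv_into (carrier (fib (vp C r) s)) ((\<lambda>s\<in>SS n C. \<lambda>v\<in>carrier (fib (vp C r) s). v) s) w = w"
  using s w by simp
qed

lemma U_op_md:
 assumes f: "f : Sh C r s"
 shows "U_op n \<alpha> C h r s f = R_mor n h C f" "U_op n \<alpha> C h r s f : Sh C r s"
  "md C r s (U_op n \<alpha> C h r s f) = msh h (md C r s f)"
proof -
 have R: "R_mor n h C f : Sh C r s & md C r s (R_mor n h C f) = msh h (md C r s f)"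
  unfolding R_mor_def cj_CH0[OF C h] by (rule pull_mor_md[OF C C h shift_translate[OF C h] subset_refl f])
 hence "R_mor n h C f : Ih C r s" unfolding S_hom_def by blast
 thus e: "U_op n \<alpha> C h r s f = R_mor n h C f"
  unfolding U_op_def phi_pow_id phi_pow_inv_id by (simp add: I_comp_id)
 show "U_op n \<alpha> C h r s f : Sh C r s" "md C r s (U_op n \<alpha> C h r s f) = msh h (md C r s f)"
  unfolding e using R by blast+
qed

lemma U_op_functor:
 "isometric_dagger_functor (SC C) (S_form n C) (SC C) (S_form n C) (%r. r) (U_op n \<alpha> C h)"
proof (rule dag_functor[OF S_cat_model[OF C] S_cat_model[OF C] h])
 have carr: "Hom (SC C) r s = Sh C r s" for r s
  by (simp add: S_cat_def Let_def mk_module_def)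
 show "U_op n \<alpha> C h r s f : Hom (SC C) r s"
  "md C r s (U_op n \<alpha> C h r s f) = msh h (md C r s f)" if "f : Hom (SC C) r s" for f r s
  using U_op_md[of f r s] that unfolding carr by simp_all
qed (simp add: S_cat_def)

lemma U_op_picture:
 assumes f: "f : Sh C r s" and k: "k : H0 n"
 shows "picture n C r s (U_op n \<alpha> C h r s f) (k <| C) = picture n C r s f ((k \<odot> h) <| C)"
proof -
 have "R_mor n h C f (k <| C) = f ((k \<odot> h) <| C)"
  using shift_translate[OF C h] lco_SS[OF GG_of(2)[OF k], of C] k
  unfolding R_mor_def cj_CH0[OF C h] pull_mor_def shift_map_def by simp
 thus ?thesis
  unfolding U_op_md(1)[OF f] picture_def using k h by (simp add: XX_I)
qed

lemma phi_facts:
 "fam_obj n \<alpha> C (R_fam n h C (vp C r))"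
 "phi_pow n \<alpha> C h r : I_hom n C (R_fam n h C (vp C r)) (vp C r)"
 "phi_pow_inv n \<alpha> C h r : I_hom n C (vp C r) (R_fam n h C (vp C r))"
 "I_comp n C (vp C r) (phi_pow n \<alpha> C h r) (phi_pow_inv n \<alpha> C h r) = I_id n C (vp C r)"
 "I_comp n C (R_fam n h C (vp C r)) (phi_pow_inv n \<alpha> C h r) (phi_pow n \<alpha> C h r)
   = I_id n C (R_fam n h C (vp C r))"
proof -
 have i: "I_id n C (vp C r) : Ih C r r"
  using I_id_md(1)[OF C, of r] unfolding S_hom_def by blast
 note e = R_fam_sph_pow phi_pow_id phi_pow_inv_id
 show "fam_obj n \<alpha> C (R_fam n h C (vp C r))" unfolding e by (rule vpow_fam_obj[OF C])
 show "phi_pow n \<alpha> C h r : I_hom n C (R_fam n h C (vp C r)) (vp C r)"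
  "phi_pow_inv n \<alpha> C h r : I_hom n C (vp C r) (R_fam n h C (vp C r))"
  unfolding e by (rule i)+
 show "I_comp n C (vp C r) (phi_pow n \<alpha> C h r) (phi_pow_inv n \<alpha> C h r) = I_id n C (vp C r)"
  "I_comp n C (R_fam n h C (vp C r)) (phi_pow_inv n \<alpha> C h r) (phi_pow n \<alpha> C h r)
   = I_id n C (R_fam n h C (vp C r))"
  unfolding e by (rule I_comp_id[OF i])+
qed

lemma phi_line:
 assumes x: "x : XX n C"
 shows "line_unit n : carrier (fib (sph n \<alpha> C) x)" "phi n \<alpha> C h x (line_unit n) = line_unit n"
proof -
 obtain k where k: "k : H0 n" "x = k <| C" using x unfolding XX_def by blast
 have s: "x : SS n C" using lco_SS[OF GG_of(2)[OF k(1)], of C] k(2) by simp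
 have "carrier (fib (sph n \<alpha> C) x) = Fb k"
  using s sph_fib_eq[OF C GG_of(2)[OF k(1)]] by (simp add: sph_def k(2) mk_module_def)
 thus l: "line_unit n : carrier (fib (sph n \<alpha> C) x)" using line_unit_Fb[OF k(1)] by simp
 show "phi n \<alpha> C h x (line_unit n) = line_unit n" unfolding phi_id I_id_def using s l by simp
qed

lemma phi_ref: "D : CH0 n ==> D <= C ==> ref_mor n D C (phi n \<alpha> C h) = I_id n D (sph n \<alpha> D)"
 unfolding ref_mor_def phi_id
 by (simp only: pull_id[OF shift_SS[OF C _ H0_closed(3) shift_refine[OF C]]]
   pull_sph[OF C _ H0_closed(3) shift_refine[OF C]])

end

lemma phi_mult:
 fixes C :: "'k::{field,finite} HH set"
 assumes C: "C : CH0 n" and h: "h : H0 n" "h' : H0 n"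
 shows "phi n \<alpha> C (h \<odot> h') = I_comp n C (R_fam n (h \<odot> h') C (sph n \<alpha> C)) (phi n \<alpha> C h) (R_mor n h C (phi n \<alpha> C h'))"
proof -
 have hh: "h \<odot> h' : H0 n" using h by simp
 have "I_comp n C V (I_id n C V) (I_id n C V) = I_id n C V" for V :: "('k HH, 'k HH => lam) tfam"
  unfolding I_comp_def I_id_def by (intro restrict_ext) simp
 moreover have "R_mor n h C (I_id n C (sph n \<alpha> C)) = I_id n C (sph n \<alpha> C)"
  unfolding R_mor_def cj_CH0[OF C h(1)] pull_id[OF shift_SS[OF C C h(1) shift_translate[OF C h(1)]]]
   pull_sph[OF C C h(1) shift_translate[OF C h(1)]] ..
 ultimately show ?thesis
  unfolding phi_id[OF C hh] phi_id[OF C h(1)] phi_id[OF C h(2)] R_fam_sph[OF C hh] by simp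
qed

end

section \<open>The filtered colimit of the cylindrical categories\<close>

context unitary_param begin

lemma common_level:
 fixes P :: "'i => 'k::{field,finite} HH set => bool"
 assumes "finite I" "K : CH0 n" "!!i. i : I ==> EX D:CH0 n. P i D"
  and "!!i D D'. P i D ==> D' <= D ==> P i D'"
 shows "EX D:CH0 n. D <= K & (ALL i:I. P i D)"
 using assms(1,3)
proof (induction I rule: finite_induct)
 case (insert i I)
 obtain D where D: "D : CH0 n" "D <= K" "ALL i:I. P i D" using insert by blast
 obtain D' where D': "D' : CH0 n" "P i D'" using insert.prems by blast
 have "P j (D Int D')" if "j : insert i I" for j
  using that D D' assms(4)[of j D "D Int D'"] assms(4)[of j D' "D Int D'"] by blast
 thus ?case using CH0_Int[OF D(1) D'(1)] D(2) by blast
qed (use assms(2) in blast)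

lemma lv_mono: "D <= C ==> lv C <= lv D"
 unfolding lv_def by blast

lemma Cyl_level:
 fixes K :: "'k::{field,finite} HH set" and F :: "'k HH => lam"
 assumes K: "K : CH0 n" and F: "F : Cyl n (CH0 n)"
 shows "EX D:CH0 n. F : Cyl n (lv D)"
proof -
 obtain \<T> c where *: "finite \<T>" "\<T> <= cyl_sets n (CH0 n)" "F = (%k. \<Sum>A\<in>\<T>. c A * ind A k)"
  using F by (rule CylE)
 have "EX D:CH0 n. D <= K & (ALL A:\<T>. A : cyl_sets n (lv D))"
 proof (rule common_level[OF *(1) K])
  fix A assume "A : \<T>"
  then consider "A = H0 n" | E g where "A = QE n E #>\<^bsub>Hgrp n\<^esub> g" "E : CH0 n" "g : H0 n"
   using *(2) unfolding cyl_sets_def by blast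
  thus "EX D:CH0 n. A : cyl_sets n (lv D)"
  proof cases
   case 1
   thus ?thesis using K unfolding cyl_sets_def by blast
  next
   case (2 E g)
   hence "A : cyl_sets n (lv E)" unfolding cyl_sets_def lv_def by blast
   thus ?thesis using 2(2) by blast
  qed
 next
  fix A and D D' :: "'k HH set" assume "A : cyl_sets n (lv D)" "D' <= D"
  thus "A : cyl_sets n (lv D')" using lv_mono[of D' D] unfolding cyl_sets_def by blast
 qed
 thus ?thesis using CylI[OF *(1)] unfolding *(3) by blast
qed

text \<open>Only finitely many cosets occur in the entries, so one level serves all of them.\<close>

lemma MM_level:
 fixes K :: "'k::{field,finite} HH set" and M :: "'k HH => nat => nat => lam"
 assumes K: "K : CH0 n" and M: "M : MM (CH0 n) r s"
 shows "EX D:CH0 n. D <= K & M : MM (lv D) r s"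
proof -
 have "EX D:CH0 n. D <= K & (ALL p:{..<s} \<times> {..<r}. (%k. M k (fst p) (snd p)) : Cyl n (lv D))"
 proof (rule common_level[OF _ K])
  fix p and D D' :: "'k HH set" assume "(%k. M k (fst p) (snd p)) : Cyl n (lv D)" "D' <= D"
  thus "(%k. M k (fst p) (snd p)) : Cyl n (lv D')" using Cyl_mono[OF lv_mono, of D' D n] by blast
 qed (use Cyl_level[OF K MM_Cyl[OF M]] in auto)
 then obtain D where D: "D : CH0 n" "D <= K" "ALL p:{..<s} \<times> {..<r}. (%k. M k (fst p) (snd p)) : Cyl n (lv D)"
  by blast
 have "M : MM (lv D) r s"
 proof (rule MM_I[OF MM_supp[OF M]])
  fix i j
  show "(%k. M k i j) : Cyl n (lv D)"
  proof (cases "i < s & j < r")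
   case True
   thus ?thesis using D(3) by (auto dest: bspec[of _ _ "(i, j)"])
  next
   case False
   hence "(%k. M k i j) = (%k. 0)" using supp_zero[OF MM_supp[OF M]] by blast
   thus ?thesis by (simp only: Cyl_0)
  qed
 qed
 thus ?thesis using D by blast
qed

text \<open>A morphism of the colimit is the set of all its representatives, that is of all morphisms at
 sufficiently deep levels with a given matrix function.\<close>

definition cls :: "'k::{field,finite} HH set \<times> nat => 'k HH set \<times> nat => ('k HH => nat => nat => lam)
  => ('k HH set \<times> ('k HH set => (nat => 'k HH => lam) => nat => 'k HH => lam)) set" where
 "cls X Y M = {(D, f). D : CH0 n & D <= fst X Int fst Y & f : Sh D (snd X) (snd Y) & md D (snd X) (snd Y) f = M}"

definition \<beta>F :: "'k::{field,finite} HH set \<times> nat => 'k HH set \<times> nat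
  => ('k HH set \<times> ('k HH set => (nat => 'k HH => lam) => nat => 'k HH => lam)) set => 'k HH => nat => nat => lam" where
 "\<beta>F X Y P = (case SOME p. p : P of (D, f) => md D (snd X) (snd Y) f)"

abbreviation obF :: "('k::{field,finite} HH set \<times> nat) set" where "obF \<equiv> CH0 n \<times> UNIV"

abbreviation MF :: "'k::{field,finite} HH set \<times> nat => 'k HH set \<times> nat => ('k HH => nat => nat => lam) set" where
 "MF X Y \<equiv> MM (CH0 n) (snd X) (snd Y)"

lemma SF_reps_iff: "(D, f) : SF_reps n \<alpha> X Y \<longleftrightarrow> D : CH0 n & D <= fst X Int fst Y & f : Sh D (snd X) (snd Y)"
 unfolding SF_reps_def colim_reps_def by simp

text \<open>Refinement preserves the matrix function, and at a common level it determines the morphism.\<close>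

lemma SF_rel_iff:
 "((D, f), (D', f')) : SF_rel n \<alpha> X Y \<longleftrightarrow> (D, f) : SF_reps n \<alpha> X Y & (D', f') : SF_reps n \<alpha> X Y
  & md D (snd X) (snd Y) f = md D' (snd X) (snd Y) f'"
proof -
 have "(EX E:CH0 n. E <= D Int D' & ref_mor n E D f = ref_mor n E D' f')
   \<longleftrightarrow> md D (snd X) (snd Y) f = md D' (snd X) (snd Y) f'"
  if f: "(D, f) : SF_reps n \<alpha> X Y" and f': "(D', f') : SF_reps n \<alpha> X Y"
 proof
  have D: "D : CH0 n" "f : Sh D (snd X) (snd Y)" and D': "D' : CH0 n" "f' : Sh D' (snd X) (snd Y)"
   using f f' unfolding SF_reps_iff by blast+
  show "md D (snd X) (snd Y) f = md D' (snd X) (snd Y) f'"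
   if ex: "EX E:CH0 n. E <= D Int D' & ref_mor n E D f = ref_mor n E D' f'"
  proof -
   obtain E where E: "E : CH0 n" "E <= D" "E <= D'" "ref_mor n E D f = ref_mor n E D' f'" using ex by blast
   show ?thesis using refine_mor(2)[OF D(1) E(1,2) D(2)] refine_mor(2)[OF D'(1) E(1,3) D'(2)] E(4) by simp
  qed
  show "EX E:CH0 n. E <= D Int D' & ref_mor n E D f = ref_mor n E D' f'"
   if e: "md D (snd X) (snd Y) f = md D' (snd X) (snd Y) f'"
  proof (intro bexI conjI)
   show E: "D Int D' : CH0 n" by (rule CH0_Int[OF D(1) D'(1)])
   note 1 = refine_mor[OF D(1) E Int_lower1 D(2)] and 2 = refine_mor[OF D'(1) E Int_lower2 D'(2)]
   show "ref_mor n (D Int D') D f = ref_mor n (D Int D') D' f'"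
    by (rule inj_onD[OF bij_betw_imp_inj_on[OF md_bij[OF E]] _ 1(1) 2(1)]) (simp add: 1(2) 2(2) e)
  qed simp
 qed
 thus ?thesis unfolding SF_rel_def colim_rel_def SF_reps_def[symmetric] by blast
qed

lemma SF_rel_class:
 assumes "(D, f) : SF_reps n \<alpha> X Y"
 shows "SF_rel n \<alpha> X Y `` {(D, f)} = cls X Y (md D (snd X) (snd Y) f)"
proof (intro equalityI subsetI)
 fix p
 show "p : cls X Y (md D (snd X) (snd Y) f)" if "p : SF_rel n \<alpha> X Y `` {(D, f)}"
  using that by (cases p) (auto simp: SF_rel_iff SF_reps_iff cls_def)
 show "p : SF_rel n \<alpha> X Y `` {(D, f)}" if "p : cls X Y (md D (snd X) (snd Y) f)"
  using that assms by (cases p) (auto simp: SF_rel_iff SF_reps_iff cls_def)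
qed

lemma cls_nonempty:
 fixes X Y :: "'a::{field,finite} HH set \<times> nat"
 assumes X: "X : obF" "Y : obF" and M: "M : MF X Y"
 shows "EX D f. (D, f) : cls X Y M"
proof -
 have "fst X Int fst Y : CH0 n" using X CH0_Int by auto
 then obtain D where D: "D : CH0 n" "D <= fst X Int fst Y" "M : MM (lv D) (snd X) (snd Y)"
  using MM_level[OF _ M] by blast
 have "M : md D (snd X) (snd Y) ` Sh D (snd X) (snd Y)"
  using D(3) bij_betw_imp_surj_on[OF md_bij[OF D(1)]] by simp
 then obtain f where "M = md D (snd X) (snd Y) f" "f : Sh D (snd X) (snd Y)" by (rule imageE)
 hence "(D, f) : cls X Y M" using D unfolding cls_def by simp
 thus ?thesis by blast
qed

lemma S_hom_MF: "D : CH0 n ==> f : Sh D (snd X) (snd Y) ==> md D (snd X) (snd Y) f : MF X Y"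
 using S_hom_iff[of D f "snd X" "snd Y"] MM_mono[OF lv_CH0, of D "snd X" "snd Y"] by blast

lemma \<beta>F_cls:
 fixes X Y :: "'a::{field,finite} HH set \<times> nat"
 assumes "X : obF" "Y : obF" "M : MF X Y"
 shows "\<beta>F X Y (cls X Y M) = M"
proof -
 have "(SOME p. p : cls X Y M) : cls X Y M" using cls_nonempty[OF assms] by (metis someI)
 thus ?thesis unfolding \<beta>F_def cls_def by auto
qed

lemma SF_carrier:
 fixes X Y :: "'a::{field,finite} HH set \<times> nat"
 assumes X: "X : obF" "Y : obF"
 shows "Hom SFc X Y = cls X Y ` MF X Y"
proof -
 have "Hom SFc X Y = SF_reps n \<alpha> X Y // SF_rel n \<alpha> X Y"
  by (simp add: SF_cat_def mk_module_def)
 also have "... = cls X Y ` MF X Y"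
 proof (intro equalityI subsetI)
  fix P assume "P : SF_reps n \<alpha> X Y // SF_rel n \<alpha> X Y"
  then obtain p where "p : SF_reps n \<alpha> X Y" "P = SF_rel n \<alpha> X Y `` {p}" by (rule quotientE)
  then obtain D f where f: "(D, f) : SF_reps n \<alpha> X Y" "P = SF_rel n \<alpha> X Y `` {(D, f)}" by (cases p) auto
  thus "P : cls X Y ` MF X Y"
   unfolding f(2) SF_rel_class[OF f(1)] using S_hom_MF[of D f X Y] unfolding SF_reps_iff by blast
 next
  fix P assume "P : cls X Y ` MF X Y"
  then obtain M where M: "P = cls X Y M" "M : MF X Y" by blast
  then obtain D f where f: "(D, f) : cls X Y M" using cls_nonempty[OF X] by blast
  hence "(D, f) : SF_reps n \<alpha> X Y" "md D (snd X) (snd Y) f = M" unfolding cls_def SF_reps_iff by blast+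
  thus "P : SF_reps n \<alpha> X Y // SF_rel n \<alpha> X Y"
   using SF_rel_class[of D f X Y] quotientI[of "(D, f)" "SF_reps n \<alpha> X Y" "SF_rel n \<alpha> X Y"] M by simp
 qed
 finally show ?thesis .
qed

lemma cls_UN:
 fixes X Y :: "'a::{field,finite} HH set \<times> nat"
 assumes X: "X : obF" "Y : obF" and M: "M : MF X Y"
  and S: "!!D f. D : CH0 n ==> D <= fst X Int fst Y ==> f : Sh D (snd X) (snd Y) ==>
   md D (snd X) (snd Y) f = M ==> S D f = T"
 shows "(\<Union>(D, f)\<in>cls X Y M. S D f) = T"
proof -
 obtain D f where f: "(D, f) : cls X Y M" using cls_nonempty[OF X M] by blast
 have "S D f = T" if "(D, f) : cls X Y M" for D f using S[of D f] that unfolding cls_def by blast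
 thus ?thesis using f by blast
qed

lemma SF_rel_cls:
 assumes "D : CH0 n" "D <= fst X Int fst Y" "f : Sh D (snd X) (snd Y)" "md D (snd X) (snd Y) f = M"
 shows "SF_rel n \<alpha> X Y `` {(D, f)} = cls X Y M"
 using SF_rel_class[of D f X Y] assms unfolding SF_reps_iff by simp

lemma cls_form_value:
 fixes X Y :: "'a::{field,finite} HH set \<times> nat"
 assumes X: "X : obF" "Y : obF" and M: "M : MF X Y" and N: "N : MF X Y"
 shows "SF_form_value n X Y (cls X Y M) (cls X Y N) v \<longleftrightarrow> v = mform (snd X) (snd Y) M N"
proof -
 have val: "S_form n E (snd X) (snd Y) (ref_mor n E D f) (ref_mor n E D' g) = mform (snd X) (snd Y) M N"
  if "(D, f) : cls X Y M" "(D', g) : cls X Y N" "E : CH0 n" "E <= D Int D'" for D f D' g E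
  using that refine_mor(2)[of D E f] refine_mor(2)[of D' E g] unfolding cls_def S_form_mform by simp
 obtain D f D' g where f: "(D, f) : cls X Y M" and g: "(D', g) : cls X Y N"
  using cls_nonempty[OF X M] cls_nonempty[OF X N] by blast
 have E: "D Int D' : CH0 n" using f g CH0_Int unfolding cls_def by blast
 show ?thesis
 proof
  assume "SF_form_value n X Y (cls X Y M) (cls X Y N) v"
  hence "v = S_form n (D Int D') (snd X) (snd Y) (ref_mor n (D Int D') D f) (ref_mor n (D Int D') D' g)"
   using f g E unfolding SF_form_value_def by fast
  thus "v = mform (snd X) (snd Y) M N" using val[OF f g E] by simp
 next
  assume v: "v = mform (snd X) (snd Y) M N"
  show "SF_form_value n X Y (cls X Y M) (cls X Y N) v"
   unfolding SF_form_value_def v using val by (auto simp del: Int_subset_iff)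
 qed
qed

lemma SF_ops:
 fixes X Y :: "'a::{field,finite} HH set \<times> nat"
 assumes X: "X : obF" "Y : obF" and M: "M : MF X Y"
 shows "N : MF X Y ==> cls X Y M \<oplus>\<^bsub>hm SFc X Y\<^esub> cls X Y N = cls X Y (%k i j. M k i j + N k i j)"
  "c \<odot>\<^bsub>hm SFc X Y\<^esub> cls X Y M = cls X Y (%k i j. c * M k i j)"
  "Z : obF ==> N : MF Y Z ==> cmp SFc X Y Z (cls Y Z N) (cls X Y M) = cls X Z (mmul (snd Y) N M)"
  "dgr SFc X Y (cls X Y M) = cls Y X (mdag M)"
  "h : H0 n ==> U_F n \<alpha> h X Y (cls X Y M) = cls X Y (msh h M)"
proof -
 note mod = S_cat_model
 have carr: "Hom (SC B) r s = Sh B r s" for B :: "'a HH set" and r s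
  by (simp add: S_cat_def Let_def mk_module_def)
 have obs: "r : obs (SC B)" for B :: "'a HH set" and r by (simp add: S_cat_def)
 show "cls X Y M \<oplus>\<^bsub>hm SFc X Y\<^esub> cls X Y N = cls X Y (%k i j. M k i j + N k i j)" if N: "N : MF X Y"
 proof -
  have "(\<Union>(D, f)\<in>cls X Y M. \<Union>(D', g)\<in>cls X Y N. SF_rel n \<alpha> X Y `` {(D Int D', ref_mor n (D Int D') D f
    \<oplus>\<^bsub>hm (SC (D Int D')) (snd X) (snd Y)\<^esub> ref_mor n (D Int D') D' g)}) = cls X Y (%k i j. M k i j + N k i j)"
  proof (rule cls_UN[OF X M], rule cls_UN[OF X N])
   fix D f D' g assume D: "D : CH0 n" "D <= fst X Int fst Y" "f : Sh D (snd X) (snd Y)" "md D (snd X) (snd Y) f = M"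
    and D': "D' : CH0 n" "D' <= fst X Int fst Y" "g : Sh D' (snd X) (snd Y)" "md D' (snd X) (snd Y) g = N"
   have E: "D Int D' : CH0 n" by (rule CH0_Int[OF D(1) D'(1)])
   note r = refine_mor[OF D(1) E Int_lower1 D(3)] refine_mor[OF D'(1) E Int_lower2 D'(3)]
   note a = dag_model.add[OF mod[OF E] obs obs, unfolded carr, OF r(1,3)]
   show "SF_rel n \<alpha> X Y `` {(D Int D', ref_mor n (D Int D') D f
    \<oplus>\<^bsub>hm (SC (D Int D')) (snd X) (snd Y)\<^esub> ref_mor n (D Int D') D' g)} = cls X Y (%k i j. M k i j + N k i j)"
    by (rule SF_rel_cls[OF E _ a(1)]) (use D D' r a(2) in auto)
  qed
  thus ?thesis by (simp add: SF_cat_def mk_module_def)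
 qed
 show "c \<odot>\<^bsub>hm SFc X Y\<^esub> cls X Y M = cls X Y (%k i j. c * M k i j)"
 proof -
  have "(\<Union>(D, f)\<in>cls X Y M. SF_rel n \<alpha> X Y `` {(D, c \<odot>\<^bsub>hm (SC D) (snd X) (snd Y)\<^esub> f)}) = cls X Y (%k i j. c * M k i j)"
  proof (rule cls_UN[OF X M])
   fix D f assume D: "D : CH0 n" "D <= fst X Int fst Y" "f : Sh D (snd X) (snd Y)" "md D (snd X) (snd Y) f = M"
   note a = dag_model.smult[OF mod[OF D(1)] obs obs, unfolded carr, OF D(3), of c]
   show "SF_rel n \<alpha> X Y `` {(D, c \<odot>\<^bsub>hm (SC D) (snd X) (snd Y)\<^esub> f)} = cls X Y (%k i j. c * M k i j)"
    by (rule SF_rel_cls[OF D(1,2) a(1)]) (simp add: a(2) D(4))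
  qed
  thus ?thesis by (simp add: SF_cat_def mk_module_def)
 qed
 show "cmp SFc X Y Z (cls Y Z N) (cls X Y M) = cls X Z (mmul (snd Y) N M)" if Z: "Z : obF" and N: "N : MF Y Z"
 proof -
  have "(\<Union>(D, f)\<in>cls X Y M. \<Union>(D', g)\<in>cls Y Z N. SF_rel n \<alpha> X Z `` {(D Int D', cmp (SC (D Int D')) (snd X) (snd Y) (snd Z)
     (ref_mor n (D Int D') D' g) (ref_mor n (D Int D') D f))}) = cls X Z (mmul (snd Y) N M)"
  proof (rule cls_UN[OF X M], rule cls_UN[OF X(2) Z N])
   fix D f D' g assume D: "D : CH0 n" "D <= fst X Int fst Y" "f : Sh D (snd X) (snd Y)" "md D (snd X) (snd Y) f = M"
    and D': "D' : CH0 n" "D' <= fst Y Int fst Z" "g : Sh D' (snd Y) (snd Z)" "md D' (snd Y) (snd Z) g = N"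
   have E: "D Int D' : CH0 n" by (rule CH0_Int[OF D(1) D'(1)])
   note r = refine_mor[OF D(1) E Int_lower1 D(3)] refine_mor[OF D'(1) E Int_lower2 D'(3)]
   note a = dag_model.cmp[OF mod[OF E] obs obs obs, unfolded carr, OF r(1,3)]
   show "SF_rel n \<alpha> X Z `` {(D Int D', cmp (SC (D Int D')) (snd X) (snd Y) (snd Z)
     (ref_mor n (D Int D') D' g) (ref_mor n (D Int D') D f))} = cls X Z (mmul (snd Y) N M)"
    by (rule SF_rel_cls[OF E _ a(1)]) (use D D' r a(2) in auto)
  qed
  thus ?thesis by (simp add: SF_cat_def)
 qed
 show "dgr SFc X Y (cls X Y M) = cls Y X (mdag M)"
 proof -
  have "(\<Union>(D, f)\<in>cls X Y M. SF_rel n \<alpha> Y X `` {(D, dgr (SC D) (snd X) (snd Y) f)}) = cls Y X (mdag M)"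
  proof (rule cls_UN[OF X M])
   fix D f assume D: "D : CH0 n" "D <= fst X Int fst Y" "f : Sh D (snd X) (snd Y)" "md D (snd X) (snd Y) f = M"
   note a = dag_model.dgr[OF mod[OF D(1)] obs obs, unfolded carr, OF D(3)]
   show "SF_rel n \<alpha> Y X `` {(D, dgr (SC D) (snd X) (snd Y) f)} = cls Y X (mdag M)"
    by (rule SF_rel_cls[OF D(1) _ a(1)]) (use D a(2) in auto)
  qed
  thus ?thesis by (simp add: SF_cat_def)
 qed
 show "U_F n \<alpha> h X Y (cls X Y M) = cls X Y (msh h M)" if h: "h : H0 n"
  unfolding U_F_def
 proof (rule cls_UN[OF X M])
  fix D f assume D: "D : CH0 n" "D <= fst X Int fst Y" "f : Sh D (snd X) (snd Y)" "md D (snd X) (snd Y) f = M"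
  show "SF_rel n \<alpha> X Y `` {(D, U_op n \<alpha> D h (snd X) (snd Y) f)} = cls X Y (msh h M)"
   by (rule SF_rel_cls[OF D(1,2) U_op_md(2)[OF D(1) h D(3)]]) (simp add: U_op_md(3)[OF D(1) h D(3)] D(4))
 qed
qed

lemma SF_units:
 fixes X Y :: "'a::{field,finite} HH set \<times> nat"
 assumes X: "X : obF" "Y : obF"
 shows "\<zero>\<^bsub>hm SFc X Y\<^esub> = cls X Y (%k i j. 0)" "idn SFc X = cls X X (mid (snd X))"
proof -
 have K: "fst X Int fst Y : CH0 n" "fst X : CH0 n" using X CH0_Int by auto
 have carr: "Hom (SC B) r s = Sh B r s" for B :: "'a HH set" and r s
  by (simp add: S_cat_def Let_def mk_module_def)
 have obs: "r : obs (SC B)" for B :: "'a HH set" and r by (simp add: S_cat_def)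
 note z = dag_model.zero[OF S_cat_model[OF K(1)] obs obs, unfolded carr]
 note i = dag_model.idn[OF S_cat_model[OF K(2)] obs, unfolded carr]
 have "\<zero>\<^bsub>hm SFc X Y\<^esub> = SF_rel n \<alpha> X Y `` {(fst X Int fst Y, \<zero>\<^bsub>hm (SC (fst X Int fst Y)) (snd X) (snd Y)\<^esub>)}"
  by (simp add: SF_cat_def mk_module_def)
 also have "... = cls X Y (%k i j. 0)" by (rule SF_rel_cls[OF K(1) subset_refl z(1) z(2)])
 finally show "\<zero>\<^bsub>hm SFc X Y\<^esub> = cls X Y (%k i j. 0)" .
 have "idn SFc X = SF_rel n \<alpha> X X `` {(fst X, idn (SC (fst X)) (snd X))}"
  by (simp add: SF_cat_def)
 also have "... = cls X X (mid (snd X))" by (rule SF_rel_cls[OF K(2) _ i(1) i(2)]) simp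
 finally show "idn SFc X = cls X X (mid (snd X))" .
qed

lemma SF_form_cls:
 fixes X Y :: "'a::{field,finite} HH set \<times> nat"
 assumes X: "X : obF" "Y : obF" and M: "M : MF X Y" "N : MF X Y"
 shows "SF_form n X Y (cls X Y M) (cls X Y N) = mform (snd X) (snd Y) M N"
 unfolding SF_form_def cls_form_value[OF X M] by simp

lemma SF_model: "dag_model n \<alpha> SFc (CH0 n :: 'k::{field,finite} HH set set) snd \<beta>F (SF_form n)"
proof -
 have ob: "obs SFc = (obF :: ('k HH set \<times> nat) set)" by (simp add: SF_cat_def)
 have bij: "bij_betw (\<beta>F X Y) (Hom SFc X Y) (MF X Y)"
  if X: "X : obF" "Y : obF" for X Y :: "'k HH set \<times> nat"
  unfolding SF_carrier[OF X]
  by (rule bij_betw_byWitness[where f' = "cls X Y"]) (use \<beta>F_cls[OF X] in auto)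
 show ?thesis
 proof (unfold_locales, unfold ob)
  fix X Y Z :: "'k HH set \<times> nat" and f g c
  assume X: "X : obF"
  show "idn SFc X : Hom SFc X X" "\<beta>F X X (idn SFc X) = mid (snd X)"
   unfolding SF_units(2)[OF X X] SF_carrier[OF X X] \<beta>F_cls[OF X X MM_mid] using MM_mid by blast+
  assume Y: "Y : obF"
  note XY = X Y
  show "\<zero>\<^bsub>hm SFc X Y\<^esub> : Hom SFc X Y" "\<beta>F X Y \<zero>\<^bsub>hm SFc X Y\<^esub> = (%k i j. 0)"
   unfolding SF_units(1)[OF XY] SF_carrier[OF XY] \<beta>F_cls[OF XY MM_0] using MM_0 by blast+
  show "bij_betw (\<beta>F X Y) (Hom SFc X Y) (MF X Y)" by (rule bij[OF XY])
  assume f: "f : Hom SFc X Y"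
  then obtain M where M: "f = cls X Y M" "M : MF X Y" unfolding SF_carrier[OF XY] by blast
  show "c \<odot>\<^bsub>hm SFc X Y\<^esub> f : Hom SFc X Y"
   "\<beta>F X Y (c \<odot>\<^bsub>hm SFc X Y\<^esub> f) = (%k i j. c * \<beta>F X Y f k i j)"
   unfolding M(1) SF_ops(2)[OF XY M(2)] SF_carrier[OF XY] \<beta>F_cls[OF XY M(2)] \<beta>F_cls[OF XY MM_scale[OF M(2)]]
   using MM_scale[OF M(2)] by blast+
  show "dgr SFc X Y f : Hom SFc Y X" "\<beta>F Y X (dgr SFc X Y f) = mdag (\<beta>F X Y f)"
   unfolding M(1) SF_ops(4)[OF XY M(2)] SF_carrier[OF Y X] \<beta>F_cls[OF XY M(2)] \<beta>F_cls[OF Y X MM_mdag[OF M(2)]]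
   using MM_mdag[OF M(2)] by blast+
  {
   assume "g : Hom SFc X Y"
   then obtain N where N: "g = cls X Y N" "N : MF X Y" unfolding SF_carrier[OF XY] by blast
   show "f \<oplus>\<^bsub>hm SFc X Y\<^esub> g : Hom SFc X Y"
    "\<beta>F X Y (f \<oplus>\<^bsub>hm SFc X Y\<^esub> g) = (%k i j. \<beta>F X Y f k i j + \<beta>F X Y g k i j)"
    unfolding M(1) N(1) SF_ops(1)[OF XY M(2) N(2)] SF_carrier[OF XY] \<beta>F_cls[OF XY M(2)] \<beta>F_cls[OF XY N(2)]
     \<beta>F_cls[OF XY MM_add[OF M(2) N(2)]] using MM_add[OF M(2) N(2)] by blast+
   show "SF_form n X Y f g = mform (snd X) (snd Y) (\<beta>F X Y f) (\<beta>F X Y g)"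
    unfolding M(1) N(1) \<beta>F_cls[OF XY M(2)] \<beta>F_cls[OF XY N(2)] by (rule SF_form_cls[OF XY M(2) N(2)])
  next
   assume Z: "Z : obF" and "g : Hom SFc Y Z"
   then obtain N where N: "g = cls Y Z N" "N : MF Y Z" unfolding SF_carrier[OF Y Z] by blast
   note NM = MM_mmul[OF subset_refl M(2) N(2)]
   show "cmp SFc X Y Z g f : Hom SFc X Z"
    "\<beta>F X Z (cmp SFc X Y Z g f) = mmul (snd Y) (\<beta>F Y Z g) (\<beta>F X Y f)"
    unfolding M(1) N(1) SF_ops(3)[OF XY M(2) Z N(2)] SF_carrier[OF X Z] \<beta>F_cls[OF XY M(2)] \<beta>F_cls[OF Y Z N(2)]
     \<beta>F_cls[OF X Z NM] using NM by blast+
  }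
 qed simp
qed

lemma SF_form_value_unique:
 fixes X Y :: "'a::{field,finite} HH set \<times> nat"
 assumes X: "X : obs SFc" "Y : obs SFc"
  and P: "P : Hom SFc X Y" "Q : Hom SFc X Y"
 shows "\<exists>!v. SF_form_value n X Y P Q v"
proof -
 have X': "X : obF" "Y : obF" using X by (simp_all add: SF_cat_def)
 obtain M N where "P = cls X Y M" "Q = cls X Y N" "M : MF X Y" "N : MF X Y"
  using P unfolding SF_carrier[OF X'] by blast
 thus ?thesis using cls_form_value[OF X'] by simp
qed

lemma U_F_functor:
 fixes h :: "'a::{field,finite} HH"
 assumes h: "h : H0 n"
 shows "isometric_dagger_functor SFc (SF_form n) SFc (SF_form n) (%X. X) (U_F n \<alpha> h)"
proof (rule dag_functor[OF SF_model SF_model h])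
 fix X Y :: "'a HH set \<times> nat" and P
 assume "X : obs SFc" "Y : obs SFc" and P: "P : Hom SFc X Y"
 hence X: "X : obF" "Y : obF" by (simp_all add: SF_cat_def)
 obtain M where M: "P = cls X Y M" "M : MF X Y" using P unfolding SF_carrier[OF X] by blast
 have N: "msh h M : MF X Y"
  using MM_msh[OF _ _ h shift_translate[OF _ h] M(2) subset_refl, of "fst X"] X by auto
 show "U_F n \<alpha> h X Y P : Hom SFc X Y" "\<beta>F X Y (U_F n \<alpha> h X Y P) = msh h (\<beta>F X Y P)"
  unfolding M(1) SF_ops(5)[OF X M(2) h] SF_carrier[OF X] \<beta>F_cls[OF X M(2)] \<beta>F_cls[OF X N] using N by blast+
qed simp

lemma U_F_group:
 fixes X Y :: "'a::{field,finite} HH set \<times> nat"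
 assumes "X : obs SFc" "Y : obs SFc" and P: "P : Hom SFc X Y" and h: "h : H0 n"
 shows "U_F n \<alpha> g1 X Y P = P"
  "h' : H0 n ==> U_F n \<alpha> (h \<odot> h') X Y P = U_F n \<alpha> h X Y (U_F n \<alpha> h' X Y P)"
proof -
 have X: "X : obF" "Y : obF" using assms by (simp_all add: SF_cat_def)
 obtain M where M: "P = cls X Y M" "M : MF X Y" using P unfolding SF_carrier[OF X] by blast
 show "U_F n \<alpha> g1 X Y P = P"
  unfolding M(1) SF_ops(5)[OF X M(2) H0_closed(3)] msh_one[OF MM_supp[OF M(2)]] ..
 assume h': "h' : H0 n"
 have N: "msh h' M : MF X Y"
  using MM_msh[OF _ _ h' shift_translate[OF _ h'] M(2) subset_refl, of "fst X"] X by auto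
 have "msh (h \<odot> h') M = msh h (msh h' M)"
  using h h' by (intro ext) (simp add: msh_def sh_def HG.m_assoc)
 thus "U_F n \<alpha> (h \<odot> h') X Y P = U_F n \<alpha> h X Y (U_F n \<alpha> h' X Y P)"
  unfolding M(1) SF_ops(5)[OF X M(2) h'] SF_ops(5)[OF X N h] SF_ops(5)[OF X M(2) H0_closed(1)[OF h h']] by simp
qed

end

section \<open>The embedding into the smooth principal series\<close>

context unitary_param begin

lemma cj_mem:
 fixes D :: "'k::{field,finite} HH set"
 assumes D: "D <= GG" and h: "h : GG"
 shows "x : cj n h D \<longleftrightarrow> x : GG & gi h \<odot> x \<odot> h : D"
proof
 assume "x : cj n h D"
 then obtain d where d: "d : D" "x = h \<odot> d \<odot> gi h" unfolding cj_eq by blast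
 hence dG: "d : GG" using D by blast
 hence "gi h \<odot> x \<odot> h = d" unfolding d(2) using h by (simp add: HG.m_assoc)
 thus "x : GG & gi h \<odot> x \<odot> h : D" using d dG h by simp
next
 assume x: "x : GG & gi h \<odot> x \<odot> h : D"
 hence "x = h \<odot> (gi h \<odot> x \<odot> h) \<odot> gi h" using h by (simp add: HG.m_assoc)
 thus "x : cj n h D" using x unfolding cj_eq by blast
qed

lemma cj_cj:
 fixes D :: "'k::{field,finite} HH set"
 assumes D: "D <= GG" and h: "h : GG" "h' : GG"
 shows "cj n h (cj n h' D) = cj n (h \<odot> h') D"
proof -
 have D': "cj n h' D <= GG" using cj_mem[OF D h(2)] by blast
 have hh: "h \<odot> h' : GG" using h by simp
 have e: "gi h' \<odot> (gi h \<odot> x \<odot> h) \<odot> h' = gi (h \<odot> h') \<odot> x \<odot> (h \<odot> h')" if "x : GG" for x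
  using that h by (simp add: HG.inv_mult_group HG.m_assoc)
 show ?thesis
 proof (intro equalityI subsetI)
  fix x
  show "x : cj n (h \<odot> h') D" if "x : cj n h (cj n h' D)"
   using that e[of x] unfolding cj_mem[OF D' h(1)] cj_mem[OF D h(2)] cj_mem[OF D hh] by simp
  show "x : cj n h (cj n h' D)" if "x : cj n (h \<odot> h') D"
   using that e[of x] h unfolding cj_mem[OF D' h(1)] cj_mem[OF D h(2)] cj_mem[OF D hh] by simp
 qed
qed

lemma cj_subgroup:
 fixes D :: "'k::{field,finite} HH set"
 assumes D: "subgroup D (Hgrp n)" and h: "h : GG"
 shows "subgroup (cj n h D) (Hgrp n)"
proof -
 have DG: "D <= GG" by (rule subgroup.subset[OF D])
 note m = cj_mem[OF DG h]
 show ?thesis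
 proof (rule HG.subgroupI)
  show "cj n h D <= GG" using m by blast
  have "g1 : cj n h D" unfolding m using h subgroup.one_closed[OF D] by simp
  thus "cj n h D ~= {}" by blast
  show "gi x : cj n h D" if "x : cj n h D" for x
  proof -
   have x: "x : GG" "gi h \<odot> x \<odot> h : D" using that unfolding m by blast+
   have "gi h \<odot> gi x \<odot> h = gi (gi h \<odot> x \<odot> h)" using x h by (simp add: HG.inv_mult_group HG.m_assoc)
   thus ?thesis unfolding m using x subgroup.m_inv_closed[OF D x(2)] by simp
  qed
  show "x \<odot> y : cj n h D" if "x : cj n h D" "y : cj n h D" for x y
  proof -
   have x: "x : GG" "gi h \<odot> x \<odot> h : D" "y : GG" "gi h \<odot> y \<odot> h : D" using that unfolding m by blast+
   have "gi h \<odot> (x \<odot> y) \<odot> h = (gi h \<odot> x \<odot> h) \<odot> (gi h \<odot> y \<odot> h)" using x h by (simp add: HG.m_assoc)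
   thus ?thesis unfolding m using x subgroup.m_closed[OF D x(2,4)] by simp
  qed
 qed
qed

definition conj_levels :: "'k::{field,finite} HH set set" where
 "conj_levels = {cj n h (Cdbl n i j) | h i j. h : GG & 1 <= i & 1 <= j}"

lemma CH_iff: "D : CH n \<longleftrightarrow> (\<exists>\<C>. D = \<Inter>\<C> & finite \<C> & \<C> ~= {} & \<C> <= conj_levels)"
 unfolding CH_def conj_levels_def by blast

lemma conj_levels_subgroup: "D : conj_levels ==> subgroup D (Hgrp n)"
 unfolding conj_levels_def using cj_subgroup[OF Cdbl_subgroup] by blast

lemma CH_subgroup:
 fixes D :: "'k::{field,finite} HH set"
 assumes "D : CH n"
 shows "subgroup D (Hgrp n)"
proof -
 obtain \<C> where \<C>: "D = \<Inter>\<C>" "\<C> ~= {}" "\<C> <= conj_levels" using assms unfolding CH_iff by blast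
 show ?thesis unfolding \<C>(1)
 proof (rule HG.subgroups_Inter)
  show "subgroup B (Hgrp n)" if "B : \<C>" for B
   by (rule conj_levels_subgroup[OF subsetD[OF \<C>(3) that]])
 qed (rule \<C>(2))
qed

lemma CH_carrier: "D : CH n ==> D <= GG"
 for D :: "'k::{field,finite} HH set"
 by (rule subgroup.subset[OF CH_subgroup])

lemma CH_Int:
 fixes D D' :: "'a::{field,finite} HH set"
 assumes "D : CH n" "D' : CH n"
 shows "D Int D' : CH n"
 using assms unfolding CH_iff
proof (elim exE conjE)
 fix \<C> \<C>' :: "'a HH set set" assume "D = \<Inter>\<C>" "finite \<C>" "\<C> ~= {}" "\<C> <= conj_levels"
  "D' = \<Inter>\<C>'" "finite \<C>'" "\<C>' ~= {}" "\<C>' <= conj_levels"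
 thus "\<exists>\<B>. D Int D' = \<Inter>\<B> & finite \<B> & \<B> ~= {} & \<B> <= conj_levels"
  by (intro exI[of _ "\<C> Un \<C>'"]) auto
qed

lemma CH0_CH:
 fixes C :: "'k::{field,finite} HH set"
 assumes C: "C : CH0 n" shows "C : CH n"
proof -
 obtain i j where ij: "C = Cdbl n i j" "1 <= i" "1 <= j" using C by (rule CH0_cases)
 have "C = cj n g1 C" using cj_CH0[OF C H0_closed(3)] by simp
 hence "C : conj_levels" using ij HG.one_closed unfolding conj_levels_def by blast
 thus ?thesis unfolding CH_iff by (intro exI[of _ "{C}"]) simp
qed

lemma cj_CH:
 fixes D :: "'k::{field,finite} HH set"
 assumes D: "D : CH n" and h: "h : GG"
 shows "cj n h D : CH n"
proof -
 obtain \<C> where \<C>: "D = \<Inter>\<C>" "finite \<C>" "\<C> ~= {}" "\<C> <= conj_levels" using D unfolding CH_iff by blast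
 have sub: "B <= GG" if "B : \<C>" for B
  by (rule subgroup.subset[OF conj_levels_subgroup[OF subsetD[OF \<C>(4) that]]])
 have "x : cj n h D \<longleftrightarrow> (ALL B:\<C>. x : cj n h B)" for x
  using \<C>(1,3) cj_mem[OF CH_carrier[OF D] h, of x] cj_mem[OF sub h, of _ x] by blast
 hence e: "cj n h D = \<Inter>(cj n h ` \<C>)" by auto
 have "cj n h B : conj_levels" if B: "B : \<C>" for B
 proof -
  obtain h' i j where h': "B = cj n h' (Cdbl n i j)" "h' : GG" "1 <= i" "1 <= j"
   using B \<C>(4) unfolding conj_levels_def by blast
  have "cj n h B = cj n (h \<odot> h') (Cdbl n i j)"
   unfolding h'(1) by (rule cj_cj[OF subgroup.subset[OF Cdbl_subgroup[OF h'(3,4)]] h h'(2)])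
  moreover have "h \<odot> h' : GG" using h h' by simp
  ultimately show ?thesis using h' unfolding conj_levels_def by blast
 qed
 thus ?thesis unfolding CH_iff e using \<C>(2,3) by (intro exI[of _ "cj n h ` \<C>"]) auto
qed

text \<open>The conditions for a family of maps, one for each \<open>g\<close>, to come from a morphism at some level.\<close>

definition eqv :: "nat => nat => ('k::{field,finite} HH => (nat => 'k HH => lam) => nat => 'k HH => lam) => bool" where
 "eqv r s \<phi> \<longleftrightarrow> (ALL g:GG. linF r s g (\<phi> g))
  & (ALL b:BH n. ALL g:GG. ALL v:PF r g. \<phi> (b \<odot> g) (actP r b v) = actP s b (\<phi> g v))"

abbreviation eob where "eob \<equiv> SF_emb_obj n \<alpha>"

lemma ref_fam_deep:
 fixes C D :: "'k::{field,finite} HH set"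
 assumes C: "C : CH0 n" and D: "D : CH n" "D <= C" and g: "g : GG"
 shows "fib (ref_fam n D C (vp C r)) (g <| D) = fib (vp C r) (g <| C)"
  "b : BH n ==> act (ref_fam n D C (vp C r)) b (g <| D) = act (vp C r) b (g <| C)"
 using lco_SS[OF g, of D] refine_coset[OF CH_subgroup[OF D(1)] D(2) CH0_subgroup[OF C] g]
 unfolding ref_fam_def pull_fam_def by simp_all

lemma IF_homs_iff:
 fixes X Y :: "'k::{field,finite} HH set \<times> nat"
 assumes X: "X : obF" "Y : obF" and D: "D : CH n" "D <= fst X Int fst Y"
 shows "f : IF_homs n (eob X) (eob Y) D \<longleftrightarrow> f : extensional (SS n D) & eqv (snd X) (snd Y) (%g. f (g <| D))"
proof -
 have C: "fst X : CH0 n" "fst Y : CH0 n" and DX: "D <= fst X" "D <= fst Y" using X D by auto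
 define V where "V = ref_fam n D (fst X) (vp (fst X) (snd X))"
 define W where "W = ref_fam n D (fst Y) (vp (fst Y) (snd Y))"
 have fV: "fib V (g <| D) = fib (vp (fst X) (snd X)) (g <| fst X)"
  and fW: "fib W (g <| D) = fib (vp (fst Y) (snd Y)) (g <| fst Y)"
  and aV: "b : BH n ==> act V b (g <| D) = (\<lambda>v\<in>PF (snd X) g. actP (snd X) b v)"
  and aW: "b : BH n ==> act W b (g <| D) = (\<lambda>v\<in>PF (snd Y) g. actP (snd Y) b v)" if "g : GG" for g b
  unfolding V_def W_def using ref_fam_deep[OF C(1) D(1) DX(1) that] ref_fam_deep[OF C(2) D(1) DX(2) that]
   vpow_act[OF C(1) _ that] vpow_act[OF C(2) _ that] by simp_all
 have 1: "f (g <| D) : extensional (carrier (fib V (g <| D))) & lin_map (fib V (g <| D)) (fib W (g <| D)) (f (g <| D))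
   \<longleftrightarrow> linF (snd X) (snd Y) g (f (g <| D))" if "g : GG" for g
  unfolding linF_def lin_map_def fV[OF that] fW[OF that] vpow_fib[OF C(1) that] vpow_fib[OF C(2) that]
  by (simp add: mk_module_def)
 have 2: "(ALL v:carrier (fib V (g <| D)). f (b <| g <| D) (act V b (g <| D) v) = act W b (g <| D) (f (g <| D) v))
   \<longleftrightarrow> (ALL v:PF (snd X) g. f ((b \<odot> g) <| D) (actP (snd X) b v) = actP (snd Y) b (f (g <| D) v))"
  if "g : GG" "b : BH n" "linF (snd X) (snd Y) g (f (g <| D))" for g b
  using that unfolding fV[OF that(1)] vpow_carrier[OF C(1) that(1)] aV[OF that(1,2)] aW[OF that(1,2)]
   HG.lcos_m_assoc[OF CH_carrier[OF D(1)] GG_of(1)[OF that(2)] that(1)]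
  by (auto simp: linF_def)
 have "IF_homs n (eob X) (eob Y) D = I_hom n D V W"
  unfolding IF_homs_def SF_emb_obj_def V_def W_def by simp
 moreover have ball: "(ALL s:SS n D. P s) \<longleftrightarrow> (ALL g:GG. P (g <| D))" for P unfolding SS_def by blast
 moreover have A: "(ALL g:GG. f (g <| D) : extensional (carrier (fib V (g <| D))) & lin_map (fib V (g <| D)) (fib W (g <| D)) (f (g <| D)))
   \<longleftrightarrow> (ALL g:GG. linF (snd X) (snd Y) g (f (g <| D)))"
  by (intro ball_cong refl 1)
 moreover have B: "(ALL b:BH n. ALL g:GG. ALL v:carrier (fib V (g <| D)). f (b <| g <| D) (act V b (g <| D) v) = act W b (g <| D) (f (g <| D) v))
   \<longleftrightarrow> (ALL b:BH n. ALL g:GG. ALL v:PF (snd X) g. f ((b \<odot> g) <| D) (actP (snd X) b v) = actP (snd Y) b (f (g <| D) v))"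
  if "ALL g:GG. linF (snd X) (snd Y) g (f (g <| D))"
  by (intro ball_cong refl 2) (use that in simp_all)
 ultimately show ?thesis unfolding I_hom_def eqv_def by (simp only: ball mem_Collect_eq A cong: conj_cong)
qed

text \<open>The analogue of \<open>cls\<close>: all representatives with prescribed values at the cosets \<open>gD\<close>. These values, unlike a matrix function
 on \<open>H0 n\<close>, make sense at every level in \<open>CH n\<close>.\<close>

definition icls :: "'k::{field,finite} HH set \<times> nat => 'k HH set \<times> nat
  => ('k HH => (nat => 'k HH => lam) => nat => 'k HH => lam)
  => ('k HH set \<times> ('k HH set => (nat => 'k HH => lam) => nat => 'k HH => lam)) set" where
 "icls X Y \<phi> = {(D, f). D : CH n & D <= fst X Int fst Y & f : IF_homs n (eob X) (eob Y) D & (ALL g:GG. f (g <| D) = \<phi> g)}"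

lemma icls_cong: "(!!g. g : GG ==> \<phi> g = \<psi> g) ==> icls X Y \<phi> = icls X Y \<psi>"
 unfolding icls_def by simp

lemma ref_mor_at:
 fixes D :: "'k::{field,finite} HH set"
 assumes "E : CH n" "D : CH n" "E <= D" "g : GG"
 shows "ref_mor n E D f (g <| E) = f (g <| D)"
 using lco_SS[OF assms(4), of E] refine_coset[OF CH_subgroup[OF assms(1)] assms(3) CH_subgroup[OF assms(2)] assms(4)]
 unfolding ref_mor_def pull_mor_def by simp

lemma eob_fst: "fst (eob X) = fst X"
 unfolding SF_emb_obj_def by simp

lemma IF_rel_iff:
 fixes X Y :: "'k::{field,finite} HH set \<times> nat"
 shows "((D, f), (D', f')) : IF_rel n (eob X) (eob Y) \<longleftrightarrow>
  (D : CH n & D <= fst X Int fst Y & f : IF_homs n (eob X) (eob Y) D)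
  & (D' : CH n & D' <= fst X Int fst Y & f' : IF_homs n (eob X) (eob Y) D')
  & (ALL g:GG. f (g <| D) = f' (g <| D'))"
proof -
 have "(EX E:CH n. E <= D Int D' & ref_mor n E D f = ref_mor n E D' f') \<longleftrightarrow> (ALL g:GG. f (g <| D) = f' (g <| D'))"
  if D: "D : CH n" "D' : CH n"
 proof
  assume "EX E:CH n. E <= D Int D' & ref_mor n E D f = ref_mor n E D' f'"
  then obtain E where E: "E : CH n" "E <= D" "E <= D'" "ref_mor n E D f = ref_mor n E D' f'" by blast
  show "ALL g:GG. f (g <| D) = f' (g <| D')"
   using ref_mor_at[OF E(1) D(1) E(2)] ref_mor_at[OF E(1) D(2) E(3)] E(4) by metis
 next
  assume e: "ALL g:GG. f (g <| D) = f' (g <| D')"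
  have E: "D Int D' : CH n" by (rule CH_Int[OF D])
  have "ref_mor n (D Int D') D f = ref_mor n (D Int D') D' f'"
  proof (rule extensionalityI[of _ "SS n (D Int D')"])
   fix s assume "s : SS n (D Int D')"
   then obtain g where g: "g : GG" "s = g <| (D Int D')" unfolding SS_def by blast
   show "ref_mor n (D Int D') D f s = ref_mor n (D Int D') D' f' s"
    unfolding g(2) using ref_mor_at[OF E D(1) Int_lower1 g(1), of f] ref_mor_at[OF E D(2) Int_lower2 g(1), of f'] e g(1) by simp
  qed (simp_all add: ref_mor_def pull_mor_def)
  thus "EX E:CH n. E <= D Int D' & ref_mor n E D f = ref_mor n E D' f'" using E by blast
 qed
 thus ?thesis unfolding IF_rel_def colim_rel_def colim_reps_def eob_fst by blast
qed

lemma IF_rel_icls: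
 fixes X Y :: "'k::{field,finite} HH set \<times> nat"
 assumes "(D, f) : icls X Y \<phi>"
 shows "IF_rel n (eob X) (eob Y) `` {(D, f)} = icls X Y \<phi>"
proof (intro equalityI subsetI)
 fix p
 show "p : icls X Y \<phi>" if "p : IF_rel n (eob X) (eob Y) `` {(D, f)}"
 proof (cases p)
  case (Pair D' f')
  thus ?thesis using that assms IF_rel_iff[of D f D' f' X Y] unfolding icls_def by simp
 qed
 show "p : IF_rel n (eob X) (eob Y) `` {(D, f)}" if "p : icls X Y \<phi>"
 proof (cases p)
  case (Pair D' f')
  thus ?thesis using that assms IF_rel_iff[of D f D' f' X Y] unfolding icls_def by simp
 qed
qed

lemma icls_IF_hom:
 fixes X Y :: "'k::{field,finite} HH set \<times> nat"
 assumes "(D, f) : icls X Y \<phi>"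
 shows "icls X Y \<phi> : IF_hom n (eob X) (eob Y)"
 using quotientI[of "(D, f)" "colim_reps (CH n) (fst (eob X) Int fst (eob Y)) (IF_homs n (eob X) (eob Y))" "IF_rel n (eob X) (eob Y)"]
  assms unfolding IF_rel_icls[OF assms] IF_hom_def eob_fst colim_reps_def icls_def by blast

lemma IF_comp_icls:
 fixes X Y Z :: "'k::{field,finite} HH set \<times> nat"
 assumes X: "X : obF" "Y : obF" "Z : obF"
  and P: "P <= icls X Y \<phi>" "P ~= {}" and Q: "Q <= icls Y Z \<psi>" "Q ~= {}"
 shows "IF_comp n (eob X) (eob Z) Q P = icls X Z (%g. \<lambda>v\<in>PF (snd X) g. \<psi> g (\<phi> g v))"
proof -
 let ?T = "icls X Z (%g. \<lambda>v\<in>PF (snd X) g. \<psi> g (\<phi> g v))"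
 have one: "IF_rel n (eob X) (eob Z) `` {(D Int D', I_comp n (D Int D') (ref_fam n (D Int D') (fst (eob X)) (snd (eob X)))
    (ref_mor n (D Int D') D' g) (ref_mor n (D Int D') D f))} = ?T"
  if f: "(D, f) : P" and g: "(D', g) : Q" for D f D' g
 proof (rule IF_rel_icls)
  have D: "D : CH n" "D <= fst X Int fst Y" "f : IF_homs n (eob X) (eob Y) D" "ALL x:GG. f (x <| D) = \<phi> x"
   using f P(1) unfolding icls_def by blast+
  have D': "D' : CH n" "D' <= fst Y Int fst Z" "g : IF_homs n (eob Y) (eob Z) D'" "ALL x:GG. g (x <| D') = \<psi> x"
   using g Q(1) unfolding icls_def by blast+
  have E: "D Int D' : CH n" "D Int D' <= fst X" "D Int D' <= fst X Int fst Z" using CH_Int[OF D(1) D'(1)] D(2) D'(2) by blast+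
  have C: "fst X : CH0 n" using X by auto
  let ?h = "I_comp n (D Int D') (ref_fam n (D Int D') (fst (eob X)) (snd (eob X))) (ref_mor n (D Int D') D' g) (ref_mor n (D Int D') D f)"
  have at: "?h (x <| (D Int D')) = (\<lambda>v\<in>PF (snd X) x. \<psi> x (\<phi> x v))" if x: "x : GG" for x
  proof -
   have "carrier (fib (ref_fam n (D Int D') (fst (eob X)) (snd (eob X))) (x <| (D Int D'))) = PF (snd X) x"
    unfolding SF_emb_obj_def fst_conv snd_conv ref_fam_deep(1)[OF C E(1,2) x] by (rule vpow_carrier[OF C x])
   moreover have "ref_mor n (D Int D') D f (x <| (D Int D')) = \<phi> x" "ref_mor n (D Int D') D' g (x <| (D Int D')) = \<psi> x"
    using ref_mor_at[OF E(1) D(1) Int_lower1 x, of f] ref_mor_at[OF E(1) D'(1) Int_lower2 x, of g] D(4) D'(4) x by simp_all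
   ultimately show ?thesis unfolding I_comp_def using lco_SS[OF x, of "D Int D'"] by simp
  qed
  have ef: "eqv (snd X) (snd Y) (%g. f (g <| D))" and eg: "eqv (snd Y) (snd Z) (%x. g (x <| D'))"
   using IF_homs_iff[OF X(1,2) D(1,2)] D(3) IF_homs_iff[OF X(2,3) D'(1,2)] D'(3) by blast+
  have lf: "linF (snd X) (snd Y) x (\<phi> x)" and lg: "linF (snd Y) (snd Z) x (\<psi> x)" if "x : GG" for x
   using ef eg that D(4) D'(4) unfolding eqv_def by simp_all
  have bf: "\<phi> (b \<odot> x) (actP (snd X) b v) = actP (snd Y) b (\<phi> x v)" if "b : BH n" "x : GG" "v : PF (snd X) x" for b x v
   using ef that D(4) unfolding eqv_def by simp
  have bg: "\<psi> (b \<odot> x) (actP (snd Y) b v) = actP (snd Z) b (\<psi> x v)" if "b : BH n" "x : GG" "v : PF (snd Y) x" for b x v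
   using eg that D'(4) unfolding eqv_def by simp
  have \<phi>v: "\<phi> x v : PF (snd Y) x" if "x : GG" "v : PF (snd X) x" for x v
   using lf[OF that(1)] that(2) unfolding linF_def by blast
  have "eqv (snd X) (snd Z) (%x. ?h (x <| (D Int D')))"
   unfolding eqv_def
  proof (intro conjI ballI)
   fix x :: "'k HH" assume x: "x : GG"
   show "linF (snd X) (snd Z) x (?h (x <| (D Int D')))"
    unfolding at[OF x] linF_def
   proof (intro conjI ballI allI)
    show "(\<lambda>v\<in>PF (snd X) x. \<psi> x (\<phi> x v)) : PF (snd X) x \<rightarrow> PF (snd Z) x"
     using \<phi>v[OF x] lg[OF x] unfolding linF_def by auto
    show "(\<lambda>v\<in>PF (snd X) x. \<psi> x (\<phi> x v)) (\<lambda>i\<in>{..<snd X}. %b. v i b + w i b)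
     = (\<lambda>i\<in>{..<snd Z}. %b. (\<lambda>v\<in>PF (snd X) x. \<psi> x (\<phi> x v)) v i b + (\<lambda>v\<in>PF (snd X) x. \<psi> x (\<phi> x v)) w i b)"
     if v: "v : PF (snd X) x" "w : PF (snd X) x" for v w
    proof -
     have "\<phi> x (\<lambda>i\<in>{..<snd X}. %b. v i b + w i b) = (\<lambda>i\<in>{..<snd Y}. %b. \<phi> x v i b + \<phi> x w i b)"
      using lf[OF x] v unfolding linF_def by blast
     moreover have "\<psi> x (\<lambda>i\<in>{..<snd Y}. %b. \<phi> x v i b + \<phi> x w i b)
       = (\<lambda>i\<in>{..<snd Z}. %b. \<psi> x (\<phi> x v) i b + \<psi> x (\<phi> x w) i b)"
      using lg[OF x] \<phi>v[OF x v(1)] \<phi>v[OF x v(2)] unfolding linF_def by blast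
     ultimately show ?thesis using PF_add[OF v] v by simp
    qed
    show "(\<lambda>v\<in>PF (snd X) x. \<psi> x (\<phi> x v)) (\<lambda>i\<in>{..<snd X}. %b. c * v i b)
     = (\<lambda>i\<in>{..<snd Z}. %b. c * (\<lambda>v\<in>PF (snd X) x. \<psi> x (\<phi> x v)) v i b)"
     if v: "v : PF (snd X) x" for c v
    proof -
     have "\<phi> x (\<lambda>i\<in>{..<snd X}. %b. c * v i b) = (\<lambda>i\<in>{..<snd Y}. %b. c * \<phi> x v i b)"
      using lf[OF x] v unfolding linF_def by blast
     moreover have "\<psi> x (\<lambda>i\<in>{..<snd Y}. %b. c * \<phi> x v i b) = (\<lambda>i\<in>{..<snd Z}. %b. c * \<psi> x (\<phi> x v) i b)"
      using lg[OF x] \<phi>v[OF x v] unfolding linF_def by blast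
     ultimately show ?thesis using PF_scale[OF v] v by simp
    qed
   qed simp
  next
   fix b x :: "'k HH" and v assume b: "b : BH n" and x: "x : GG" and v: "v : PF (snd X) x"
   have bx: "b \<odot> x : GG" using b x by simp
   show "?h ((b \<odot> x) <| (D Int D')) (actP (snd X) b v) = actP (snd Z) b (?h (x <| (D Int D')) v)"
    unfolding at[OF x] at[OF bx] using actP_PF[OF b x v] v bf[OF b x v] bg[OF b x \<phi>v[OF x v]] by simp
  qed
  moreover have "?h : extensional (SS n (D Int D'))" unfolding I_comp_def by simp
  ultimately have "?h : IF_homs n (eob X) (eob Z) (D Int D')"
   unfolding IF_homs_iff[OF X(1,3) E(1,3)] by blast
  thus "(D Int D', ?h) : ?T" using E at unfolding icls_def by blast
 qed
 obtain D f D' g where "(D, f) : P" "(D', g) : Q" using P(2) Q(2) by (metis ex_in_conv surj_pair)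
 thus ?thesis unfolding IF_comp_def using one by (intro equalityI subsetI) (clarsimp, blast)+
qed

definition evM :: "nat => nat => ('k::{field,finite} HH => nat => nat => lam)
  => 'k HH => (nat => 'k HH => lam) => nat => 'k HH => lam" where
 "evM r s M g = (\<lambda>v\<in>PF r g. opv r s M g v)"

lemma cls_icls:
 fixes X Y :: "'k::{field,finite} HH set \<times> nat"
 assumes X: "X : obF" "Y : obF" and f: "(D, f) : cls X Y M"
 shows "(D, f) : icls X Y (evM (snd X) (snd Y) M)"
proof -
 have D: "D : CH0 n" "D <= fst X Int fst Y" "f : Sh D (snd X) (snd Y)" "md D (snd X) (snd Y) f = M"
  using f unfolding cls_def by blast+
 have C: "fst X : CH0 n" "fst Y : CH0 n" "D <= fst X" "D <= fst Y" using X D(2) by auto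
 have I: "f : Ih D (snd X) (snd Y)" using D(3) unfolding S_hom_def by blast
 hence "f : IF_homs n (eob X) (eob Y) D"
  unfolding IF_homs_def SF_emb_obj_def fst_conv snd_conv refine_fam[OF C(1) D(1) C(3)] refine_fam[OF C(2) D(1) C(4)] .
 moreover have "f (g <| D) = evM (snd X) (snd Y) M g" if g: "g : GG" for g
 proof (rule extensionalityI[of _ "PF (snd X) g"])
  show "f (g <| D) : extensional (PF (snd X) g)" using I g unfolding I_hom_iff[OF D(1)] linF_def by blast
  show "evM (snd X) (snd Y) M g : extensional (PF (snd X) g)" unfolding evM_def by simp
  show "f (g <| D) v = evM (snd X) (snd Y) M g v" if "v : PF (snd X) g" for v
   using S_hom_opv[OF D(1,3) g that] that unfolding evM_def D(4) by simp
 qed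
 ultimately show ?thesis using D(2) CH0_CH[OF D(1)] unfolding icls_def by blast
qed

lemma SF_emb_cls:
 fixes X Y :: "'k::{field,finite} HH set \<times> nat"
 assumes X: "X : obF" "Y : obF" and M: "M : MF X Y"
 shows "SF_emb n \<alpha> X Y (cls X Y M) = icls X Y (evM (snd X) (snd Y) M)"
proof -
 obtain D f where "(D, f) : cls X Y M" using cls_nonempty[OF X M] by blast
 moreover have "IF_rel n (eob X) (eob Y) `` {p} = icls X Y (evM (snd X) (snd Y) M)" if "p : cls X Y M" for p
  using that IF_rel_icls[OF cls_icls[OF X], of "fst p" "snd p" M] by simp
 ultimately have "(\<Union>p\<in>cls X Y M. IF_rel n (eob X) (eob Y) `` {p}) = icls X Y (evM (snd X) (snd Y) M)" by blast
 thus ?thesis unfolding SF_emb_def by (subst Image_eq_UN)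
qed

lemma icls_cls_inj:
 fixes X Y :: "'k::{field,finite} HH set \<times> nat"
 assumes X: "X : obF" "Y : obF" and M: "M : MF X Y" "N : MF X Y"
  and e: "icls X Y (evM (snd X) (snd Y) M) = icls X Y (evM (snd X) (snd Y) N)"
 shows "M = N"
proof -
 obtain D f D' f' where f: "(D, f) : cls X Y M" and f': "(D', f') : cls X Y N"
  using cls_nonempty[OF X M(1)] cls_nonempty[OF X M(2)] by blast
 have "(D, f) : icls X Y (evM (snd X) (snd Y) N)" using cls_icls[OF X f] unfolding e .
 hence "f (g <| D) = f' (g <| D')" if "g : GG" for g
  using cls_icls[OF X f'] that unfolding icls_def by simp
 hence "md D (snd X) (snd Y) f = md D' (snd X) (snd Y) f'" by (intro ext) (simp add: md_def)
 thus "M = N" using f f' unfolding cls_def by simp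
qed

lemma id_icls:
 fixes X :: "'k::{field,finite} HH set \<times> nat"
 assumes X: "X : obF"
 shows "(fst X, I_id n (fst X) (vp (fst X) (snd X))) : icls X X (%g. \<lambda>v\<in>PF (snd X) g. v)"
proof -
 have C: "fst X : CH0 n" using X by auto
 have "I_id n (fst X) (vp (fst X) (snd X)) : Ih (fst X) (snd X) (snd X)"
  using I_id_md(1)[OF C, of "snd X"] unfolding S_hom_def by blast
 hence "I_id n (fst X) (vp (fst X) (snd X)) : IF_homs n (eob X) (eob X) (fst X)"
  unfolding IF_homs_def SF_emb_obj_def fst_conv snd_conv refine_fam[OF C C subset_refl] .
 moreover have "I_id n (fst X) (vp (fst X) (snd X)) (g <| fst X) = (\<lambda>v\<in>PF (snd X) g. v)" if "g : GG" for g
  using lco_SS[OF that, of "fst X"] by (simp add: I_id_def vpow_carrier[OF C that])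
 ultimately show ?thesis using CH0_CH[OF C] unfolding icls_def by simp
qed

lemma rho_eob:
 fixes X :: "'k::{field,finite} HH set \<times> nat"
 assumes X: "X : obF" and h: "h : H0 n"
 shows "rho_obj n h (eob X) = eob X"
proof -
 have C: "fst X : CH0 n" using X by auto
 show ?thesis unfolding rho_obj_def SF_emb_obj_def fst_conv snd_conv cj_CH0[OF C h] R_fam_sph_pow[OF C h] ..
qed

lemma phi_F_icls:
 fixes X :: "'k::{field,finite} HH set \<times> nat"
 assumes X: "X : obF" and h: "h : H0 n"
 shows "phi_F n \<alpha> h X = icls X X (%g. \<lambda>v\<in>PF (snd X) g. v)" "phi_F_inv n \<alpha> h X = icls X X (%g. \<lambda>v\<in>PF (snd X) g. v)"
proof -
 have C: "fst X : CH0 n" using X by auto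
 show "phi_F n \<alpha> h X = icls X X (%g. \<lambda>v\<in>PF (snd X) g. v)" "phi_F_inv n \<alpha> h X = icls X X (%g. \<lambda>v\<in>PF (snd X) g. v)"
  unfolding phi_F_def phi_F_inv_def rho_eob[OF X h] phi_pow_id[OF C h] phi_pow_inv_id[OF C h]
  by (rule IF_rel_icls[OF id_icls[OF X]])+
qed

lemma eob_IF_obj: "X : obF ==> eob X : IF_obj n \<alpha>"
 for X :: "'k::{field,finite} HH set \<times> nat"
 unfolding IF_obj_def SF_emb_obj_def using vpow_fam_obj[of "fst X" "snd X"] CH0_CH[of "fst X"] by auto

lemma rho_icls:
 fixes X Y :: "'k::{field,finite} HH set \<times> nat"
 assumes X: "X : obF" "Y : obF" and h: "h : H0 n"
 shows "rho_mor n h (icls X Y \<phi>) <= icls X Y (%g. \<phi> (g \<odot> h))"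
proof
 fix p assume "p : rho_mor n h (icls X Y \<phi>)"
 then obtain D f where f: "(D, f) : icls X Y \<phi>" and p: "p = (cj n h D, R_mor n h D f)"
  unfolding rho_mor_def by auto
 have D: "D : CH n" "D <= fst X Int fst Y" "f : IF_homs n (eob X) (eob Y) D" "ALL g:GG. f (g <| D) = \<phi> g"
  using f unfolding icls_def by blast+
 have hG: "h : GG" and C: "fst X : CH0 n" using h X by auto
 have E: "cj n h D : CH n" by (rule cj_CH[OF D(1) hG])
 have K: "fst X Int fst Y : CH0 n" using X CH0_Int by auto
 have "cj n h D <= cj n h (fst X Int fst Y)" using D(2) unfolding cj_eq by blast
 hence EK: "cj n h D <= fst X Int fst Y" unfolding cj_CH0[OF K h] .
 have at: "R_mor n h D f (g <| cj n h D) = \<phi> (g \<odot> h)" if g: "g : GG" for g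
  using lco_SS[OF g, of "cj n h D"] translate_coset[OF CH_carrier[OF D(1)] hG g] D(4) g hG
  unfolding R_mor_def pull_mor_def by simp
 have e: "eqv (snd X) (snd Y) \<phi>"
  using IF_homs_iff[OF X D(1,2)] D(3,4) unfolding eqv_def by simp
 have P: "PF r (g \<odot> h) = PF r g" if "g : GG" for r g
  by (rule PF_shift[OF C C h shift_translate[OF C h] that])
 have "eqv (snd X) (snd Y) (%g. R_mor n h D f (g <| cj n h D))"
  unfolding eqv_def
 proof (intro conjI ballI)
  fix g :: "'k HH" assume g: "g : GG"
  have "linF (snd X) (snd Y) (g \<odot> h) (\<phi> (g \<odot> h))" using e g hG unfolding eqv_def by simp
  thus "linF (snd X) (snd Y) g (R_mor n h D f (g <| cj n h D))"
   unfolding at[OF g] linF_def P[OF g] .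
 next
  fix b g :: "'k HH" and v assume b: "b : BH n" and g: "g : GG" and v: "v : PF (snd X) g"
  have bg: "b \<odot> g : GG" and gh: "g \<odot> h : GG" and as: "b \<odot> g \<odot> h = b \<odot> (g \<odot> h)"
   using b g hG by (simp_all add: HG.m_assoc)
  have "v : PF (snd X) (g \<odot> h)" using v P[OF g] by simp
  thus "R_mor n h D f ((b \<odot> g) <| cj n h D) (actP (snd X) b v) = actP (snd Y) b (R_mor n h D f (g <| cj n h D) v)"
   unfolding at[OF g] at[OF bg] as using e b gh unfolding eqv_def by blast
 qed
 moreover have "R_mor n h D f : extensional (SS n (cj n h D))" unfolding R_mor_def pull_mor_def by simp
 ultimately have "R_mor n h D f : IF_homs n (eob X) (eob Y) (cj n h D)"
  unfolding IF_homs_iff[OF X E EK] by blast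
 thus "p : icls X Y (%g. \<phi> (g \<odot> h))" unfolding p icls_def using E EK at by blast
qed

text \<open>Both sides are classes, so their values at \<open>g\<close> are compared. The structure maps contribute identities, and \<open>rho_mor\<close>
 replaces \<open>g\<close> by \<open>gh\<close>.\<close>

lemma SF_emb_equivariant:
 fixes X Y :: "'k::{field,finite} HH set \<times> nat"
 assumes X: "X : obF" "Y : obF" and h: "h : H0 n" and P: "P : Hom SFc X Y"
 shows "SF_emb n \<alpha> X Y P : IF_hom n (eob X) (eob Y)"
  "SF_emb n \<alpha> X Y (U_F n \<alpha> h X Y P) = IF_comp n (eob X) (eob Y) (phi_F n \<alpha> h Y)
   (IF_comp n (eob X) (rho_obj n h (eob Y)) (rho_mor n h (SF_emb n \<alpha> X Y P)) (phi_F_inv n \<alpha> h X))"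
proof -
 obtain M where M: "P = cls X Y M" "M : MF X Y" using P unfolding SF_carrier[OF X] by blast
 obtain D f where f: "(D, f) : cls X Y M" using cls_nonempty[OF X M(2)] by blast
 note i = cls_icls[OF X f]
 show "SF_emb n \<alpha> X Y P : IF_hom n (eob X) (eob Y)"
  unfolding M(1) SF_emb_cls[OF X M(2)] by (rule icls_IF_hom[OF i])
 have C: "fst X : CH0 n" using X by auto
 note sh = C C h shift_translate[OF C h]
 have N: "msh h M : MF X Y" by (rule MM_msh[OF sh M(2) subset_refl])
 let ?\<phi> = "evM (snd X) (snd Y) M" and ?id = "%r g. \<lambda>v\<in>PF r g. v"
 have rne: "rho_mor n h (icls X Y ?\<phi>) ~= {}" using i unfolding rho_mor_def by blast
 have 1: "IF_comp n (eob X) (eob Y) (rho_mor n h (icls X Y ?\<phi>)) (icls X X (?id (snd X)))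
   = icls X Y (%g. \<lambda>v\<in>PF (snd X) g. ?\<phi> (g \<odot> h) (?id (snd X) g v))" (is "_ = ?I")
  by (rule IF_comp_icls[OF X(1,1,2) subset_refl _ rho_icls[OF X h] rne]) (use id_icls[OF X(1)] in blast)
 have e: "(\<lambda>v\<in>PF (snd X) g. ?id (snd Y) g ((\<lambda>v\<in>PF (snd X) g. ?\<phi> (g \<odot> h) (?id (snd X) g v)) v))
   = evM (snd X) (snd Y) (msh h M) g" if g: "g : GG" for g
  unfolding evM_def
 proof (rule restrict_ext)
  fix v assume v: "v : PF (snd X) g"
  obtain D where D: "D : CH0 n" "msh h M : MM (lv D) (snd X) (snd Y)" using MM_level[OF C N] by blast
  have "opv (snd X) (snd Y) (msh h M) g v : PF (snd Y) g" by (rule opv_PF[OF MM_good[OF D] g v])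
  thus "?id (snd Y) g ((\<lambda>v\<in>PF (snd X) g. (\<lambda>v\<in>PF (snd X) (g \<odot> h). opv (snd X) (snd Y) M (g \<odot> h) v) (?id (snd X) g v)) v)
   = opv (snd X) (snd Y) (msh h M) g v"
   using v by (simp add: PF_shift[OF sh g] opv_shift[OF sh g])
 qed
 have "rho_mor n h (icls X Y ?\<phi>) <= icls X Y (%g. ?\<phi> (g \<odot> h))" by (rule rho_icls[OF X h])
 have ne: "?I ~= {}"
 proof -
  have "(cj n h D, R_mor n h D f) : icls X Y (%g. ?\<phi> (g \<odot> h))"
   using rho_icls[OF X h, of ?\<phi>] i unfolding rho_mor_def by blast
  moreover have "icls X Y (%g. ?\<phi> (g \<odot> h)) = ?I"
  proof (rule icls_cong)
   fix g :: "'k HH" assume g: "g : GG"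
   show "?\<phi> (g \<odot> h) = (\<lambda>v\<in>PF (snd X) g. ?\<phi> (g \<odot> h) (?id (snd X) g v))"
    unfolding evM_def PF_shift[OF sh g] by (intro restrict_ext) simp
  qed
  ultimately have "(cj n h D, R_mor n h D f) : ?I" by (simp only:)
  thus ?thesis by (intro notI) (simp only: empty_iff)
 qed
 have 2: "IF_comp n (eob X) (eob Y) (icls Y Y (?id (snd Y))) ?I
   = icls X Y (%g. \<lambda>v\<in>PF (snd X) g. ?id (snd Y) g ((\<lambda>v\<in>PF (snd X) g. ?\<phi> (g \<odot> h) (?id (snd X) g v)) v))"
  by (rule IF_comp_icls[OF X(1,2,2) subset_refl ne subset_refl]) (use id_icls[OF X(2)] in blast)
 show "SF_emb n \<alpha> X Y (U_F n \<alpha> h X Y P) = IF_comp n (eob X) (eob Y) (phi_F n \<alpha> h Y)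
   (IF_comp n (eob X) (rho_obj n h (eob Y)) (rho_mor n h (SF_emb n \<alpha> X Y P)) (phi_F_inv n \<alpha> h X))"
  unfolding M(1) SF_ops(5)[OF X M(2) h] SF_emb_cls[OF X N] SF_emb_cls[OF X M(2)] rho_eob[OF X(2) h]
   phi_F_icls(1)[OF X(2) h] phi_F_icls(2)[OF X(1) h] 1 2
  by (rule icls_cong) (rule e[symmetric])
qed

lemma SF_emb_inj:
 fixes X Y :: "'k::{field,finite} HH set \<times> nat"
 assumes X: "X : obF" "Y : obF"
 shows "inj_on (SF_emb n \<alpha> X Y) (Hom SFc X Y)"
proof (rule inj_onI)
 fix P Q assume P: "P : Hom SFc X Y" "Q : Hom SFc X Y"
  and e: "SF_emb n \<alpha> X Y P = SF_emb n \<alpha> X Y Q"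
 obtain M N where M: "P = cls X Y M" "M : MF X Y" and N: "Q = cls X Y N" "N : MF X Y"
  using P unfolding SF_carrier[OF X] by blast
 have "M = N" using e unfolding M(1) N(1) SF_emb_cls[OF X M(2)] SF_emb_cls[OF X N(2)]
  by (rule icls_cls_inj[OF X M(2) N(2)])
 thus "P = Q" unfolding M(1) N(1) by simp
qed

end

theorem theorem6p9:
  fixes n :: nat and \<alpha> :: "nat \<Rightarrow> complex fls"
  assumes "n \<ge> 1"
    and "\<forall>r<n. lam_dag (\<alpha> r) * \<alpha> r = 1"
  shows
    "(\<comment> \<open>(i)\<close>
      \<forall>C \<in> (CH0 n :: 'k::{field,finite} HH set set).
        (\<forall>r s. \<forall>\<Phi>\<in>S_hom n \<alpha> C r s. \<forall>\<Psi>\<in>S_hom n \<alpha> C r s. \<exists>!v. has_tau n C (tr_fun n C r s \<Phi> \<Psi>) v)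
        \<and> (\<forall>r s. pos_def_hermitian (hm (S_cat n \<alpha> C) r s) (S_form n C r s))
        \<and> S_form n C 1 1 (idn (S_cat n \<alpha> C) 1) (idn (S_cat n \<alpha> C) 1) = 1)
   \<and> (\<comment> \<open>(ii)\<close>
      \<forall>C \<in> (CH0 n :: 'k HH set set).
        (\<forall>r. fam_obj n \<alpha> C (sph_pow n \<alpha> C r))
        \<and> (\<forall>r s. bij_betw (picture n C r s) (S_hom n \<alpha> C r s)
             {M \<in> XX n C \<rightarrow>\<^sub>E carrier_mat s r. \<forall>i<s. \<forall>j<r. (\<lambda>x\<in>XX n C. M x $$ (i, j)) \<in> A_cyl n C})
        \<and> dagger_category (S_cat n \<alpha> C)
        \<and> hom_bifunctor (S_cat n \<alpha> C) (S_form n C)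
        \<and> dagger_antiunitary (S_cat n \<alpha> C) (S_form n C)
        \<and> composition_adjointable (S_cat n \<alpha> C) (S_form n C))
   \<and> (\<comment> \<open>(iii)\<close>
      \<forall>C \<in> (CH0 n :: 'k HH set set). \<forall>D\<in>CH0 n. D \<subseteq> C \<longrightarrow>
        (\<forall>r. ref_fam n D C (sph_pow n \<alpha> C r) = sph_pow n \<alpha> D r)
        \<and> isometric_dagger_functor (S_cat n \<alpha> C) (S_form n C) (S_cat n \<alpha> D) (S_form n D)
            (\<lambda>r. r) (\<lambda>r s. ref_mor n D C))
   \<and> (\<forall>X\<in>obs (SF_cat n \<alpha> :: ('k HH set \<times> nat, _) dagcat). \<forall>Y\<in>obs (SF_cat n \<alpha>).
        \<forall>P\<in>carrier (hm (SF_cat n \<alpha>) X Y). \<forall>Q\<in>carrier (hm (SF_cat n \<alpha>) X Y).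
          \<exists>!v. SF_form_value n X Y P Q v)
   \<and> two_inner_product (SF_cat n \<alpha> :: ('k HH set \<times> nat, _) dagcat) (SF_form n)
   \<and> (\<comment> \<open>(iv), at a fixed level\<close>
      \<forall>C \<in> (CH0 n :: 'k HH set set).
        (\<forall>h\<in>H0 n. cj n h C = C
          \<and> (\<forall>r. fam_obj n \<alpha> C (R_fam n h C (sph_pow n \<alpha> C r))
               \<and> phi_pow n \<alpha> C h r \<in> I_hom n C (R_fam n h C (sph_pow n \<alpha> C r)) (sph_pow n \<alpha> C r)
               \<and> phi_pow_inv n \<alpha> C h r \<in> I_hom n C (sph_pow n \<alpha> C r) (R_fam n h C (sph_pow n \<alpha> C r))
               \<and> I_comp n C (sph_pow n \<alpha> C r) (phi_pow n \<alpha> C h r) (phi_pow_inv n \<alpha> C h r)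
                   = I_id n C (sph_pow n \<alpha> C r)
               \<and> I_comp n C (R_fam n h C (sph_pow n \<alpha> C r)) (phi_pow_inv n \<alpha> C h r) (phi_pow n \<alpha> C h r)
                   = I_id n C (R_fam n h C (sph_pow n \<alpha> C r)))
          \<and> (\<forall>x\<in>XX n C. line_unit n \<in> carrier (fib (sph n \<alpha> C) x)
               \<and> phi n \<alpha> C h x (line_unit n) = line_unit n)
          \<and> (\<forall>h'\<in>H0 n. phi n \<alpha> C (h \<otimes>\<^bsub>Hgrp n\<^esub> h')
               = I_comp n C (R_fam n (h \<otimes>\<^bsub>Hgrp n\<^esub> h') C (sph n \<alpha> C))
                   (phi n \<alpha> C h) (R_mor n h C (phi n \<alpha> C h')))
          \<and> (\<forall>D\<in>CH0 n. D \<subseteq> C \<longrightarrow> ref_mor n D C (phi n \<alpha> C h) = phi n \<alpha> D h)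
          \<and> (\<forall>r s. \<forall>\<Phi>\<in>S_hom n \<alpha> C r s. \<forall>k\<in>H0 n.
               picture n C r s (U_op n \<alpha> C h r s \<Phi>) (k <#\<^bsub>Hgrp n\<^esub> C)
                 = picture n C r s \<Phi> ((k \<otimes>\<^bsub>Hgrp n\<^esub> h) <#\<^bsub>Hgrp n\<^esub> C))
          \<and> isometric_dagger_functor (S_cat n \<alpha> C) (S_form n C) (S_cat n \<alpha> C) (S_form n C)
              (\<lambda>r. r) (U_op n \<alpha> C h)))
   \<and> (\<comment> \<open>(iv), on the pseudocolimit\<close>
      \<forall>h \<in> (H0 n :: 'k HH set).
        (\<forall>X\<in>obs (SF_cat n \<alpha>).
           SF_emb_obj n \<alpha> X \<in> IF_obj n \<alpha>
           \<and> rho_obj n h (SF_emb_obj n \<alpha> X) \<in> IF_obj n \<alpha>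
           \<and> phi_F n \<alpha> h X \<in> IF_hom n (rho_obj n h (SF_emb_obj n \<alpha> X)) (SF_emb_obj n \<alpha> X)
           \<and> phi_F_inv n \<alpha> h X \<in> IF_hom n (SF_emb_obj n \<alpha> X) (rho_obj n h (SF_emb_obj n \<alpha> X)))
        \<and> (\<forall>X\<in>obs (SF_cat n \<alpha>). \<forall>Y\<in>obs (SF_cat n \<alpha>).
             inj_on (SF_emb n \<alpha> X Y) (carrier (hm (SF_cat n \<alpha>) X Y))
             \<and> (\<forall>P\<in>carrier (hm (SF_cat n \<alpha>) X Y).
                  SF_emb n \<alpha> X Y P \<in> IF_hom n (SF_emb_obj n \<alpha> X) (SF_emb_obj n \<alpha> Y)
                  \<and> SF_emb n \<alpha> X Y (U_F n \<alpha> h X Y P)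
                    = IF_comp n (SF_emb_obj n \<alpha> X) (SF_emb_obj n \<alpha> Y) (phi_F n \<alpha> h Y)
                        (IF_comp n (SF_emb_obj n \<alpha> X) (rho_obj n h (SF_emb_obj n \<alpha> Y))
                          (rho_mor n h (SF_emb n \<alpha> X Y P)) (phi_F_inv n \<alpha> h X))))
        \<and> isometric_dagger_functor (SF_cat n \<alpha>) (SF_form n) (SF_cat n \<alpha>) (SF_form n)
            (\<lambda>X. X) (U_F n \<alpha> h)
        \<and> (\<forall>X\<in>obs (SF_cat n \<alpha>). \<forall>Y\<in>obs (SF_cat n \<alpha>). \<forall>P\<in>carrier (hm (SF_cat n \<alpha>) X Y).
             U_F n \<alpha> \<one>\<^bsub>Hgrp n\<^esub> X Y P = P
             \<and> (\<forall>h'\<in>H0 n. U_F n \<alpha> (h \<otimes>\<^bsub>Hgrp n\<^esub> h') X Y P = U_F n \<alpha> h X Y (U_F n \<alpha> h' X Y P))))"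
proof -
  interpret unitary_param n \<alpha> by unfold_locales (use assms(2) in blast)
  have obs: "r \<in> obs (S_cat n \<alpha> C)" for C :: "'k HH set" and r by (simp add: S_cat_def)
  have ref: "ref_mor n D C (phi n \<alpha> C h) = phi n \<alpha> D h"
    if "C \<in> CH0 n" "h \<in> H0 n" "D \<in> CH0 n" "D \<subseteq> C" for C D :: "'k HH set" and h
    unfolding phi_ref[OF that] phi_id[OF that(3,2)] ..
  have obF: "X \<in> obs (SF_cat n \<alpha>) \<Longrightarrow> X \<in> obF" for X :: "'k HH set \<times> nat" by (simp add: SF_cat_def)
  have objs: "rho_obj n h (eob X) \<in> IF_obj n \<alpha>"
    "phi_F n \<alpha> h X \<in> IF_hom n (rho_obj n h (eob X)) (eob X)"
    "phi_F_inv n \<alpha> h X \<in> IF_hom n (eob X) (rho_obj n h (eob X))"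
    if X: "X \<in> obs (SF_cat n \<alpha>)" and h: "h \<in> H0 n" for X :: "'k HH set \<times> nat" and h
    unfolding rho_eob[OF obF[OF X] h] phi_F_icls[OF obF[OF X] h]
    using eob_IF_obj[OF obF[OF X]] icls_IF_hom[OF id_icls[OF obF[OF X]]] by blast+
  show ?thesis
    by (intro conjI ballI allI impI has_tau_unique dag_model.pos_def[OF S_cat_model obs obs] S_form_id
        vpow_fam_obj picture_bij dag_model.dagger[OF S_cat_model] dag_model.bifunctor[OF S_cat_model]
        dag_model.antiunitary[OF S_cat_model] dag_model.adjointable[OF S_cat_model]
        refine_fam refine_functor SF_form_value_unique dag_model.two_ip[OF SF_model]
        cj_CH0 phi_facts phi_line phi_mult ref U_op_picture U_op_functor
        eob_IF_obj[OF obF] objs SF_emb_inj[OF obF obF] SF_emb_equivariant[OF obF obF] U_F_functor U_F_group)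
      assumption+
qed

end
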